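(* For every measure $\mu\in\mathcal M_a(\mathcal N')$ one has the topological identity $$(\mathcal N)^1_\mu=\mathcal E^1_{\min}(\mathcal N').$$ That is, identifying each $\varphi=\sum_{n=0}^\infty\langle P_n^\mu,\varphi^{(n)}\rangle\in(\mathcal N)^1_\mu$ with the function $x\mapsto\sum_{n=0}^\infty\langle P_n^\mu(x),\varphi^{(n)}\rangle$ on $\mathcal N'$, the two spaces coincide as sets of functions on $\mathcal N'$ and their topologies are equal.
   Context: Nuclear triple: $\mathcal H$ is a real separable Hilbert space with norm $|\cdot|$; $\mathcal N\subset\mathcal H$ is a separable nuclear Fréchet space, densely and continuously embedded, $\mathcal N=\bigcap_{p\in\mathbb N}\mathcal H_p$ with the projective limit topology, where the $\mathcal H_p$ are Hilbert spaces with norms $|\cdot|_p$, $|\cdot|\le|\cdot|_p\le|\cdot|_q$ for $p<q$, and for every $p$ there is $p'>p$ such that the embedding $\mathcal H_{p'}\hookrightarrow\mathcal H_p$ is Hilbert–Schmidt. $\mathcal N'=\bigcup_p\mathcal H_{-p}$ is the dual, $\mathcal H_{-p}$ being the dual of $\mathcal H_p$ with respect to $\mathcal H$, with norm $|\cdot|_{-p}$; $\langle\cdot,\cdot\rangle$ is the bilinear dual pairing. A subscript $\mathbb C$ denotes complexification, $\hat\otimes$ the symmetric tensor product; $|\cdot|_{\pm p}$ also denotes the norm on $\mathcal H_{\pm p,\mathbb C}^{\hat\otimes n}$ (complex modulus if $n=0$); $\mathcal N_{\mathbb C}^{\hat\otimes n}$ is the projective limit of the $\mathcal H_{p,\mathbb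 C}^{\hat\otimes n}$, and its dual is the inductive limit of the $\mathcal H_{-p,\mathbb C}^{\hat\otimes n}$. Measures: $\mathcal M_a(\mathcal N')$ is the set of measures $\mu$ on the cylinder $\sigma$-algebra of $\mathcal N'$ (here normalized to be probability measures) whose Laplace transform $l_\mu(\theta)=\int_{\mathcal N'}e^{\langle x,\theta\rangle}\,d\mu(x)$ is holomorphic in a neighborhood of $0\in\mathcal N_{\mathbb C}$ (holomorphic = Gâteaux-holomorphic and locally bounded). Appell polynomials: for $\theta$ in a neighborhood of $0$ in $\mathcal N_{\mathbb C}$ and $z\in\mathcal N'_{\mathbb C}$, $e^{\langle z,\theta\rangle}/l_\mu(\theta)=\sum_{n\ge0}\frac1{n!}\langle P_n^\mu(z),\theta^{\otimes n}\rangle$ defines the kernels $P_n^\mu(z)\in(\mathcal N_{\mathbb C}^{\hat\otimes n})'$. Continuous polynomials: $\mathcal P(\mathcal N')$ is the set of functions $\varphi(x)=\sum_{n=0}^N\langle x^{\otimes n},\tilde\varphi^{(n)}\rangle$ on $\mathcal N'$ with $\tilde\varphi^{(n)}\in\mathcal N_{\mathbb C}^{\hat\otimes n}$; each has a unique representation $\varphi=\sum_{n=0}^N\langle P_n^\mu,\varphi^{(n)}\rangle$, $\varphi^{(n)}\in\mathcal N_{\mathbb C}^{\hat\otimes n}$. Test functions: $(\mathcal H_p)^1_{q,\mu}$ is the completion of $\mathcal P(\mathcal N')$ in the norm $\|\varphi\|_{p,q,\mu}^2=\sum_n(n!)^2\,2^{nq}|\varphi^{(n)}|_p^2$ (equivalently,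 the space of series $\sum_n\langle P^\mu_n,\varphi^{(n)}\rangle$ with $\varphi^{(n)}\in\mathcal H_{p,\mathbb C}^{\hat\otimes n}$ and finite norm), and $(\mathcal N)^1_\mu$ is the projective limit of the $(\mathcal H_p)^1_{q,\mu}$ over $p,q\in\mathbb N$. Entire functions: $\mathcal E^1_{2^{-l}}(\mathcal H_{-p,\mathbb C})$ is the space of entire functions $\varphi$ on $\mathcal H_{-p,\mathbb C}$ with finite norm $\mathrm n_{p,l,1}(\varphi)=\sup_{z}|\varphi(z)|\exp(-2^{-l}|z|_{-p})$; $\mathcal E^1_{\min}(\mathcal N'_{\mathbb C})$ is the projective limit of these spaces over $p,l\in\mathbb N$ (entire functions on $\mathcal N'_{\mathbb C}$ of first order growth and minimal type), and $\mathcal E^1_{\min}(\mathcal N')=\{\varphi|_{\mathcal N'}:\varphi\in\mathcal E^1_{\min}(\mathcal N'_{\mathbb C})\}$ with the topology carried over from $\mathcal E^1_{\min}(\mathcal N'_{\mathbb C})$. *)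

theory Defs
  imports "HOL-Probability.Probability"
begin

section \<open>Generic topological notions\<close>

text \<open>Projective limit topology on \<open>V\<close>: the coarsest topology that makes \<open>V\<close> map continuously
  into each of the spaces normed by \<open>\<nu> i\<close>, where \<open>i\<close> ranges over the whole index type.\<close>

definition projlim_topology :: "'a::minus set \<Rightarrow> ('i \<Rightarrow> 'a \<Rightarrow> real) \<Rightarrow> 'a topology" where
  "projlim_topology V \<nu> =
     topology_generated_by {{y \<in> V. \<nu> i (y - x) < \<epsilon>} | i x \<epsilon>. x \<in> V \<and> \<epsilon> > 0}"

text \<open>Topology carried over from \<open>T\<close> to the image of its carrier under an injective map \<open>f\<close>.\<close>

definition carried_topology :: "('a \<Rightarrow> 'b) \<Rightarrow> 'a topology \<Rightarrow> 'b topology" where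
  "carried_topology f T = pullback_topology (f ` topspace T) (inv_into (topspace T) f) T"

text \<open>Gateaux-holomorphic and locally bounded on the open set \<open>U\<close>. The complex vector space
  structure enters only through \<open>line x t h\<close>, which stands for \<open>x + t h\<close>.\<close>

definition holomorphic_in ::
  "('a \<Rightarrow> complex \<Rightarrow> 'a \<Rightarrow> 'a) \<Rightarrow> 'a topology \<Rightarrow> 'a set \<Rightarrow> ('a \<Rightarrow> complex) \<Rightarrow> bool" where
  "holomorphic_in line T U f \<longleftrightarrow>
     openin T U \<and>
     (\<forall>x\<in>U. \<forall>h\<in>topspace T. (\<lambda>t. f (line x t h)) analytic_on {0}) \<and>
     (\<forall>x\<in>U. \<exists>V. openin T V \<and> x \<in> V \<and> V \<subseteq> U \<and> bounded (f ` V))"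


section \<open>Nuclear triples\<close>

text \<open>The Hilbert space \<open>\<H>\<close> is the type \<open>'h\<close>; the spaces \<open>\<H>\<^sub>p\<close> are subspaces of it, carrying
  their own inner products. Values of \<open>ip S p\<close> outside \<open>level S p\<close> are irrelevant.\<close>

record 'h hilbert_scale =
  level :: "nat \<Rightarrow> 'h set"
  ip :: "nat \<Rightarrow> 'h \<Rightarrow> 'h \<Rightarrow> real"

definition lnorm :: "'h hilbert_scale \<Rightarrow> nat \<Rightarrow> 'h \<Rightarrow> real" where
  "lnorm S p x = sqrt (ip S p x x)"

definition hilbert_level :: "'h::real_vector hilbert_scale \<Rightarrow> nat \<Rightarrow> bool" where
  "hilbert_level S p \<longleftrightarrow>
     subspace (level S p) \<and>
     (\<forall>x\<in>level S p. \<forall>y\<in>level S p. ip S p x y = ip S p y x) \<and>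
     (\<forall>x\<in>level S p. \<forall>y\<in>level S p. \<forall>z\<in>level S p. \<forall>a b.
        ip S p (a *\<^sub>R x + b *\<^sub>R y) z = a * ip S p x z + b * ip S p y z) \<and>
     (\<forall>x\<in>level S p. x \<noteq> 0 \<longrightarrow> ip S p x x > 0) \<and>
     (\<forall>X :: nat \<Rightarrow> 'h.
        (\<forall>n. X n \<in> level S p) \<and>
        (\<forall>\<epsilon>>0. \<exists>M. \<forall>m\<ge>M. \<forall>n\<ge>M. lnorm S p (X m - X n) < \<epsilon>) \<longrightarrow>
        (\<exists>x\<in>level S p. (\<lambda>n. lnorm S p (X n - x)) \<longlonglongrightarrow> 0))"

definition orthonormal_in :: "'h hilbert_scale \<Rightarrow> nat \<Rightarrow> 'h set \<Rightarrow> bool" where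
  "orthonormal_in S p B \<longleftrightarrow>
     B \<subseteq> level S p \<and> (\<forall>e\<in>B. \<forall>f\<in>B. ip S p e f = (if e = f then 1 else 0))"

definition orthonormal_basis :: "'h::real_vector hilbert_scale \<Rightarrow> nat \<Rightarrow> 'h set \<Rightarrow> bool" where
  "orthonormal_basis S p B \<longleftrightarrow>
     orthonormal_in S p B \<and>
     (\<forall>x\<in>level S p. \<forall>\<epsilon>>0. \<exists>y\<in>span B. lnorm S p (x - y) < \<epsilon>)"

definition hs_embedding :: "'h::real_vector hilbert_scale \<Rightarrow> nat \<Rightarrow> nat \<Rightarrow> bool" where
  "hs_embedding S q p \<longleftrightarrow>
     (\<exists>B. orthonormal_basis S q B \<and> (\<lambda>e. (lnorm S p e)\<^sup>2) summable_on B)"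

definition nuc :: "'h hilbert_scale \<Rightarrow> 'h set" where
  "nuc S = (\<Inter>p. level S p)"

text \<open>The projective limit topology on \<open>\<N> = nuc S\<close> is then automatically nuclear, Frechet and
  separable, and finer than that of \<open>\<H>\<close>.\<close>

definition nuclear_triple :: "'h::{real_inner, polish_space} hilbert_scale \<Rightarrow> bool" where
  "nuclear_triple S \<longleftrightarrow>
     (\<forall>p. hilbert_level S p) \<and>
     (\<forall>p. \<forall>x\<in>level S p. norm x \<le> lnorm S p x) \<and>
     (\<forall>p q. p < q \<longrightarrow>
        level S q \<subseteq> level S p \<and> (\<forall>x\<in>level S q. lnorm S p x \<le> lnorm S q x)) \<and>
     (\<forall>p. \<exists>p'>p. hs_embedding S p' p) \<and>
     closure (nuc S) = UNIV"


subsection \<open>Complexification of \<open>\<N>\<close>\<close>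

text \<open>The pair \<open>(a, b)\<close> stands for \<open>a + \<i> b\<close>.\<close>

definition nucC :: "'h hilbert_scale \<Rightarrow> ('h \<times> 'h) set" where
  "nucC S = nuc S \<times> nuc S"

definition lnormC :: "'h hilbert_scale \<Rightarrow> nat \<Rightarrow> 'h \<times> 'h \<Rightarrow> real" where
  "lnormC S p \<theta> = sqrt ((lnorm S p (fst \<theta>))\<^sup>2 + (lnorm S p (snd \<theta>))\<^sup>2)"

definition nucC_topology :: "'h::real_vector hilbert_scale \<Rightarrow> ('h \<times> 'h) topology" where
  "nucC_topology S = projlim_topology (nucC S) (lnormC S)"

definition nucC_line :: "'h::real_vector \<times> 'h \<Rightarrow> complex \<Rightarrow> 'h \<times> 'h \<Rightarrow> 'h \<times> 'h" where
  "nucC_line \<theta> t \<eta> =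
     (fst \<theta> + (Re t *\<^sub>R fst \<eta> - Im t *\<^sub>R snd \<eta>),
      snd \<theta> + (Re t *\<^sub>R snd \<eta> + Im t *\<^sub>R fst \<eta>))"


subsection \<open>The dual space and its complexification\<close>

text \<open>Elements of \<open>\<H>\<^sub>-\<^sub>p\<close> are taken as the functionals on \<open>\<N>\<close> (extended by 0 to \<open>'h\<close>) that are
  bounded for \<open>|\<cdot>|\<^sub>p\<close>. When \<open>\<N>\<close> is dense in \<open>\<H>\<^sub>p\<close> (which is implicit in \<open>\<H>\<^sub>-\<^sub>p \<subseteq> \<N>'\<close>), these are
  the restrictions of the elements of the dual of \<open>\<H>\<^sub>p\<close>, with the same norm. Density
  is not assumed; without it \<open>\<H>\<^sub>p\<close> is in effect replaced by the closure of \<open>\<N>\<close> in it. In this form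
  \<open>\<H>\<^sub>-\<^sub>p \<subseteq> \<H>\<^sub>-\<^sub>q \<subseteq> \<N>'\<close> for \<open>p \<le> q\<close> are inclusions of sets.\<close>

definition dual_level :: "'h::real_vector hilbert_scale \<Rightarrow> nat \<Rightarrow> ('h \<Rightarrow> real) set" where
  "dual_level S p = {x.
     (\<forall>\<theta>\<in>nuc S. \<forall>\<eta>\<in>nuc S. \<forall>a b. x (a *\<^sub>R \<theta> + b *\<^sub>R \<eta>) = a * x \<theta> + b * x \<eta>) \<and>
     (\<exists>C. \<forall>\<theta>\<in>nuc S. \<bar>x \<theta>\<bar> \<le> C * lnorm S p \<theta>) \<and>
     (\<forall>\<theta>. \<theta> \<notin> nuc S \<longrightarrow> x \<theta> = 0)}"

definition dnorm :: "'h hilbert_scale \<Rightarrow> nat \<Rightarrow> ('h \<Rightarrow> real) \<Rightarrow> real" where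
  "dnorm S p x = Sup {\<bar>x \<theta>\<bar> | \<theta>. \<theta> \<in> nuc S \<and> lnorm S p \<theta> \<le> 1}"

definition nuc_dual :: "'h::real_vector hilbert_scale \<Rightarrow> ('h \<Rightarrow> real) set" where
  "nuc_dual S = (\<Union>p. dual_level S p)"

text \<open>An element \<open>x + \<i> y\<close> of the complexified dual is the complex-valued real-linear functional
  \<open>\<theta> \<mapsto> x \<theta> + \<i> y \<theta>\<close>; \<open>cplx\<close> embeds the real dual.\<close>

definition dual_levelC :: "'h::real_vector hilbert_scale \<Rightarrow> nat \<Rightarrow> ('h \<Rightarrow> complex) set" where
  "dual_levelC S p =
     {z. (\<lambda>\<theta>. Re (z \<theta>)) \<in> dual_level S p \<and> (\<lambda>\<theta>. Im (z \<theta>)) \<in> dual_level S p}"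

definition dnormC :: "'h hilbert_scale \<Rightarrow> nat \<Rightarrow> ('h \<Rightarrow> complex) \<Rightarrow> real" where
  "dnormC S p z = sqrt ((dnorm S p (\<lambda>\<theta>. Re (z \<theta>)))\<^sup>2 + (dnorm S p (\<lambda>\<theta>. Im (z \<theta>)))\<^sup>2)"

definition nuc_dualC :: "'h::real_vector hilbert_scale \<Rightarrow> ('h \<Rightarrow> complex) set" where
  "nuc_dualC S = (\<Union>p. dual_levelC S p)"

definition cplx :: "('h \<Rightarrow> real) \<Rightarrow> 'h \<Rightarrow> complex" where
  "cplx x = (\<lambda>\<theta>. complex_of_real (x \<theta>))"

definition pairing :: "('h \<Rightarrow> complex) \<Rightarrow> 'h \<times> 'h \<Rightarrow> complex" where
  "pairing z \<theta> = z (fst \<theta>) + \<i> * z (snd \<theta>)"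

definition dual_levelC_topology ::
  "'h::real_vector hilbert_scale \<Rightarrow> nat \<Rightarrow> ('h \<Rightarrow> complex) topology" where
  "dual_levelC_topology S p = projlim_topology (dual_levelC S p) (\<lambda>_::unit. dnormC S p)"

definition dualC_line :: "('h \<Rightarrow> complex) \<Rightarrow> complex \<Rightarrow> ('h \<Rightarrow> complex) \<Rightarrow> 'h \<Rightarrow> complex" where
  "dualC_line z t w = (\<lambda>\<theta>. z \<theta> + t * w \<theta>)"


section \<open>Symmetric tensor powers\<close>

text \<open>The Hilbert tensor power \<open>\<H>\<^sub>p\<^sub>,\<^sub>\<complex>\<^sup>\<otimes>\<^sup>n\<close> is realized as the space of complex-valued
  Hilbert-Schmidt \<open>n\<close>-linear functionals on the dual \<open>\<H>\<^sub>-\<^sub>p\<close> (the tensor \<open>f\<close> being the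
  functional \<open>(x\<^sub>1,\<dots>,x\<^sub>n) \<mapsto> \<langle>x\<^sub>1 \<otimes> \<dots> \<otimes> x\<^sub>n, f\<rangle>\<close>), with the Hilbert-Schmidt norm. The tuple of
  arguments is a list of length \<open>n\<close>. The embedding of \<open>\<H>\<^sub>q\<^sub>,\<^sub>\<complex>\<^sup>\<otimes>\<^sup>n\<close> into \<open>\<H>\<^sub>p\<^sub>,\<^sub>\<complex>\<^sup>\<otimes>\<^sup>n\<close> for
  \<open>p \<le> q\<close> is the restriction of functionals from \<open>\<H>\<^sub>-\<^sub>q\<close> to \<open>\<H>\<^sub>-\<^sub>p\<close>.\<close>

type_synonym 'h tensor = "('h \<Rightarrow> real) list \<Rightarrow> complex"

definition sym_multilinear :: "('h \<Rightarrow> real) set \<Rightarrow> nat \<Rightarrow> 'h tensor \<Rightarrow> bool" where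
  "sym_multilinear D n F \<longleftrightarrow>
     (\<forall>xs. length xs = n \<and> set xs \<subseteq> D \<longrightarrow>
        (\<forall>ys. mset ys = mset xs \<longrightarrow> F ys = F xs) \<and>
        (\<forall>i<n. \<forall>x\<in>D. \<forall>y\<in>D. \<forall>a b.
           F (xs[i := (\<lambda>\<theta>. a * x \<theta> + b * y \<theta>)]) =
             of_real a * F (xs[i := x]) + of_real b * F (xs[i := y])))"

text \<open>The Riesz isomorphism from \<open>\<H>\<^sub>p\<close> onto \<open>\<H>\<^sub>-\<^sub>p\<close>.\<close>

definition riesz :: "'h hilbert_scale \<Rightarrow> nat \<Rightarrow> 'h \<Rightarrow> 'h \<Rightarrow> real" where
  "riesz S p e = (\<lambda>\<theta>. if \<theta> \<in> nuc S then ip S p e \<theta> else 0)"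

text \<open>The squared Hilbert-Schmidt norm is the sum of \<open>|F(e\<^sub>i\<^sub>1,\<dots>,e\<^sub>i\<^sub>n)|\<^sup>2\<close> over an orthonormal
  basis. That sum does not depend on the basis and every finite orthonormal system extends to a
  basis, so it is the supremum of the sums below. Its finiteness implies that \<open>F\<close> is bounded.\<close>

definition hs_sums :: "'h hilbert_scale \<Rightarrow> nat \<Rightarrow> nat \<Rightarrow> 'h tensor \<Rightarrow> real set" where
  "hs_sums S p n F =
     {(\<Sum>es | set es \<subseteq> B \<and> length es = n. (cmod (F (map (riesz S p) es)))\<^sup>2) | B.
        finite B \<and> orthonormal_in S p B}"

text \<open>Only the values of \<open>F\<close> on tuples from \<open>\<H>\<^sub>-\<^sub>p\<close> matter in the next two definitions, so no
  restriction operator is needed when forming the projective limit \<open>nuc_tensor\<close>.\<close>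

definition tensor_level :: "'h::real_vector hilbert_scale \<Rightarrow> nat \<Rightarrow> nat \<Rightarrow> 'h tensor set" where
  "tensor_level S p n =
     {F. sym_multilinear (dual_level S p) n F \<and> bdd_above (hs_sums S p n F)}"

definition tnorm :: "'h hilbert_scale \<Rightarrow> nat \<Rightarrow> nat \<Rightarrow> 'h tensor \<Rightarrow> real" where
  "tnorm S p n F = sqrt (Sup (hs_sums S p n F))"

definition nuc_tensor :: "'h::real_vector hilbert_scale \<Rightarrow> nat \<Rightarrow> 'h tensor set" where
  "nuc_tensor S n =
     {F. (\<forall>p. F \<in> tensor_level S p n) \<and>
         (\<forall>xs. \<not> (length xs = n \<and> set xs \<subseteq> nuc_dual S) \<longrightarrow> F xs = 0)}"

definition tensor_power :: "'h::real_vector hilbert_scale \<Rightarrow> nat \<Rightarrow> 'h \<times> 'h \<Rightarrow> 'h tensor" where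
  "tensor_power S n \<theta> =
     (\<lambda>xs. if length xs = n \<and> set xs \<subseteq> nuc_dual S
           then (\<Prod>x\<leftarrow>xs. pairing (cplx x) \<theta>) else 0)"

definition tensor_dual ::
  "'h::real_vector hilbert_scale \<Rightarrow> nat \<Rightarrow> ('h tensor \<Rightarrow> complex) set" where
  "tensor_dual S n = {P.
     (\<forall>F\<in>nuc_tensor S n. \<forall>G\<in>nuc_tensor S n. \<forall>a b.
        P (\<lambda>xs. a * F xs + b * G xs) = a * P F + b * P G) \<and>
     (\<exists>p C. \<forall>F\<in>nuc_tensor S n. cmod (P F) \<le> C * tnorm S p n F)}"


section \<open>Measures and Appell polynomials\<close>

definition cylinder_algebra :: "'h::real_vector hilbert_scale \<Rightarrow> ('h \<Rightarrow> real) measure" where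
  "cylinder_algebra S =
     sigma (nuc_dual S) {{x \<in> nuc_dual S. x \<theta> \<in> A} | \<theta> A. \<theta> \<in> nuc S \<and> A \<in> sets borel}"

definition laplace :: "('h \<Rightarrow> real) measure \<Rightarrow> 'h \<times> 'h \<Rightarrow> complex" where
  "laplace \<mu> \<theta> = (\<integral>x. exp (pairing (cplx x) \<theta>) \<partial>\<mu>)"

definition analytic_measures :: "'h::real_vector hilbert_scale \<Rightarrow> ('h \<Rightarrow> real) measure set" where
  "analytic_measures S =
     {\<mu>. prob_space \<mu> \<and> sets \<mu> = sets (cylinder_algebra S) \<and>
         (\<exists>U. 0 \<in> U \<and>
              (\<forall>\<theta>\<in>U. integrable \<mu> (\<lambda>x. exp (pairing (cplx x) \<theta>))) \<and>
              holomorphic_in nucC_line (nucC_topology S) U (laplace \<mu>))}"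

text \<open>\<open>appell S \<mu> z n F\<close> is \<open>\<langle>P\<^sub>n\<^sup>\<mu>(z), F\<rangle>\<close>. The kernels are determined by the generating function as
  functionals on \<open>nuc_tensor S n\<close>; the choice only affects values at arguments outside it.\<close>

definition appell ::
  "'h::real_vector hilbert_scale \<Rightarrow> ('h \<Rightarrow> real) measure \<Rightarrow> ('h \<Rightarrow> complex) \<Rightarrow> nat \<Rightarrow> 'h tensor \<Rightarrow> complex"
  where
  "appell S \<mu> z = (SOME P.
     (\<forall>n. P n \<in> tensor_dual S n) \<and>
     (\<exists>U. openin (nucC_topology S) U \<and> 0 \<in> U \<and>
          (\<forall>\<theta>\<in>U. (\<lambda>n. 1 / fact n * P n (tensor_power S n \<theta>)) sums
                     (exp (pairing z \<theta>) / laplace \<mu> \<theta>))))"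


section \<open>Test functions\<close>

text \<open>An element of \<open>(\<H>\<^sub>p)\<^sup>1\<^sub>q\<^sub>,\<^sub>\<mu>\<close> is represented by the sequence of its kernels \<open>\<phi>\<^sup>(\<^sup>n\<^sup>)\<close>; the measure
  enters through the function \<open>test_fun S \<mu> \<phi>\<close> that the sequence represents.\<close>

definition test_level ::
  "'h::real_vector hilbert_scale \<Rightarrow> nat \<Rightarrow> nat \<Rightarrow> (nat \<Rightarrow> 'h tensor) set" where
  "test_level S p q =
     {\<phi>. (\<forall>n. \<phi> n \<in> tensor_level S p n) \<and>
         summable (\<lambda>n. (fact n)\<^sup>2 * 2 ^ (n * q) * (tnorm S p n (\<phi> n))\<^sup>2)}"

definition test_norm :: "'h hilbert_scale \<Rightarrow> nat \<times> nat \<Rightarrow> (nat \<Rightarrow> 'h tensor) \<Rightarrow> real" where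
  "test_norm S = (\<lambda>(p, q) \<phi>.
     sqrt (\<Sum>n. (fact n)\<^sup>2 * 2 ^ (n * q) * (tnorm S p n (\<phi> n))\<^sup>2))"

definition test_series :: "'h::real_vector hilbert_scale \<Rightarrow> (nat \<Rightarrow> 'h tensor) set" where
  "test_series S =
     {\<phi>. (\<forall>n. \<phi> n \<in> nuc_tensor S n) \<and> (\<forall>p q. \<phi> \<in> test_level S p q)}"

definition test_fun ::
  "'h::real_vector hilbert_scale \<Rightarrow> ('h \<Rightarrow> real) measure \<Rightarrow> (nat \<Rightarrow> 'h tensor) \<Rightarrow> ('h \<Rightarrow> real) \<Rightarrow> complex"
  where
  "test_fun S \<mu> \<phi> =
     (\<lambda>x. if x \<in> nuc_dual S then \<Sum>n. appell S \<mu> (cplx x) n (\<phi> n) else 0)"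

text \<open>\<open>(\<N>)\<^sup>1\<^sub>\<mu>\<close> as a topological space of functions on \<open>\<N>'\<close> (extended by 0).\<close>

definition test_topology ::
  "'h::real_vector hilbert_scale \<Rightarrow> ('h \<Rightarrow> real) measure \<Rightarrow> (('h \<Rightarrow> real) \<Rightarrow> complex) topology" where
  "test_topology S \<mu> =
     carried_topology (test_fun S \<mu>) (projlim_topology (test_series S) (test_norm S))"


section \<open>Entire functions of first order growth and minimal type\<close>

definition growth_norm ::
  "'h::real_vector hilbert_scale \<Rightarrow> nat \<times> nat \<Rightarrow> (('h \<Rightarrow> complex) \<Rightarrow> complex) \<Rightarrow> real" where
  "growth_norm S = (\<lambda>(p, l) \<phi>.
     SUP z\<in>dual_levelC S p. cmod (\<phi> z) * exp (- (1 / 2 ^ l * dnormC S p z)))"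

definition entire_level ::
  "'h::real_vector hilbert_scale \<Rightarrow> nat \<Rightarrow> nat \<Rightarrow> (('h \<Rightarrow> complex) \<Rightarrow> complex) set" where
  "entire_level S p l =
     {\<phi>. holomorphic_in dualC_line (dual_levelC_topology S p) (dual_levelC S p) \<phi> \<and>
         bdd_above ((\<lambda>z. cmod (\<phi> z) * exp (- (1 / 2 ^ l * dnormC S p z))) ` dual_levelC S p)}"

definition entire_min :: "'h::real_vector hilbert_scale \<Rightarrow> (('h \<Rightarrow> complex) \<Rightarrow> complex) set" where
  "entire_min S =
     {\<phi>. (\<forall>p l. \<phi> \<in> entire_level S p l) \<and> (\<forall>z. z \<notin> nuc_dualC S \<longrightarrow> \<phi> z = 0)}"

definition real_restriction ::
  "'h::real_vector hilbert_scale \<Rightarrow> (('h \<Rightarrow> complex) \<Rightarrow> complex) \<Rightarrow> ('h \<Rightarrow> real) \<Rightarrow> complex" where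
  "real_restriction S \<phi> = (\<lambda>x. if x \<in> nuc_dual S then \<phi> (cplx x) else 0)"

definition entire_min_real_topology ::
  "'h::real_vector hilbert_scale \<Rightarrow> (('h \<Rightarrow> real) \<Rightarrow> complex) topology" where
  "entire_min_real_topology S =
     carried_topology (real_restriction S) (projlim_topology (entire_min S) (growth_norm S))"

end

theory Submission
  imports Defs "HOL-Complex_Analysis.Complex_Analysis"
begin

text \<open>
  Since the embeddings are Hilbert-Schmidt, the Hilbert-Schmidt norms of symmetric tensors may be
  replaced by the norms of the corresponding multilinear functionals on the dual levels. In these
  terms a family \<open>\<phi>\<^sup>(\<^sup>n\<^sup>)\<close> is a test series iff for every \<open>p\<close> and every \<open>R > 0\<close> the functional \<open>\<phi>\<^sup>(\<^sup>n\<^sup>)\<close> has norm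
  at most \<open>A R\<^sup>n / n!\<close> on \<open>\<H>\<^sub>-\<^sub>p\<close>; by Cauchy's estimates these are precisely the Taylor coefficients of the
  entire functions of minimal type, the case of the trivial kernels \<open>P\<^sub>n(z) = z\<^sup>\<otimes>\<^sup>n\<close>.

  For general \<open>\<mu>\<close> the moments extend to functionals \<open>M\<^sub>n\<close> on symmetric tensors with bound \<open>K r\<^sup>n n!\<close>. The
  sequence \<open>M\<close> has an inverse \<open>a\<close> under the convolution product of functionals, with a bound of the same
  form, and \<open>\<langle>P\<^sub>n\<^sup>\<mu>(x), F\<rangle>\<close> is the sum of \<open>binom n k\<close> times the contraction of \<open>F\<close> with \<open>a\<^sub>n\<^sub>-\<^sub>k\<close>, evaluated at
  \<open>x\<^sup>\<otimes>\<^sup>k\<close>. Hence \<open>\<Sum>\<^sub>n \<langle>P\<^sub>n\<^sup>\<mu>(x), \<phi>\<^sup>(\<^sup>n\<^sup>)\<rangle>\<close> is the power series with coefficients \<open>a * \<phi>\<close>, and \<open>\<phi> \<mapsto> a * \<phi>\<close>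
  is a homeomorphism of the space of test series with inverse \<open>\<psi> \<mapsto> M * \<psi>\<close>.
\<close>

text \<open>Comparing norms costs only factors geometric in the degree \<open>n\<close>, together
  with a change of level: \<open>K ^ n\<close> for a Hilbert-Schmidt embedding, \<open>2 ^ n\<close>
  for complexification. Convolution needs the same freedom: contracting \<open>m\<close> arguments
  costs \<open>(r * R) ^ m\<close>, so \<open>R\<close> has to be small compared with
  \<open>1 / r\<close>, a quantity dictated by the measure.

  Two obstacles shape the rest. The moments are integrals of products of pairings, whereas
  contraction requires continuous functionals on all symmetric tensors; a kernel theorem bridges the
  gap. The Appell kernels are chosen by means of a generating function, which sees tensor powers
  only; hence the density of their span, proved with finite rank projections. The same density makes
  convolution commutative, which turns a left inverse into a two-sided one.

  Tensors take real functionals as arguments. Points of the complexified dual are therefore reached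
  by complex multilinear extension, and uniqueness is drawn from real points by the identity theorem
  and polarization.\<close>

lemma has_sum_finite_sum:
  fixes f :: "'i \<Rightarrow> 'a \<Rightarrow> real"
  assumes "\<And>i. i \<in> I \<Longrightarrow> (f i has_sum s i) A"
  shows "((\<lambda>a. \<Sum>i\<in>I. f i a) has_sum (\<Sum>i\<in>I. s i)) A"
  using assms by (induction I rule: infinite_finite_induct) (auto intro: has_sum_add)

locale nuclear_scale =
  fixes S :: "'h::{real_inner, polish_space} hilbert_scale"
  assumes nuclear: "nuclear_triple S"
begin

section \<open>Inner products on the levels\<close>

lemma hilbert_level: "hilbert_level S p"
  using nuclear by (simp add: nuclear_triple_def)

lemma subspace_level: "subspace (level S p)"
  using hilbert_level[of p] by (simp add: hilbert_level_def)

lemma level_mono: "p \<le> q \<Longrightarrow> level S q \<subseteq> level S p"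
  using nuclear by (cases "p = q") (auto simp: nuclear_triple_def)

lemma lnorm_mono: "p \<le> q \<Longrightarrow> x \<in> level S q \<Longrightarrow> lnorm S p x \<le> lnorm S q x"
  using nuclear by (cases "p = q") (auto simp: nuclear_triple_def)

lemma subspace_nuc: "subspace (nuc S)"
  unfolding nuc_def using subspace_level by (auto simp: subspace_def)

lemma nuc_level: "x \<in> nuc S \<Longrightarrow> x \<in> level S p"
  by (auto simp: nuc_def)

lemma ip_sym: "x \<in> level S p \<Longrightarrow> y \<in> level S p \<Longrightarrow> ip S p x y = ip S p y x"
  using hilbert_level[of p] by (simp add: hilbert_level_def)

lemma ip_lin_left:
  "x \<in> level S p \<Longrightarrow> y \<in> level S p \<Longrightarrow> z \<in> level S p \<Longrightarrow>
    ip S p (a *\<^sub>R x + b *\<^sub>R y) z = a * ip S p x z + b * ip S p y z"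
  using hilbert_level[of p] by (simp add: hilbert_level_def)

lemma ip_pos: "x \<in> level S p \<Longrightarrow> x \<noteq> 0 \<Longrightarrow> ip S p x x > 0"
  using hilbert_level[of p] by (simp add: hilbert_level_def)

lemma level_complete:
  assumes "\<And>n. X n \<in> level S p"
    and "\<And>\<epsilon>. \<epsilon> > 0 \<Longrightarrow> \<exists>M. \<forall>m\<ge>M. \<forall>n\<ge>M. lnorm S p (X m - X n) < \<epsilon>"
  obtains x where "x \<in> level S p" "(\<lambda>n. lnorm S p (X n - x)) \<longlonglongrightarrow> 0"
proof -
  have "\<forall>X :: nat \<Rightarrow> 'h.
        (\<forall>n. X n \<in> level S p) \<and>
        (\<forall>\<epsilon>>0. \<exists>M. \<forall>m\<ge>M. \<forall>n\<ge>M. lnorm S p (X m - X n) < \<epsilon>) \<longrightarrow>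
        (\<exists>x\<in>level S p. (\<lambda>n. lnorm S p (X n - x)) \<longlonglongrightarrow> 0)"
    using hilbert_level[of p] unfolding hilbert_level_def by argo
  then show ?thesis
    using that assms by blast
qed

lemmas level_0 = subspace_0[OF subspace_level]
lemmas level_add = subspace_add[OF subspace_level]
lemmas level_diff = subspace_diff[OF subspace_level]
lemmas level_scale = subspace_scale[OF subspace_level]
lemmas level_sum = subspace_sum[OF subspace_level]
lemmas nuc_0 = subspace_0[OF subspace_nuc]
lemmas nuc_add = subspace_add[OF subspace_nuc]
lemmas nuc_diff = subspace_diff[OF subspace_nuc]
lemmas nuc_scale = subspace_scale[OF subspace_nuc]
lemmas nuc_sum = subspace_sum[OF subspace_nuc]

lemma ip_add_left:
  "x \<in> level S p \<Longrightarrow> y \<in> level S p \<Longrightarrow> z \<in> level S p \<Longrightarrow>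
    ip S p (x + y) z = ip S p x z + ip S p y z"
  using ip_lin_left[of x p y z 1 1] by simp

lemma ip_scale_left:
  "x \<in> level S p \<Longrightarrow> z \<in> level S p \<Longrightarrow> ip S p (a *\<^sub>R x) z = a * ip S p x z"
  using ip_lin_left[of x p x z a 0] by simp

lemma ip_zero_left [simp]: "z \<in> level S p \<Longrightarrow> ip S p 0 z = 0"
  using ip_scale_left[of 0 p z 0] level_0 by simp

lemma ip_diff_left:
  "x \<in> level S p \<Longrightarrow> y \<in> level S p \<Longrightarrow> z \<in> level S p \<Longrightarrow>
    ip S p (x - y) z = ip S p x z - ip S p y z"
  using ip_lin_left[of x p y z 1 "-1"] by simp

lemma ip_add_right:
  "x \<in> level S p \<Longrightarrow> y \<in> level S p \<Longrightarrow> z \<in> level S p \<Longrightarrow>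
    ip S p z (x + y) = ip S p z x + ip S p z y"
  by (simp add: ip_sym[of z] ip_add_left level_add)

lemma ip_diff_right:
  "x \<in> level S p \<Longrightarrow> y \<in> level S p \<Longrightarrow> z \<in> level S p \<Longrightarrow>
    ip S p z (x - y) = ip S p z x - ip S p z y"
  by (simp add: ip_sym[of z] ip_diff_left level_diff)

lemma ip_scale_right:
  "x \<in> level S p \<Longrightarrow> z \<in> level S p \<Longrightarrow> ip S p z (a *\<^sub>R x) = a * ip S p z x"
  by (simp add: ip_sym[of z] ip_scale_left level_scale)

lemma ip_sum_left:
  assumes "\<And>i. i \<in> I \<Longrightarrow> x i \<in> level S p" "z \<in> level S p"
  shows "ip S p (\<Sum>i\<in>I. x i) z = (\<Sum>i\<in>I. ip S p (x i) z)"
  using assms by (induction I rule: infinite_finite_induct) (auto simp: ip_add_left level_sum)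

lemma ip_sum_right:
  assumes "\<And>i. i \<in> I \<Longrightarrow> x i \<in> level S p" "z \<in> level S p"
  shows "ip S p z (\<Sum>i\<in>I. x i) = (\<Sum>i\<in>I. ip S p z (x i))"
  using assms ip_sum_left[of I x p z] by (simp add: ip_sym[of z] level_sum)

lemma ip_nonneg: "x \<in> level S p \<Longrightarrow> 0 \<le> ip S p x x"
  using ip_pos[of x p] by (cases "x = 0") (auto simp: level_0)

lemma lnorm_sq: "x \<in> level S p \<Longrightarrow> (lnorm S p x)\<^sup>2 = ip S p x x"
  by (simp add: lnorm_def ip_nonneg)

lemma lnorm_nonneg: "x \<in> level S p \<Longrightarrow> 0 \<le> lnorm S p x"
  by (simp add: lnorm_def ip_nonneg)

lemma lnorm_0 [simp]: "lnorm S p 0 = 0"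
  by (simp add: lnorm_def level_0)

lemma lnorm_pos: "x \<in> level S p \<Longrightarrow> x \<noteq> 0 \<Longrightarrow> 0 < lnorm S p x"
  by (simp add: lnorm_def ip_pos)

lemma lnorm_scale: "x \<in> level S p \<Longrightarrow> lnorm S p (a *\<^sub>R x) = \<bar>a\<bar> * lnorm S p x"
  by (simp add: lnorm_def ip_scale_left ip_scale_right level_scale real_sqrt_mult flip: mult.assoc)

lemma lnorm_minus_commute:
  "x \<in> level S p \<Longrightarrow> y \<in> level S p \<Longrightarrow> lnorm S p (x - y) = lnorm S p (y - x)"
  using lnorm_scale[of "x - y" p "-1"] by (simp add: level_diff)

lemma lnorm_add_sq:
  "x \<in> level S p \<Longrightarrow> y \<in> level S p \<Longrightarrow>
    (lnorm S p (x + y))\<^sup>2 = (lnorm S p x)\<^sup>2 + 2 * ip S p x y + (lnorm S p y)\<^sup>2"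
  by (simp add: lnorm_sq ip_add_left ip_add_right level_add ip_sym[of y p x])

lemma lnorm_diff_sq:
  "x \<in> level S p \<Longrightarrow> y \<in> level S p \<Longrightarrow>
    (lnorm S p (x - y))\<^sup>2 = (lnorm S p x)\<^sup>2 - 2 * ip S p x y + (lnorm S p y)\<^sup>2"
  by (simp add: lnorm_sq ip_diff_left ip_diff_right level_diff ip_sym[of y p x])

lemma ip_Cauchy_Schwarz:
  assumes x: "x \<in> level S p" and y: "y \<in> level S p"
  shows "\<bar>ip S p x y\<bar> \<le> lnorm S p x * lnorm S p y"
proof (cases "y = 0")
  case True
  then show ?thesis using x ip_scale_right[of x p x 0] by simp
next
  case False
  define n where "n = lnorm S p y"
  have n: "n > 0" using False y lnorm_pos by (simp add: n_def)
  \<comment> \<open>The coefficient of the projection of \<open>x\<close> onto the line of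
    \<open>y\<close>; it minimizes the norm of \<open>x - a *\<^sub>R y\<close>.\<close>
  define a where "a = ip S p x y / n\<^sup>2"
  have "0 \<le> (lnorm S p (x - a *\<^sub>R y))\<^sup>2" by simp
  also have "\<dots> = (lnorm S p x)\<^sup>2 - 2 * (a * ip S p x y) + a\<^sup>2 * n\<^sup>2"
    using x y by (simp add: lnorm_diff_sq level_scale ip_scale_right lnorm_scale power_mult_distrib n_def)
  also have "\<dots> = (lnorm S p x)\<^sup>2 - (ip S p x y)\<^sup>2 / n\<^sup>2"
    using n by (simp add: a_def power2_eq_square field_simps)
  finally have "(ip S p x y)\<^sup>2 \<le> (lnorm S p x * n)\<^sup>2"
    using n by (simp add: field_simps)
  then show ?thesis
    using x n lnorm_nonneg n_def by (metis abs_le_square_iff abs_of_nonneg less_imp_le mult_nonneg_nonneg)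
qed

lemma lnorm_triangle:
  assumes x: "x \<in> level S p" and y: "y \<in> level S p"
  shows "lnorm S p (x + y) \<le> lnorm S p x + lnorm S p y"
proof (rule power2_le_imp_le)
  show "(lnorm S p (x + y))\<^sup>2 \<le> (lnorm S p x + lnorm S p y)\<^sup>2"
    using ip_Cauchy_Schwarz[OF x y] x y by (simp add: lnorm_add_sq power2_sum)
qed (use x y lnorm_nonneg in auto)

subsection \<open>Orthogonal projections\<close>

text \<open>For a finite orthonormal \<open>B\<close>, the equation \<open>proj p B x = x\<close>
  serves throughout as the statement that \<open>x\<close> lies in the span of
  \<open>B\<close>.\<close>

definition proj :: "nat \<Rightarrow> 'h set \<Rightarrow> 'h \<Rightarrow> 'h" where
  "proj p B x = (\<Sum>e\<in>B. ip S p e x *\<^sub>R e)"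

lemma orthonormal_level: "orthonormal_in S p B \<Longrightarrow> e \<in> B \<Longrightarrow> e \<in> level S p"
  by (auto simp: orthonormal_in_def)

lemma orthonormal_ip:
  "orthonormal_in S p B \<Longrightarrow> e \<in> B \<Longrightarrow> f \<in> B \<Longrightarrow> ip S p e f = (if e = f then 1 else 0)"
  by (auto simp: orthonormal_in_def)

lemma proj_level: "orthonormal_in S p B \<Longrightarrow> proj p B x \<in> level S p"
  unfolding proj_def by (intro level_sum level_scale orthonormal_level)

lemma proj_nuc: "B \<subseteq> nuc S \<Longrightarrow> proj p B x \<in> nuc S"
  unfolding proj_def by (intro nuc_sum nuc_scale) auto

lemma ip_combination:
  assumes "finite B" "orthonormal_in S p B" "f \<in> B"
  shows "ip S p f (\<Sum>e\<in>B. c e *\<^sub>R e) = c f"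
proof -
  have "ip S p f (\<Sum>e\<in>B. c e *\<^sub>R e) = (\<Sum>e\<in>B. c e * ip S p f e)"
    using assms by (simp add: ip_sum_right ip_scale_right level_scale orthonormal_level)
  also have "\<dots> = (\<Sum>e\<in>B. if f = e then c e else 0)"
    using assms by (intro sum.cong) (auto simp: orthonormal_ip)
  finally show ?thesis using assms by simp
qed

lemma lnorm_combination_sq:
  assumes "finite B" "orthonormal_in S p B"
  shows "(lnorm S p (\<Sum>e\<in>B. c e *\<^sub>R e))\<^sup>2 = (\<Sum>e\<in>B. (c e)\<^sup>2)"
proof -
  have lv: "(\<Sum>e\<in>B. c e *\<^sub>R e) \<in> level S p"
    using assms by (intro level_sum level_scale orthonormal_level)
  have "(lnorm S p (\<Sum>e\<in>B. c e *\<^sub>R e))\<^sup>2 = (\<Sum>f\<in>B. c f * ip S p f (\<Sum>e\<in>B. c e *\<^sub>R e))"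
    using assms lv
    by (simp add: lnorm_sq ip_sum_left ip_scale_left level_scale orthonormal_level)
  also have "\<dots> = (\<Sum>e\<in>B. (c e)\<^sup>2)"
    using assms by (intro sum.cong) (auto simp: ip_combination power2_eq_square)
  finally show ?thesis .
qed

lemma ip_proj:
  assumes "finite B" "orthonormal_in S p B" "f \<in> B"
  shows "ip S p f (proj p B x) = ip S p f x"
  using ip_combination[OF assms] by (simp add: proj_def)

lemma ip_proj_residual:
  assumes "finite B" "orthonormal_in S p B" "f \<in> B" "x \<in> level S p"
  shows "ip S p f (x - proj p B x) = 0"
  using assms by (simp add: ip_diff_right proj_level orthonormal_level ip_proj)

lemma pythagoras:
  assumes "finite B" "orthonormal_in S p B" "x \<in> level S p"
  shows "(lnorm S p x)\<^sup>2 = (\<Sum>e\<in>B. (ip S p e x)\<^sup>2) + (lnorm S p (x - proj p B x))\<^sup>2"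
proof -
  have "ip S p (proj p B x) (x - proj p B x) = 0"
  proof -
    define r where "r = x - proj p B x"
    have "r \<in> level S p" "\<And>e. e \<in> B \<Longrightarrow> ip S p e r = 0"
      using assms by (auto simp: r_def level_diff proj_level ip_proj_residual)
    then have "ip S p (proj p B x) r = 0"
      unfolding proj_def using assms
      by (simp add: ip_sum_left ip_scale_left level_scale orthonormal_level)
    then show ?thesis by (simp add: r_def)
  qed
  moreover have "(lnorm S p (proj p B x + (x - proj p B x)))\<^sup>2 =
      (lnorm S p (proj p B x))\<^sup>2 + 2 * ip S p (proj p B x) (x - proj p B x)
        + (lnorm S p (x - proj p B x))\<^sup>2"
    using assms by (intro lnorm_add_sq) (auto simp: proj_level level_diff)
  ultimately show ?thesis
    using assms lnorm_combination_sq[of B p "\<lambda>e. ip S p e x"] by (simp add: proj_def)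
qed

lemma Bessel:
  assumes "finite B" "orthonormal_in S p B" "x \<in> level S p"
  shows "(\<Sum>e\<in>B. (ip S p e x)\<^sup>2) \<le> (lnorm S p x)\<^sup>2"
  using pythagoras[OF assms] by simp

lemma lnorm_proj_le:
  assumes "finite B" "orthonormal_in S p B" "x \<in> level S p"
  shows "lnorm S p (proj p B x) \<le> lnorm S p x" "lnorm S p (x - proj p B x) \<le> lnorm S p x"
proof -
  have "(lnorm S p (proj p B x))\<^sup>2 \<le> (lnorm S p x)\<^sup>2"
    using Bessel[OF assms] lnorm_combination_sq[OF assms(1,2), of "\<lambda>e. ip S p e x"]
    by (simp add: proj_def)
  then show "lnorm S p (proj p B x) \<le> lnorm S p x"
    using assms lnorm_nonneg power2_le_imp_le by blast
  have "(lnorm S p (x - proj p B x))\<^sup>2 \<le> (lnorm S p x)\<^sup>2"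
    using pythagoras[OF assms] by (simp add: sum_nonneg)
  then show "lnorm S p (x - proj p B x) \<le> lnorm S p x"
    using assms lnorm_nonneg power2_le_imp_le by blast
qed

text \<open>The vectors of \<open>B'\<close> outside \<open>B\<close> are orthogonal to the span of
  \<open>B\<close>, so they contribute nothing to the projection of \<open>x\<close>.\<close>

lemma proj_subset_fixed:
  assumes "finite B'" "orthonormal_in S p B'" "B \<subseteq> B'" "proj p B x = x"
  shows "proj p B' x = x"
proof -
  have "orthonormal_in S p B" "finite B"
    using assms finite_subset unfolding orthonormal_in_def by blast+
  have "ip S p e x = 0" if "e \<in> B' - B" for e
  proof -
    have "ip S p e (proj p B x) = (\<Sum>f\<in>B. ip S p f x * ip S p e f)"
    proof -
      have "e \<in> level S p" "\<And>f. f \<in> B \<Longrightarrow> f \<in> level S p"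
        using that assms orthonormal_level[OF assms(2)] by auto
      then show ?thesis
        unfolding proj_def by (simp add: ip_sum_right ip_scale_right level_scale)
    qed
    also have "\<dots> = 0"
    proof (intro sum.neutral ballI)
      fix f assume "f \<in> B"
      then have "ip S p e f = 0" using that assms orthonormal_ip[OF assms(2), of e f] by auto
      then show "ip S p f x * ip S p e f = 0" by simp
    qed
    finally show ?thesis using assms by simp
  qed
  then have "proj p B' x = proj p B x"
    unfolding proj_def using assms by (intro sum.mono_neutral_right) auto
  then show ?thesis using assms by simp
qed

text \<open>The residual of each new \<open>c\<close> is normalized and added to the system. The
  subspace \<open>W\<close> is a parameter because the process is run both in a whole level and
  inside \<open>nuc S\<close>, and a starting system \<open>B\<close> is kept so that nested systems
  can be built.\<close>

lemma Gram_Schmidt: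
  assumes W: "subspace W" "W \<subseteq> level S p" and C: "finite C" "C \<subseteq> W"
    and B: "finite B" "orthonormal_in S p B" "B \<subseteq> W"
  shows "\<exists>B'. finite B' \<and> orthonormal_in S p B' \<and> B \<subseteq> B' \<and> B' \<subseteq> W \<and> (\<forall>c\<in>C. proj p B' c = c)"
  using C
proof (induction C rule: finite_induct)
  case empty
  then show ?case using B by blast
next
  case (insert c C)
  then obtain B' where B': "finite B'" "orthonormal_in S p B'" "B \<subseteq> B'" "B' \<subseteq> W"
    "\<forall>c\<in>C. proj p B' c = c" by auto
  have c: "c \<in> W" "c \<in> level S p" using insert W by auto
  define r where "r = c - proj p B' c"
  have "proj p B' c \<in> W"
    unfolding proj_def using B' W by (intro subspace_sum subspace_scale) auto
  then have rW: "r \<in> W" using W c subspace_diff by (auto simp: r_def)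
  then have rl: "r \<in> level S p" using W by auto
  show ?case
  proof (cases "r = 0")
    case True
    then have "proj p B' c = c" by (simp add: r_def)
    then show ?thesis using B' by blast
  next
    case False
    define n where "n = lnorm S p r"
    have n: "n > 0" using False rl lnorm_pos by (simp add: n_def)
    define f where "f = (1 / n) *\<^sub>R r"
    have fl: "f \<in> level S p" "f \<in> W"
      using rl rW W by (auto simp: f_def level_scale subspace_scale)
    have ff: "ip S p f f = 1"
    proof -
      have "lnorm S p f = 1" using n rl by (simp add: f_def lnorm_scale flip: n_def)
      then show ?thesis using lnorm_sq[OF fl(1)] by simp
    qed
    have ef: "ip S p e f = 0" "ip S p f e = 0" if "e \<in> B'" for e
    proof -
      have "ip S p e r = 0" unfolding r_def using that B' c by (intro ip_proj_residual) auto
      then show "ip S p e f = 0"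
        using that B' rl by (simp add: f_def ip_scale_right orthonormal_level)
      then show "ip S p f e = 0"
        using that B' fl by (simp add: ip_sym[of f] orthonormal_level)
    qed
    have fB': "f \<notin> B'" using ff ef by force
    have on: "orthonormal_in S p (insert f B')"
      using B' fl ff ef fB' unfolding orthonormal_in_def by auto
    \<comment> \<open>\<open>f\<close> is orthogonal to the projected part of \<open>c\<close>, so
      only the residual, which is \<open>n *\<^sub>R f\<close>, contributes.\<close>
    have "ip S p f c = n"
    proof -
      have "ip S p f (proj p B' c) = 0"
        unfolding proj_def using B' fl ef
        by (simp add: ip_sum_right ip_scale_right level_scale orthonormal_level)
      then have "ip S p f c = ip S p f r"
        using c fl B' by (simp add: r_def ip_diff_right proj_level)
      also have "\<dots> = n * ip S p f f"
        using n rl fl by (simp add: f_def ip_scale_left ip_scale_right)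
      finally show ?thesis by (simp add: ff)
    qed
    then have "proj p (insert f B') c = n *\<^sub>R f + proj p B' c"
      using fB' B' by (simp add: proj_def)
    also have "\<dots> = c" using n by (simp add: f_def r_def)
    finally have "proj p (insert f B') c = c" .
    moreover have "proj p (insert f B') d = d" if "d \<in> C" for d
      using that B' on by (intro proj_subset_fixed[of "insert f B'" p B']) auto
    ultimately show ?thesis
      using B' on fl by (intro exI[of _ "insert f B'"]) auto
  qed
qed

section \<open>The dual levels\<close>

lemma dual_linear:
  assumes "x \<in> dual_level S p" "\<theta> \<in> nuc S" "\<eta> \<in> nuc S"
  shows "x (a *\<^sub>R \<theta> + b *\<^sub>R \<eta>) = a * x \<theta> + b * x \<eta>"
  using assms by (auto simp: dual_level_def)

lemma dual_outside: "x \<in> dual_level S p \<Longrightarrow> \<theta> \<notin> nuc S \<Longrightarrow> x \<theta> = 0"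
  by (auto simp: dual_level_def)

lemma dual_add: "x \<in> dual_level S p \<Longrightarrow> \<theta> \<in> nuc S \<Longrightarrow> \<eta> \<in> nuc S \<Longrightarrow> x (\<theta> + \<eta>) = x \<theta> + x \<eta>"
  using dual_linear[of x p \<theta> \<eta> 1 1] by simp

lemma dual_diff: "x \<in> dual_level S p \<Longrightarrow> \<theta> \<in> nuc S \<Longrightarrow> \<eta> \<in> nuc S \<Longrightarrow> x (\<theta> - \<eta>) = x \<theta> - x \<eta>"
  using dual_linear[of x p \<theta> \<eta> 1 "-1"] by simp

lemma dual_scale: "x \<in> dual_level S p \<Longrightarrow> \<theta> \<in> nuc S \<Longrightarrow> x (a *\<^sub>R \<theta>) = a * x \<theta>"
  using dual_linear[of x p \<theta> \<theta> a 0] by simp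

lemma dual_0: "x \<in> dual_level S p \<Longrightarrow> x 0 = 0"
  using dual_scale[of x p 0 0] nuc_0 by simp

lemma dual_sum:
  assumes "x \<in> dual_level S p" "\<And>i. i \<in> I \<Longrightarrow> \<theta> i \<in> nuc S"
  shows "x (\<Sum>i\<in>I. \<theta> i) = (\<Sum>i\<in>I. x (\<theta> i))"
  using assms(2)
  by (induction I rule: infinite_finite_induct) (auto simp: dual_0[OF assms(1)] dual_add[OF assms(1)] nuc_sum)

lemma dual_levelI:
  assumes "\<And>\<theta> \<eta> a b. \<theta> \<in> nuc S \<Longrightarrow> \<eta> \<in> nuc S \<Longrightarrow> x (a *\<^sub>R \<theta> + b *\<^sub>R \<eta>) = a * x \<theta> + b * x \<eta>"
    and "\<And>\<theta>. \<theta> \<in> nuc S \<Longrightarrow> \<bar>x \<theta>\<bar> \<le> C * lnorm S p \<theta>"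
    and "\<And>\<theta>. \<theta> \<notin> nuc S \<Longrightarrow> x \<theta> = 0"
  shows "x \<in> dual_level S p"
  unfolding dual_level_def using assms by blast

lemma dnorm_bdd:
  assumes "x \<in> dual_level S p"
  shows "bdd_above {\<bar>x \<theta>\<bar> | \<theta>. \<theta> \<in> nuc S \<and> lnorm S p \<theta> \<le> 1}"
proof -
  obtain C where C: "\<forall>\<theta>\<in>nuc S. \<bar>x \<theta>\<bar> \<le> C * lnorm S p \<theta>"
    using assms by (auto simp: dual_level_def)
  have "\<bar>x \<theta>\<bar> \<le> \<bar>C\<bar>" if "\<theta> \<in> nuc S" "lnorm S p \<theta> \<le> 1" for \<theta>
  proof -
    have "\<bar>x \<theta>\<bar> \<le> C * lnorm S p \<theta>" using C that by auto
    also have "\<dots> \<le> \<bar>C\<bar> * lnorm S p \<theta>"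
      using that lnorm_nonneg nuc_level by (intro mult_right_mono) auto
    also have "\<dots> \<le> \<bar>C\<bar> * 1" using that by (intro mult_left_mono) auto
    finally show ?thesis by simp
  qed
  then show ?thesis by (intro bdd_aboveI[of _ "\<bar>C\<bar>"]) auto
qed

lemma dnorm_nonneg: "x \<in> dual_level S p \<Longrightarrow> 0 \<le> dnorm S p x"
  unfolding dnorm_def
  by (rule cSup_upper2[OF _ _ dnorm_bdd, of "\<bar>x 0\<bar>"]) (auto intro!: exI[of _ 0] simp: nuc_0)

lemma dual_bound:
  assumes x: "x \<in> dual_level S p" and \<theta>: "\<theta> \<in> nuc S"
  shows "\<bar>x \<theta>\<bar> \<le> dnorm S p x * lnorm S p \<theta>"
proof (cases "\<theta> = 0")
  case True
  then show ?thesis using x by (simp add: dual_0)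
next
  case False
  define n where "n = lnorm S p \<theta>"
  have n: "n > 0" using False \<theta> lnorm_pos nuc_level by (simp add: n_def)
  have "\<bar>x ((1 / n) *\<^sub>R \<theta>)\<bar> \<le> dnorm S p x"
    unfolding dnorm_def using n \<theta> nuc_level
    by (intro cSup_upper dnorm_bdd[OF x])
      (auto intro!: exI[of _ "(1 / n) *\<^sub>R \<theta>"] simp: nuc_scale lnorm_scale simp flip: n_def)
  then show ?thesis
    using n x \<theta> by (simp add: dual_scale abs_mult field_simps flip: n_def)
qed

lemma dnorm_le:
  assumes "\<And>\<theta>. \<theta> \<in> nuc S \<Longrightarrow> \<bar>x \<theta>\<bar> \<le> C * lnorm S p \<theta>" "0 \<le> C"
  shows "dnorm S p x \<le> C"
  unfolding dnorm_def
proof (rule cSup_least)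
  show "{\<bar>x \<theta>\<bar> |\<theta>. \<theta> \<in> nuc S \<and> lnorm S p \<theta> \<le> 1} \<noteq> {}"
    using nuc_0 by (auto intro!: exI[of _ 0])
  fix y assume "y \<in> {\<bar>x \<theta>\<bar> |\<theta>. \<theta> \<in> nuc S \<and> lnorm S p \<theta> \<le> 1}"
  then obtain \<theta> where \<theta>: "y = \<bar>x \<theta>\<bar>" "\<theta> \<in> nuc S" "lnorm S p \<theta> \<le> 1" by auto
  then have "y \<le> C * lnorm S p \<theta>" using assms by auto
  also have "\<dots> \<le> C * 1" using \<theta> assms by (intro mult_left_mono) auto
  finally show "y \<le> C" by simp
qed

lemma dual_level_mono: "p \<le> q \<Longrightarrow> x \<in> dual_level S p \<Longrightarrow> x \<in> dual_level S q"
proof (rule dual_levelI[where C = "dnorm S p x"])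
  fix \<theta> assume *: "p \<le> q" "x \<in> dual_level S p" "\<theta> \<in> nuc S"
  have "\<bar>x \<theta>\<bar> \<le> dnorm S p x * lnorm S p \<theta>" using * by (intro dual_bound)
  also have "\<dots> \<le> dnorm S p x * lnorm S q \<theta>"
    using * by (intro mult_left_mono lnorm_mono nuc_level dnorm_nonneg)
  finally show "\<bar>x \<theta>\<bar> \<le> dnorm S p x * lnorm S q \<theta>" .
qed (auto simp: dual_linear dual_outside)

lemma dnorm_mono: "p \<le> q \<Longrightarrow> x \<in> dual_level S p \<Longrightarrow> dnorm S q x \<le> dnorm S p x"
proof (rule dnorm_le)
  fix \<theta> assume *: "p \<le> q" "x \<in> dual_level S p" "\<theta> \<in> nuc S"
  have "\<bar>x \<theta>\<bar> \<le> dnorm S p x * lnorm S p \<theta>" using * by (intro dual_bound)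
  also have "\<dots> \<le> dnorm S p x * lnorm S q \<theta>"
    using * by (intro mult_left_mono lnorm_mono nuc_level dnorm_nonneg)
  finally show "\<bar>x \<theta>\<bar> \<le> dnorm S p x * lnorm S q \<theta>" .
qed (rule dnorm_nonneg)

lemma dual_comb_bound:
  assumes x: "x \<in> dual_level S p" and y: "y \<in> dual_level S p" and \<theta>: "\<theta> \<in> nuc S"
  shows "\<bar>a * x \<theta> + b * y \<theta>\<bar> \<le> (\<bar>a\<bar> * dnorm S p x + \<bar>b\<bar> * dnorm S p y) * lnorm S p \<theta>"
proof -
  have "\<bar>a * x \<theta> + b * y \<theta>\<bar> \<le> \<bar>a\<bar> * \<bar>x \<theta>\<bar> + \<bar>b\<bar> * \<bar>y \<theta>\<bar>"
    by (metis abs_mult abs_triangle_ineq)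
  also have "\<dots> \<le> \<bar>a\<bar> * (dnorm S p x * lnorm S p \<theta>) + \<bar>b\<bar> * (dnorm S p y * lnorm S p \<theta>)"
    using assms by (intro add_mono mult_left_mono dual_bound) auto
  finally show ?thesis by (simp add: algebra_simps)
qed

lemma dual_level_comb:
  assumes "x \<in> dual_level S p" "y \<in> dual_level S p"
  shows "(\<lambda>\<theta>. a * x \<theta> + b * y \<theta>) \<in> dual_level S p"
  using assms
  by (intro dual_levelI[where C = "\<bar>a\<bar> * dnorm S p x + \<bar>b\<bar> * dnorm S p y"])
    (auto simp: dual_linear dual_outside algebra_simps intro: dual_comb_bound[simplified algebra_simps])

lemma dnorm_comb:
  assumes "x \<in> dual_level S p" "y \<in> dual_level S p"
  shows "dnorm S p (\<lambda>\<theta>. a * x \<theta> + b * y \<theta>) \<le> \<bar>a\<bar> * dnorm S p x + \<bar>b\<bar> * dnorm S p y"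
  using assms by (intro dnorm_le dual_comb_bound) (auto simp: dnorm_nonneg)

lemma dual_level_zero: "(\<lambda>\<theta>. 0) \<in> dual_level S p"
  by (rule dual_levelI[where C = 0]) auto

lemma dnorm_zero: "dnorm S p (\<lambda>\<theta>. 0) = 0"
  using dnorm_le[of "\<lambda>\<theta>. 0" 0 p] dnorm_nonneg[OF dual_level_zero[of p]] by simp

lemma dual_level_scale: "x \<in> dual_level S p \<Longrightarrow> (\<lambda>\<theta>. a * x \<theta>) \<in> dual_level S p"
  using dual_level_comb[of x p x a 0] by simp

lemma dual_level_add:
  "x \<in> dual_level S p \<Longrightarrow> y \<in> dual_level S p \<Longrightarrow> (\<lambda>\<theta>. x \<theta> + y \<theta>) \<in> dual_level S p"
  using dual_level_comb[of x p y 1 1] by simp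

lemma dual_level_diff:
  "x \<in> dual_level S p \<Longrightarrow> y \<in> dual_level S p \<Longrightarrow> (\<lambda>\<theta>. x \<theta> - y \<theta>) \<in> dual_level S p"
  using dual_level_comb[of x p y 1 "-1"] by simp

lemma dnorm_scale_le: "x \<in> dual_level S p \<Longrightarrow> dnorm S p (\<lambda>\<theta>. a * x \<theta>) \<le> \<bar>a\<bar> * dnorm S p x"
  using dnorm_comb[of x p x a 0] by simp

lemma dnorm_eq_0:
  assumes "x \<in> dual_level S p" "dnorm S p x = 0"
  shows "x = (\<lambda>\<theta>. 0)"
proof
  fix \<theta> show "x \<theta> = 0"
    using dual_bound[of x p \<theta>] assms dual_outside[of x p \<theta>] by (cases "\<theta> \<in> nuc S") auto
qed

lemma riesz_dual: "e \<in> level S p \<Longrightarrow> riesz S p e \<in> dual_level S p"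
  by (rule dual_levelI[where C = "lnorm S p e"])
    (auto simp: riesz_def nuc_add nuc_scale ip_add_right ip_scale_right nuc_level level_scale
      ip_Cauchy_Schwarz)

text \<open>The representing vector is the limit of a sequence in \<open>\<N>\<close> minimizing
  \<open>|\<theta>|\<^sub>p\<^sup>2 - 2 x(\<theta>)\<close>; being a limit of vectors of \<open>\<N>\<close>, it lies in the closure of \<open>\<N>\<close>, which is why its norm
  does not exceed that of \<open>x\<close>.\<close>

lemma riesz_representation:
  assumes x: "x \<in> dual_level S p"
  obtains h where "h \<in> level S p" "x = riesz S p h" "lnorm S p h \<le> dnorm S p x"
proof -
  define J where "J \<theta> = (lnorm S p \<theta>)\<^sup>2 - 2 * x \<theta>" for \<theta>
  define d where "d = dnorm S p x"
  have d: "d \<ge> 0" using x dnorm_nonneg d_def by simp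
  have J_ge: "- d\<^sup>2 \<le> J \<theta>" if "\<theta> \<in> nuc S" for \<theta>
  proof -
    have "x \<theta> \<le> d * lnorm S p \<theta>" using dual_bound[OF x that] by (simp add: d_def)
    moreover have "0 \<le> (lnorm S p \<theta> - d)\<^sup>2" by simp
    ultimately show ?thesis unfolding J_def power2_diff by (simp add: algebra_simps)
  qed
  define m where "m = Inf (J ` nuc S)"
  have bdd: "bdd_below (J ` nuc S)" using J_ge by (intro bdd_belowI[of _ "- d\<^sup>2"]) auto
  have m_le: "m \<le> J \<theta>" if "\<theta> \<in> nuc S" for \<theta>
    unfolding m_def using that bdd by (intro cInf_lower) auto
  have "\<exists>\<theta>\<in>nuc S. J \<theta> < m + 1 / real (Suc n)" for n
  proof -
    have "Inf (J ` nuc S) < m + 1 / real (Suc n)" unfolding m_def by simp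
    then show ?thesis using cInf_lessD[of "J ` nuc S"] nuc_0 by fastforce
  qed
  then obtain \<theta> where \<theta>: "\<And>n. \<theta> n \<in> nuc S" "\<And>n. J (\<theta> n) < m + 1 / real (Suc n)"
    by metis
  \<comment> \<open>Parallelogram identity: the midpoint of two almost minimal vectors cannot push
    \<open>J\<close> below \<open>m\<close>, so the two vectors are close. The minimizing sequence
    is therefore Cauchy.\<close>
  have par: "(lnorm S p (\<theta> i - \<theta> j))\<^sup>2 \<le> 2 / real (Suc i) + 2 / real (Suc j)" for i j
  proof -
    have l: "\<theta> i \<in> level S p" "\<theta> j \<in> level S p" using \<theta> nuc_level by auto
    have mid: "(1/2) *\<^sub>R \<theta> i + (1/2) *\<^sub>R \<theta> j \<in> nuc S" using \<theta> nuc_add nuc_scale by auto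
    have "J ((1/2) *\<^sub>R \<theta> i + (1/2) *\<^sub>R \<theta> j) =
       (lnorm S p (\<theta> i))\<^sup>2 / 4 + (lnorm S p (\<theta> j))\<^sup>2 / 4 + ip S p (\<theta> i) (\<theta> j) / 2 - x (\<theta> i) - x (\<theta> j)"
      unfolding J_def using l \<theta>
      by (simp add: lnorm_add_sq level_scale lnorm_scale ip_scale_left ip_scale_right
          dual_linear[OF x] power_mult_distrib power_divide)
    moreover have "(lnorm S p (\<theta> i - \<theta> j))\<^sup>2 =
       (lnorm S p (\<theta> i))\<^sup>2 - 2 * ip S p (\<theta> i) (\<theta> j) + (lnorm S p (\<theta> j))\<^sup>2"
      using l by (rule lnorm_diff_sq)
    ultimately have "(lnorm S p (\<theta> i - \<theta> j))\<^sup>2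
        = 2 * J (\<theta> i) + 2 * J (\<theta> j) - 4 * J ((1/2) *\<^sub>R \<theta> i + (1/2) *\<^sub>R \<theta> j)"
      by (simp add: J_def)
    then show ?thesis using \<theta>(2)[of i] \<theta>(2)[of j] m_le[OF mid] by linarith
  qed
  obtain h where h: "h \<in> level S p" "(\<lambda>n. lnorm S p (\<theta> n - h)) \<longlonglongrightarrow> 0"
  proof (rule level_complete[of \<theta> p])
    show "\<theta> n \<in> level S p" for n using \<theta> nuc_level by auto
    fix \<epsilon> :: real assume \<epsilon>: "\<epsilon> > 0"
    obtain M :: nat where M: "4 / \<epsilon>\<^sup>2 < real M" using reals_Archimedean2 by blast
    have "lnorm S p (\<theta> i - \<theta> j) < \<epsilon>" if "i \<ge> M" "j \<ge> M" for i j
    proof (rule power2_less_imp_less)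
      have "M > 0" using M by (metis divide_nonneg_nonneg less_eq_real_def not_less of_nat_0 zero_less_iff_neq_zero zero_le_power2 zero_le_numeral)
      have "2 / real (Suc i) + 2 / real (Suc j) \<le> 2 / real M + 2 / real M"
        using that \<open>M > 0\<close> by (intro add_mono divide_left_mono) auto
      also have "\<dots> < \<epsilon>\<^sup>2" using M \<epsilon> \<open>M > 0\<close> by (simp add: field_simps)
      finally show "(lnorm S p (\<theta> i - \<theta> j))\<^sup>2 < \<epsilon>\<^sup>2" using par[of i j] by linarith
    qed (use \<epsilon> in auto)
    then show "\<exists>M. \<forall>m\<ge>M. \<forall>n\<ge>M. lnorm S p (\<theta> m - \<theta> n) < \<epsilon>" by blast
  qed
  have lim_ip: "(\<lambda>n. ip S p (\<theta> n) \<eta>) \<longlonglongrightarrow> ip S p h \<eta>" if "\<eta> \<in> level S p" for \<eta>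
  proof (rule LIM_zero_cancel, rule Lim_null_comparison)
    show "\<forall>\<^sub>F n in sequentially. norm (ip S p (\<theta> n) \<eta> - ip S p h \<eta>) \<le> lnorm S p (\<theta> n - h) * lnorm S p \<eta>"
      using ip_Cauchy_Schwarz[of "\<theta> _ - h" p \<eta>] that h \<theta> nuc_level
      by (intro always_eventually) (auto simp: ip_diff_left level_diff)
    show "(\<lambda>n. lnorm S p (\<theta> n - h) * lnorm S p \<eta>) \<longlonglongrightarrow> 0"
      using h(2) tendsto_mult_left_zero by blast
  qed
  \<comment> \<open>First variation: perturbing \<open>\<theta> n\<close> by
    \<open>t *\<^sub>R \<eta>\<close> keeps \<open>J\<close> above \<open>m\<close>. In the limit a
    quadratic in \<open>t\<close> without constant term is nonnegative for all \<open>t\<close>,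
    which forces its linear coefficient to vanish.\<close>
  have rep: "x \<eta> = ip S p h \<eta>" if \<eta>: "\<eta> \<in> nuc S" for \<eta>
  proof -
    define A where "A = (lnorm S p \<eta>)\<^sup>2"
    have A: "A \<ge> 0" by (simp add: A_def)
    have l: "\<eta> \<in> level S p" using \<eta> nuc_level by auto
    have key: "0 \<le> 1 / real (Suc n) + t * (2 * (ip S p (\<theta> n) \<eta> - x \<eta>)) + t\<^sup>2 * A" for n t
    proof -
      have "\<theta> n + t *\<^sub>R \<eta> \<in> nuc S" using \<theta> \<eta> nuc_add nuc_scale by auto
      then have "m \<le> J (\<theta> n + t *\<^sub>R \<eta>)" by (rule m_le)
      also have "\<dots> = J (\<theta> n) + t * (2 * (ip S p (\<theta> n) \<eta> - x \<eta>)) + t\<^sup>2 * A"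
        using \<theta> \<eta> l nuc_level[OF \<theta>(1)] x
        by (simp add: J_def A_def lnorm_add_sq level_scale lnorm_scale ip_scale_right
            dual_add dual_scale nuc_scale power_mult_distrib algebra_simps)
      finally show ?thesis using \<theta>(2)[of n] by linarith
    qed
    have "0 \<le> t * (2 * (ip S p h \<eta> - x \<eta>)) + t\<^sup>2 * A" for t
    proof -
      have "(\<lambda>n. 1 / real (Suc n) + t * (2 * (ip S p (\<theta> n) \<eta> - x \<eta>)) + t\<^sup>2 * A) \<longlonglongrightarrow>
          0 + t * (2 * (ip S p h \<eta> - x \<eta>)) + t\<^sup>2 * A"
        using LIMSEQ_inverse_real_of_nat lim_ip[OF l]
        by (intro tendsto_intros) (simp_all add: inverse_eq_divide)
      then show ?thesis using key by (intro LIMSEQ_le_const[where a = 0]) auto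
    qed
    note q = this
    define c where "c = ip S p h \<eta> - x \<eta>"
    have "c = 0"
    proof (rule ccontr)
      assume "c \<noteq> 0"
      \<comment> \<open>Near the minimum of the quadratic, where it would be negative;
        \<open>A + 1\<close> in place of \<open>A\<close> keeps the quotient meaningful when
        \<open>\<eta> = 0\<close>.\<close>
      define t where "t = - c / (A + 1)"
      have "0 \<le> t * (2 * c) + t\<^sup>2 * A" using q[of t] by (simp add: c_def)
      also have "t * (2 * c) + t\<^sup>2 * A = - (c\<^sup>2 * (A + 2)) / (A + 1)\<^sup>2"
        using A by (simp add: t_def power2_eq_square divide_simps) (simp add: algebra_simps)
      also have "\<dots> < 0"
      proof (rule divide_neg_pos)
        have "0 < c\<^sup>2 * (A + 2)" using A \<open>c \<noteq> 0\<close> by (intro mult_pos_pos) auto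
        then show "- (c\<^sup>2 * (A + 2)) < 0" by linarith
        show "0 < (A + 1)\<^sup>2" using A by (intro zero_less_power) auto
      qed
      finally show False by simp
    qed
    then show ?thesis by (simp add: c_def)
  qed
  have "x = riesz S p h"
    using rep dual_outside[OF x] by (auto simp: riesz_def)
  \<comment> \<open>\<open>h\<close> itself need not lie in \<open>nuc S\<close>, so
    \<open>x\<close> is evaluated at \<open>\<theta> n\<close> instead. The limit gives
    \<open>|h|^2 \<le> d |h|\<close>.\<close>
  moreover have "lnorm S p h \<le> d"
  proof -
    have "(\<lambda>n. ip S p (\<theta> n) h) \<longlonglongrightarrow> (lnorm S p h)\<^sup>2" using lim_ip[OF h(1)] h by (simp add: lnorm_sq)
    moreover have "(\<lambda>n. d * (lnorm S p (\<theta> n - h) + lnorm S p h)) \<longlonglongrightarrow> d * (0 + lnorm S p h)"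
      using h by (intro tendsto_intros)
    moreover have "ip S p (\<theta> n) h \<le> d * (lnorm S p (\<theta> n - h) + lnorm S p h)" for n
    proof -
      have l: "\<theta> n \<in> level S p" using \<theta> nuc_level by auto
      have "ip S p (\<theta> n) h = x (\<theta> n)" using rep[OF \<theta>(1)] ip_sym[OF l h(1)] by simp
      also have "\<dots> \<le> d * lnorm S p (\<theta> n)" using dual_bound[OF x \<theta>(1), of n] by (simp add: d_def)
      also have "\<dots> \<le> d * (lnorm S p (\<theta> n - h) + lnorm S p h)"
        using lnorm_triangle[of "\<theta> n - h" p h] l h d by (intro mult_left_mono) (auto simp: level_diff)
      finally show ?thesis .
    qed
    ultimately have "(lnorm S p h)\<^sup>2 \<le> d * (0 + lnorm S p h)"
      by (intro LIMSEQ_le) auto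
    then show ?thesis
      using lnorm_nonneg[OF h(1)] d by (cases "lnorm S p h = 0") (auto simp: power2_eq_square)
  qed
  ultimately show ?thesis using that h d_def by auto
qed


section \<open>Hilbert-Schmidt embeddings\<close>

text \<open>Both forms of the Hilbert-Schmidt norm of the embedding of level \<open>q\<close> into
  level \<open>p\<close>. The second sum runs over orthonormal systems of the source. The first runs
  over systems of the target and measures the adjoint, since \<open>dnorm S q (riesz S p e)\<close>
  is the norm of \<open>ip S p e\<close> as a functional on \<open>nuc S\<close> with the norm of
  level \<open>q\<close>. Finite systems with a common bound replace bases.\<close>

definition hs_bound :: "nat \<Rightarrow> nat \<Rightarrow> real \<Rightarrow> bool" where
  "hs_bound p q K \<longleftrightarrow> p \<le> q \<and> 0 \<le> K \<and>
     (\<forall>B. finite B \<and> orthonormal_in S p B \<longrightarrow> (\<Sum>e\<in>B. (dnorm S q (riesz S p e))\<^sup>2) \<le> K\<^sup>2) \<and>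
     (\<forall>B. finite B \<and> orthonormal_in S q B \<longrightarrow> (\<Sum>e\<in>B. (lnorm S p e)\<^sup>2) \<le> K\<^sup>2)"

text \<open>\<open>\<kappa> c\<close> is the square-sum norm of the coefficients of
  \<open>ip S p c\<close> along the given basis \<open>E\<close> of level \<open>q\<close>, hence a
  bound for this functional on level \<open>q\<close>. Summing over \<open>C\<close> first, Bessel's
  inequality in level \<open>p\<close> leaves the sum of \<open>(lnorm S p e)\<^sup>2\<close> over
  \<open>E\<close>, which no longer depends on \<open>C\<close>.\<close>

lemma hs_embedding_functional_bounds:
  assumes "hs_embedding S q p" "p \<le> q"
  obtains \<kappa> K where "0 \<le> K" "\<And>c. 0 \<le> \<kappa> c"
    "\<And>c x. c \<in> level S p \<Longrightarrow> x \<in> level S q \<Longrightarrow> \<bar>ip S p c x\<bar> \<le> \<kappa> c * lnorm S q x"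
    "\<And>C. finite C \<Longrightarrow> orthonormal_in S p C \<Longrightarrow> (\<Sum>c\<in>C. (\<kappa> c)\<^sup>2) \<le> K\<^sup>2"
proof -
  obtain E where E: "orthonormal_basis S q E" "(\<lambda>e. (lnorm S p e)\<^sup>2) summable_on E"
    using assms by (auto simp: hs_embedding_def)
  have on: "orthonormal_in S q E" using E by (simp add: orthonormal_basis_def)
  have Eq: "e \<in> level S q" "e \<in> level S p" if "e \<in> E" for e
    using that on orthonormal_level level_mono[OF \<open>p \<le> q\<close>] by blast+
  define K where "K = sqrt (infsum (\<lambda>e. (lnorm S p e)\<^sup>2) E)"
  have K2: "K\<^sup>2 = infsum (\<lambda>e. (lnorm S p e)\<^sup>2) E" by (simp add: K_def infsum_nonneg)
  define \<kappa> where "\<kappa> c = sqrt (infsum (\<lambda>e. (ip S p c e)\<^sup>2) E)" for c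
  have \<kappa>2: "(\<kappa> c)\<^sup>2 = infsum (\<lambda>e. (ip S p c e)\<^sup>2) E" for c by (simp add: \<kappa>_def infsum_nonneg)
  have summ: "(\<lambda>e. (ip S p c e)\<^sup>2) summable_on E" if c: "c \<in> level S p" for c
  proof (rule summable_on_comparison_test)
    show "(\<lambda>e. (lnorm S p c)\<^sup>2 * (lnorm S p e)\<^sup>2) summable_on E"
      using E by (intro summable_on_cmult_right)
    show "(ip S p c e)\<^sup>2 \<le> (lnorm S p c)\<^sup>2 * (lnorm S p e)\<^sup>2" if "e \<in> E" for e
      using power_mono[OF ip_Cauchy_Schwarz[OF c Eq(2)[OF that]], of 2]
      by (simp add: power_mult_distrib)
  qed auto
  have fin: "\<bar>ip S p c y\<bar> \<le> \<kappa> c * lnorm S q y" if c: "c \<in> level S p" and y: "y \<in> span E" for c y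
  proof -
    obtain F u where F: "finite F" "F \<subseteq> E" "y = (\<Sum>e\<in>F. u e *\<^sub>R e)"
      using y by (auto simp: span_explicit)
    have onF: "orthonormal_in S q F" using F on unfolding orthonormal_in_def by blast
    have yq: "y \<in> level S q" unfolding F using F Eq by (intro level_sum level_scale) auto
    have "ip S p c y = (\<Sum>e\<in>F. u e * ip S p c e)"
      unfolding F using c F Eq(2) by (subst ip_sum_right) (auto simp: level_scale ip_scale_right subset_iff)
    also have "\<bar>\<dots>\<bar> \<le> L2_set u F * L2_set (\<lambda>e. ip S p c e) F"
      by (rule order_trans[OF sum_abs]) (auto simp: abs_mult intro: L2_set_mult_ineq)
    also have "L2_set u F = lnorm S q y"
      using lnorm_combination_sq[OF F(1) onF, of u] lnorm_nonneg[OF yq]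
      unfolding L2_set_def F(3)[symmetric] by (metis real_sqrt_unique)
    also have "L2_set (\<lambda>e. ip S p c e) F \<le> \<kappa> c"
      unfolding L2_set_def \<kappa>_def
      using F summ[OF c] by (intro real_sqrt_le_mono finite_sum_le_infsum) auto
    finally show ?thesis
      using lnorm_nonneg[OF yq] by (simp add: mult.commute mult_right_mono)
  qed
  have bound: "\<bar>ip S p c x\<bar> \<le> \<kappa> c * lnorm S q x" if c: "c \<in> level S p" and x: "x \<in> level S q" for c x
  proof (rule field_le_epsilon)
    fix \<epsilon> :: real assume \<epsilon>: "\<epsilon> > 0"
    have \<kappa>0: "0 \<le> \<kappa> c" by (simp add: \<kappa>_def infsum_nonneg)
    have lc: "0 \<le> lnorm S p c" using c lnorm_nonneg by simp
    \<comment> \<open>The bound on the span of \<open>E\<close> passes to \<open>x\<close> by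
      density with error \<open>(\<kappa> c + lnorm S p c) * \<delta>\<close>; the summand 1 keeps
      the denominator positive.\<close>
    define \<delta> where "\<delta> = \<epsilon> / (\<kappa> c + lnorm S p c + 1)"
    have \<delta>: "\<delta> > 0" using \<epsilon> \<kappa>0 lc by (simp add: \<delta>_def)
    obtain y where y: "y \<in> span E" "lnorm S q (x - y) < \<delta>"
      using E(1) x \<delta> unfolding orthonormal_basis_def by blast
    have yq: "y \<in> level S q"
      using y(1) Eq(1) span_minimal[OF _ subspace_level, of E q] by blast
    have p: "x \<in> level S p" "y \<in> level S p" "x - y \<in> level S q"
      using x yq level_mono[OF \<open>p \<le> q\<close>] level_diff by blast+
    have "\<bar>ip S p c x\<bar> \<le> \<bar>ip S p c y\<bar> + \<bar>ip S p c (x - y)\<bar>"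
      using c p by (simp add: ip_diff_right)
    also have "\<dots> \<le> \<kappa> c * lnorm S q y + lnorm S p c * lnorm S p (x - y)"
      using c p y by (intro add_mono fin ip_Cauchy_Schwarz level_diff)
    also have "\<dots> \<le> \<kappa> c * (lnorm S q x + \<delta>) + lnorm S p c * \<delta>"
    proof (intro add_mono mult_left_mono)
      have "lnorm S q y \<le> lnorm S q x + lnorm S q (y - x)"
        using lnorm_triangle[of x q "y - x"] x yq by (simp add: level_diff)
      then show "lnorm S q y \<le> lnorm S q x + \<delta>"
        using y lnorm_minus_commute[OF x yq] by simp
      show "lnorm S p (x - y) \<le> \<delta>"
        using lnorm_mono[OF \<open>p \<le> q\<close> p(3)] y by simp
    qed (use \<kappa>0 lc in auto)
    also have "\<dots> = \<kappa> c * lnorm S q x + (\<kappa> c + lnorm S p c) * \<delta>" by (simp add: algebra_simps)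
    also have "(\<kappa> c + lnorm S p c) * \<delta> \<le> \<epsilon>"
      using \<kappa>0 lc \<epsilon> by (simp add: \<delta>_def field_simps)
    finally show "\<bar>ip S p c x\<bar> \<le> \<kappa> c * lnorm S q x + \<epsilon>" by simp
  qed
  have "(\<Sum>c\<in>C. (\<kappa> c)\<^sup>2) \<le> K\<^sup>2" if C: "finite C" "orthonormal_in S p C" for C
  proof -
    have Cl: "c \<in> level S p" if "c \<in> C" for c using that C orthonormal_level by blast
    have hs: "((\<lambda>e. \<Sum>c\<in>C. (ip S p c e)\<^sup>2) has_sum (\<Sum>c\<in>C. (\<kappa> c)\<^sup>2)) E"
      unfolding \<kappa>2 by (intro has_sum_finite_sum has_sum_infsum summ Cl)
    then show ?thesis
      unfolding K2 using has_sum_infsum[OF E(2)]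
      by (rule has_sum_mono) (auto intro!: Bessel C Eq)
  qed
  then show ?thesis
    using that[of K \<kappa>] bound by (auto simp: K_def \<kappa>_def infsum_nonneg)
qed

text \<open>The sum over systems of level \<open>p\<close> is read off from the functionals
  \<open>\<kappa>\<close>. For a system \<open>B\<close> of level \<open>q\<close>, Gram-Schmidt in
  level \<open>p\<close> supplies an orthonormal \<open>C\<close> whose span contains
  \<open>B\<close>. Expanding each \<open>lnorm S p e\<close> along \<open>C\<close> and exchanging
  the sums reduces the second bound to the first kind.\<close>

lemma hs_bound_exists: "\<exists>q K. hs_bound p q K"
proof -
  obtain q where q: "p < q" "hs_embedding S q p"
    using nuclear unfolding nuclear_triple_def by blast
  then have pq: "p \<le> q" by simp
  obtain K \<kappa> where K: "0 \<le> K" "\<And>c. 0 \<le> \<kappa> c"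
    "\<And>c x. c \<in> level S p \<Longrightarrow> x \<in> level S q \<Longrightarrow> \<bar>ip S p c x\<bar> \<le> \<kappa> c * lnorm S q x"
    "\<And>C. finite C \<Longrightarrow> orthonormal_in S p C \<Longrightarrow> (\<Sum>c\<in>C. (\<kappa> c)\<^sup>2) \<le> K\<^sup>2"
    using hs_embedding_functional_bounds[OF q(2) pq] by metis
  have "(\<Sum>e\<in>B. (dnorm S q (riesz S p e))\<^sup>2) \<le> K\<^sup>2" if B: "finite B" "orthonormal_in S p B" for B
  proof -
    have "(dnorm S q (riesz S p e))\<^sup>2 \<le> (\<kappa> e)\<^sup>2" if "e \<in> B" for e
    proof (rule power_mono)
      have e: "e \<in> level S p" using that B orthonormal_level by blast
      show "dnorm S q (riesz S p e) \<le> \<kappa> e"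
        using K e by (intro dnorm_le) (auto simp: riesz_def nuc_level)
      show "0 \<le> dnorm S q (riesz S p e)"
        using e riesz_dual dual_level_mono[OF pq] dnorm_nonneg by blast
    qed
    then show ?thesis using K(4)[OF B] sum_mono[of B] by (meson order_trans)
  qed
  moreover have "(\<Sum>e\<in>B. (lnorm S p e)\<^sup>2) \<le> K\<^sup>2" if B: "finite B" "orthonormal_in S q B" for B
  proof -
    have Bl: "B \<subseteq> level S p" "\<And>e. e \<in> B \<Longrightarrow> e \<in> level S q"
      using B orthonormal_level level_mono[OF pq] by blast+
    have "\<exists>C. finite C \<and> orthonormal_in S p C \<and> {} \<subseteq> C \<and> C \<subseteq> level S p \<and> (\<forall>c\<in>B. proj p C c = c)"
      using B Bl by (intro Gram_Schmidt subspace_level) (auto simp: orthonormal_in_def)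
    then obtain C where C: "finite C" "orthonormal_in S p C" "\<forall>c\<in>B. proj p C c = c" by blast
    have col: "(\<Sum>e\<in>B. (ip S p c e)\<^sup>2) \<le> (\<kappa> c)\<^sup>2" if "c \<in> C" for c
    proof -
      have c: "c \<in> level S p" using that C orthonormal_level by blast
      define t where "t = (\<Sum>e\<in>B. (ip S p c e)\<^sup>2)"
      have t0: "t \<ge> 0" by (simp add: t_def sum_nonneg)
      \<comment> \<open>Testing \<open>ip S p c\<close> on the combination of \<open>B\<close> with
        its own coefficients: value and squared norm are both \<open>t\<close>, so the bound for the
        functional reads \<open>t^2 \<le> (\<kappa> c)^2 t\<close>.\<close>
      define x where "x = (\<Sum>e\<in>B. ip S p c e *\<^sub>R e)"
      have xq: "x \<in> level S q" unfolding x_def using Bl by (intro level_sum level_scale)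
      have "ip S p c x = t"
        unfolding x_def t_def using c Bl
        by (subst ip_sum_right) (auto simp: ip_scale_right level_scale power2_eq_square subset_iff)
      moreover have "(lnorm S q x)\<^sup>2 = t"
        unfolding x_def t_def by (rule lnorm_combination_sq[OF B])
      ultimately have "t\<^sup>2 \<le> (\<kappa> c)\<^sup>2 * t"
        using power_mono[OF K(3)[OF c xq], of 2] t0 by (simp add: power_mult_distrib)
      then show ?thesis
        using t0 unfolding t_def[symmetric] by (cases "t = 0") (auto simp: power2_eq_square)
    qed
    have "(\<Sum>e\<in>B. (lnorm S p e)\<^sup>2) = (\<Sum>e\<in>B. \<Sum>c\<in>C. (ip S p c e)\<^sup>2)"
    proof (rule sum.cong)
      fix e assume e: "e \<in> B"
      show "(lnorm S p e)\<^sup>2 = (\<Sum>c\<in>C. (ip S p c e)\<^sup>2)"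
        using pythagoras[OF C(1,2), of e] e C(3) Bl by auto
    qed simp
    also have "\<dots> = (\<Sum>c\<in>C. \<Sum>e\<in>B. (ip S p c e)\<^sup>2)" by (rule sum.swap)
    also have "\<dots> \<le> (\<Sum>c\<in>C. (\<kappa> c)\<^sup>2)" by (intro sum_mono col)
    also have "\<dots> \<le> K\<^sup>2" using C by (intro K(4))
    finally show ?thesis .
  qed
  ultimately show ?thesis using K(1) pq unfolding hs_bound_def by blast
qed

text \<open>A finite orthonormal system in \<open>\<N>\<close> almost exhausting the Hilbert-Schmidt norm leaves no room
  for a further unit vector with large \<open>|\<cdot>|\<^sub>p\<close>.\<close>

lemma finite_rank_approximation:
  assumes hs: "hs_bound p q K" and \<epsilon>: "\<epsilon> > 0"
  obtains B where "finite B" "orthonormal_in S q B" "B \<subseteq> nuc S"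
    "\<And>\<theta>. \<theta> \<in> nuc S \<Longrightarrow> lnorm S p (\<theta> - proj q B \<theta>) \<le> \<epsilon> * lnorm S q \<theta>"
proof -
  let ?Z = "{B. finite B \<and> orthonormal_in S q B \<and> B \<subseteq> nuc S}"
  let ?f = "\<lambda>B. \<Sum>e\<in>B. (lnorm S p e)\<^sup>2"
  have bdd: "bdd_above (?f ` ?Z)"
    using hs by (intro bdd_aboveI[of _ "K\<^sup>2"]) (auto simp: hs_bound_def)
  have ne: "?f ` ?Z \<noteq> {}" by (auto simp: orthonormal_in_def intro!: exI[of _ "{}"])
  define s where "s = Sup (?f ` ?Z)"
  have "s - \<epsilon>\<^sup>2 < Sup (?f ` ?Z)" using \<epsilon> by (simp add: s_def)
  then obtain B where B: "finite B" "orthonormal_in S q B" "B \<subseteq> nuc S" "s - \<epsilon>\<^sup>2 < ?f B"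
    using less_cSup_iff[OF ne bdd] by auto
  have "lnorm S p (\<theta> - proj q B \<theta>) \<le> \<epsilon> * lnorm S q \<theta>" if \<theta>: "\<theta> \<in> nuc S" for \<theta>
  proof -
    define r where "r = \<theta> - proj q B \<theta>"
    have r: "r \<in> nuc S" using \<theta> B by (simp add: r_def nuc_diff proj_nuc)
    have rl: "r \<in> level S q" "r \<in> level S p" using r nuc_level by auto
    have le: "lnorm S q r \<le> lnorm S q \<theta>"
      unfolding r_def using B \<theta> nuc_level by (intro lnorm_proj_le) auto
    have "lnorm S p r \<le> \<epsilon> * lnorm S q r"
    proof (cases "r = 0")
      case False
      define n where "n = lnorm S q r"
      have n: "n > 0" using False rl lnorm_pos by (simp add: n_def)
      define f where "f = (1 / n) *\<^sub>R r"
      have f: "f \<in> nuc S" "f \<in> level S q" using r rl by (auto simp: f_def nuc_scale level_scale)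
      have "lnorm S q f = 1" using n rl by (simp add: f_def lnorm_scale flip: n_def)
      then have ff: "ip S q f f = 1" using lnorm_sq[OF f(2)] by simp
      have ef: "ip S q e f = 0" "ip S q f e = 0" if "e \<in> B" for e
      proof -
        have e: "e \<in> level S q" using that B orthonormal_level by blast
        have "ip S q e r = 0"
          unfolding r_def using B \<theta> nuc_level that by (intro ip_proj_residual) auto
        then show "ip S q e f = 0" using e rl by (simp add: f_def ip_scale_right)
        then show "ip S q f e = 0" using e f ip_sym by simp
      qed
      have fB: "f \<notin> B" using ef ff by force
      have "insert f B \<in> ?Z"
        using B f ff ef fB unfolding orthonormal_in_def by auto
      then have "?f (insert f B) \<le> s" unfolding s_def using bdd by (intro cSup_upper) auto
      then have "(lnorm S p f)\<^sup>2 < \<epsilon>\<^sup>2" using B fB by simp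
      then have "lnorm S p f < \<epsilon>" using \<epsilon> power2_less_imp_less by (metis less_imp_le)
      then show ?thesis
        using n rl by (simp add: f_def lnorm_scale field_simps flip: n_def)
    qed simp
    also have "\<dots> \<le> \<epsilon> * lnorm S q \<theta>" using le \<epsilon> by simp
    finally show ?thesis by (simp add: r_def)
  qed
  then show ?thesis using that B by blast
qed

end

section \<open>Multilinear functionals on tuples\<close>

definition tuples :: "'a set \<Rightarrow> nat \<Rightarrow> 'a list set" where
  "tuples A n = {xs. set xs \<subseteq> A \<and> length xs = n}"

lemma tuples_0 [simp]: "tuples A 0 = {[]}"
  by (auto simp: tuples_def)

lemma Cons_tuples [simp]: "x # xs \<in> tuples A (Suc n) \<longleftrightarrow> x \<in> A \<and> xs \<in> tuples A n"
  by (auto simp: tuples_def)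

lemma tuples_SucE:
  assumes "xs \<in> tuples A (Suc n)"
  obtains x ys where "xs = x # ys" "x \<in> A" "ys \<in> tuples A n"
  using assms by (cases xs) (auto simp: tuples_def)

lemma append_tuples: "xs \<in> tuples A m \<Longrightarrow> ys \<in> tuples A n \<Longrightarrow> xs @ ys \<in> tuples A (m + n)"
  by (auto simp: tuples_def)

lemma append_tuples_iff: "xs \<in> tuples A m \<Longrightarrow> xs @ ys \<in> tuples A (m + n) \<longleftrightarrow> ys \<in> tuples A n"
  by (auto simp: tuples_def)

lemma replicate_tuples: "x \<in> A \<Longrightarrow> replicate n x \<in> tuples A n"
  by (auto simp: tuples_def)

lemma tuples_mono: "A \<subseteq> B \<Longrightarrow> xs \<in> tuples A n \<Longrightarrow> xs \<in> tuples B n"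
  by (auto simp: tuples_def)

lemma map_tuples: "xs \<in> tuples A n \<Longrightarrow> (\<And>x. x \<in> A \<Longrightarrow> f x \<in> B) \<Longrightarrow> map f xs \<in> tuples B n"
  by (auto simp: tuples_def)

lemma finite_tuples: "finite A \<Longrightarrow> finite (tuples A n)"
  unfolding tuples_def by (rule finite_lists_length_eq)

lemma tuples_Suc: "tuples A (Suc n) = (\<lambda>(x, xs). x # xs) ` (A \<times> tuples A n)"
  by (force simp: tuples_def length_Suc_conv)

lemma sum_tuples_Suc:
  "(\<Sum>es\<in>tuples A (Suc n). g es) = (\<Sum>e\<in>A. \<Sum>es\<in>tuples A n. g (e # es))"
proof -
  have "inj_on (\<lambda>(x, xs). x # xs) (A \<times> tuples A n)" by (auto simp: inj_on_def)
  then have "(\<Sum>es\<in>tuples A (Suc n). g es) = (\<Sum>(e, es)\<in>A \<times> tuples A n. g (e # es))"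
    unfolding tuples_Suc by (subst sum.reindex) (auto simp: case_prod_unfold)
  then show ?thesis by (simp add: sum.cartesian_product)
qed

lemma sum_tuples_prod:
  fixes c :: "'b \<Rightarrow> 'a \<Rightarrow> 'c::comm_semiring_1"
  assumes "length cs = n"
  shows "(\<Sum>es\<in>tuples A n. \<Prod>(a, e)\<leftarrow>zip cs es. c a e) = (\<Prod>a\<leftarrow>cs. \<Sum>e\<in>A. c a e)"
  using assms
proof (induction cs arbitrary: n)
  case (Cons a cs)
  then obtain m where n: "n = Suc m" "length cs = m" by (metis Suc_length_conv)
  show ?case
    using Cons.IH[OF n(2)] by (simp add: n(1) sum_tuples_Suc sum_distrib_right flip: sum_distrib_left)
qed simp

lemma sum_tuples_power:
  fixes f :: "'a \<Rightarrow> 'c::comm_semiring_1"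
  shows "(\<Sum>es\<in>tuples A n. \<Prod>e\<leftarrow>es. f e) = (\<Sum>e\<in>A. f e) ^ n"
  by (induction n) (simp_all add: sum_tuples_Suc sum_distrib_right flip: sum_distrib_left)

lemma prod_list_nonneg_real: "(\<And>x. x \<in> set xs \<Longrightarrow> 0 \<le> f x) \<Longrightarrow> 0 \<le> (\<Prod>x\<leftarrow>xs. f x :: real)"
  by (induction xs) auto

lemma prod_list_mono_real:
  "(\<And>x. x \<in> set xs \<Longrightarrow> 0 \<le> f x \<and> f x \<le> g x) \<Longrightarrow> (\<Prod>x\<leftarrow>xs. f x :: real) \<le> (\<Prod>x\<leftarrow>xs. g x)"
proof (induction xs)
  case (Cons x xs)
  then have "0 \<le> (\<Prod>x\<leftarrow>xs. f x)" by (intro prod_list_nonneg_real) auto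
  moreover have "(\<Prod>x\<leftarrow>xs. f x) \<le> (\<Prod>x\<leftarrow>xs. g x)" "0 \<le> f x" "f x \<le> g x" using Cons by auto
  ultimately show ?case by (simp add: mult_mono)
qed simp

lemma prod_list_power: "(\<Prod>x\<leftarrow>xs. (f x :: 'a::comm_monoid_mult) ^ k) = (\<Prod>x\<leftarrow>xs. f x) ^ k"
  by (induction xs) (auto simp: power_mult_distrib)

definition lin_closed :: "('h \<Rightarrow> real) set \<Rightarrow> bool" where
  "lin_closed D \<longleftrightarrow> (\<lambda>\<theta>. 0) \<in> D \<and>
     (\<forall>x\<in>D. \<forall>y\<in>D. \<forall>a b. (\<lambda>\<theta>. a * x \<theta> + b * y \<theta>) \<in> D)"

lemma lin_closedD: "lin_closed D \<Longrightarrow> x \<in> D \<Longrightarrow> y \<in> D \<Longrightarrow> (\<lambda>\<theta>. a * x \<theta> + b * y \<theta>) \<in> D"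
  by (auto simp: lin_closed_def)

lemma lin_closed_sum:
  assumes "lin_closed D" "\<And>e. e \<in> B \<Longrightarrow> x e \<in> D"
  shows "(\<lambda>\<theta>. \<Sum>e\<in>B. c e * x e \<theta>) \<in> D"
  using assms(2)
proof (induction B rule: infinite_finite_induct)
  case (insert e B)
  then show ?case using lin_closedD[OF assms(1), of "x e" "\<lambda>\<theta>. \<Sum>e\<in>B. c e * x e \<theta>" "c e" 1] by simp
qed (use assms in \<open>auto simp: lin_closed_def\<close>)

lemma symml_perm:
  "sym_multilinear D n F \<Longrightarrow> xs \<in> tuples D n \<Longrightarrow> mset ys = mset xs \<Longrightarrow> F ys = F xs"
  unfolding sym_multilinear_def tuples_def by blast

lemma symml_head:
  assumes "sym_multilinear D (Suc n) F" "xs \<in> tuples D n" "x \<in> D" "y \<in> D"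
  shows "F ((\<lambda>\<theta>. a * x \<theta> + b * y \<theta>) # xs) = of_real a * F (x # xs) + of_real b * F (y # xs)"
proof -
  have "F ((x # xs)[0 := (\<lambda>\<theta>. a * x \<theta> + b * y \<theta>)]) =
      of_real a * F ((x # xs)[0 := x]) + of_real b * F ((x # xs)[0 := y])"
  proof -
    have "length (x # xs) = Suc n \<and> set (x # xs) \<subseteq> D" using assms by (auto simp: tuples_def)
    then show ?thesis using assms(1,3,4) unfolding sym_multilinear_def by blast
  qed
  then show ?thesis by simp
qed

text \<open>By symmetry the entry in position \<open>i\<close> can be moved to the front, so
  linearity needs to be checked in the first argument only.\<close>

lemma symmlI:
  assumes "lin_closed D"
    and perm: "\<And>xs ys. xs \<in> tuples D n \<Longrightarrow> mset ys = mset xs \<Longrightarrow> F ys = F xs"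
    and lin: "\<And>m xs x y a b. n = Suc m \<Longrightarrow> xs \<in> tuples D m \<Longrightarrow> x \<in> D \<Longrightarrow> y \<in> D \<Longrightarrow>
      F ((\<lambda>\<theta>. a * x \<theta> + b * y \<theta>) # xs) = of_real a * F (x # xs) + of_real b * F (y # xs)"
  shows "sym_multilinear D n F"
  unfolding sym_multilinear_def
proof (intro allI impI conjI ballI)
  fix xs ys assume "length xs = n \<and> set xs \<subseteq> D" "mset ys = mset xs"
  then show "F ys = F xs" by (intro perm) (auto simp: tuples_def)
next
  fix xs i x y and a b :: real
  assume xs: "length xs = n \<and> set xs \<subseteq> D" and i: "i < n" and x: "x \<in> D" and y: "y \<in> D"
  obtain m where m: "n = Suc m" using i by (cases n) auto
  define r where "r = take i xs @ drop (Suc i) xs"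
  have "set r \<subseteq> set xs" by (auto simp: r_def dest: in_set_takeD in_set_dropD)
  then have r: "r \<in> tuples D m" using xs i m by (auto simp: r_def tuples_def)
  have upd: "F (xs[i := z]) = F (z # r)" if "z \<in> D" for z
  proof (rule perm)
    show "z # r \<in> tuples D n" using r m that by simp
    show "mset (xs[i := z]) = mset (z # r)"
      using xs i by (simp add: upd_conv_take_nth_drop r_def)
  qed
  have "F (xs[i := \<lambda>\<theta>. a * x \<theta> + b * y \<theta>]) = F ((\<lambda>\<theta>. a * x \<theta> + b * y \<theta>) # r)"
    using x y assms(1) by (intro upd lin_closedD)
  also have "\<dots> = of_real a * F (x # r) + of_real b * F (y # r)" by (intro lin[OF m r] x y)
  finally show "F (xs[i := \<lambda>\<theta>. a * x \<theta> + b * y \<theta>]) =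
      of_real a * F (xs[i := x]) + of_real b * F (xs[i := y])"
    using upd x y by simp
qed

lemma symml_append:
  assumes D: "lin_closed D" and F: "sym_multilinear D (k + n) F" and zs: "zs \<in> tuples D k"
  shows "sym_multilinear D n (\<lambda>xs. F (zs @ xs))"
proof (rule symmlI[OF D])
  fix xs ys assume "xs \<in> tuples D n" "mset ys = mset xs"
  then show "F (zs @ ys) = F (zs @ xs)"
    using zs by (intro symml_perm[OF F]) (auto intro: append_tuples)
next
  fix m xs x y and a b :: real
  assume m: "n = Suc m" and xs: "xs \<in> tuples D m" and x: "x \<in> D" and y: "y \<in> D"
  have move: "F (zs @ z # xs) = F (z # (zs @ xs))" if "z \<in> D" for z
    using that zs xs m by (intro symml_perm[OF F]) (auto intro: append_tuples)
  have F': "sym_multilinear D (Suc (k + m)) F" using F m by simp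
  show "F (zs @ (\<lambda>\<theta>. a * x \<theta> + b * y \<theta>) # xs) =
      of_real a * F (zs @ x # xs) + of_real b * F (zs @ y # xs)"
    using symml_head[OF F' append_tuples[OF zs xs] x y, of a b] x y
    by (simp add: move lin_closedD[OF D])
qed

lemma symml_Cons:
  assumes "lin_closed D" "sym_multilinear D (Suc n) F" "x \<in> D"
  shows "sym_multilinear D n (\<lambda>xs. F (x # xs))"
  using symml_append[of D 1 n F "[x]"] assms by (simp add: tuples_def)

lemma symml_mono: "D' \<subseteq> D \<Longrightarrow> sym_multilinear D n F \<Longrightarrow> sym_multilinear D' n F"
  unfolding sym_multilinear_def by blast

lemma symml_lincomb:
  assumes "sym_multilinear D n F" "sym_multilinear D n G"
  shows "sym_multilinear D n (\<lambda>xs. a * F xs + b * G xs)"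
  unfolding sym_multilinear_def
proof (intro allI impI conjI ballI)
  fix xs ys assume "length xs = n \<and> set xs \<subseteq> D" "mset ys = mset xs"
  then have "F ys = F xs" "G ys = G xs" using assms unfolding sym_multilinear_def by blast+
  then show "a * F ys + b * G ys = a * F xs + b * G xs" by simp
next
  fix xs i x y and c d :: real
  assume "length xs = n \<and> set xs \<subseteq> D" "i < n" "x \<in> D" "y \<in> D"
  then have "F (xs[i := \<lambda>\<theta>. c * x \<theta> + d * y \<theta>]) = of_real c * F (xs[i := x]) + of_real d * F (xs[i := y])"
    "G (xs[i := \<lambda>\<theta>. c * x \<theta> + d * y \<theta>]) = of_real c * G (xs[i := x]) + of_real d * G (xs[i := y])"
    using assms unfolding sym_multilinear_def by blast+
  then show "a * F (xs[i := \<lambda>\<theta>. c * x \<theta> + d * y \<theta>]) + b * G (xs[i := \<lambda>\<theta>. c * x \<theta> + d * y \<theta>]) =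
      of_real c * (a * F (xs[i := x]) + b * G (xs[i := x])) +
      of_real d * (a * F (xs[i := y]) + b * G (xs[i := y]))"
    by (simp add: algebra_simps)
qed

lemma symml_zero_head:
  assumes "lin_closed D" "sym_multilinear D (Suc n) F" "xs \<in> tuples D n"
  shows "F ((\<lambda>\<theta>. 0) # xs) = 0"
  using symml_head[OF assms(2,3), of "\<lambda>\<theta>. 0" "\<lambda>\<theta>. 0" 0 0] assms(1) by (simp add: lin_closed_def)

lemma symml_scale_head:
  assumes "sym_multilinear D (Suc n) F" "xs \<in> tuples D n" "x \<in> D"
  shows "F ((\<lambda>\<theta>. a * x \<theta>) # xs) = of_real a * F (x # xs)"
  using symml_head[OF assms(1,2), of x x a 0] assms(3) by simp

lemma symml_sum_head:
  assumes D: "lin_closed D" and F: "sym_multilinear D (Suc n) F" and xs: "xs \<in> tuples D n"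
    and x: "\<And>e. e \<in> B \<Longrightarrow> x e \<in> D"
  shows "F ((\<lambda>\<theta>. \<Sum>e\<in>B. c e * x e \<theta>) # xs) = (\<Sum>e\<in>B. of_real (c e) * F (x e # xs))"
  using x
proof (induction B rule: infinite_finite_induct)
  case (insert e B)
  then show ?case
    using symml_head[OF F xs, of "x e" "\<lambda>\<theta>. \<Sum>e\<in>B. c e * x e \<theta>" "c e" 1] lin_closed_sum[OF D, of B x c]
    by simp
qed (use symml_zero_head[OF D F xs] in auto)

text \<open>The list \<open>cs\<close> holds labels of the arguments, so that each position has its
  own coefficients with respect to the common finite family \<open>x\<close>.\<close>

lemma symml_expand:
  assumes D: "lin_closed D" and F: "sym_multilinear D n F" and x: "\<And>e. e \<in> B \<Longrightarrow> x e \<in> D"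
    and "length cs = n"
  shows "F (map (\<lambda>a. \<lambda>\<theta>. \<Sum>e\<in>B. c a e * x e \<theta>) cs) =
    (\<Sum>es\<in>tuples B n. of_real (\<Prod>(a, e)\<leftarrow>zip cs es. c a e) * F (map x es))"
  using assms(2,4)
proof (induction cs arbitrary: n F)
  case (Cons a cs)
  then obtain m where n: "n = Suc m" "length cs = m" by (metis Suc_length_conv)
  have F: "sym_multilinear D (Suc m) F" using Cons.prems n by simp
  have t: "map (\<lambda>a. \<lambda>\<theta>. \<Sum>e\<in>B. c a e * x e \<theta>) cs \<in> tuples D m"
    using n lin_closed_sum[OF D, of B x] x by (auto simp: tuples_def)
  have "F (map (\<lambda>a. \<lambda>\<theta>. \<Sum>e\<in>B. c a e * x e \<theta>) (a # cs)) =
      (\<Sum>e\<in>B. of_real (c a e) * F (x e # map (\<lambda>a. \<lambda>\<theta>. \<Sum>e\<in>B. c a e * x e \<theta>) cs))"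
    using symml_sum_head[OF D F t, of B x "c a"] x by simp
  also have "\<dots> = (\<Sum>e\<in>B. of_real (c a e) *
      (\<Sum>es\<in>tuples B m. of_real (\<Prod>(a, e)\<leftarrow>zip cs es. c a e) * F (x e # map x es)))"
    using x by (intro sum.cong refl arg_cong2[where f = "(*)"] Cons.IH symml_Cons[OF D F] n)
  finally show ?case
    by (simp add: n(1) sum_tuples_Suc sum_distrib_left mult.assoc)
qed simp

lemma prod_list_zip_power2:
  "(\<Prod>(a, e)\<leftarrow>zip cs es. (g a e :: 'c::comm_monoid_mult) ^ 2) = (\<Prod>(a, e)\<leftarrow>zip cs es. g a e) ^ 2"
  using prod_list_power[of "\<lambda>(a, e). g a e" 2 "zip cs es"] by (simp add: case_prod_unfold)

context nuclear_scale
begin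

section \<open>Bounded symmetric tensors\<close>

lemma nuc_dualI: "x \<in> dual_level S p \<Longrightarrow> x \<in> nuc_dual S"
  by (auto simp: nuc_dual_def)

lemma dual_level_subset: "dual_level S p \<subseteq> nuc_dual S"
  by (auto simp: nuc_dual_def)

lemma nuc_dual_levelE:
  assumes "x \<in> nuc_dual S"
  obtains q where "p \<le> q" "x \<in> dual_level S q"
  using assms dual_level_mono[of _ "max p _" x] that unfolding nuc_dual_def
  by (metis UN_E max.cobounded1 max.cobounded2)

text \<open>The finitely many entries of a tuple share a level, which may be taken above any given
  \<open>p\<close>. In this way assertions about all of \<open>nuc_dual S\<close> are reduced to a
  single level.\<close>

lemma nuc_dual_tuplesE:
  assumes "xs \<in> tuples (nuc_dual S) n"
  obtains q where "p \<le> q" "xs \<in> tuples (dual_level S q) n"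
proof -
  have "\<exists>q\<ge>p. set xs \<subseteq> dual_level S q"
    using assms
  proof (induction xs arbitrary: n)
    case (Cons x xs)
    then have *: "x \<in> nuc_dual S" "xs \<in> tuples (nuc_dual S) (length xs)"
      by (auto simp: tuples_def)
    obtain q where q: "p \<le> q" "set xs \<subseteq> dual_level S q" using Cons.IH[OF *(2)] by blast
    obtain r where r: "q \<le> r" "x \<in> dual_level S r" using nuc_dual_levelE[OF *(1)] by blast
    show ?case using q r dual_level_mono[of q r] by (intro exI[of _ r]) auto
  qed auto
  then show ?thesis using that assms by (auto simp: tuples_def)
qed

lemma lin_closed_dual_level: "lin_closed (dual_level S p)"
  by (auto simp: lin_closed_def dual_level_zero dual_level_comb)

lemma lin_closed_nuc_dual: "lin_closed (nuc_dual S)"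
  unfolding lin_closed_def
proof (intro conjI ballI allI)
  show "(\<lambda>\<theta>. 0) \<in> nuc_dual S" using dual_level_zero nuc_dualI by blast
  fix x y and a b :: real assume xy: "x \<in> nuc_dual S" "y \<in> nuc_dual S"
  then obtain p where p: "x \<in> dual_level S p" by (auto simp: nuc_dual_def)
  obtain q where q: "p \<le> q" "y \<in> dual_level S q" using nuc_dual_levelE[OF xy(2)] by blast
  show "(\<lambda>\<theta>. a * x \<theta> + b * y \<theta>) \<in> nuc_dual S"
    using dual_level_comb[OF dual_level_mono[OF q(1) p] q(2)] nuc_dualI by blast
qed

text \<open>\<open>M\<close> bounds \<open>F\<close> as an \<open>n\<close>-linear form on the dual
  level \<open>p\<close>. Unlike \<open>tnorm\<close>, this notion is inherited directly by partial
  evaluation and by contraction, which is why all estimates are carried out with it.\<close>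

definition tbound :: "nat \<Rightarrow> nat \<Rightarrow> 'h tensor \<Rightarrow> real \<Rightarrow> bool" where
  "tbound p n F M \<longleftrightarrow>
     (\<forall>xs\<in>tuples (dual_level S p) n. cmod (F xs) \<le> M * (\<Prod>x\<leftarrow>xs. dnorm S p x))"

lemma tboundI:
  "(\<And>xs. xs \<in> tuples (dual_level S p) n \<Longrightarrow> cmod (F xs) \<le> M * (\<Prod>x\<leftarrow>xs. dnorm S p x)) \<Longrightarrow> tbound p n F M"
  by (simp add: tbound_def)

lemma tboundD:
  "tbound p n F M \<Longrightarrow> xs \<in> tuples (dual_level S p) n \<Longrightarrow> cmod (F xs) \<le> M * (\<Prod>x\<leftarrow>xs. dnorm S p x)"
  by (simp add: tbound_def)

lemma prod_dnorm_nonneg: "xs \<in> tuples (dual_level S p) n \<Longrightarrow> 0 \<le> (\<Prod>x\<leftarrow>xs. dnorm S p x)"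
  by (intro prod_list_nonneg_real dnorm_nonneg) (auto simp: tuples_def)

lemma prod_dnorm_mono:
  assumes "p \<le> q" "xs \<in> tuples (dual_level S p) n"
  shows "(\<Prod>x\<leftarrow>xs. dnorm S q x) \<le> (\<Prod>x\<leftarrow>xs. dnorm S p x)"
proof (rule prod_list_mono_real)
  fix x assume "x \<in> set xs"
  then have "x \<in> dual_level S p" using assms by (auto simp: tuples_def)
  then show "0 \<le> dnorm S q x \<and> dnorm S q x \<le> dnorm S p x"
    using dnorm_mono[OF assms(1)] dnorm_nonneg dual_level_mono[OF assms(1)] by blast
qed

lemma dual_tuples_mono:
  "p \<le> q \<Longrightarrow> xs \<in> tuples (dual_level S p) n \<Longrightarrow> xs \<in> tuples (dual_level S q) n"
  using dual_level_mono by (auto intro: tuples_mono)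

lemma dual_tuples_nuc:
  "xs \<in> tuples (dual_level S p) n \<Longrightarrow> xs \<in> tuples (nuc_dual S) n"
  using dual_level_subset by (rule tuples_mono)

lemma tbound_weaken: "tbound p n F M \<Longrightarrow> M \<le> M' \<Longrightarrow> tbound p n F M'"
  unfolding tbound_def by (meson mult_right_mono order_trans prod_dnorm_nonneg)

lemma tbound_mono:
  assumes "p \<le> q" "tbound q n F M" "0 \<le> M"
  shows "tbound p n F M"
proof (rule tboundI)
  fix xs assume xs: "xs \<in> tuples (dual_level S p) n"
  have "cmod (F xs) \<le> M * (\<Prod>x\<leftarrow>xs. dnorm S q x)"
    using tboundD[OF assms(2) dual_tuples_mono[OF assms(1) xs]] .
  also have "\<dots> \<le> M * (\<Prod>x\<leftarrow>xs. dnorm S p x)"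
    using prod_dnorm_mono[OF assms(1) xs] assms by (intro mult_left_mono)
  finally show "cmod (F xs) \<le> M * (\<Prod>x\<leftarrow>xs. dnorm S p x)" .
qed

lemma tbound_lincomb:
  assumes "tbound p n F M" "tbound p n G N"
  shows "tbound p n (\<lambda>xs. a * F xs + b * G xs) (cmod a * M + cmod b * N)"
proof (rule tboundI)
  fix xs assume xs: "xs \<in> tuples (dual_level S p) n"
  have "cmod (a * F xs + b * G xs) \<le> cmod a * cmod (F xs) + cmod b * cmod (G xs)"
    by (metis norm_mult norm_triangle_ineq)
  also have "\<dots> \<le> cmod a * (M * (\<Prod>x\<leftarrow>xs. dnorm S p x)) + cmod b * (N * (\<Prod>x\<leftarrow>xs. dnorm S p x))"
    using assms xs by (intro add_mono mult_left_mono tboundD) auto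
  finally show "cmod (a * F xs + b * G xs) \<le> (cmod a * M + cmod b * N) * (\<Prod>x\<leftarrow>xs. dnorm S p x)"
    by (simp add: algebra_simps)
qed

lemma tbound_append:
  assumes "tbound p (k + n) F M" "zs \<in> tuples (dual_level S p) k"
  shows "tbound p n (\<lambda>xs. F (zs @ xs)) (M * (\<Prod>x\<leftarrow>zs. dnorm S p x))"
proof (rule tboundI)
  fix xs assume xs: "xs \<in> tuples (dual_level S p) n"
  show "cmod (F (zs @ xs)) \<le> M * (\<Prod>x\<leftarrow>zs. dnorm S p x) * (\<Prod>x\<leftarrow>xs. dnorm S p x)"
    using tboundD[OF assms(1) append_tuples[OF assms(2) xs]] by (simp add: mult.assoc)
qed

text \<open>Homogeneity in each argument; an argument of norm 0 is the zero functional, on which the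
  form vanishes.\<close>

lemma tbound_from_unit_ball:
  assumes F: "sym_multilinear (dual_level S p) n F"
    and "\<And>xs. xs \<in> tuples (dual_level S p) n \<Longrightarrow> (\<And>x. x \<in> set xs \<Longrightarrow> dnorm S p x \<le> 1) \<Longrightarrow> cmod (F xs) \<le> M"
  shows "tbound p n F M"
  using assms
proof (induction n arbitrary: F)
  case 0
  then show ?case by (auto simp: tbound_def)
next
  case (Suc n)
  have unit: "tbound p n (\<lambda>xs. F (x # xs)) M" if "x \<in> dual_level S p" "dnorm S p x \<le> 1" for x
    using that by (intro Suc.IH symml_Cons[OF lin_closed_dual_level Suc.prems(1)] Suc.prems(2)) auto
  show ?case
  proof (rule tboundI)
    fix xs assume "xs \<in> tuples (dual_level S p) (Suc n)"
    then obtain x ys where x: "xs = x # ys" "x \<in> dual_level S p" "ys \<in> tuples (dual_level S p) n"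
      by (rule tuples_SucE)
    show "cmod (F xs) \<le> M * (\<Prod>x\<leftarrow>xs. dnorm S p x)"
    proof (cases "dnorm S p x = 0")
      case True
      then show ?thesis
        using x dnorm_eq_0[OF x(2)] symml_zero_head[OF lin_closed_dual_level Suc.prems(1) x(3)] by simp
    next
      case False
      define d where "d = dnorm S p x"
      have d: "d > 0" using False dnorm_nonneg[OF x(2)] by (simp add: d_def)
      define u where "u = (\<lambda>\<theta>. (1 / d) * x \<theta>)"
      have u: "u \<in> dual_level S p" unfolding u_def using x by (intro dual_level_scale)
      have "dnorm S p u \<le> 1"
        using dnorm_scale_le[OF x(2), of "1 / d"] d unfolding u_def by (simp flip: d_def)
      then have "cmod (F (u # ys)) \<le> M * (\<Prod>x\<leftarrow>ys. dnorm S p x)"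
        using unit u x tboundD by blast
      moreover have "F (x # ys) = of_real d * F (u # ys)"
        using symml_scale_head[OF Suc.prems(1) x(3,2), of "1 / d"] d by (simp add: u_def)
      ultimately show ?thesis
        using d x by (simp add: norm_mult mult.left_commute flip: d_def)
    qed
  qed
qed

text \<open>The operator norm does not exceed the Hilbert-Schmidt norm. The entries of a tuple are
  represented by vectors, a finite orthonormal \<open>B\<close> is chosen whose span contains these
  vectors, and Cauchy-Schwarz is applied to the expansion of \<open>F\<close> along
  \<open>B\<close>. Bessel's inequality turns the coefficients into the product of dual
  norms.\<close>

lemma tbound_tnorm:
  assumes F: "F \<in> tensor_level S p n"
  shows "tbound p n F (tnorm S p n F)"
proof (rule tboundI)
  fix xs assume xs: "xs \<in> tuples (dual_level S p) n"
  have sym: "sym_multilinear (dual_level S p) n F" and bdd: "bdd_above (hs_sums S p n F)"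
    using F by (auto simp: tensor_level_def)
  obtain h where h: "\<And>x. x \<in> dual_level S p \<Longrightarrow>
      h x \<in> level S p \<and> x = riesz S p (h x) \<and> lnorm S p (h x) \<le> dnorm S p x"
  proof -
    have "\<forall>x\<in>dual_level S p. \<exists>h. h \<in> level S p \<and> x = riesz S p h \<and> lnorm S p h \<le> dnorm S p x"
      using riesz_representation by blast
    then show ?thesis using that by (auto dest!: bchoice)
  qed
  have xsD: "x \<in> dual_level S p" if "x \<in> set xs" for x using xs that by (auto simp: tuples_def)
  have "\<exists>B. finite B \<and> orthonormal_in S p B \<and> {} \<subseteq> B \<and> B \<subseteq> level S p \<and> (\<forall>c\<in>h ` set xs. proj p B c = c)"
    using h xsD by (intro Gram_Schmidt subspace_level) (auto simp: orthonormal_in_def)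
  then obtain B where B: "finite B" "orthonormal_in S p B" "\<And>x. x \<in> set xs \<Longrightarrow> proj p B (h x) = h x"
    by blast
  define c where "c x e = ip S p e (h x)" for x e
  have repr: "x = (\<lambda>\<theta>. \<Sum>e\<in>B. c x e * riesz S p e \<theta>)" if x: "x \<in> set xs" for x
  proof
    fix \<theta>
    have "x \<theta> = riesz S p (proj p B (h x)) \<theta>" using h[OF xsD[OF x]] B(3)[OF x] by simp
    also have "\<dots> = (\<Sum>e\<in>B. c x e * riesz S p e \<theta>)"
      using B(2) by (auto simp: riesz_def proj_def c_def ip_sum_left ip_scale_left level_scale
          orthonormal_level nuc_level)
    finally show "x \<theta> = (\<Sum>e\<in>B. c x e * riesz S p e \<theta>)" .
  qed
  have "xs = map (\<lambda>x. \<lambda>\<theta>. \<Sum>e\<in>B. c x e * riesz S p e \<theta>) xs"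
    by (rule map_idI[symmetric]) (rule repr[symmetric])
  then have "F xs = (\<Sum>es\<in>tuples B n. of_real (\<Prod>(a, e)\<leftarrow>zip xs es. c a e) * F (map (riesz S p) es))"
    using symml_expand[OF lin_closed_dual_level sym, of B "riesz S p" xs c] B(2) xs
    by (simp add: riesz_dual orthonormal_level tuples_def)
  then have "cmod (F xs) \<le>
      (\<Sum>es\<in>tuples B n. \<bar>\<Prod>(a, e)\<leftarrow>zip xs es. c a e\<bar> * \<bar>cmod (F (map (riesz S p) es))\<bar>)"
    using norm_sum[of "\<lambda>es. of_real (\<Prod>(a, e)\<leftarrow>zip xs es. c a e) * F (map (riesz S p) es)" "tuples B n"]
    by (simp add: norm_mult)
  also have "\<dots> \<le> L2_set (\<lambda>es. \<Prod>(a, e)\<leftarrow>zip xs es. c a e) (tuples B n)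
      * L2_set (\<lambda>es. cmod (F (map (riesz S p) es))) (tuples B n)"
    by (rule L2_set_mult_ineq)
  also have "\<dots> \<le> (\<Prod>x\<leftarrow>xs. dnorm S p x) * tnorm S p n F"
  proof (rule mult_mono)
    have "(\<Sum>es\<in>tuples B n. (\<Prod>(a, e)\<leftarrow>zip xs es. c a e)\<^sup>2) = (\<Prod>x\<leftarrow>xs. \<Sum>e\<in>B. (c x e)\<^sup>2)"
      unfolding prod_list_zip_power2[symmetric] using xs by (intro sum_tuples_prod) (auto simp: tuples_def)
    also have "\<dots> \<le> (\<Prod>x\<leftarrow>xs. (dnorm S p x)\<^sup>2)"
    proof (rule prod_list_mono_real)
      fix x assume x: "x \<in> set xs"
      have "(\<Sum>e\<in>B. (c x e)\<^sup>2) \<le> (lnorm S p (h x))\<^sup>2"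
        unfolding c_def using h[OF xsD[OF x]] B by (intro Bessel) auto
      also have "\<dots> \<le> (dnorm S p x)\<^sup>2" using h[OF xsD[OF x]] lnorm_nonneg by (intro power_mono) auto
      finally show "0 \<le> (\<Sum>e\<in>B. (c x e)\<^sup>2) \<and> (\<Sum>e\<in>B. (c x e)\<^sup>2) \<le> (dnorm S p x)\<^sup>2"
        by (simp add: sum_nonneg)
    qed
    also have "\<dots> = (\<Prod>x\<leftarrow>xs. dnorm S p x)\<^sup>2" by (rule prod_list_power)
    finally show "L2_set (\<lambda>es. \<Prod>(a, e)\<leftarrow>zip xs es. c a e) (tuples B n) \<le> (\<Prod>x\<leftarrow>xs. dnorm S p x)"
      unfolding L2_set_def using prod_dnorm_nonneg[OF xs] by (simp add: real_le_lsqrt)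
    show "L2_set (\<lambda>es. cmod (F (map (riesz S p) es))) (tuples B n) \<le> tnorm S p n F"
      unfolding L2_set_def tnorm_def tuples_def using B bdd
      by (intro real_sqrt_le_mono cSup_upper) (auto simp: hs_sums_def)
  qed (use prod_dnorm_nonneg[OF xs] in \<open>auto simp: L2_set_nonneg\<close>)
  finally show "cmod (F xs) \<le> tnorm S p n F * (\<Prod>x\<leftarrow>xs. dnorm S p x)" by (simp add: mult.commute)
qed

lemma hs_sums_nonempty: "hs_sums S p n F \<noteq> {}"
  by (auto simp: hs_sums_def orthonormal_in_def intro!: exI[of _ "{}"])

text \<open>The reverse comparison, at the price of a higher level. The sum over tuples of products
  of squared norms is the \<open>n\<close>-th power of one Hilbert-Schmidt sum, whence
  \<open>K ^ n\<close>.\<close>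

lemma hs_sums_le:
  assumes hs: "hs_bound p q K" and F: "tbound q n F M" and "s \<in> hs_sums S p n F"
  shows "s \<le> (K ^ n * M)\<^sup>2"
proof -
  obtain B where B: "finite B" "orthonormal_in S p B"
      "s = (\<Sum>es\<in>tuples B n. (cmod (F (map (riesz S p) es)))\<^sup>2)"
    using assms(3) by (auto simp: hs_sums_def tuples_def)
  have rd: "riesz S p e \<in> dual_level S q" if "e \<in> B" for e
  proof -
    have "p \<le> q" using hs by (simp add: hs_bound_def)
    then show ?thesis
      using riesz_dual[OF orthonormal_level[OF B(2) that]] by (rule dual_level_mono)
  qed
  have "s \<le> (\<Sum>es\<in>tuples B n. M\<^sup>2 * (\<Prod>e\<leftarrow>es. (dnorm S q (riesz S p e))\<^sup>2))"
    unfolding B(3)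
  proof (rule sum_mono)
    fix es assume "es \<in> tuples B n"
    then have "map (riesz S p) es \<in> tuples (dual_level S q) n" using rd by (rule map_tuples)
    then have "cmod (F (map (riesz S p) es)) \<le> M * (\<Prod>e\<leftarrow>es. dnorm S q (riesz S p e))"
      using tboundD[OF F] by (fastforce simp: comp_def)
    then have "(cmod (F (map (riesz S p) es)))\<^sup>2 \<le> (M * (\<Prod>e\<leftarrow>es. dnorm S q (riesz S p e)))\<^sup>2"
      by (intro power_mono) auto
    then show "(cmod (F (map (riesz S p) es)))\<^sup>2 \<le> M\<^sup>2 * (\<Prod>e\<leftarrow>es. (dnorm S q (riesz S p e))\<^sup>2)"
      by (simp add: power_mult_distrib prod_list_power)
  qed
  also have "\<dots> = M\<^sup>2 * (\<Sum>e\<in>B. (dnorm S q (riesz S p e))\<^sup>2) ^ n"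
    by (simp add: sum_tuples_power flip: sum_distrib_left)
  also have "\<dots> \<le> M\<^sup>2 * (K\<^sup>2) ^ n"
    using hs B by (intro mult_left_mono power_mono) (auto simp: hs_bound_def sum_nonneg)
  also have "\<dots> = (K ^ n * M)\<^sup>2" by (simp add: power_mult_distrib power2_eq_square mult_ac flip: power_mult)
  finally show ?thesis .
qed

lemma tnorm_le:
  assumes hs: "hs_bound p q K" and F: "tbound q n F M" and "0 \<le> M"
  shows "bdd_above (hs_sums S p n F)" "tnorm S p n F \<le> K ^ n * M"
proof -
  show "bdd_above (hs_sums S p n F)" using hs_sums_le[OF hs F] by (intro bdd_aboveI)
  have "Sup (hs_sums S p n F) \<le> (K ^ n * M)\<^sup>2"
    using hs_sums_le[OF hs F] by (intro cSup_least hs_sums_nonempty)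
  then show "tnorm S p n F \<le> K ^ n * M"
    unfolding tnorm_def using assms by (intro real_le_lsqrt) (auto simp: hs_bound_def)
qed

text \<open>Operator bounds on all levels suffice: the Hilbert-Schmidt norm at \<open>p\<close> is
  controlled by the operator bound at a level \<open>q\<close> above it.\<close>

lemma nuc_tensorI:
  assumes "sym_multilinear (nuc_dual S) n F" "\<And>p. \<exists>M. tbound p n F M"
    "\<And>xs. xs \<notin> tuples (nuc_dual S) n \<Longrightarrow> F xs = 0"
  shows "F \<in> nuc_tensor S n"
proof -
  have "F \<in> tensor_level S p n" for p
  proof -
    obtain q K where hs: "hs_bound p q K" using hs_bound_exists by blast
    obtain M where "tbound q n F M" using assms by blast
    then have "tbound q n F \<bar>M\<bar>" using tbound_weaken abs_ge_self by blast
    then show ?thesis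
      using symml_mono[OF dual_level_subset assms(1)] tnorm_le(1)[OF hs] by (auto simp: tensor_level_def)
  qed
  then show ?thesis using assms(3) by (auto simp: nuc_tensor_def tuples_def)
qed

lemma nuc_tensor_level: "F \<in> nuc_tensor S n \<Longrightarrow> F \<in> tensor_level S p n"
  by (simp add: nuc_tensor_def)

lemma nuc_tensor_outside: "F \<in> nuc_tensor S n \<Longrightarrow> xs \<notin> tuples (nuc_dual S) n \<Longrightarrow> F xs = 0"
  by (auto simp: nuc_tensor_def tuples_def)

lemma nuc_tensor_tbound: "F \<in> nuc_tensor S n \<Longrightarrow> tbound p n F (tnorm S p n F)"
  by (intro tbound_tnorm nuc_tensor_level)

lemma tnorm_nonneg: "F \<in> tensor_level S p n \<Longrightarrow> 0 \<le> tnorm S p n F"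
proof -
  assume F: "F \<in> tensor_level S p n"
  obtain s where s: "s \<in> hs_sums S p n F" using hs_sums_nonempty by blast
  then have "0 \<le> s" by (auto simp: hs_sums_def intro!: sum_nonneg)
  also have "s \<le> Sup (hs_sums S p n F)"
    using s F by (intro cSup_upper) (auto simp: tensor_level_def)
  finally show ?thesis by (simp add: tnorm_def)
qed

lemma nuc_tensor_symml:
  assumes F: "F \<in> nuc_tensor S n"
  shows "sym_multilinear (nuc_dual S) n F"
proof (rule symmlI[OF lin_closed_nuc_dual])
  have *: "sym_multilinear (dual_level S p) n F" for p
    using F by (simp add: nuc_tensor_def tensor_level_def)
  show "F ys = F xs" if xs: "xs \<in> tuples (nuc_dual S) n" and ys: "mset ys = mset xs" for xs ys
  proof -
    obtain q where "xs \<in> tuples (dual_level S q) n" using nuc_dual_tuplesE[OF xs] by blast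
    then show ?thesis using symml_perm[OF *] ys by blast
  qed
  fix m xs x y and a b :: real
  assume m: "n = Suc m" and xs: "xs \<in> tuples (nuc_dual S) m" and x: "x \<in> nuc_dual S" and y: "y \<in> nuc_dual S"
  have "y # x # xs \<in> tuples (nuc_dual S) (Suc (Suc m))" using xs x y by simp
  then obtain q where "y # x # xs \<in> tuples (dual_level S q) (Suc (Suc m))" using nuc_dual_tuplesE by blast
  then show "F ((\<lambda>\<theta>. a * x \<theta> + b * y \<theta>) # xs) = of_real a * F (x # xs) + of_real b * F (y # xs)"
    using symml_head[of "dual_level S q" m F xs x y a b] * m by simp
qed

lemma nuc_tensor_lincomb:
  assumes "F \<in> nuc_tensor S n" "G \<in> nuc_tensor S n"
  shows "(\<lambda>xs. a * F xs + b * G xs) \<in> nuc_tensor S n"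
proof (rule nuc_tensorI)
  show "\<exists>M. tbound p n (\<lambda>xs. a * F xs + b * G xs) M" for p
    using tbound_lincomb[OF nuc_tensor_tbound[OF assms(1)] nuc_tensor_tbound[OF assms(2)]] by blast
qed (use assms in \<open>auto simp: nuc_tensor_outside intro: symml_lincomb nuc_tensor_symml\<close>)

lemma nuc_tensor_diff:
  "F \<in> nuc_tensor S n \<Longrightarrow> G \<in> nuc_tensor S n \<Longrightarrow> (\<lambda>xs. F xs - G xs) \<in> nuc_tensor S n"
  using nuc_tensor_lincomb[of F n G 1 "-1"] by simp

lemma nuc_tensor_zero: "(\<lambda>xs. 0) \<in> nuc_tensor S n"
  by (rule nuc_tensorI) (auto simp: sym_multilinear_def tbound_def intro!: exI[of _ 0])

lemma nuc_tensor_sum: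
  assumes "\<And>i. i \<in> I \<Longrightarrow> F i \<in> nuc_tensor S n"
  shows "(\<lambda>xs. \<Sum>i\<in>I. c i * F i xs) \<in> nuc_tensor S n"
  using assms
proof (induction I rule: infinite_finite_induct)
  case (insert i I)
  then show ?case using nuc_tensor_lincomb[of "F i" n "\<lambda>xs. \<Sum>i\<in>I. c i * F i xs" "c i" 1] by simp
qed (auto simp: nuc_tensor_zero)

lemma nuc_tensor_append:
  assumes F: "F \<in> nuc_tensor S (k + n)" and zs: "zs \<in> tuples (nuc_dual S) k"
  shows "(\<lambda>xs. F (zs @ xs)) \<in> nuc_tensor S n"
proof (rule nuc_tensorI)
  show "sym_multilinear (nuc_dual S) n (\<lambda>xs. F (zs @ xs))"
    using F zs by (intro symml_append lin_closed_nuc_dual nuc_tensor_symml)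
  show "F (zs @ xs) = 0" if "xs \<notin> tuples (nuc_dual S) n" for xs
    using that F zs nuc_tensor_outside append_tuples_iff by blast
  fix p
  obtain q where q: "p \<le> q" "zs \<in> tuples (dual_level S q) k" using nuc_dual_tuplesE[OF zs] by blast
  have "tbound q n (\<lambda>xs. F (zs @ xs)) (tnorm S q (k + n) F * (\<Prod>x\<leftarrow>zs. dnorm S q x))"
    by (rule tbound_append[OF nuc_tensor_tbound[OF F] q(2)])
  moreover have "0 \<le> tnorm S q (k + n) F * (\<Prod>x\<leftarrow>zs. dnorm S q x)"
    using F q by (intro mult_nonneg_nonneg tnorm_nonneg nuc_tensor_level prod_dnorm_nonneg)
  ultimately show "\<exists>M. tbound p n (\<lambda>xs. F (zs @ xs)) M" using tbound_mono q by blast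
qed

lemma tnorm_triangle:
  assumes F: "F \<in> tensor_level S p n" and G: "G \<in> tensor_level S p n"
  shows "tnorm S p n (\<lambda>xs. F xs + G xs) \<le> tnorm S p n F + tnorm S p n G"
proof -
  have t0: "0 \<le> tnorm S p n F + tnorm S p n G" using F G tnorm_nonneg by (simp add: add_nonneg_nonneg)
  have part: "L2_set (\<lambda>es. cmod (H (map (riesz S p) es))) (tuples B n) \<le> tnorm S p n H"
    if "H \<in> tensor_level S p n" "finite B" "orthonormal_in S p B" for H B
    unfolding L2_set_def tnorm_def tuples_def using that
    by (intro real_sqrt_le_mono cSup_upper) (auto simp: hs_sums_def tensor_level_def)
  have "Sup (hs_sums S p n (\<lambda>xs. F xs + G xs)) \<le> (tnorm S p n F + tnorm S p n G)\<^sup>2"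
  proof (rule cSup_least[OF hs_sums_nonempty])
    fix s assume "s \<in> hs_sums S p n (\<lambda>xs. F xs + G xs)"
    then obtain B where B: "finite B" "orthonormal_in S p B"
        "s = (\<Sum>es\<in>tuples B n. (cmod (F (map (riesz S p) es) + G (map (riesz S p) es)))\<^sup>2)"
      by (auto simp: hs_sums_def tuples_def)
    have "sqrt s = L2_set (\<lambda>es. cmod (F (map (riesz S p) es) + G (map (riesz S p) es))) (tuples B n)"
      by (simp add: B(3) L2_set_def)
    also have "\<dots> \<le> L2_set (\<lambda>es. cmod (F (map (riesz S p) es)) + cmod (G (map (riesz S p) es))) (tuples B n)"
      by (intro L2_set_mono norm_triangle_ineq) auto
    also have "\<dots> \<le> L2_set (\<lambda>es. cmod (F (map (riesz S p) es))) (tuples B n)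
        + L2_set (\<lambda>es. cmod (G (map (riesz S p) es))) (tuples B n)"
      by (rule L2_set_triangle_ineq)
    also have "\<dots> \<le> tnorm S p n F + tnorm S p n G"
      using F G B by (intro add_mono part)
    finally show "s \<le> (tnorm S p n F + tnorm S p n G)\<^sup>2" by (rule sqrt_le_D)
  qed
  then show ?thesis unfolding tnorm_def[of S p n "\<lambda>xs. F xs + G xs"] using t0 by (intro real_le_lsqrt)
qed

end

section \<open>Continuous functionals on symmetric tensors\<close>

text \<open>Since \<open>\<omega> ^ Suc d = 1\<close>, the weight \<open>\<omega> ^ (k * d)\<close>
  is \<open>\<omega> ^ (-k)\<close>, and averaging over \<open>k\<close> isolates the coefficient of
  degree 1. This expresses a derivative at 0 as a finite combination of values, so that no limit has
  to be taken in the span of tensor powers.\<close>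

lemma roots_of_unity_filter:
  fixes p :: "complex poly"
  assumes d: "degree p \<le> d" "d \<ge> 1"
  defines "\<omega> \<equiv> cis (2 * pi / real (Suc d))"
  shows "(\<Sum>k<Suc d. \<omega> ^ (k * d) * poly p (\<omega> ^ k)) = of_nat (Suc d) * coeff p 1"
proof -
  have \<omega>: "\<omega> ^ m = 1 \<longleftrightarrow> Suc d dvd m" for m
  proof -
    have "\<omega> ^ m = cis (2 * pi * real m / real (Suc d))"
      by (simp add: \<omega>_def Complex.DeMoivre mult_ac)
    also have "\<dots> = exp (2 * of_real pi * \<i> * of_nat m / of_nat (Suc d))"
      by (simp add: cis_conv_exp mult_ac)
    also have "\<dots> = 1 \<longleftrightarrow> Suc d dvd m" by (intro complex_root_unity_eq_1) simp
    finally show ?thesis .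
  qed
  have \<omega>1: "\<omega> ^ Suc d = 1" unfolding \<omega> by simp
  have geo: "(\<Sum>k<Suc d. (\<omega> ^ (d + j)) ^ k) = (if j = 1 then of_nat (Suc d) else 0)" if j: "j \<le> d" for j
  proof (cases "j = 1")
    case True
    then have "\<omega> ^ (d + j) = 1" using \<omega>1 by simp
    then show ?thesis using True by simp
  next
    case False
    \<comment> \<open>\<open>d + j\<close> lies between \<open>d\<close> and \<open>2 * d\<close>;
      the only multiple of \<open>Suc d\<close> in that range is \<open>Suc d\<close> itself, which
      is the case \<open>j = 1\<close>.\<close>
    have "\<not> Suc d dvd d + j"
    proof
      assume "Suc d dvd d + j"
      then obtain c where c: "d + j = Suc d * c" by blast
      consider "c = 0" | "c = 1" | "c \<ge> 2" by linarith
      then show False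
      proof cases
        case 3
        have "Suc d * 2 \<le> Suc d * c" using 3 by (intro mult_le_mono2)
        then show ?thesis using c j by simp
      qed (use c d False in auto)
    qed
    then have ne: "\<omega> ^ (d + j) \<noteq> 1" using \<omega> by simp
    have "(\<omega> ^ (d + j)) ^ Suc d = 1" by (metis \<omega>1 mult.commute power_mult power_one)
    then show ?thesis using ne False by (simp add: sum_gp_strict del: power_Suc sum.lessThan_Suc)
  qed
  have "(\<Sum>k<Suc d. \<omega> ^ (k * d) * poly p (\<omega> ^ k)) =
      (\<Sum>k<Suc d. \<Sum>j\<le>d. coeff p j * (\<omega> ^ (d + j)) ^ k)"
  proof (rule sum.cong)
    fix k
    have "poly p (\<omega> ^ k) = (\<Sum>j\<le>d. coeff p j * (\<omega> ^ k) ^ j)"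
      unfolding poly_altdef using d(1) by (intro sum.mono_neutral_left) (auto simp: coeff_eq_0)
    then show "\<omega> ^ (k * d) * poly p (\<omega> ^ k) = (\<Sum>j\<le>d. coeff p j * (\<omega> ^ (d + j)) ^ k)"
      by (simp add: sum_distrib_left algebra_simps flip: power_mult power_add)
  qed simp
  also have "\<dots> = (\<Sum>j\<le>d. coeff p j * (\<Sum>k<Suc d. (\<omega> ^ (d + j)) ^ k))"
    by (subst sum.swap) (simp add: sum_distrib_left del: sum.lessThan_Suc)
  also have "\<dots> = (\<Sum>j\<le>d. if j = 1 then coeff p j * of_nat (Suc d) else 0)"
    by (intro sum.cong refl) (auto simp: geo simp del: sum.lessThan_Suc)
  also have "\<dots> = of_nat (Suc d) * coeff p 1" using d by (simp add: mult.commute)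
  finally show ?thesis .
qed

definition drop_nth :: "nat \<Rightarrow> 'a list \<Rightarrow> 'a list" where
  "drop_nth i xs = take i xs @ drop (Suc i) xs"

lemma drop_nth_simps [simp]:
  "drop_nth 0 (x # xs) = xs" "drop_nth (Suc i) (x # xs) = x # drop_nth i xs"
  by (simp_all add: drop_nth_def)

lemma mset_drop_nth: "i < length xs \<Longrightarrow> mset (xs ! i # drop_nth i xs) = mset xs"
  by (metis drop_nth_def id_take_nth_drop mset_append mset.simps(2) union_mset_add_mset_right)

lemma drop_nth_tuples: "xs \<in> tuples A (Suc n) \<Longrightarrow> i < Suc n \<Longrightarrow> drop_nth i xs \<in> tuples A n"
  by (auto simp: tuples_def drop_nth_def dest: in_set_takeD in_set_dropD)

lemma degree_prod_linear: "degree (\<Prod>x\<leftarrow>xs. [:a x, b x:]) \<le> length xs"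
proof (induction xs)
  case (Cons x xs)
  have "degree ([:a x, b x:] * (\<Prod>x\<leftarrow>xs. [:a x, b x:])) \<le> degree [:a x, b x:] + degree (\<Prod>x\<leftarrow>xs. [:a x, b x:])"
    by (rule degree_mult_le)
  also have "\<dots> \<le> 1 + length xs" using Cons by (intro add_mono) auto
  finally show ?case by simp
qed simp

lemma poly_prod_linear: "poly (\<Prod>x\<leftarrow>xs. [:a x, b x:]) t = (\<Prod>x\<leftarrow>xs. a x + t * b x)"
  by (induction xs) (auto simp: algebra_simps)

lemma coeff_prod_linear:
  fixes a b :: "'a \<Rightarrow> 'b::comm_semiring_1"
  shows "coeff (\<Prod>x\<leftarrow>xs. [:a x, b x:]) 0 = (\<Prod>x\<leftarrow>xs. a x)"
    "coeff (\<Prod>x\<leftarrow>xs. [:a x, b x:]) 1 = (\<Sum>i<length xs. b (xs ! i) * (\<Prod>x\<leftarrow>drop_nth i xs. a x))"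
proof -
  show c0: "coeff (\<Prod>x\<leftarrow>xs. [:a x, b x:]) 0 = (\<Prod>x\<leftarrow>xs. a x)" for xs
    by (induction xs) auto
  show "coeff (\<Prod>x\<leftarrow>xs. [:a x, b x:]) 1 = (\<Sum>i<length xs. b (xs ! i) * (\<Prod>x\<leftarrow>drop_nth i xs. a x))"
  proof (induction xs)
    case (Cons x xs)
    then show ?case
      by (simp add: sum.lessThan_Suc_shift c0 sum_distrib_left mult_ac add.commute del: sum.lessThan_Suc)
  qed simp
qed

lemma prod_list_mset_cong: "mset xs = mset ys \<Longrightarrow> (\<Prod>x\<leftarrow>xs. f x) = (\<Prod>x\<leftarrow>ys. f x :: 'c::comm_monoid_mult)"
  by (metis mset_map prod_mset_prod_list)

lemma norm_prod_list: "norm (\<Prod>x\<leftarrow>xs. f x :: complex) = (\<Prod>x\<leftarrow>xs. norm (f x))"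
  by (induction xs) (auto simp: norm_mult)

lemma prod_list_const_mult:
  "(\<Prod>x\<leftarrow>xs. (c :: 'c::comm_monoid_mult) * f x) = c ^ length xs * (\<Prod>x\<leftarrow>xs. f x)"
  by (induction xs) (auto simp: mult_ac)

context nuclear_scale
begin

definition dlin :: "nat \<Rightarrow> ('h tensor \<Rightarrow> complex) \<Rightarrow> bool" where
  "dlin n P \<longleftrightarrow> (\<forall>F\<in>nuc_tensor S n. \<forall>G\<in>nuc_tensor S n. \<forall>a b.
     P (\<lambda>xs. a * F xs + b * G xs) = a * P F + b * P G)"

text \<open>Continuity measured against operator bounds. Compared with the bound by
  \<open>tnorm\<close> in \<open>tensor_dual\<close>, a change of level and a factor
  \<open>K ^ n\<close> are lost. A functional bounded at \<open>p\<close> is bounded at every higher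
  level with the same constant.\<close>

definition dbound :: "nat \<Rightarrow> nat \<Rightarrow> ('h tensor \<Rightarrow> complex) \<Rightarrow> real \<Rightarrow> bool" where
  "dbound p n P C \<longleftrightarrow>
     0 \<le> C \<and> (\<forall>F\<in>nuc_tensor S n. \<forall>M\<ge>0. tbound p n F M \<longrightarrow> cmod (P F) \<le> C * M)"

lemma dlinD: "dlin n P \<Longrightarrow> F \<in> nuc_tensor S n \<Longrightarrow> G \<in> nuc_tensor S n \<Longrightarrow>
    P (\<lambda>xs. a * F xs + b * G xs) = a * P F + b * P G"
  by (simp add: dlin_def)

lemma dlin_scale: "dlin n P \<Longrightarrow> F \<in> nuc_tensor S n \<Longrightarrow> P (\<lambda>xs. a * F xs) = a * P F"
  using dlinD[of n P F F a 0] by simp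

lemma dlin_zero: "dlin n P \<Longrightarrow> P (\<lambda>xs. 0) = 0"
  using dlin_scale[of n P "\<lambda>xs. 0" 0] nuc_tensor_zero by simp

lemma dlin_diff: "dlin n P \<Longrightarrow> F \<in> nuc_tensor S n \<Longrightarrow> G \<in> nuc_tensor S n \<Longrightarrow>
    P (\<lambda>xs. F xs - G xs) = P F - P G"
  using dlinD[of n P F G 1 "-1"] by simp

lemma dlin_sum:
  assumes "dlin n P" "\<And>i. i \<in> I \<Longrightarrow> F i \<in> nuc_tensor S n"
  shows "P (\<lambda>xs. \<Sum>i\<in>I. c i * F i xs) = (\<Sum>i\<in>I. c i * P (F i))"
  using assms(2)
proof (induction I rule: infinite_finite_induct)
  case (insert i I)
  then show ?case
    using dlinD[OF assms(1), of "F i" "\<lambda>xs. \<Sum>i\<in>I. c i * F i xs" "c i" 1] by (simp add: nuc_tensor_sum)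
qed (auto simp: dlin_zero[OF assms(1)])

lemma dbound_mono: "p \<le> q \<Longrightarrow> dbound p n P C \<Longrightarrow> dbound q n P C"
  unfolding dbound_def using tbound_mono by blast

lemma dboundD:
  "dbound p n P C \<Longrightarrow> F \<in> nuc_tensor S n \<Longrightarrow> tbound p n F M \<Longrightarrow> 0 \<le> M \<Longrightarrow> cmod (P F) \<le> C * M"
  by (auto simp: dbound_def)

lemma tensor_dualI: "dlin n P \<Longrightarrow> dbound p n P C \<Longrightarrow> P \<in> tensor_dual S n"
  unfolding tensor_dual_def dlin_def
  using dboundD[of p n P C] nuc_tensor_tbound[of _ n p] tnorm_nonneg[OF nuc_tensor_level] by blast

lemma tensor_dual_dlin: "P \<in> tensor_dual S n \<Longrightarrow> dlin n P"
  by (simp add: tensor_dual_def dlin_def)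

lemma tensor_dual_dbound:
  assumes "P \<in> tensor_dual S n"
  obtains p C where "dbound p n P C"
proof -
  obtain p C where C: "\<And>F. F \<in> nuc_tensor S n \<Longrightarrow> cmod (P F) \<le> C * tnorm S p n F"
    using assms unfolding tensor_dual_def by blast
  obtain q K where hs: "hs_bound p q K" using hs_bound_exists by blast
  have "dbound q n P (\<bar>C\<bar> * K ^ n)"
    unfolding dbound_def
  proof (intro conjI ballI allI impI)
    show "0 \<le> \<bar>C\<bar> * K ^ n" using hs by (simp add: hs_bound_def)
    fix F M assume F: "F \<in> nuc_tensor S n" "0 \<le> M" "tbound q n F M"
    have "cmod (P F) \<le> C * tnorm S p n F" using C F by blast
    also have "\<dots> \<le> \<bar>C\<bar> * tnorm S p n F"
      using tnorm_nonneg[OF nuc_tensor_level[OF F(1)]] by (intro mult_right_mono) auto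
    also have "\<dots> \<le> \<bar>C\<bar> * (K ^ n * M)" using tnorm_le(2)[OF hs F(3,2)] by (intro mult_left_mono) auto
    finally show "cmod (P F) \<le> \<bar>C\<bar> * K ^ n * M" by (simp add: mult.assoc)
  qed
  then show ?thesis using that by blast
qed

subsection \<open>Tensor powers and their span\<close>

lemma pairing_bound:
  assumes x: "x \<in> dual_level S p" and \<theta>: "\<theta> \<in> nucC S"
  shows "cmod (pairing (cplx x) \<theta>) \<le> (lnorm S p (fst \<theta>) + lnorm S p (snd \<theta>)) * dnorm S p x"
proof -
  have "cmod (pairing (cplx x) \<theta>) \<le> \<bar>x (fst \<theta>)\<bar> + \<bar>x (snd \<theta>)\<bar>"
    unfolding pairing_def cplx_def by (rule order_trans[OF norm_triangle_ineq]) (simp add: norm_mult)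
  also have "\<dots> \<le> dnorm S p x * lnorm S p (fst \<theta>) + dnorm S p x * lnorm S p (snd \<theta>)"
    using x \<theta> by (intro add_mono dual_bound) (auto simp: nucC_def)
  finally show ?thesis by (simp add: algebra_simps)
qed

lemma pairing_lin:
  "pairing (cplx (\<lambda>\<theta>. a * x \<theta> + b * y \<theta>)) \<theta> =
    of_real a * pairing (cplx x) \<theta> + of_real b * pairing (cplx y) \<theta>"
  by (simp add: pairing_def cplx_def algebra_simps)

lemma tensor_power_eq:
  "xs \<in> tuples (nuc_dual S) n \<Longrightarrow> tensor_power S n \<theta> xs = (\<Prod>x\<leftarrow>xs. pairing (cplx x) \<theta>)"
  by (auto simp: tensor_power_def tuples_def)

lemma tensor_power_outside: "xs \<notin> tuples (nuc_dual S) n \<Longrightarrow> tensor_power S n \<theta> xs = 0"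
  by (auto simp: tensor_power_def tuples_def)

lemma tensor_power_tbound:
  assumes \<theta>: "\<theta> \<in> nucC S"
  shows "tbound p n (tensor_power S n \<theta>) ((lnorm S p (fst \<theta>) + lnorm S p (snd \<theta>)) ^ n)"
proof (rule tboundI)
  fix xs assume xs: "xs \<in> tuples (dual_level S p) n"
  have "cmod (tensor_power S n \<theta> xs) = (\<Prod>x\<leftarrow>xs. cmod (pairing (cplx x) \<theta>))"
    by (simp add: tensor_power_eq[OF dual_tuples_nuc[OF xs]] norm_prod_list)
  also have "\<dots> \<le> (\<Prod>x\<leftarrow>xs. (lnorm S p (fst \<theta>) + lnorm S p (snd \<theta>)) * dnorm S p x)"
    using xs \<theta> by (intro prod_list_mono_real) (auto simp: tuples_def intro!: pairing_bound)
  also have "\<dots> = (lnorm S p (fst \<theta>) + lnorm S p (snd \<theta>)) ^ n * (\<Prod>x\<leftarrow>xs. dnorm S p x)"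
    using xs by (simp add: prod_list_const_mult tuples_def)
  finally show "cmod (tensor_power S n \<theta> xs) \<le> \<dots>" .
qed

lemma tensor_power_nuc:
  assumes \<theta>: "\<theta> \<in> nucC S"
  shows "tensor_power S n \<theta> \<in> nuc_tensor S n"
proof (rule nuc_tensorI)
  show "sym_multilinear (nuc_dual S) n (tensor_power S n \<theta>)"
  proof (rule symmlI[OF lin_closed_nuc_dual])
    fix xs ys assume *: "xs \<in> tuples (nuc_dual S) n" "mset ys = mset xs"
    then have "ys \<in> tuples (nuc_dual S) n"
      unfolding tuples_def using mset_eq_setD[OF *(2)] mset_eq_length[OF *(2)] by simp
    then show "tensor_power S n \<theta> ys = tensor_power S n \<theta> xs"
      using * prod_list_mset_cong[OF *(2)] by (simp add: tensor_power_eq)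
  next
    fix m xs x y and a b :: real
    assume "n = Suc m" "xs \<in> tuples (nuc_dual S) m" "x \<in> nuc_dual S" "y \<in> nuc_dual S"
    then show "tensor_power S n \<theta> ((\<lambda>\<theta>. a * x \<theta> + b * y \<theta>) # xs) =
       of_real a * tensor_power S n \<theta> (x # xs) + of_real b * tensor_power S n \<theta> (y # xs)"
      using lin_closedD[OF lin_closed_nuc_dual, of x y a b]
      by (simp add: tensor_power_eq pairing_lin algebra_simps)
  qed
  show "\<exists>M. tbound p n (tensor_power S n \<theta>) M" for p using tensor_power_tbound[OF \<theta>] by blast
qed (rule tensor_power_outside)

text \<open>The linear span of the tensor powers of degree \<open>n\<close>, generated by one
  summand at a time so that linear statements follow by rule induction.\<close>

inductive_set tpspan :: "nat \<Rightarrow> 'h tensor set" for n where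
  zero: "(\<lambda>xs. 0) \<in> tpspan n"
| step: "F \<in> tpspan n \<Longrightarrow> \<theta> \<in> nucC S \<Longrightarrow> (\<lambda>xs. c * tensor_power S n \<theta> xs + F xs) \<in> tpspan n"

lemma tpspan_add: "F \<in> tpspan n \<Longrightarrow> G \<in> tpspan n \<Longrightarrow> (\<lambda>xs. F xs + G xs) \<in> tpspan n"
proof (induction rule: tpspan.induct)
  case (step F \<theta> c)
  then show ?case using tpspan.step[of "\<lambda>xs. F xs + G xs" n \<theta> c] by (simp add: add.assoc)
qed simp

lemma tpspan_scale: "F \<in> tpspan n \<Longrightarrow> (\<lambda>xs. a * F xs) \<in> tpspan n"
proof (induction rule: tpspan.induct)
  case (step F \<theta> c)
  then show ?case using tpspan.step[of "\<lambda>xs. a * F xs" n \<theta> "a * c"] by (simp add: algebra_simps)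
qed (simp add: tpspan.zero)

lemma tpspan_sum: "(\<And>i. i \<in> I \<Longrightarrow> F i \<in> tpspan n) \<Longrightarrow> (\<lambda>xs. \<Sum>i\<in>I. F i xs) \<in> tpspan n"
  by (induction I rule: infinite_finite_induct) (auto simp: tpspan.zero intro: tpspan_add)

lemma tpspan_power: "\<theta> \<in> nucC S \<Longrightarrow> tensor_power S n \<theta> \<in> tpspan n"
  using tpspan.step[OF tpspan.zero, where c = 1] by simp

lemma tpspan_nuc: "F \<in> tpspan n \<Longrightarrow> F \<in> nuc_tensor S n"
proof (induction rule: tpspan.induct)
  case (step F \<theta> c)
  then show ?case using nuc_tensor_lincomb[OF tensor_power_nuc[OF step(2)], of F n c 1] by simp
qed (rule nuc_tensor_zero)

definition lift_tensor :: "nat \<Rightarrow> 'h \<Rightarrow> 'h tensor \<Rightarrow> 'h tensor" where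
  "lift_tensor n e F = (\<lambda>xs. if xs \<in> tuples (nuc_dual S) (Suc n)
     then \<Sum>i<Suc n. of_real ((xs ! i) e) * F (drop_nth i xs) else 0)"

text \<open>Up to a factor, \<open>lift_tensor n e \<theta>\<^sup>\<otimes>\<^sup>n\<close> is the symmetrization of \<open>e \<otimes> \<theta>\<^sup>\<otimes>\<^sup>n\<close>, i.e. the
  coefficient of \<open>t\<close> in \<open>(\<theta> + t e)\<^sup>\<otimes>\<^sup>(\<^sup>n\<^sup>+\<^sup>1\<^sup>)\<close>, which is extracted by averaging over roots of unity.\<close>

lemma lift_tensor_power:
  assumes e: "e \<in> nuc S" and \<theta>: "\<theta> \<in> nucC S"
  shows "lift_tensor n e (tensor_power S n \<theta>) \<in> tpspan (Suc n)"
proof -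
  \<comment> \<open>A root of unity of order \<open>n + 2\<close>, one more than the degree
    \<open>n + 1\<close> of the polynomial in \<open>t\<close> to be filtered.\<close>
  define \<omega> where "\<omega> = cis (2 * pi / real (Suc (Suc n)))"
  define \<eta> where "\<eta> k = nucC_line \<theta> (\<omega> ^ k) (e, 0)" for k
  have \<eta>: "\<eta> k \<in> nucC S" for k
    using e \<theta> by (auto simp: \<eta>_def nucC_line_def nucC_def intro!: nuc_add nuc_scale)
  have pair: "pairing (cplx x) (\<eta> k) = pairing (cplx x) \<theta> + \<omega> ^ k * of_real (x e)"
    if "x \<in> nuc_dual S" for x k
  proof -
    obtain p where x: "x \<in> dual_level S p" using \<open>x \<in> nuc_dual S\<close> by (auto simp: nuc_dual_def)
    have "of_real (Re t) * of_real (x e) + \<i> * (of_real (Im t) * of_real (x e)) = t * of_real (x e)" for t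
      by (simp add: complex_eq_iff)
    note * = this[of "\<omega> ^ k"]
    show ?thesis
      using e \<theta> x *
      by (simp add: \<eta>_def nucC_line_def pairing_def cplx_def nucC_def dual_add dual_scale nuc_scale
          mem_Times_iff algebra_simps)
  qed
  have "lift_tensor n e (tensor_power S n \<theta>) =
      (\<lambda>xs. \<Sum>k<Suc (Suc n). 1 / of_nat (Suc (Suc n)) * \<omega> ^ (k * Suc n) * tensor_power S (Suc n) (\<eta> k) xs)"
  proof
    fix xs
    show "lift_tensor n e (tensor_power S n \<theta>) xs =
      (\<Sum>k<Suc (Suc n). 1 / of_nat (Suc (Suc n)) * \<omega> ^ (k * Suc n) * tensor_power S (Suc n) (\<eta> k) xs)"
    proof (cases "xs \<in> tuples (nuc_dual S) (Suc n)")
      case True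
      define p where "p = (\<Prod>x\<leftarrow>xs. [:pairing (cplx x) \<theta>, of_real (x e) :: complex:])"
      have len: "length xs = Suc n" using True by (simp add: tuples_def)
      have dp: "degree p \<le> Suc n" unfolding p_def len[symmetric] by (rule degree_prod_linear)
      have "tensor_power S (Suc n) (\<eta> k) xs = poly p (\<omega> ^ k)" for k
        unfolding p_def poly_prod_linear tensor_power_eq[OF True] using True pair
        by (auto simp: tuples_def intro!: arg_cong[where f = prod_list] map_cong)
      then have "(\<Sum>k<Suc (Suc n). 1 / of_nat (Suc (Suc n)) * \<omega> ^ (k * Suc n) * tensor_power S (Suc n) (\<eta> k) xs)
          = 1 / of_nat (Suc (Suc n)) * (\<Sum>k<Suc (Suc n). \<omega> ^ (k * Suc n) * poly p (\<omega> ^ k))"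
        by (simp add: sum_distrib_left mult.assoc del: sum.lessThan_Suc)
      also have "\<dots> = coeff p 1"
        unfolding \<omega>_def using roots_of_unity_filter[OF dp] by (simp del: sum.lessThan_Suc of_nat_Suc)
      also have "\<dots> = (\<Sum>i<Suc n. of_real ((xs ! i) e) * (\<Prod>x\<leftarrow>drop_nth i xs. pairing (cplx x) \<theta>))"
        unfolding p_def coeff_prod_linear len ..
      also have "\<dots> = lift_tensor n e (tensor_power S n \<theta>) xs"
        using True drop_nth_tuples[OF True]
        by (simp add: lift_tensor_def tensor_power_eq del: sum.lessThan_Suc)
      finally show ?thesis ..
    qed (simp add: lift_tensor_def tensor_power_outside)
  qed
  then show ?thesis using \<eta> by (simp only:) (intro tpspan_sum tpspan_scale tpspan_power)
qed

lemma lift_tensor_tpspan: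
  assumes e: "e \<in> nuc S" and "F \<in> tpspan n"
  shows "lift_tensor n e F \<in> tpspan (Suc n)"
  using assms(2)
proof (induction rule: tpspan.induct)
  case zero
  have "lift_tensor n e (\<lambda>xs. 0) = (\<lambda>xs. 0)" by (simp add: lift_tensor_def fun_eq_iff)
  then show ?case by (simp add: tpspan.zero)
next
  case (step F \<theta> c)
  have "lift_tensor n e (\<lambda>xs. c * tensor_power S n \<theta> xs + F xs) =
      (\<lambda>xs. c * lift_tensor n e (tensor_power S n \<theta>) xs + lift_tensor n e F xs)"
    unfolding lift_tensor_def
    by (rule ext) (simp add: sum_distrib_left distrib_left sum.distrib mult.left_commute
        del: sum.lessThan_Suc)
  then show ?case using step e lift_tensor_power by (simp add: tpspan_add tpspan_scale)
qed

subsection \<open>Finite rank approximation of tensors\<close>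

text \<open>The adjoint of \<open>proj q B\<close>: on \<open>nuc S\<close> it is \<open>x\<close>
  composed with the projection. The form as a combination of \<open>riesz S q e\<close> shows at
  once that the result lies in level \<open>q\<close> of the dual and in a finite-dimensional
  space.\<close>

definition padj :: "nat \<Rightarrow> 'h set \<Rightarrow> ('h \<Rightarrow> real) \<Rightarrow> 'h \<Rightarrow> real" where
  "padj q B x = (\<lambda>\<theta>. \<Sum>e\<in>B. x e * riesz S q e \<theta>)"

lemma padj_dual: "B \<subseteq> nuc S \<Longrightarrow> padj q B x \<in> dual_level S q"
  unfolding padj_def by (intro lin_closed_sum lin_closed_dual_level riesz_dual nuc_level) auto

lemma padj_apply:
  assumes "B \<subseteq> nuc S" "x \<in> dual_level S r" "\<theta> \<in> nuc S"
  shows "padj q B x \<theta> = x (proj q B \<theta>)"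
proof -
  have "x (proj q B \<theta>) = (\<Sum>e\<in>B. x (ip S q e \<theta> *\<^sub>R e))"
    unfolding proj_def using assms by (intro dual_sum nuc_scale) auto
  also have "\<dots> = (\<Sum>e\<in>B. x e * riesz S q e \<theta>)"
    using assms by (intro sum.cong) (auto simp: dual_scale riesz_def mult.commute subset_iff)
  finally show ?thesis by (simp add: padj_def)
qed

lemma dnorm_padj_le:
  assumes B: "finite B" "orthonormal_in S q B" "B \<subseteq> nuc S" and x: "x \<in> dual_level S p" and "p \<le> q"
  shows "dnorm S q (padj q B x) \<le> dnorm S p x"
proof (rule dnorm_le)
  fix \<theta> assume \<theta>: "\<theta> \<in> nuc S"
  have pr: "proj q B \<theta> \<in> nuc S" using B by (simp add: proj_nuc)
  have "\<bar>padj q B x \<theta>\<bar> \<le> dnorm S p x * lnorm S p (proj q B \<theta>)"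
    unfolding padj_apply[OF B(3) x \<theta>] by (rule dual_bound[OF x pr])
  also have "\<dots> \<le> dnorm S p x * lnorm S q \<theta>"
    using lnorm_mono[OF \<open>p \<le> q\<close> nuc_level[OF pr]] lnorm_proj_le(1)[OF B(1,2) nuc_level[OF \<theta>]]
    by (intro mult_left_mono dnorm_nonneg[OF x]) auto
  finally show "\<bar>padj q B x \<theta>\<bar> \<le> dnorm S p x * lnorm S q \<theta>" .
qed (rule dnorm_nonneg[OF x])

lemma dnorm_diff_padj_le:
  assumes B: "B \<subseteq> nuc S" and x: "x \<in> dual_level S p" and "0 \<le> \<epsilon>"
    and approx: "\<And>\<theta>. \<theta> \<in> nuc S \<Longrightarrow> lnorm S p (\<theta> - proj q B \<theta>) \<le> \<epsilon> * lnorm S q \<theta>"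
  shows "dnorm S q (\<lambda>\<theta>. x \<theta> - padj q B x \<theta>) \<le> \<epsilon> * dnorm S p x"
proof (rule dnorm_le)
  fix \<theta> assume \<theta>: "\<theta> \<in> nuc S"
  have pr: "proj q B \<theta> \<in> nuc S" using B by (simp add: proj_nuc)
  have "\<bar>x \<theta> - padj q B x \<theta>\<bar> = \<bar>x (\<theta> - proj q B \<theta>)\<bar>"
    using padj_apply[OF B x \<theta>] dual_diff[OF x \<theta> pr] by simp
  also have "\<dots> \<le> dnorm S p x * lnorm S p (\<theta> - proj q B \<theta>)"
    by (rule dual_bound[OF x nuc_diff[OF \<theta> pr]])
  also have "\<dots> \<le> dnorm S p x * (\<epsilon> * lnorm S q \<theta>)"
    using approx[OF \<theta>] by (intro mult_left_mono dnorm_nonneg[OF x])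
  finally show "\<bar>x \<theta> - padj q B x \<theta>\<bar> \<le> \<epsilon> * dnorm S p x * lnorm S q \<theta>" by (simp add: mult_ac)
qed (use dnorm_nonneg[OF x] assms in auto)

text \<open>Telescoping: the arguments are replaced by their projections one after the other. Each
  replacement costs \<open>\<epsilon> * M\<close> times the product of the dual norms at level
  \<open>p\<close>, and there are \<open>n\<close> of them.\<close>

lemma tensor_padj_approx:
  assumes B: "finite B" "orthonormal_in S q B" "B \<subseteq> nuc S" and "p \<le> q" "0 \<le> \<epsilon>"
    and approx: "\<And>\<theta>. \<theta> \<in> nuc S \<Longrightarrow> lnorm S p (\<theta> - proj q B \<theta>) \<le> \<epsilon> * lnorm S q \<theta>"
    and "sym_multilinear (dual_level S q) n F" "tbound q n F M" "0 \<le> M" "xs \<in> tuples (dual_level S p) n"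
  shows "cmod (F xs - F (map (padj q B) xs)) \<le> real n * \<epsilon> * M * (\<Prod>x\<leftarrow>xs. dnorm S p x)"
  using assms(7-)
proof (induction n arbitrary: F M xs)
  case (Suc n)
  obtain x ys where x: "xs = x # ys" "x \<in> dual_level S p" "ys \<in> tuples (dual_level S p) n"
    using Suc.prems(4) by (rule tuples_SucE)
  define u where "u = padj q B x"
  define v where "v = (\<lambda>\<theta>. x \<theta> - u \<theta>)"
  define d where "d = (\<Prod>x\<leftarrow>ys. dnorm S p x)"
  have d0: "0 \<le> d" unfolding d_def using x(3) by (rule prod_dnorm_nonneg)
  have xq: "x \<in> dual_level S q" using dual_level_mono \<open>p \<le> q\<close> x by blast
  have u: "u \<in> dual_level S q" "dnorm S q u \<le> dnorm S p x"
    using dnorm_padj_le[OF B x(2) \<open>p \<le> q\<close>] padj_dual[OF B(3)] by (auto simp: u_def)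
  have v: "v \<in> dual_level S q" "dnorm S q v \<le> \<epsilon> * dnorm S p x"
    using dnorm_diff_padj_le[OF B(3) x(2) \<open>0 \<le> \<epsilon>\<close> approx] dual_level_diff[OF xq u(1)] by (auto simp: u_def v_def)
  have ysq: "ys \<in> tuples (dual_level S q) n" using dual_tuples_mono[OF \<open>p \<le> q\<close> x(3)] .
  have "F (v # ys) = F (x # ys) - F (u # ys)"
    using symml_head[OF Suc.prems(1) ysq xq u(1), of 1 "-1"] by (simp add: v_def)
  moreover have "cmod (F (v # ys)) \<le> \<epsilon> * M * (dnorm S p x * d)"
  proof -
    have "cmod (F (v # ys)) \<le> M * (dnorm S q v * (\<Prod>x\<leftarrow>ys. dnorm S q x))"
      using tboundD[OF Suc.prems(2), of "v # ys"] v ysq by simp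
    also have "\<dots> \<le> M * ((\<epsilon> * dnorm S p x) * d)"
      unfolding d_def using v Suc.prems(3) prod_dnorm_mono[OF \<open>p \<le> q\<close> x(3)] prod_dnorm_nonneg[OF ysq]
        dnorm_nonneg[OF x(2)] \<open>0 \<le> \<epsilon>\<close>
      by (intro mult_left_mono mult_mono) auto
    finally show ?thesis by (simp add: mult_ac)
  qed
  moreover have "cmod (F (u # ys) - F (u # map (padj q B) ys)) \<le> real n * \<epsilon> * (M * dnorm S p x) * d"
    unfolding d_def
  proof (rule Suc.IH)
    show "sym_multilinear (dual_level S q) n (\<lambda>ys. F (u # ys))"
      by (rule symml_Cons[OF lin_closed_dual_level Suc.prems(1) u(1)])
    have "tbound q n (\<lambda>ys. F ([u] @ ys)) (M * (\<Prod>x\<leftarrow>[u]. dnorm S q x))"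
      using Suc.prems(2) u by (intro tbound_append) (auto simp: tuples_def)
    then show "tbound q n (\<lambda>ys. F (u # ys)) (M * dnorm S p x)"
      using u Suc.prems(3) by (auto intro: tbound_weaken mult_left_mono)
  qed (use x Suc.prems(3) dnorm_nonneg in auto)
  ultimately have "cmod (F (x # ys) - F (u # map (padj q B) ys)) \<le>
      \<epsilon> * M * (dnorm S p x * d) + real n * \<epsilon> * (M * dnorm S p x) * d"
    using norm_triangle_ineq[of "F (v # ys)" "F (u # ys) - F (u # map (padj q B) ys)"] by simp
  then show ?case by (simp add: x(1) u_def d_def algebra_simps)
qed simp

text \<open>A symmetric form that only sees the projections of its arguments is a combination of
  tensor powers. Expanding one argument along \<open>B\<close> leaves forms \<open>Ge e\<close> of
  lower degree. They factor in the same way because \<open>padj q B\<close> fixes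
  \<open>riesz S q e\<close>, and \<open>lift_tensor\<close> returns to degree
  \<open>Suc n\<close>.\<close>

lemma padj_factor_tpspan:
  assumes B: "finite B" "orthonormal_in S q B" "B \<subseteq> nuc S"
    and "sym_multilinear (nuc_dual S) n G"
    and "\<And>xs. xs \<notin> tuples (nuc_dual S) n \<Longrightarrow> G xs = 0"
    and "\<And>xs. xs \<in> tuples (nuc_dual S) n \<Longrightarrow> G xs = G (map (padj q B) xs)"
  shows "G \<in> tpspan n"
  using assms(4-)
proof (induction n arbitrary: G)
  case 0
  have "G = (\<lambda>xs. G [] * tensor_power S 0 0 xs)"
    using 0(2) by (auto simp: fun_eq_iff tensor_power_def)
  then show ?case using tpspan_scale[OF tpspan_power[of 0 0], of "G []"] nuc_0 by (simp add: nucC_def zero_prod_def)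
next
  case (Suc n)
  note D = lin_closed_nuc_dual
  have re: "riesz S q e \<in> nuc_dual S" if "e \<in> B" for e
    using that B riesz_dual nuc_level nuc_dualI by blast
  have pn: "padj q B x \<in> nuc_dual S" for x using padj_dual[OF B(3)] nuc_dualI by blast
  define Ge where "Ge e = (\<lambda>xs. G (riesz S q e # xs))" for e
  have pe: "padj q B (riesz S q e) = riesz S q e" if "e \<in> B" for e
  proof
    fix \<theta>
    have "padj q B (riesz S q e) \<theta> = (\<Sum>f\<in>B. if f = e then riesz S q f \<theta> else 0)"
      unfolding padj_def using that B orthonormal_ip[OF B(2) that]
      by (intro sum.cong) (auto simp: riesz_def)
    then show "padj q B (riesz S q e) \<theta> = riesz S q e \<theta>" using that B by simp
  qed
  have Ge: "Ge e \<in> tpspan n" if e: "e \<in> B" for e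
  proof (rule Suc.IH)
    show "sym_multilinear (nuc_dual S) n (Ge e)"
      unfolding Ge_def by (rule symml_Cons[OF D Suc.prems(1) re[OF e]])
    show "Ge e xs = 0" if "xs \<notin> tuples (nuc_dual S) n" for xs
      unfolding Ge_def using that by (intro Suc.prems(2)) auto
    show "Ge e xs = Ge e (map (padj q B) xs)" if "xs \<in> tuples (nuc_dual S) n" for xs
      using Suc.prems(3)[of "riesz S q e # xs"] that re[OF e] pe[OF e] by (simp add: Ge_def)
  qed
  have expand: "G (x # ys) = (\<Sum>e\<in>B. of_real (x e) * Ge e ys)"
    if x: "x \<in> nuc_dual S" and ys: "ys \<in> tuples (nuc_dual S) n" for x ys
  proof -
    have t: "map (padj q B) ys \<in> tuples (nuc_dual S) n" using ys pn by (rule map_tuples)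
    have "G (x # ys) = G (padj q B x # map (padj q B) ys)" using Suc.prems(3)[of "x # ys"] x ys by simp
    also have "\<dots> = (\<Sum>e\<in>B. of_real (x e) * G (riesz S q e # map (padj q B) ys))"
      unfolding padj_def[of q B x] using re by (intro symml_sum_head[OF D Suc.prems(1) t]) auto
    also have "\<dots> = (\<Sum>e\<in>B. of_real (x e) * Ge e ys)"
    proof (intro sum.cong refl arg_cong2[where f = "(*)"])
      fix e assume e: "e \<in> B"
      show "G (riesz S q e # map (padj q B) ys) = Ge e ys"
        using Suc.prems(3)[of "riesz S q e # ys"] ys re[OF e] pe[OF e] by (simp add: Ge_def)
    qed
    finally show ?thesis .
  qed
  \<comment> \<open>Each of the \<open>Suc n\<close> arguments may be the one that is expanded,
    always with the value of \<open>G\<close> as result; averaging these expansions gives the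
    symmetrized lift.\<close>
  have "G = (\<lambda>xs. 1 / of_nat (Suc n) * (\<Sum>e\<in>B. lift_tensor n e (Ge e) xs))"
  proof
    fix xs show "G xs = 1 / of_nat (Suc n) * (\<Sum>e\<in>B. lift_tensor n e (Ge e) xs)"
    proof (cases "xs \<in> tuples (nuc_dual S) (Suc n)")
      case True
      have "G xs = (\<Sum>e\<in>B. of_real ((xs ! i) e) * Ge e (drop_nth i xs))" if i: "i < Suc n" for i
      proof -
        have len: "length xs = Suc n" using True by (simp add: tuples_def)
        have "G (xs ! i # drop_nth i xs) = G xs"
          using True i len by (intro symml_perm[OF Suc.prems(1)] mset_drop_nth) auto
        moreover have "xs ! i \<in> nuc_dual S" using True i len by (auto simp: tuples_def)
        ultimately show ?thesis using expand drop_nth_tuples[OF True i] by simp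
      qed
      then have "(\<Sum>i<Suc n. G xs) = (\<Sum>i<Suc n. \<Sum>e\<in>B. of_real ((xs ! i) e) * Ge e (drop_nth i xs))"
        by (intro sum.cong) auto
      also have "\<dots> = (\<Sum>e\<in>B. lift_tensor n e (Ge e) xs)"
        by (subst sum.swap) (simp add: lift_tensor_def True del: sum.lessThan_Suc)
      finally show ?thesis by (simp add: eq_divide_eq mult.commute del: sum.lessThan_Suc of_nat_Suc)
    qed (simp add: Suc.prems(2) lift_tensor_def)
  qed
  moreover have "(\<lambda>xs. 1 / of_nat (Suc n) * (\<Sum>e\<in>B. lift_tensor n e (Ge e) xs)) \<in> tpspan (Suc n)"
    using Ge B by (intro tpspan_scale tpspan_sum lift_tensor_tpspan) auto
  ultimately show ?case by simp
qed

lemma dlin_vanish_tpspan: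
  assumes "dlin n P" "\<And>\<theta>. \<theta> \<in> nucC S \<Longrightarrow> P (tensor_power S n \<theta>) = 0" "F \<in> tpspan n"
  shows "P F = 0"
  using assms(3)
proof (induction rule: tpspan.induct)
  case (step F \<theta> c)
  then show ?case
    using dlinD[OF assms(1) tensor_power_nuc[OF step(2)] tpspan_nuc[OF step(1)], of c 1] assms(2) by simp
qed (rule dlin_zero[OF assms(1)])

text \<open>Symmetric tensors are approximated by combinations of tensor powers.\<close>

lemma functional_vanishes:
  assumes lin: "dlin n P" and bd: "dbound p n P C"
    and vanish: "\<And>\<theta>. \<theta> \<in> nucC S \<Longrightarrow> P (tensor_power S n \<theta>) = 0" and F: "F \<in> nuc_tensor S n"
  shows "P F = 0"
proof -
  obtain q K where hs: "hs_bound p q K" using hs_bound_exists by blast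
  have pq: "p \<le> q" using hs by (simp add: hs_bound_def)
  define M where "M = tnorm S q n F"
  have M: "0 \<le> M" "tbound q n F M"
    using F by (auto simp: M_def intro: nuc_tensor_tbound tnorm_nonneg nuc_tensor_level)
  have C: "0 \<le> C" using bd by (simp add: dbound_def)
  have small: "cmod (P F) \<le> C * (real n * \<epsilon> * M)" if \<epsilon>: "\<epsilon> > 0" for \<epsilon>
  proof -
    obtain B where B: "finite B" "orthonormal_in S q B" "B \<subseteq> nuc S"
      "\<And>\<theta>. \<theta> \<in> nuc S \<Longrightarrow> lnorm S p (\<theta> - proj q B \<theta>) \<le> \<epsilon> * lnorm S q \<theta>"
      using finite_rank_approximation[OF hs \<epsilon>] by blast
    have pn: "padj q B x \<in> nuc_dual S" for x using padj_dual[OF B(3)] nuc_dualI by blast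
    \<comment> \<open>\<open>F\<close> with all arguments projected. It has finite rank, so
      \<open>P\<close> vanishes on it, and it differs from \<open>F\<close> by a small bound at
      level \<open>p\<close>, where \<open>P\<close> is continuous.\<close>
    define G where "G xs = (if xs \<in> tuples (nuc_dual S) n then F (map (padj q B) xs) else 0)" for xs
    have sF: "sym_multilinear (nuc_dual S) n F" using F by (rule nuc_tensor_symml)
    have padj_lin: "padj q B (\<lambda>\<theta>. a * x \<theta> + b * y \<theta>) = (\<lambda>\<theta>. a * padj q B x \<theta> + b * padj q B y \<theta>)" for a b x y
      by (simp add: padj_def fun_eq_iff sum_distrib_left sum.distrib algebra_simps)
    have padj_idem: "padj q B (padj q B x) = padj q B x" for x
    proof -
      have "padj q B x f = x f" if f: "f \<in> B" for f
      proof -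
        have "padj q B x f = (\<Sum>e\<in>B. if e = f then x e else 0)"
          unfolding padj_def using f B orthonormal_ip[OF B(2) _ f] by (intro sum.cong) (auto simp: riesz_def)
        then show ?thesis using f B by simp
      qed
      then show ?thesis unfolding padj_def[of q B "padj q B x"] by (simp add: padj_def)
    qed
    have "G \<in> tpspan n"
    proof (rule padj_factor_tpspan[OF B(1-3)])
      show "sym_multilinear (nuc_dual S) n G"
      proof (rule symmlI[OF lin_closed_nuc_dual])
        fix xs ys assume *: "xs \<in> tuples (nuc_dual S) n" "mset ys = mset xs"
        then have "ys \<in> tuples (nuc_dual S) n"
          unfolding tuples_def using mset_eq_setD[OF *(2)] mset_eq_length[OF *(2)] by simp
        moreover have "F (map (padj q B) ys) = F (map (padj q B) xs)"
          using * pn by (intro symml_perm[OF sF] map_tuples) auto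
        ultimately show "G ys = G xs" using * by (simp add: G_def)
      next
        fix m xs x y and a b :: real
        assume m: "n = Suc m" "xs \<in> tuples (nuc_dual S) m" "x \<in> nuc_dual S" "y \<in> nuc_dual S"
        have t: "map (padj q B) xs \<in> tuples (nuc_dual S) m" using m(2) pn by (rule map_tuples)
        show "G ((\<lambda>\<theta>. a * x \<theta> + b * y \<theta>) # xs) = of_real a * G (x # xs) + of_real b * G (y # xs)"
          using m symml_head[OF sF[unfolded m(1)] t pn pn] lin_closedD[OF lin_closed_nuc_dual m(3,4)]
          by (simp add: G_def padj_lin)
      qed
      show "G xs = G (map (padj q B) xs)" if "xs \<in> tuples (nuc_dual S) n" for xs
        using that map_tuples[OF that, of "padj q B" "nuc_dual S"] pn by (simp add: G_def padj_idem comp_def)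
    qed (simp add: G_def)
    then have PG: "P G = 0" and Gn: "G \<in> nuc_tensor S n"
      using dlin_vanish_tpspan[OF lin vanish] tpspan_nuc by auto
    have "P (\<lambda>xs. F xs - G xs) = P F" using dlin_diff[OF lin F Gn] PG by simp
    moreover have "tbound p n (\<lambda>xs. F xs - G xs) (real n * \<epsilon> * M)"
    proof (rule tboundI)
      fix xs assume xs: "xs \<in> tuples (dual_level S p) n"
      have "cmod (F xs - F (map (padj q B) xs)) \<le> real n * \<epsilon> * M * (\<Prod>x\<leftarrow>xs. dnorm S p x)"
        using B \<epsilon> M pq xs symml_mono[OF dual_level_subset sF] by (intro tensor_padj_approx) auto
      then show "cmod (F xs - G xs) \<le> real n * \<epsilon> * M * (\<Prod>x\<leftarrow>xs. dnorm S p x)"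
        using dual_tuples_nuc[OF xs] by (simp add: G_def)
    qed
    ultimately show ?thesis
      using dboundD[OF bd nuc_tensor_diff[OF F Gn], of "real n * \<epsilon> * M"] \<epsilon> M by simp
  qed
  have "cmod (P F) \<le> 0"
  proof (rule field_le_epsilon)
    fix e :: real assume e: "e > 0"
    define D where "D = C * real n * M + 1"
    have D: "D > 0" using C M by (simp add: D_def add_nonneg_pos)
    have "cmod (P F) \<le> C * (real n * (e / D) * M)" using e D by (intro small) simp
    also have "\<dots> = (D - 1) * (e / D)" by (simp add: D_def)
    also have "\<dots> \<le> D * (e / D)" using e D by (intro mult_right_mono) auto
    also have "\<dots> = e" using D by simp
    finally show "cmod (P F) \<le> 0 + e" by simp
  qed
  then show ?thesis by simp
qed

lemma dlin_diff_functional: "dlin n P \<Longrightarrow> dlin n Q \<Longrightarrow> dlin n (\<lambda>F. P F - Q F)"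
  unfolding dlin_def by (simp add: algebra_simps)

lemma dbound_diff_functional:
  assumes "dbound p n P C" "dbound p n Q C'"
  shows "dbound p n (\<lambda>F. P F - Q F) (C + C')"
  unfolding dbound_def
proof (intro conjI ballI allI impI)
  show "0 \<le> C + C'" using assms by (simp add: dbound_def)
  fix F M assume "F \<in> nuc_tensor S n" "0 \<le> M" "tbound p n F M"
  then have "cmod (P F) \<le> C * M" "cmod (Q F) \<le> C' * M" using assms dboundD by blast+
  then show "cmod (P F - Q F) \<le> (C + C') * M"
    using norm_triangle_ineq4[of "P F" "Q F"] by (simp add: algebra_simps)
qed

text \<open>The tool by which identities between functionals are reduced to tensor powers. The two
  functionals may be bounded at different levels; their difference is bounded at the larger
  one.\<close>

lemma functional_unique:
  assumes "dlin n P" "dbound p n P C" "dlin n Q" "dbound p' n Q C'"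
    and "\<And>\<theta>. \<theta> \<in> nucC S \<Longrightarrow> P (tensor_power S n \<theta>) = Q (tensor_power S n \<theta>)" "F \<in> nuc_tensor S n"
  shows "P F = Q F"
proof -
  have "dbound (max p p') n (\<lambda>F. P F - Q F) (C + C')"
    using assms by (intro dbound_diff_functional) (auto intro: dbound_mono[rotated])
  then have "P F - Q F = 0"
    using functional_vanishes[OF dlin_diff_functional[OF assms(1,3)]] assms(5,6) by auto
  then show ?thesis by simp
qed

end

section \<open>Series of tensors and convolution operators\<close>

text \<open>The geometric majorant makes the family absolutely summable over all pairs, hence
  summation by rows and summation by diagonals agree.\<close>

lemma double_series_diagonal:
  fixes f :: "nat \<Rightarrow> nat \<Rightarrow> complex"
  assumes bound: "\<And>m l. cmod (f m l) \<le> A * s ^ m * s ^ l" and s: "0 \<le> s" "s < 1"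
  shows "\<And>m. summable (f m)"
    "(\<lambda>n. \<Sum>m\<le>n. f m (n - m)) sums (\<Sum>m. \<Sum>l. f m l)"
    "summable (\<lambda>m. \<Sum>l. f m l)"
proof -
  have geo: "summable (\<lambda>l. s ^ l)" using s by (simp add: summable_geometric)
  have A: "0 \<le> A" using order_trans[OF norm_ge_zero bound[of 0 0]] by simp
  have "(\<lambda>x. norm ((A * s ^ fst x) * s ^ snd x)) summable_on (UNIV \<times> UNIV :: (nat \<times> nat) set)"
    unfolding Infinite_Sum.abs_summable_on_Sigma_iff
  proof (intro conjI ballI)
    fix m :: nat
    show "(\<lambda>y. norm ((A * s ^ fst (m, y)) * s ^ snd (m, y))) summable_on UNIV"
      using s A geo by (auto simp: summable_on_UNIV_nonneg_real_iff intro!: summable_mult)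
  next
    have "infsum (\<lambda>y. norm ((A * s ^ fst (m, y)) * s ^ snd (m, y))) UNIV = A * infsum (\<lambda>y. s ^ y) UNIV * s ^ m" for m :: nat
      using s A by (simp add: infsum_cmult_right' abs_mult)
    then show "(\<lambda>m. norm (infsum (\<lambda>y. norm ((A * s ^ fst (m, y)) * s ^ snd (m, y))) UNIV)) summable_on UNIV"
      using s A geo by (auto simp: summable_on_UNIV_nonneg_real_iff infsum_nonneg intro!: summable_mult)
  qed
  then have "(\<lambda>x. norm (case x of (m, l) \<Rightarrow> f m l)) summable_on (UNIV \<times> UNIV :: (nat \<times> nat) set)"
    by (rule Infinite_Sum.abs_summable_on_comparison_test) (use bound s A in \<open>auto simp: abs_mult\<close>)
  then obtain T where T: "((\<lambda>(m, l). f m l) has_sum T) (UNIV \<times> UNIV)"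
    using abs_summable_summable summable_on_def by blast
  have row: "summable (\<lambda>l. norm (f m l))" for m
    by (rule summable_comparison_test'[OF summable_mult[OF geo, of "A * s ^ m"], of 0]) (simp add: bound)
  show "summable (f m)" for m using row summable_norm_cancel by blast
  have "(f m has_sum (\<Sum>l. f m l)) UNIV" for m
    by (rule norm_summable_imp_has_sum[OF row summable_sums[OF summable_norm_cancel[OF row]]])
  then have rows: "((\<lambda>m. \<Sum>l. f m l) has_sum T) UNIV"
    using has_sum_SigmaD[OF T, of "\<lambda>m. \<Sum>l. f m l"] by simp
  have "bij_betw (\<lambda>(n, m). (m, n - m)) (SIGMA n:UNIV. {..n}) (UNIV \<times> UNIV :: (nat \<times> nat) set)"
    by (rule bij_betwI[where g = "\<lambda>(m, l). (m + l, m)"]) auto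
  from has_sum_reindex_bij_betw[OF this, of "\<lambda>(m, l). f m l" T] T
  have "((\<lambda>(n, m). f m (n - m)) has_sum T) (SIGMA n:UNIV. {..n})"
    by (simp add: case_prod_unfold)
  from has_sum_SigmaD[OF this, of "\<lambda>n. \<Sum>m\<le>n. f m (n - m)"]
  have "((\<lambda>n. \<Sum>m\<le>n. f m (n - m)) has_sum T) UNIV" by (simp add: has_sum_finite)
  then show "(\<lambda>n. \<Sum>m\<le>n. f m (n - m)) sums (\<Sum>m. \<Sum>l. f m l)" "summable (\<lambda>m. \<Sum>l. f m l)"
    using rows has_sum_imp_sums sums_unique sums_summable by metis+
qed

text \<open>For such \<open>R\<close> the weight \<open>2 ^ (n * q)\<close> and the factor
  \<open>K ^ n\<close> of the norm comparison, both entering a sum of squares, leave a geometric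
  series of ratio \<open>1 / 4\<close>.\<close>

lemma small_radius_exists:
  assumes "0 \<le> (K::real)"
  obtains R :: real where "0 < R" "2 ^ q * (K * R)\<^sup>2 \<le> 1 / 4"
proof
  define R where "R = 1 / (2 * 2 ^ q * (K + 1))"
  show R0: "0 < R" using assms by (simp add: R_def)
  show "2 ^ q * (K * R)\<^sup>2 \<le> 1 / 4"
  proof -
    have "K * R \<le> (K + 1) * (1 / (2 * 2 ^ q * (K + 1)))"
      using assms R0 by (intro mult_mono) (auto simp: R_def)
    also have "\<dots> = 1 / (2 * 2 ^ q)" using assms by simp
    finally have "(K * R)\<^sup>2 \<le> (1 / (2 * 2 ^ q))\<^sup>2" using assms R0 by (intro power_mono) auto
    also have "\<dots> = 1 / (4 * 2 ^ q * 2 ^ q)" by (simp add: power2_eq_square)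
    finally have "2 ^ q * (K * R)\<^sup>2 \<le> 2 ^ q * (1 / (4 * 2 ^ q * 2 ^ q))" by (intro mult_left_mono) auto
    also have "\<dots> = 1 / (4 * 2 ^ q)" by simp
    also have "\<dots> \<le> 1 / 4" by (intro divide_left_mono) auto
    finally show ?thesis .
  qed
qed

text \<open>\<open>r * R \<le> 1 / 2\<close> makes the convolution series converge with sum at most
  twice its first bound; \<open>R0\<close> leaves room for a further restriction on the
  radius.\<close>

lemma radius_for: "\<exists>R>0. R \<le> R0 \<and> r * R \<le> 1 / 2" if "0 \<le> (r::real)" "0 < R0" for R0 :: real
proof -
  define R where "R = min R0 (1 / (2 * (r + 1)))"
  have "r * R \<le> (r + 1) * (1 / (2 * (r + 1)))" using that by (intro mult_mono) (auto simp: R_def)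
  also have "\<dots> = 1 / 2" using that by simp
  finally show ?thesis using that by (intro exI[of _ R]) (auto simp: R_def)
qed

context nuclear_scale
begin

subsection \<open>Contraction\<close>

text \<open>For \<open>F\<close> of degree \<open>k + m\<close> and \<open>c\<close> a functional in
  degree \<open>m\<close>, the last \<open>m\<close> arguments are integrated out by
  \<open>c\<close>. The cutoff follows the convention of \<open>nuc_tensor\<close> that tensors
  vanish off the tuples.\<close>

definition contr :: "nat \<Rightarrow> ('h tensor \<Rightarrow> complex) \<Rightarrow> 'h tensor \<Rightarrow> 'h tensor" where
  "contr k c F = (\<lambda>xs. if xs \<in> tuples (nuc_dual S) k then c (\<lambda>ys. F (xs @ ys)) else 0)"

lemma contr_tbound:
  assumes F: "F \<in> nuc_tensor S (k + m)" and c: "dbound p m c C" and M: "tbound p (k + m) F M" "0 \<le> M"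
  shows "tbound p k (contr k c F) (C * M)"
proof (rule tboundI)
  fix xs assume xs: "xs \<in> tuples (dual_level S p) k"
  have "cmod (c (\<lambda>ys. F (xs @ ys))) \<le> C * (M * (\<Prod>x\<leftarrow>xs. dnorm S p x))"
    using F xs M by (intro dboundD[OF c] nuc_tensor_append tbound_append)
      (auto simp: dual_tuples_nuc prod_dnorm_nonneg)
  then show "cmod (contr k c F xs) \<le> C * M * (\<Prod>x\<leftarrow>xs. dnorm S p x)"
    using dual_tuples_nuc[OF xs] by (simp add: contr_def mult.assoc)
qed

lemma contr_nuc:
  assumes F: "F \<in> nuc_tensor S (k + m)" and lin: "dlin m c" and c: "dbound p m c C"
  shows "contr k c F \<in> nuc_tensor S k"
proof (rule nuc_tensorI)
  show "sym_multilinear (nuc_dual S) k (contr k c F)"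
  proof (rule symmlI[OF lin_closed_nuc_dual])
    fix xs ys assume *: "xs \<in> tuples (nuc_dual S) k" "mset ys = mset xs"
    then have ys: "ys \<in> tuples (nuc_dual S) k"
      unfolding tuples_def using mset_eq_setD[OF *(2)] mset_eq_length[OF *(2)] by simp
    \<comment> \<open>\<open>c\<close> acts on whole functions, so equality is required for every
      \<open>zs\<close>; for lists that are not tuples both sides are 0 by convention.\<close>
    have "F (ys @ zs) = F (xs @ zs)" for zs
    proof (cases "zs \<in> tuples (nuc_dual S) m")
      case True
      then show ?thesis
        using * by (intro symml_perm[OF nuc_tensor_symml[OF F]] append_tuples) auto
    next
      case False
      then show ?thesis
        using nuc_tensor_outside[OF F] append_tuples_iff[OF ys] append_tuples_iff[OF *(1)] by metis
    qed
    then show "contr k c F ys = contr k c F xs" using * ys by (simp add: contr_def)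
  next
    fix n xs x y and a b :: real
    assume n: "k = Suc n" and xs: "xs \<in> tuples (nuc_dual S) n" and x: "x \<in> nuc_dual S" and y: "y \<in> nuc_dual S"
    define z where "z = (\<lambda>\<theta>. a * x \<theta> + b * y \<theta>)"
    have z: "z \<in> nuc_dual S" unfolding z_def by (rule lin_closedD[OF lin_closed_nuc_dual x y])
    have t: "u # xs \<in> tuples (nuc_dual S) k" if "u \<in> nuc_dual S" for u using that xs n by simp
    have "(\<lambda>ys. F ((z # xs) @ ys)) = (\<lambda>ys. of_real a * F ((x # xs) @ ys) + of_real b * F ((y # xs) @ ys))"
    proof
      fix ys
      show "F ((z # xs) @ ys) = of_real a * F ((x # xs) @ ys) + of_real b * F ((y # xs) @ ys)"
      proof (cases "ys \<in> tuples (nuc_dual S) m")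
        case True
        have "sym_multilinear (nuc_dual S) (Suc (n + m)) F" using nuc_tensor_symml[OF F] n by simp
        then show ?thesis
          using symml_head[of "nuc_dual S" "n + m" F "xs @ ys" x y a b] x y append_tuples[OF xs True]
          by (simp add: z_def)
      next
        case False
        have "F ((u # xs) @ ys) = 0" if "u \<in> nuc_dual S" for u
          using nuc_tensor_outside[OF F] append_tuples_iff[OF t[OF that], of ys m] False by blast
        then show ?thesis using x y z by simp
      qed
    qed
    then show "contr k c F ((\<lambda>\<theta>. a * x \<theta> + b * y \<theta>) # xs) =
        of_real a * contr k c F (x # xs) + of_real b * contr k c F (y # xs)"
      using t[OF x] t[OF y] t[OF z] dlinD[OF lin nuc_tensor_append[OF F t[OF x]] nuc_tensor_append[OF F t[OF y]]]
      unfolding z_def[symmetric] contr_def by simp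
  qed
  show "\<exists>M. tbound q k (contr k c F) M" for q
  proof -
    \<comment> \<open>\<open>c\<close> is known to be bounded at level \<open>p\<close>, hence above
      it. The bound is obtained at \<open>max p q\<close> and lowered to \<open>q\<close>.\<close>
    have "tbound (max p q) k (contr k c F) (C * tnorm S (max p q) (k + m) F)"
      using F c by (intro contr_tbound[OF F _ nuc_tensor_tbound[OF F]] tnorm_nonneg nuc_tensor_level)
        (auto intro: dbound_mono[rotated])
    moreover have "0 \<le> C * tnorm S (max p q) (k + m) F"
      using F c by (auto simp: dbound_def intro!: mult_nonneg_nonneg tnorm_nonneg nuc_tensor_level)
    ultimately show ?thesis using tbound_mono[of q "max p q"] by auto
  qed
qed (simp add: contr_def)

lemma contr_lincomb:
  assumes "F \<in> nuc_tensor S (k + m)" "G \<in> nuc_tensor S (k + m)" "dlin m c"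
  shows "contr k c (\<lambda>xs. a * F xs + b * G xs) = (\<lambda>xs. a * contr k c F xs + b * contr k c G xs)"
  using assms dlinD[OF assms(3) nuc_tensor_append nuc_tensor_append] by (auto simp: contr_def fun_eq_iff)

text \<open>\<open>F \<mapsto> e (contr k c F)\<close> is the tensor product of the functionals \<open>e\<close> and \<open>c\<close>.\<close>

lemma comp_contr_dlin:
  assumes "dlin k e" "dlin m c" "dbound p m c C"
  shows "dlin (k + m) (\<lambda>F. e (contr k c F))"
  unfolding dlin_def
  using assms contr_lincomb[OF _ _ assms(2)] dlinD[OF assms(1) contr_nuc contr_nuc] by (simp add: dlin_def)

lemma comp_contr_dbound:
  assumes "dbound p k e D" "dlin m c" "dbound p m c C"
  shows "dbound p (k + m) (\<lambda>F. e (contr k c F)) (D * C)"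
  unfolding dbound_def
proof (intro conjI ballI allI impI)
  show "0 \<le> D * C" using assms by (simp add: dbound_def)
  fix F M assume F: "F \<in> nuc_tensor S (k + m)" "0 \<le> M" "tbound p (k + m) F M"
  have "cmod (e (contr k c F)) \<le> D * (C * M)"
    using assms F by (intro dboundD[OF assms(1)] contr_nuc contr_tbound) (auto simp: dbound_def)
  then show "cmod (e (contr k c F)) \<le> D * C * M" by (simp add: mult.assoc)
qed

lemma contr_tensor_power:
  assumes "\<theta> \<in> nucC S" "dlin m c"
  shows "contr k c (tensor_power S (k + m) \<theta>) =
    (\<lambda>xs. c (tensor_power S m \<theta>) * tensor_power S k \<theta> xs)"
proof
  fix xs
  show "contr k c (tensor_power S (k + m) \<theta>) xs = c (tensor_power S m \<theta>) * tensor_power S k \<theta> xs"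
  proof (cases "xs \<in> tuples (nuc_dual S) k")
    case True
    have "(\<lambda>ys. tensor_power S (k + m) \<theta> (xs @ ys)) = (\<lambda>ys. tensor_power S k \<theta> xs * tensor_power S m \<theta> ys)"
    proof
      fix ys
      show "tensor_power S (k + m) \<theta> (xs @ ys) = tensor_power S k \<theta> xs * tensor_power S m \<theta> ys"
        using True append_tuples_iff[OF True, of ys m]
        by (cases "ys \<in> tuples (nuc_dual S) m") (simp_all add: tensor_power_eq tensor_power_outside)
    qed
    then show ?thesis
      using True dlin_scale[OF assms(2) tensor_power_nuc[OF assms(1)]] by (simp add: contr_def mult.commute)
  qed (simp add: contr_def tensor_power_outside)
qed

lemma comp_contr_tensor_power:
  assumes "\<theta> \<in> nucC S" "dlin k e" "dlin m c"
  shows "e (contr k c (tensor_power S (k + m) \<theta>)) = e (tensor_power S k \<theta>) * c (tensor_power S m \<theta>)"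
  using assms by (simp add: contr_tensor_power dlin_scale tensor_power_nuc)

text \<open>On a tensor power both sides are the product of the two values, and tensor powers
  determine a continuous functional. This is the commutativity of the tensor product of functionals
  on symmetric tensors.\<close>

lemma comp_contr_commute:
  assumes "dlin k e" "dbound p k e D" "dlin m c" "dbound p m c C" "F \<in> nuc_tensor S (k + m)"
  shows "e (contr k c F) = c (contr m e F)"
proof (rule functional_unique[where P = "\<lambda>F. e (contr k c F)" and Q = "\<lambda>F. c (contr m e F)"])
  show "dlin (k + m) (\<lambda>F. e (contr k c F))" "dbound p (k + m) (\<lambda>F. e (contr k c F)) (D * C)"
    using assms by (auto intro: comp_contr_dlin comp_contr_dbound)
  show "dlin (k + m) (\<lambda>F. c (contr m e F))" "dbound p (k + m) (\<lambda>F. c (contr m e F)) (C * D)"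
    using assms comp_contr_dlin[of m c k e p D] comp_contr_dbound[of p m c C k e D] by (auto simp: add.commute)
  show "e (contr k c (tensor_power S (k + m) \<theta>)) = c (contr m e (tensor_power S (k + m) \<theta>))"
    if "\<theta> \<in> nucC S" for \<theta>
    using comp_contr_tensor_power[OF that assms(1,3)] comp_contr_tensor_power[OF that assms(3,1)]
    by (simp add: add.commute)
qed (rule assms)

text \<open>The remainder of the series is bounded, in the sense of \<open>tbound\<close>, by the
  tail of \<open>b\<close>, so continuity of \<open>P\<close> carries convergence over. The sum is
  compared with \<open>H\<close> pointwise on tuples of level \<open>p\<close>, which is all that
  \<open>tbound p\<close> sees.\<close>

lemma functional_suminf:
  assumes lin: "dlin n P" and bd: "dbound p n P C" and F: "\<And>l. F l \<in> nuc_tensor S n"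
    and H: "H \<in> nuc_tensor S n"
    and b: "\<And>l. tbound p n (F l) (b l)" "summable b" "\<And>l. 0 \<le> b l"
    and eq: "\<And>xs. xs \<in> tuples (dual_level S p) n \<Longrightarrow> H xs = (\<Sum>l. F l xs)"
  shows "(\<lambda>l. P (F l)) sums P H"
proof -
  define t where "t N = (\<Sum>l. b (l + N))" for N
  have C: "0 \<le> C" using bd by (simp add: dbound_def)
  have t0: "0 \<le> t N" for N
    unfolding t_def using b by (intro suminf_nonneg) (auto simp: summable_iff_shift)
  have tlim: "t \<longlonglongrightarrow> 0"
  proof -
    have "(\<lambda>N. suminf b - (\<Sum>l<N. b l)) \<longlonglongrightarrow> suminf b - suminf b"
      using b(2) by (intro tendsto_intros summable_LIMSEQ)
    moreover have "t N = suminf b - (\<Sum>l<N. b l)" for N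
      unfolding t_def by (rule suminf_minus_initial_segment[OF b(2)])
    ultimately have "(\<lambda>N. t N) \<longlonglongrightarrow> suminf b - suminf b" by (simp only:)
    then show ?thesis by simp
  qed
  have sumF: "(\<lambda>xs. \<Sum>l<N. F l xs) \<in> nuc_tensor S n" for N
    using nuc_tensor_sum[of "{..<N}" F n "\<lambda>_. 1"] F by simp
  have "cmod (P H - (\<Sum>l<N. P (F l))) \<le> C * t N" for N
  proof -
    have "P (\<lambda>xs. \<Sum>l<N. F l xs) = (\<Sum>l<N. P (F l))"
      using dlin_sum[OF lin, of "{..<N}" F "\<lambda>_. 1"] F by simp
    then have "P H - (\<Sum>l<N. P (F l)) = P (\<lambda>xs. H xs - (\<Sum>l<N. F l xs))"
      using dlin_diff[OF lin H sumF] by simp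
    moreover have "tbound p n (\<lambda>xs. H xs - (\<Sum>l<N. F l xs)) (t N)"
    proof (rule tboundI)
      fix xs assume xs: "xs \<in> tuples (dual_level S p) n"
      define X where "X = (\<Prod>x\<leftarrow>xs. dnorm S p x)"
      have le: "cmod (F l xs) \<le> b l * X" for l unfolding X_def by (rule tboundD[OF b(1) xs])
      have sb: "summable (\<lambda>l. b l * X)" using b(2) by (rule summable_mult2)
      have sn: "summable (\<lambda>l. cmod (F l xs))" by (rule summable_comparison_test'[OF sb, of 0]) (simp add: le)
      have "H xs - (\<Sum>l<N. F l xs) = (\<Sum>l. F (l + N) xs)"
        unfolding eq[OF xs] by (rule suminf_minus_initial_segment[symmetric]) (rule summable_norm_cancel[OF sn])
      also have "cmod \<dots> \<le> (\<Sum>l. cmod (F (l + N) xs))"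
        using sn by (intro summable_norm) (simp add: summable_iff_shift[of "\<lambda>l. cmod (F l xs)"])
      also have "\<dots> \<le> (\<Sum>l. b (l + N) * X)"
        using le sn sb by (intro suminf_le)
          (auto simp: summable_iff_shift[of "\<lambda>l. cmod (F l xs)"] summable_iff_shift[of "\<lambda>l. b l * X"])
      also have "\<dots> = t N * X"
        unfolding t_def using b(2) by (intro suminf_mult2[symmetric]) (simp add: summable_iff_shift)
      finally show "cmod (H xs - (\<Sum>l<N. F l xs)) \<le> t N * (\<Prod>x\<leftarrow>xs. dnorm S p x)" by (simp add: X_def)
    qed
    ultimately show ?thesis
      using dboundD[OF bd nuc_tensor_diff[OF H sumF], of N "t N"] t0[of N] by simp
  qed
  then have ev: "\<forall>\<^sub>F N in sequentially. norm (P H - (\<Sum>l<N. P (F l))) \<le> C * t N"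
    by (intro always_eventually allI)
  have "(\<lambda>N. C * t N) \<longlonglongrightarrow> 0" using tlim by (intro tendsto_mult_right_zero)
  with ev have "(\<lambda>N. P H - (\<Sum>l<N. P (F l))) \<longlonglongrightarrow> 0"
    by (rule Lim_null_comparison)
  from tendsto_diff[OF tendsto_const[of "P H"] this] show ?thesis by (simp add: sums_def)
qed

subsection \<open>Rapidly decreasing series\<close>

text \<open>The size of the homogeneous parts of a function with growth
  \<open>A * exp (R * |z|)\<close> on the dual level \<open>p\<close>. Every operator of the proof
  is estimated by its effect on the pair \<open>(R, A)\<close>.\<close>

definition tsb :: "nat \<Rightarrow> real \<Rightarrow> real \<Rightarrow> (nat \<Rightarrow> 'h tensor) \<Rightarrow> bool" where
  "tsb p R A \<phi> \<longleftrightarrow> 0 \<le> A \<and> (\<forall>n. tbound p n (\<phi> n) (A * R ^ n / fact n))"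

lemma tsbD: "tsb p R A \<phi> \<Longrightarrow> tbound p n (\<phi> n) (A * R ^ n / fact n)"
  by (simp add: tsb_def)

lemma tsb_nonneg: "tsb p R A \<phi> \<Longrightarrow> 0 \<le> A"
  by (simp add: tsb_def)

lemma tsb_radius_mono:
  assumes "tsb p R A \<phi>" "0 \<le> R" "R \<le> R'"
  shows "tsb p R' A \<phi>"
  unfolding tsb_def
proof (intro conjI allI)
  show "0 \<le> A" using assms tsb_nonneg by blast
  fix n
  show "tbound p n (\<phi> n) (A * R' ^ n / fact n)"
    using assms by (intro tbound_weaken[OF tsbD[OF assms(1)]] divide_right_mono mult_left_mono power_mono)
      (auto simp: tsb_nonneg)
qed

lemma test_series_nuc: "\<phi> \<in> test_series S \<Longrightarrow> \<phi> n \<in> nuc_tensor S n"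
  by (simp add: test_series_def)

text \<open>A single term of the sum of squares does not exceed the whole sum. The weight index is
  \<open>2 * j\<close> so that its square root is an integral power of 2 in each degree.\<close>

lemma test_norm_tsb:
  assumes \<phi>: "\<phi> \<in> test_series S"
  shows "tsb p (1 / 2 ^ j) (test_norm S (p, 2 * j) \<phi>) \<phi>"
  unfolding tsb_def
proof (intro conjI allI)
  define N where "N = test_norm S (p, 2 * j) \<phi>"
  have summ: "summable (\<lambda>n. (fact n)\<^sup>2 * 2 ^ (n * (2 * j)) * (tnorm S p n (\<phi> n))\<^sup>2)"
    using \<phi> by (auto simp: test_series_def test_level_def)
  have N2: "N\<^sup>2 = (\<Sum>n. (fact n)\<^sup>2 * 2 ^ (n * (2 * j)) * (tnorm S p n (\<phi> n))\<^sup>2)"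
    unfolding N_def test_norm_def using summ by (simp add: suminf_nonneg)
  show N0: "0 \<le> test_norm S (p, 2 * j) \<phi>"
    unfolding test_norm_def using summ by (simp add: suminf_nonneg)
  fix n
  have t: "0 \<le> tnorm S p n (\<phi> n)" using \<phi> by (intro tnorm_nonneg nuc_tensor_level test_series_nuc)
  have "(fact n)\<^sup>2 * 2 ^ (n * (2 * j)) * (tnorm S p n (\<phi> n))\<^sup>2 \<le> N\<^sup>2"
    unfolding N2 using sum_le_suminf[OF summ, of "{n}"] by simp
  then have "(fact n * 2 ^ (n * j) * tnorm S p n (\<phi> n))\<^sup>2 \<le> N\<^sup>2"
    by (simp add: power_mult_distrib power_mult[symmetric] mult_ac)
  then have "fact n * 2 ^ (n * j) * tnorm S p n (\<phi> n) \<le> N"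
    by (rule power2_le_imp_le) (use N0 in \<open>simp add: N_def\<close>)
  then have "tnorm S p n (\<phi> n) \<le> N * (1 / 2 ^ j) ^ n / fact n"
    by (simp add: field_simps power_one_over flip: power_mult)
  then show "tbound p n (\<phi> n) (test_norm S (p, 2 * j) \<phi> * (1 / 2 ^ j) ^ n / fact n)"
    unfolding N_def using \<phi> by (intro tbound_weaken[OF nuc_tensor_tbound] test_series_nuc)
qed

lemma test_series_tsb:
  assumes \<phi>: "\<phi> \<in> test_series S" and "R > 0"
  obtains A where "tsb p R A \<phi>"
proof -
  obtain j where "(1 / 2) ^ j < R" using real_arch_pow_inv[OF \<open>R > 0\<close>, of "1/2"] by auto
  then have "1 / 2 ^ j \<le> R" by (simp add: power_one_over)
  then show ?thesis using that tsb_radius_mono[OF test_norm_tsb[OF \<phi>]] by auto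
qed

text \<open>The converse of \<open>test_norm_tsb\<close> with loss of a level. The terms are
  dominated by \<open>A^2 (1/4)^n\<close>, whose sum \<open>(4/3) A^2\<close> is at most
  \<open>(2 * A)\<^sup>2\<close>.\<close>

lemma test_norm_le:
  assumes hs: "hs_bound p p' K" and \<phi>: "tsb p' R A \<phi>" and R: "0 \<le> R" "2 ^ q * (K * R)\<^sup>2 \<le> 1 / 4"
    and nn: "\<And>n. 0 \<le> tnorm S p n (\<phi> n)"
  shows "summable (\<lambda>n. (fact n)\<^sup>2 * 2 ^ (n * q) * (tnorm S p n (\<phi> n))\<^sup>2)" "test_norm S (p, q) \<phi> \<le> 2 * A"
proof -
  have A: "0 \<le> A" using \<phi> by (rule tsb_nonneg)
  have le: "(fact n)\<^sup>2 * 2 ^ (n * q) * (tnorm S p n (\<phi> n))\<^sup>2 \<le> A\<^sup>2 * (1 / 4) ^ n" for n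
  proof -
    have "tnorm S p n (\<phi> n) \<le> K ^ n * (A * R ^ n / fact n)"
      using A R by (intro tnorm_le[OF hs tsbD[OF \<phi>]]) auto
    then have "(tnorm S p n (\<phi> n))\<^sup>2 \<le> (K ^ n * (A * R ^ n / fact n))\<^sup>2" using nn by (intro power_mono)
    then have "(fact n)\<^sup>2 * 2 ^ (n * q) * (tnorm S p n (\<phi> n))\<^sup>2 \<le>
        (fact n)\<^sup>2 * 2 ^ (n * q) * (K ^ n * (A * R ^ n / fact n))\<^sup>2" by (intro mult_left_mono) auto
    also have "\<dots> = A\<^sup>2 * (2 ^ q * (K * R)\<^sup>2) ^ n"
    proof -
      have "(2::real) ^ (n * q) = (2 ^ q) ^ n" by (simp add: mult.commute flip: power_mult)
      moreover have "(K ^ n * (A * R ^ n / fact n))\<^sup>2 = A\<^sup>2 * ((K * R)\<^sup>2) ^ n / (fact n)\<^sup>2"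
        by (simp add: power_mult_distrib power_divide mult_ac flip: power_mult)
      ultimately show ?thesis by (simp add: power_mult_distrib)
    qed
    also have "\<dots> \<le> A\<^sup>2 * (1 / 4) ^ n" using R by (intro mult_left_mono power_mono) auto
    finally show ?thesis .
  qed
  have geo: "summable (\<lambda>n. A\<^sup>2 * (1 / 4) ^ n)" by (intro summable_mult summable_geometric) auto
  show summ: "summable (\<lambda>n. (fact n)\<^sup>2 * 2 ^ (n * q) * (tnorm S p n (\<phi> n))\<^sup>2)"
    using le by (intro summable_comparison_test'[OF geo, of 0]) auto
  have "(\<Sum>n. (fact n)\<^sup>2 * 2 ^ (n * q) * (tnorm S p n (\<phi> n))\<^sup>2) \<le> (\<Sum>n. A\<^sup>2 * (1 / 4) ^ n)"
    using le summ geo by (rule suminf_le)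
  also have "\<dots> = A\<^sup>2 * (4 / 3)" by (subst suminf_mult) (auto simp: suminf_geometric summable_geometric)
  also have "\<dots> \<le> (2 * A)\<^sup>2" by (simp add: power_mult_distrib)
  finally show "test_norm S (p, q) \<phi> \<le> 2 * A"
    unfolding test_norm_def using A by (simp add: real_le_lsqrt)
qed

text \<open>Arbitrarily small radii suffice, as an estimate for a small radius implies it for larger
  ones. This form fits operators that act only on radii below a threshold of their own.\<close>

lemma test_seriesI:
  assumes n: "\<And>n. \<phi> n \<in> nuc_tensor S n" and b: "\<And>p R0. R0 > 0 \<Longrightarrow> \<exists>R A. 0 < R \<and> R \<le> R0 \<and> tsb p R A \<phi>"
  shows "\<phi> \<in> test_series S"
proof -
  have "\<phi> \<in> test_level S p q" for p q
  proof -
    obtain p' K where hs: "hs_bound p p' K" using hs_bound_exists by blast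
    then have "0 \<le> K" by (simp add: hs_bound_def)
    obtain R0 :: real where R0: "0 < R0" "2 ^ q * (K * R0)\<^sup>2 \<le> 1 / 4"
      using small_radius_exists[OF \<open>0 \<le> K\<close>, of q] by blast
    obtain R A where R: "0 < R" "R \<le> R0" "tsb p' R A \<phi>" using b[OF R0(1)] by blast
    have "tsb p' R0 A \<phi>" using tsb_radius_mono[OF R(3)] R by simp
    from test_norm_le(1)[OF hs this _ R0(2)]
    show ?thesis using R0 n by (auto simp: test_level_def intro: nuc_tensor_level tnorm_nonneg)
  qed
  then show ?thesis using n by (auto simp: test_series_def)
qed

subsection \<open>Operators induced by sequences of functionals\<close>

text \<open>One level serves all degrees. The growth \<open>r ^ m * fact m\<close> means that the
  generating series with terms \<open>c m (\<theta>^m) / fact m\<close> converges near 0 and no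
  more, as for a Laplace transform holomorphic at 0.\<close>

definition functional_seq :: "nat \<Rightarrow> real \<Rightarrow> real \<Rightarrow> (nat \<Rightarrow> 'h tensor \<Rightarrow> complex) \<Rightarrow> bool" where
  "functional_seq p K r c \<longleftrightarrow> 0 \<le> K \<and> 0 \<le> r \<and>
     (\<forall>m. dlin m (c m) \<and> dbound p m (c m) (K * r ^ m * fact m))"

text \<open>If \<open>c\<close> consists of the moments of \<mu>, these are formally the
  coefficients of the average of \<open>\<phi> (x + y)\<close> over \<open>y\<close> with respect to
  \<mu>, by the binomial formula. The inverse sequence undoes this averaging.\<close>

definition conv_op :: "(nat \<Rightarrow> 'h tensor \<Rightarrow> complex) \<Rightarrow> (nat \<Rightarrow> 'h tensor) \<Rightarrow> nat \<Rightarrow> 'h tensor" where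
  "conv_op c \<phi> k = (\<lambda>xs. \<Sum>m. of_nat ((k + m) choose k) * contr k (c m) (\<phi> (k + m)) xs)"

lemma functional_seq_dlin: "functional_seq p K r c \<Longrightarrow> dlin m (c m)"
  by (simp add: functional_seq_def)

lemma functional_seq_dbound:
  "functional_seq p0 K r c \<Longrightarrow> p0 \<le> p \<Longrightarrow> dbound p m (c m) (K * r ^ m * fact m)"
  unfolding functional_seq_def using dbound_mono by blast

lemma functional_seq_contr_nuc:
  "functional_seq p0 K r c \<Longrightarrow> F \<in> nuc_tensor S (k + m) \<Longrightarrow> contr k (c m) F \<in> nuc_tensor S k"
  using contr_nuc functional_seq_dlin functional_seq_dbound by blast

text \<open>The binomial coefficient, the \<open>fact m\<close> of the functional and the
  \<open>1 / fact (k + m)\<close> of the tensor combine to \<open>1 / fact k\<close>: the factorial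
  decay required in degree \<open>k\<close> is reproduced exactly.\<close>

lemma conv_term_tbound:
  assumes c: "functional_seq p0 K r c" "p0 \<le> p" and F: "F \<in> nuc_tensor S (k + m)"
    and M: "tbound p (k + m) F (B / fact (k + m))" "0 \<le> B"
  shows "tbound p k (\<lambda>xs. of_nat ((k + m) choose k) * contr k (c m) F xs) (K * r ^ m * B / fact k)"
proof -
  have "tbound p k (contr k (c m) F) (K * r ^ m * fact m * (B / fact (k + m)))"
    using M by (intro contr_tbound[OF F functional_seq_dbound[OF c]]) auto
  from tbound_lincomb[OF this this, of "of_nat ((k + m) choose k)" 0]
  have *: "tbound p k (\<lambda>xs. of_nat ((k + m) choose k) * contr k (c m) F xs)
      (real ((k + m) choose k) * (K * r ^ m * fact m * (B / fact (k + m))))" by simp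
  have "real ((k + m) choose k) = fact (k + m) / (fact k * fact m)"
    by (simp add: binomial_fact)
  then have "real ((k + m) choose k) * (K * r ^ m * fact m * (B / fact (k + m))) = K * r ^ m * B / fact k"
    by (simp add: field_simps)
  with * show ?thesis by simp
qed

lemma conv_op_term_bound:
  assumes c: "functional_seq p0 K r c" "p0 \<le> p" and \<phi>: "\<phi> \<in> test_series S" "tsb p R A \<phi>" and R: "0 \<le> R"
  shows "tbound p k (\<lambda>xs. of_nat ((k + m) choose k) * contr k (c m) (\<phi> (k + m)) xs)
    (K * A * R ^ k / fact k * (r * R) ^ m)"
proof -
  have "tbound p k (\<lambda>xs. of_nat ((k + m) choose k) * contr k (c m) (\<phi> (k + m)) xs)
    (K * r ^ m * (A * R ^ (k + m)) / fact k)"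
    using \<phi> R by (intro conv_term_tbound[OF c] test_series_nuc) (auto simp: tsb_def)
  then show ?thesis by (simp add: power_add power_mult_distrib mult_ac)
qed

lemma conv_op_summable:
  assumes c: "functional_seq p0 K r c" and \<phi>: "\<phi> \<in> test_series S"
  shows "summable (\<lambda>m. of_nat ((k + m) choose k) * contr k (c m) (\<phi> (k + m)) xs)"
proof (cases "xs \<in> tuples (nuc_dual S) k")
  case True
  obtain p where p: "p0 \<le> p" "xs \<in> tuples (dual_level S p) k" using nuc_dual_tuplesE[OF True] by blast
  have "0 \<le> r" using c by (simp add: functional_seq_def)
  then obtain R where R: "R > 0" "r * R \<le> 1 / 2" using radius_for[of r 1] by auto
  obtain A where A: "tsb p R A \<phi>" using test_series_tsb[OF \<phi> R(1)] by blast
  show ?thesis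
  proof (rule summable_comparison_test')
    show "summable (\<lambda>m. K * A * R ^ k / fact k * (\<Prod>x\<leftarrow>xs. dnorm S p x) * (r * R) ^ m)"
      using R \<open>0 \<le> r\<close> by (intro summable_mult summable_geometric) auto
    show "norm (of_nat ((k + m) choose k) * contr k (c m) (\<phi> (k + m)) xs) \<le>
        K * A * R ^ k / fact k * (\<Prod>x\<leftarrow>xs. dnorm S p x) * (r * R) ^ m" if "m \<ge> 0" for m
      using tboundD[OF conv_op_term_bound[OF c p(1) \<phi> A] p(2), of m] R by (simp add: mult_ac)
  qed
qed (simp add: contr_def)

text \<open>The radius is preserved; the series over the contracted degree \<open>m\<close> has
  ratio at most \<open>1 / 2\<close> and contributes the factor 2.\<close>

lemma conv_op_tsb:
  assumes c: "functional_seq p0 K r c" "p0 \<le> p" and \<phi>: "\<phi> \<in> test_series S" "tsb p R A \<phi>"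
    and R: "0 \<le> R" "r * R \<le> 1 / 2"
  shows "tsb p R (2 * K * A) (conv_op c \<phi>)"
  unfolding tsb_def
proof (intro conjI allI tboundI)
  have K: "0 \<le> K" "0 \<le> r" using c by (auto simp: functional_seq_def)
  have A: "0 \<le> A" using \<phi> tsb_nonneg by blast
  show "0 \<le> 2 * K * A" using K A by simp
  fix k xs assume xs: "xs \<in> tuples (dual_level S p) k"
  define X where "X = (\<Prod>x\<leftarrow>xs. dnorm S p x)"
  have X: "0 \<le> X" unfolding X_def using xs by (rule prod_dnorm_nonneg)
  define f where "f m = of_nat ((k + m) choose k) * contr k (c m) (\<phi> (k + m)) xs" for m
  define B where "B = K * A * R ^ k / fact k * X"
  have B: "0 \<le> B" using K A R X by (simp add: B_def)
  have le: "cmod (f m) \<le> B * (1 / 2) ^ m" for m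
  proof -
    have "cmod (f m) \<le> B * (r * R) ^ m"
      unfolding f_def B_def X_def using tboundD[OF conv_op_term_bound[OF c \<phi> R(1)] xs, of m] by (simp add: mult_ac)
    also have "\<dots> \<le> B * (1 / 2) ^ m" using B R K by (intro mult_left_mono power_mono) auto
    finally show ?thesis .
  qed
  have geo: "summable (\<lambda>m. B * (1 / 2) ^ m)" by (intro summable_mult summable_geometric) auto
  have sn: "summable (\<lambda>m. cmod (f m))" using le by (intro summable_comparison_test'[OF geo, of 0]) auto
  have "cmod (conv_op c \<phi> k xs) \<le> (\<Sum>m. cmod (f m))"
    unfolding conv_op_def f_def[symmetric] by (rule summable_norm[OF sn])
  also have "\<dots> \<le> (\<Sum>m. B * (1 / 2) ^ m)" by (rule suminf_le[OF le sn geo])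
  also have "\<dots> = 2 * B" by (subst suminf_mult) (auto simp: suminf_geometric summable_geometric)
  finally show "cmod (conv_op c \<phi> k xs) \<le> 2 * K * A * R ^ k / fact k * (\<Prod>x\<leftarrow>xs. dnorm S p x)"
    by (simp add: B_def X_def mult_ac)
qed

lemma conv_op_tsb_exists:
  assumes c: "functional_seq p0 K r c" and \<phi>: "\<phi> \<in> test_series S" and "0 < R0"
  shows "\<exists>R A. 0 < R \<and> R \<le> R0 \<and> tsb p R A (conv_op c \<phi>)"
proof -
  define q where "q = max p p0"
  have "0 \<le> r" using c by (simp add: functional_seq_def)
  then obtain R where R: "R > 0" "R \<le> R0" "r * R \<le> 1 / 2" using radius_for \<open>0 < R0\<close> by blast
  obtain A where A: "tsb q R A \<phi>" using test_series_tsb[OF \<phi> R(1)] by blast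
  have "tsb q R (2 * K * A) (conv_op c \<phi>)" using R by (intro conv_op_tsb[OF c _ \<phi> A]) (auto simp: q_def)
  then have "tsb p R (2 * K * A) (conv_op c \<phi>)"
    unfolding tsb_def using R by (auto simp: q_def intro: tbound_mono[of p "max p p0"])
  then show ?thesis using R by blast
qed

lemma conv_op_nuc:
  assumes c: "functional_seq p0 K r c" and \<phi>: "\<phi> \<in> test_series S"
  shows "conv_op c \<phi> k \<in> nuc_tensor S k"
proof (rule nuc_tensorI)
  have tn: "contr k (c m) (\<phi> (k + m)) \<in> nuc_tensor S k" for m
    using functional_seq_contr_nuc[OF c test_series_nuc[OF \<phi>]] .
  note summ = conv_op_summable[OF c \<phi>, of k]
  show "sym_multilinear (nuc_dual S) k (conv_op c \<phi> k)"
  proof (rule symmlI[OF lin_closed_nuc_dual])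
    fix xs ys assume *: "xs \<in> tuples (nuc_dual S) k" "mset ys = mset xs"
    show "conv_op c \<phi> k ys = conv_op c \<phi> k xs"
      unfolding conv_op_def using symml_perm[OF nuc_tensor_symml[OF tn] *] by simp
  next
    fix n xs x y and a b :: real
    assume n: "k = Suc n" and xs: "xs \<in> tuples (nuc_dual S) n" and x: "x \<in> nuc_dual S" and y: "y \<in> nuc_dual S"
    have head: "contr k (c m) (\<phi> (k + m)) ((\<lambda>\<theta>. a * x \<theta> + b * y \<theta>) # xs) =
        of_real a * contr k (c m) (\<phi> (k + m)) (x # xs) + of_real b * contr k (c m) (\<phi> (k + m)) (y # xs)" for m
      using nuc_tensor_symml[OF tn] n xs x y by (intro symml_head) auto
    have sums: "(\<lambda>m. of_real a * (of_nat ((k + m) choose k) * contr k (c m) (\<phi> (k + m)) (x # xs))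
          + of_real b * (of_nat ((k + m) choose k) * contr k (c m) (\<phi> (k + m)) (y # xs))) sums
        (of_real a * conv_op c \<phi> k (x # xs) + of_real b * conv_op c \<phi> k (y # xs))"
      unfolding conv_op_def using summ by (intro sums_add sums_mult summable_sums)
    have "conv_op c \<phi> k ((\<lambda>\<theta>. a * x \<theta> + b * y \<theta>) # xs) =
       (\<Sum>m. of_real a * (of_nat ((k + m) choose k) * contr k (c m) (\<phi> (k + m)) (x # xs))
          + of_real b * (of_nat ((k + m) choose k) * contr k (c m) (\<phi> (k + m)) (y # xs)))"
      unfolding conv_op_def head by (intro suminf_cong) (simp add: algebra_simps)
    also have "\<dots> = of_real a * conv_op c \<phi> k (x # xs) + of_real b * conv_op c \<phi> k (y # xs)"
      by (rule sums_unique[OF sums, symmetric])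
    finally show "conv_op c \<phi> k ((\<lambda>\<theta>. a * x \<theta> + b * y \<theta>) # xs) =
        of_real a * conv_op c \<phi> k (x # xs) + of_real b * conv_op c \<phi> k (y # xs)" .
  qed
  show "\<exists>M. tbound p k (conv_op c \<phi> k) M" for p
    using conv_op_tsb_exists[OF c \<phi>, of 1 p] tsbD by fastforce
  show "conv_op c \<phi> k xs = 0" if "xs \<notin> tuples (nuc_dual S) k" for xs
    using that by (simp add: conv_op_def contr_def)
qed

lemma conv_op_test_series:
  assumes "functional_seq p0 K r c" "\<phi> \<in> test_series S"
  shows "conv_op c \<phi> \<in> test_series S"
  by (rule test_seriesI[OF conv_op_nuc[OF assms] conv_op_tsb_exists[OF assms]])

lemma test_series_diff:
  assumes "\<phi> \<in> test_series S" "\<psi> \<in> test_series S"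
  shows "\<phi> - \<psi> \<in> test_series S"
proof (rule test_seriesI)
  show "(\<phi> - \<psi>) n \<in> nuc_tensor S n" for n
    using nuc_tensor_diff assms test_series_nuc by (simp add: fun_diff_def)
  fix p and R0 :: real assume R0: "R0 > 0"
  obtain A B where "tsb p R0 A \<phi>" "tsb p R0 B \<psi>" using test_series_tsb assms R0 by metis
  then have "tsb p R0 (A + B) (\<phi> - \<psi>)"
    unfolding tsb_def using tbound_lincomb[of p _ _ _ _ _ 1 "-1"]
    by (fastforce simp: fun_diff_def add_divide_distrib algebra_simps)
  then show "\<exists>R A. 0 < R \<and> R \<le> R0 \<and> tsb p R A (\<phi> - \<psi>)" using R0 by blast
qed

lemma conv_op_diff:
  assumes c: "functional_seq p0 K r c" and \<phi>: "\<phi> \<in> test_series S" and \<psi>: "\<psi> \<in> test_series S"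
  shows "conv_op c (\<phi> - \<psi>) = conv_op c \<phi> - conv_op c \<psi>"
proof (intro ext)
  fix k xs
  have "contr k (c m) ((\<phi> - \<psi>) (k + m)) xs = contr k (c m) (\<phi> (k + m)) xs - contr k (c m) (\<psi> (k + m)) xs" for m
    using contr_lincomb[OF test_series_nuc[OF \<phi>] test_series_nuc[OF \<psi>] functional_seq_dlin[OF c], of k m 1 "-1"]
    by (simp add: fun_diff_def fun_eq_iff)
  then have "conv_op c (\<phi> - \<psi>) k xs = (\<Sum>m. of_nat ((k + m) choose k) * contr k (c m) (\<phi> (k + m)) xs
      - of_nat ((k + m) choose k) * contr k (c m) (\<psi> (k + m)) xs)"
    by (simp add: conv_op_def right_diff_distrib del: fun_diff_def minus_apply)
  also have "\<dots> = conv_op c \<phi> k xs - conv_op c \<psi> k xs"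
    unfolding conv_op_def using conv_op_summable[OF c] \<phi> \<psi> by (intro suminf_diff[symmetric])
  finally show "conv_op c (\<phi> - \<psi>) k xs = (conv_op c \<phi> - conv_op c \<psi>) k xs" by simp
qed

text \<open>The composition is a double series in the degrees \<open>m\<close> and \<open>l\<close>
  contracted by \<open>c\<close> and \<open>c'\<close>. Regrouped by \<open>n = m + l\<close>, each
  diagonal is the identity \<open>inv\<close> applied to the component of degree
  \<open>k + n\<close> with its first \<open>k\<close> arguments frozen, so only
  \<open>n = 0\<close> survives.\<close>

lemma conv_op_inverse:
  assumes c: "functional_seq p0 K r c" and d: "functional_seq p0 K' r c'"
    and inv: "\<And>n F. F \<in> nuc_tensor S n \<Longrightarrow>
      (\<Sum>m\<le>n. of_nat (n choose m) * c m (contr m (c' (n - m)) F)) = (if n = 0 then F [] else 0)"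
    and \<phi>: "\<phi> \<in> test_series S"
  shows "conv_op c (conv_op c' \<phi>) = \<phi>"
proof (intro ext)
  fix k xs
  show "conv_op c (conv_op c' \<phi>) k xs = \<phi> k xs"
  proof (cases "xs \<in> tuples (nuc_dual S) k")
    case False
    then show ?thesis
      using nuc_tensor_outside[OF conv_op_nuc[OF c conv_op_test_series[OF d \<phi>]]]
        nuc_tensor_outside[OF test_series_nuc[OF \<phi>]] by simp
  next
    case xs: True
    obtain p where p: "p0 \<le> p" "xs \<in> tuples (dual_level S p) k" using nuc_dual_tuplesE[OF xs] by blast
    have K: "0 \<le> r" "0 \<le> K" "0 \<le> K'" using c d by (auto simp: functional_seq_def)
    then obtain R where R: "R > 0" "r * R \<le> 1 / 2" using radius_for[of r 1] by auto
    obtain A where A: "tsb p R A \<phi>" using test_series_tsb[OF \<phi> R(1)] by blast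
    have A0: "0 \<le> A" using A tsb_nonneg by blast
    define X where "X = (\<Prod>x\<leftarrow>xs. dnorm S p x)"
    have X: "0 \<le> X" unfolding X_def using p(2) by (rule prod_dnorm_nonneg)
    \<comment> \<open>The component of degree \<open>k + n\<close> with the arguments
      \<open>xs\<close> frozen, to which the identity \<open>inv\<close> in degree \<open>n\<close>
      will be applied.\<close>
    define G where "G n = (\<lambda>ys. \<phi> (k + n) (xs @ ys))" for n
    have Gn: "G n \<in> nuc_tensor S n" for n
      unfolding G_def by (rule nuc_tensor_append[OF test_series_nuc[OF \<phi>] xs])
    define b where "b m l = (of_nat ((k + m + l) choose (k + m)) :: complex)" for m l
    define Q where "Q m l = contr m (c' l) (G (m + l))" for m l
    have Qn: "Q m l \<in> nuc_tensor S m" for m l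
      unfolding Q_def by (rule functional_seq_contr_nuc[OF d Gn])
    define \<beta> where "\<beta> m l = K' * A * X * R ^ (k + m) / fact (k + m) * (r * R) ^ l" for m l
    have \<beta>0: "0 \<le> \<beta> m l" for m l using K A0 X R by (simp add: \<beta>_def)
    have Qb: "tbound p m (\<lambda>ys. b m l * Q m l ys) (\<beta> m l)" for m l
    proof (rule tboundI)
      fix ys assume ys: "ys \<in> tuples (dual_level S p) m"
      have "xs @ ys \<in> tuples (dual_level S p) (k + m)" using p(2) ys by (rule append_tuples)
      from tboundD[OF conv_op_term_bound[OF d p(1) \<phi> A, of "k + m" l] this] R
      have "cmod (of_nat ((k + m + l) choose (k + m)) * contr (k + m) (c' l) (\<phi> (k + m + l)) (xs @ ys))
          \<le> \<beta> m l * (\<Prod>x\<leftarrow>ys. dnorm S p x)"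
        by (simp add: \<beta>_def X_def mult_ac)
      moreover have "contr (k + m) (c' l) (\<phi> (k + m + l)) (xs @ ys) = Q m l ys"
        using dual_tuples_nuc[OF ys] append_tuples_iff[OF xs, of ys m]
        by (simp add: contr_def Q_def G_def add.assoc)
      ultimately show "cmod (b m l * Q m l ys) \<le> \<beta> m l * (\<Prod>x\<leftarrow>ys. dnorm S p x)" by (simp add: b_def)
    qed
    have bQn: "(\<lambda>ys. b m l * Q m l ys) \<in> nuc_tensor S m" for m l
      using nuc_tensor_lincomb[OF Qn[of m l] Qn[of m l], of "b m l" 0] by simp
    define H where "H m = (\<lambda>ys. conv_op c' \<phi> (k + m) (xs @ ys))" for m
    have Hn: "H m \<in> nuc_tensor S m" for m
      unfolding H_def using xs conv_op_nuc[OF d \<phi>] by (intro nuc_tensor_append)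
    have Heq: "H m ys = (\<Sum>l. b m l * Q m l ys)" if "ys \<in> tuples (dual_level S p) m" for m ys
      using dual_tuples_nuc[OF that] append_tuples_iff[OF xs, of ys m]
      by (simp add: H_def conv_op_def contr_def Q_def G_def b_def add.assoc)
    \<comment> \<open>Continuity of \<open>c m\<close> moves it inside the series that defines the
      inner convolution.\<close>
    have cH: "(\<lambda>l. c m (\<lambda>ys. b m l * Q m l ys)) sums c m (H m)" for m
    proof (rule functional_suminf[OF functional_seq_dlin[OF c] functional_seq_dbound[OF c p(1)] bQn Hn Qb])
      show "summable (\<beta> m)"
        unfolding \<beta>_def using R K by (intro summable_mult summable_geometric) auto
    qed (use \<beta>0 Heq in auto)
    define f where "f m l = of_nat ((k + m) choose k) * b m l * c m (Q m l)" for m l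
    have fs: "f m l = of_nat ((k + m) choose k) * c m (\<lambda>ys. b m l * Q m l ys)" for m l
      using dlin_scale[OF functional_seq_dlin[OF c] Qn] by (simp add: f_def mult.assoc)
    have fb: "cmod (f m l) \<le> K * K' * A * X * R ^ k / fact k * (1 / 2) ^ m * (1 / 2) ^ l" for m l
    proof -
      have "cmod (c m (\<lambda>ys. b m l * Q m l ys)) \<le> K * r ^ m * fact m * \<beta> m l"
        by (rule dboundD[OF functional_seq_dbound[OF c p(1)] bQn Qb \<beta>0])
      then have "cmod (f m l) \<le> real ((k + m) choose k) * (K * r ^ m * fact m * \<beta> m l)"
        unfolding fs norm_mult by (intro mult_mono) auto
      also have "\<dots> = K * K' * A * X * R ^ k / fact k * (r * R) ^ m * (r * R) ^ l"
        by (simp add: \<beta>_def binomial_fact power_add power_mult_distrib field_simps)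
      also have "\<dots> \<le> K * K' * A * X * R ^ k / fact k * (1 / 2) ^ m * (1 / 2) ^ l"
        using R K A0 X by (intro mult_mono power_mono mult_left_mono) auto
      finally show ?thesis .
    qed
    have row: "(\<Sum>l. f m l) = of_nat ((k + m) choose k) * c m (H m)" for m
      using sums_unique[OF sums_mult[OF cH[of m], of "of_nat ((k + m) choose k)"]] unfolding fs by simp
    have "(\<Sum>m\<le>n. f m (n - m)) = (if n = 0 then \<phi> k xs else 0)" for n
    proof -
      have "(\<Sum>m\<le>n. f m (n - m)) = of_nat ((k + n) choose k) *
          (\<Sum>m\<le>n. of_nat (n choose m) * c m (contr m (c' (n - m)) (G n)))"
        unfolding sum_distrib_left
      proof (rule sum.cong)
        fix m assume m: "m \<in> {..n}"
        \<comment> \<open>Trinomial revision: the product of the two binomial coefficients becomes a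
          factor independent of \<open>m\<close> times the coefficient that occurs in
          \<open>inv\<close>.\<close>
        have "((k + n) choose (k + m)) * ((k + m) choose k) = ((k + n) choose k) * (n choose m)"
          using choose_mult[of k "k + m" "k + n"] m by simp
        then have "of_nat ((k + m) choose k) * b m (n - m) = of_nat ((k + n) choose k) * (of_nat (n choose m) :: complex)"
          using m by (simp add: b_def add.assoc mult.commute flip: of_nat_mult)
        then show "f m (n - m) = of_nat ((k + n) choose k) * (of_nat (n choose m) * c m (contr m (c' (n - m)) (G n)))"
          using m by (simp add: f_def Q_def)
      qed simp
      also have "\<dots> = of_nat ((k + n) choose k) * (if n = 0 then G n [] else 0)" by (simp add: inv[OF Gn])
      finally show ?thesis by (auto simp: G_def)
    qed
    then have "(\<lambda>n. if n = 0 then \<phi> k xs else 0) sums (\<Sum>m. \<Sum>l. f m l)"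
      using double_series_diagonal(2)[OF fb] by simp
    moreover have "(\<lambda>n. if n = 0 then \<phi> k xs else 0) sums \<phi> k xs"
      using sums_single[of 0 "\<lambda>_. \<phi> k xs"] by simp
    ultimately have "\<phi> k xs = (\<Sum>m. \<Sum>l. f m l)" using sums_unique2 by blast
    also have "\<dots> = conv_op c (conv_op c' \<phi>) k xs"
      unfolding row conv_op_def[of c] using xs by (simp add: contr_def H_def)
    finally show ?thesis ..
  qed
qed

end

section \<open>Moments of an analytic measure\<close>

text \<open>The balls form only a subbasis, but the seminorms increase with the index, so a finite
  intersection of balls around a point contains a single ball.\<close>

lemma projlim_neighbourhood:
  assumes open_W: "openin (projlim_topology V \<nu>) W" and "x \<in> W"
    and tri: "\<And>i x y z. x \<in> V \<Longrightarrow> y \<in> V \<Longrightarrow> z \<in> V \<Longrightarrow> \<nu> i (x - z) \<le> \<nu> i (x - y) + \<nu> i (y - z)"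
    and mono: "\<And>i j x y. i \<le> (j :: nat) \<Longrightarrow> x \<in> V \<Longrightarrow> y \<in> V \<Longrightarrow> \<nu> i (x - y) \<le> \<nu> j (x - y)"
  obtains i \<epsilon> where "\<epsilon> > 0" "{y \<in> V. \<nu> i (y - x) < \<epsilon>} \<subseteq> W"
proof -
  have "generate_topology_on {{y \<in> V. \<nu> i (y - x) < \<epsilon>} | i x \<epsilon>. x \<in> V \<and> \<epsilon> > 0} W"
    using open_W unfolding projlim_topology_def openin_topology_generated_by_iff .
  then have "W \<subseteq> V \<and> (\<forall>x\<in>W. \<exists>i. \<exists>\<epsilon>>0. {y \<in> V. \<nu> i (y - x) < \<epsilon>} \<subseteq> W)"
  proof (induction rule: generate_topology_on.induct)
    case (Int a b)
    show ?case
    proof (intro conjI ballI)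
      fix x assume x: "x \<in> a \<inter> b"
      then have xV: "x \<in> V" using Int by blast
      obtain i \<delta> where i: "\<delta> > 0" "{y \<in> V. \<nu> i (y - x) < \<delta>} \<subseteq> a" using Int x by blast
      obtain j \<epsilon> where j: "\<epsilon> > 0" "{y \<in> V. \<nu> j (y - x) < \<epsilon>} \<subseteq> b" using Int x by blast
      have "{y \<in> V. \<nu> (max i j) (y - x) < min \<delta> \<epsilon>} \<subseteq> a \<inter> b"
        using i(2) j(2) mono[of i "max i j" _ x] mono[of j "max i j" _ x] xV by fastforce
      then show "\<exists>i. \<exists>\<epsilon>>0. {y \<in> V. \<nu> i (y - x) < \<epsilon>} \<subseteq> a \<inter> b"
        using i(1) j(1) by (intro exI[of _ "max i j"] exI[of _ "min \<delta> \<epsilon>"]) auto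
    qed (use Int in blast)
  next
    case (UN K)
    then show ?case by (meson UnionE Union_upper Sup_least order_trans)
  next
    case (Basis s)
    then obtain i x \<epsilon> where s: "s = {y \<in> V. \<nu> i (y - x) < \<epsilon>}" "x \<in> V" "\<epsilon> > 0" by blast
    have "{y \<in> V. \<nu> i (y - z) < \<epsilon> - \<nu> i (z - x)} \<subseteq> s" if "z \<in> s" for z
      using that tri[of _ z x i] s by fastforce
    moreover have "\<epsilon> - \<nu> i (z - x) > 0" if "z \<in> s" for z using that s by simp
    ultimately show ?case using s(1) by blast
  qed auto
  then show ?thesis using that \<open>x \<in> W\<close> by blast
qed

lemma power_le_fact_exp: "0 \<le> (u::real) \<Longrightarrow> u ^ n \<le> fact n * exp u"
proof -
  assume u: "0 \<le> u"
  have "u ^ n / fact n \<le> (\<Sum>n. u ^ n / fact n)"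
    using sum_le_suminf[OF summable_exp_generic[of u], of "{n}"] u
    by (simp add: scaleR_conv_of_real inverse_eq_divide)
  also have "\<dots> = exp u" by (simp add: exp_def scaleR_conv_of_real inverse_eq_divide)
  finally show ?thesis by (simp add: field_simps)
qed

text \<open>The largest entry dominates. In this way a mixed product of pairings is reduced to
  powers of a single pairing, for which exponential moments are at hand.\<close>

lemma prod_list_le_sum_power:
  assumes "\<And>v. v \<in> set vs \<Longrightarrow> 0 \<le> (v::real)" "vs \<noteq> []"
  shows "prod_list vs \<le> (\<Sum>v\<leftarrow>vs. v ^ length vs)"
proof -
  define m where "m = Max (set vs)"
  have m: "m \<in> set vs" "\<And>v. v \<in> set vs \<Longrightarrow> v \<le> m" using assms by (auto simp: m_def)
  have "prod_list vs \<le> (\<Prod>v\<leftarrow>vs. m)"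
    using prod_list_mono_real[of vs "\<lambda>v. v" "\<lambda>v. m"] assms m by simp
  also have "\<dots> = m ^ length vs" by (induction vs) auto
  also have "\<dots> \<le> (\<Sum>v\<leftarrow>vs. v ^ length vs)"
    using m assms by (intro member_le_sum_list) auto
  finally show ?thesis .
qed

context nuclear_scale
begin

lemma lnormC_triangle:
  assumes "x \<in> nucC S" "y \<in> nucC S" "z \<in> nucC S"
  shows "lnormC S p (x - z) \<le> lnormC S p (x - y) + lnormC S p (y - z)"
proof -
  have l: "fst u \<in> level S p" "snd u \<in> level S p" if "u \<in> nucC S" for u
    using that nuc_level by (auto simp: nucC_def)
  have tr: "lnorm S p (a - c) \<le> lnorm S p (a - b) + lnorm S p (b - c)"
    if "a \<in> level S p" "b \<in> level S p" "c \<in> level S p" for a b c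
    using lnorm_triangle[of "a - b" p "b - c"] that by (simp add: level_diff)
  have "lnormC S p (x - z) \<le> sqrt ((lnorm S p (fst x - fst y) + lnorm S p (fst y - fst z))\<^sup>2
      + (lnorm S p (snd x - snd y) + lnorm S p (snd y - snd z))\<^sup>2)"
    unfolding lnormC_def using l assms tr
    by (intro real_sqrt_le_mono add_mono power_mono) (auto simp: lnorm_nonneg level_diff)
  also have "\<dots> \<le> lnormC S p (x - y) + lnormC S p (y - z)"
    unfolding lnormC_def by (simp add: real_sqrt_sum_squares_triangle_ineq)
  finally show ?thesis .
qed

lemma lnormC_mono:
  assumes "p \<le> q" "x \<in> nucC S" "y \<in> nucC S"
  shows "lnormC S p (x - y) \<le> lnormC S q (x - y)"
  unfolding lnormC_def using assms
  by (intro real_sqrt_le_mono add_mono power_mono lnorm_mono lnorm_nonneg)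
    (auto simp: nucC_def intro!: nuc_level nuc_diff)

lemma zero_nucC: "0 \<in> nucC S"
  by (simp add: nucC_def zero_prod_def nuc_0)

lemma nucC_neighbourhood:
  assumes "openin (nucC_topology S) W" "0 \<in> W"
  obtains p \<epsilon> where "\<epsilon> > 0" "{\<theta> \<in> nucC S. lnormC S p \<theta> < \<epsilon>} \<subseteq> W"
proof (rule projlim_neighbourhood[OF assms(1)[unfolded nucC_topology_def] assms(2)])
  fix i and \<epsilon> :: real assume "\<epsilon> > 0" "{y \<in> nucC S. lnormC S i (y - 0) < \<epsilon>} \<subseteq> W"
  then show thesis using that[of \<epsilon> i] by simp
qed (auto intro: lnormC_triangle lnormC_mono)

lemma openin_nucC_ball: "\<epsilon> > 0 \<Longrightarrow> openin (nucC_topology S) {\<theta> \<in> nucC S. lnormC S p \<theta> < \<epsilon>}"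
  unfolding nucC_topology_def projlim_topology_def
proof (rule topology_generated_by_Basis)
  assume "\<epsilon> > 0"
  moreover have "{\<theta> \<in> nucC S. lnormC S p \<theta> < \<epsilon>} = {\<theta> \<in> nucC S. lnormC S p (\<theta> - 0) < \<epsilon>}" by simp
  ultimately show "{\<theta> \<in> nucC S. lnormC S p \<theta> < \<epsilon>} \<in>
      {{y \<in> nucC S. lnormC S i (y - x) < \<epsilon>} | i x \<epsilon>. x \<in> nucC S \<and> \<epsilon> > 0}"
    using zero_nucC by blast
qed

text \<open>A real norm on the complexification, equivalent to \<open>lnormC\<close> up to the
  factor 2. Its additive form matches the bound of \<open>pairing\<close> by the values at the two
  components.\<close>

definition asum :: "nat \<Rightarrow> 'h \<times> 'h \<Rightarrow> real" where
  "asum p \<theta> = lnorm S p (fst \<theta>) + lnorm S p (snd \<theta>)"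

lemma asum_nonneg: "\<theta> \<in> nucC S \<Longrightarrow> 0 \<le> asum p \<theta>"
  by (auto simp: asum_def nucC_def intro!: add_nonneg_nonneg lnorm_nonneg nuc_level)

lemma lnorm_le_lnormC: "lnorm S p (fst \<theta>) \<le> lnormC S p \<theta>" "lnorm S p (snd \<theta>) \<le> lnormC S p \<theta>"
  unfolding lnormC_def by (rule real_le_rsqrt; simp)+

lemma asum_le_lnormC: "asum p \<theta> \<le> 2 * lnormC S p \<theta>"
  using lnorm_le_lnormC[of p \<theta>] by (simp add: asum_def)

end

locale analytic_measure = nuclear_scale S
  for S :: "'h::{real_inner, polish_space} hilbert_scale" +
  fixes \<mu> :: "('h \<Rightarrow> real) measure"
  assumes analytic: "\<mu> \<in> analytic_measures S"
begin

sublocale prob_space \<mu>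
  using analytic by (simp add: analytic_measures_def)

lemma space_mu: "space \<mu> = nuc_dual S"
proof -
  have "sets \<mu> = sets (cylinder_algebra S)" using analytic by (simp add: analytic_measures_def)
  then have "space \<mu> = space (cylinder_algebra S)" by (rule sets_eq_imp_space_eq)
  also have "\<dots> = nuc_dual S" unfolding cylinder_algebra_def by (rule space_measure_of) auto
  finally show ?thesis .
qed

lemma measurable_eval:
  assumes "\<theta> \<in> nuc S"
  shows "(\<lambda>x. x \<theta>) \<in> borel_measurable \<mu>"
proof (rule measurableI)
  fix A :: "real set" assume A: "A \<in> sets borel"
  have "{x \<in> nuc_dual S. x \<theta> \<in> A} \<in> sets (cylinder_algebra S)"
    unfolding cylinder_algebra_def using assms A by (subst sets_measure_of) (auto intro: sigma_sets.Basic)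
  moreover have "(\<lambda>x. x \<theta>) -` A \<inter> space \<mu> = {x \<in> nuc_dual S. x \<theta> \<in> A}" using space_mu by auto
  ultimately show "(\<lambda>x. x \<theta>) -` A \<inter> space \<mu> \<in> sets \<mu>"
    using analytic by (simp add: analytic_measures_def)
qed simp

lemma measurable_pairing [measurable]:
  assumes "\<theta> \<in> nucC S"
  shows "(\<lambda>x. pairing (cplx x) \<theta>) \<in> borel_measurable \<mu>"
  unfolding pairing_def cplx_def using assms measurable_eval
  by (intro borel_measurable_add borel_measurable_times borel_measurable_const
      measurable_compose[OF measurable_eval borel_measurable_of_real]) (auto simp: nucC_def)

text \<open>At a real vector the integrand is positive, so the local bound of the Laplace transform
  at 0 is a bound for the exponential moment itself.\<close>

lemma exponential_moments_real:
  obtains p r E where "r > 0"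
    "\<And>\<theta>. \<theta> \<in> nuc S \<Longrightarrow> lnorm S p \<theta> < r \<Longrightarrow> integrable \<mu> (\<lambda>x. exp (x \<theta>)) \<and> (\<integral>x. exp (x \<theta>) \<partial>\<mu>) \<le> E"
proof -
  obtain U where U: "0 \<in> U" "\<And>\<theta>. \<theta> \<in> U \<Longrightarrow> integrable \<mu> (\<lambda>x. exp (pairing (cplx x) \<theta>))"
    "holomorphic_in nucC_line (nucC_topology S) U (laplace \<mu>)"
    using analytic by (auto simp: analytic_measures_def)
  obtain V where V: "openin (nucC_topology S) V" "0 \<in> V" "V \<subseteq> U" "bounded (laplace \<mu> ` V)"
    using U unfolding holomorphic_in_def by blast
  obtain p r where r: "r > 0" "{\<theta> \<in> nucC S. lnormC S p \<theta> < r} \<subseteq> V"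
    using nucC_neighbourhood[OF V(1,2)] by blast
  obtain E where E: "\<And>\<theta>. \<theta> \<in> V \<Longrightarrow> cmod (laplace \<mu> \<theta>) \<le> E"
    using V(4) unfolding bounded_iff by auto
  show ?thesis
  proof (rule that[OF r(1)])
    fix \<theta> assume \<theta>: "\<theta> \<in> nuc S" "lnorm S p \<theta> < r"
    have "(\<theta>, 0) \<in> V"
      using \<theta> r nuc_0 lnorm_nonneg[OF nuc_level[OF \<theta>(1)]] by (auto simp: nucC_def lnormC_def)
    then have int: "integrable \<mu> (\<lambda>x. exp (pairing (cplx x) (\<theta>, 0)))"
      and le: "cmod (laplace \<mu> (\<theta>, 0)) \<le> E" using U V E by auto
    have eq: "exp (pairing (cplx x) (\<theta>, 0)) = of_real (exp (x \<theta>))" if "x \<in> space \<mu>" for x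
    proof -
      have "x 0 = 0" using \<open>x \<in> space \<mu>\<close> dual_0 unfolding space_mu nuc_dual_def by blast
      then show ?thesis by (simp add: pairing_def cplx_def exp_of_real)
    qed
    have i: "integrable \<mu> (\<lambda>x. exp (x \<theta>))"
      using integrable_norm[OF int]
        Bochner_Integration.integrable_cong[OF refl[of \<mu>], where f = "\<lambda>x. norm (exp (pairing (cplx x) (\<theta>, 0)))" and g = "\<lambda>x. exp (x \<theta>)"]
      by (simp add: eq del: norm_exp_eq_Re)
    have "laplace \<mu> (\<theta>, 0) = (\<integral>x. of_real (exp (x \<theta>)) \<partial>\<mu>)"
      unfolding laplace_def by (rule Bochner_Integration.integral_cong) (auto simp: eq)
    also have "\<dots> = of_real (\<integral>x. exp (x \<theta>) \<partial>\<mu>)" by (rule integral_complex_of_real)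
    finally have "\<bar>\<integral>x. exp (x \<theta>) \<partial>\<mu>\<bar> \<le> E" using le by simp
    with i show "integrable \<mu> (\<lambda>x. exp (x \<theta>)) \<and> (\<integral>x. exp (x \<theta>) \<partial>\<mu>) \<le> E" by auto
  qed
qed

text \<open>The absolute values take care of both signs and both components at once.
  \<open>E \<ge> 1\<close> allows a constant 1 to be absorbed into \<open>E\<close> later.\<close>

definition exp_bound :: "nat \<Rightarrow> real \<Rightarrow> real \<Rightarrow> bool" where
  "exp_bound p r E \<longleftrightarrow> r > 0 \<and> E \<ge> 1 \<and> (\<forall>\<theta>\<in>nucC S. asum p \<theta> \<le> r \<longrightarrow>
     integrable \<mu> (\<lambda>x. exp (\<bar>x (fst \<theta>)\<bar> + \<bar>x (snd \<theta>)\<bar>)) \<and>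
     (\<integral>x. exp (\<bar>x (fst \<theta>)\<bar> + \<bar>x (snd \<theta>)\<bar>) \<partial>\<mu>) \<le> E)"

text \<open>\<open>exp (2|t|) \<le> exp (2t) + exp (-2t)\<close> removes the sign, and
  \<open>exp (|a| + |b|) \<le> exp (2|a|) + exp (2|b|)\<close> separates the components. The doubled
  exponent halves the radius, and \<open>r / 4\<close> keeps the inequality with
  \<open>r / 2\<close> strict. The two sums turn \<open>E\<close> into \<open>4 * E\<close>.\<close>

lemma exp_bound_exists: "\<exists>p r E. exp_bound p r E"
proof -
  obtain p r E where r: "r > 0" and E: "\<And>\<theta>. \<theta> \<in> nuc S \<Longrightarrow> lnorm S p \<theta> < r \<Longrightarrow>
      integrable \<mu> (\<lambda>x. exp (x \<theta>)) \<and> (\<integral>x. exp (x \<theta>) \<partial>\<mu>) \<le> E"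
    by (rule exponential_moments_real, rule that)
  have one: "integrable \<mu> (\<lambda>x. exp (2 * \<bar>x \<theta>\<bar>)) \<and> (\<integral>x. exp (2 * \<bar>x \<theta>\<bar>) \<partial>\<mu>) \<le> 2 * E"
    if \<theta>: "\<theta> \<in> nuc S" "lnorm S p \<theta> < r / 2" for \<theta>
  proof -
    have s: "lnorm S p (c *\<^sub>R \<theta>) < r" "c *\<^sub>R \<theta> \<in> nuc S" if "c = 2 \<or> c = -2" for c
      using \<theta> that nuc_level by (auto simp: lnorm_scale nuc_scale)
    have ev: "x (c *\<^sub>R \<theta>) = c * x \<theta>" if "x \<in> space \<mu>" for x c
      using that \<theta> dual_scale unfolding space_mu nuc_dual_def by blast
    have i: "integrable \<mu> (\<lambda>x. exp (x (2 *\<^sub>R \<theta>)) + exp (x ((-2) *\<^sub>R \<theta>)))"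
      using E[OF s(2,1), of 2] E[OF s(2,1), of "-2"] by auto
    have le: "exp (2 * \<bar>x \<theta>\<bar>) \<le> exp (x (2 *\<^sub>R \<theta>)) + exp (x ((-2) *\<^sub>R \<theta>))" if "x \<in> space \<mu>" for x
      unfolding ev[OF that] by (cases "x \<theta> \<ge> 0") auto
    have i2: "integrable \<mu> (\<lambda>x. exp (2 * \<bar>x \<theta>\<bar>))"
    proof (rule Bochner_Integration.integrable_bound[OF i])
      have "(\<lambda>t::real. exp (2 * \<bar>t\<bar>)) \<in> borel_measurable borel" by measurable
      from measurable_compose[OF measurable_eval[OF \<theta>(1)] this]
      show "(\<lambda>x. exp (2 * \<bar>x \<theta>\<bar>)) \<in> borel_measurable \<mu>" .
      show "AE x in \<mu>. norm (exp (2 * \<bar>x \<theta>\<bar>)) \<le> norm (exp (x (2 *\<^sub>R \<theta>)) + exp (x ((-2) *\<^sub>R \<theta>)))"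
        by (rule AE_I2) (simp only: real_norm_def abs_exp_cancel order_trans[OF le abs_ge_self])
    qed
    have "(\<integral>x. exp (2 * \<bar>x \<theta>\<bar>) \<partial>\<mu>) \<le> (\<integral>x. exp (x (2 *\<^sub>R \<theta>)) + exp (x ((-2) *\<^sub>R \<theta>)) \<partial>\<mu>)"
      using le by (intro integral_mono[OF i2 i]) auto
    also have "\<dots> \<le> 2 * E"
      using E[OF s(2,1), of 2] E[OF s(2,1), of "-2"] by (subst Bochner_Integration.integral_add) auto
    finally show ?thesis using i2 by simp
  qed
  have "integrable \<mu> (\<lambda>x. exp (\<bar>x (fst \<theta>)\<bar> + \<bar>x (snd \<theta>)\<bar>)) \<and>
     (\<integral>x. exp (\<bar>x (fst \<theta>)\<bar> + \<bar>x (snd \<theta>)\<bar>) \<partial>\<mu>) \<le> max 1 (4 * E)"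
    if \<theta>: "\<theta> \<in> nucC S" "asum p \<theta> \<le> r / 4" for \<theta>
  proof -
    have n: "fst \<theta> \<in> nuc S" "snd \<theta> \<in> nuc S" using \<theta> by (auto simp: nucC_def)
    have l: "lnorm S p (fst \<theta>) < r / 2" "lnorm S p (snd \<theta>) < r / 2"
      using \<theta> r lnorm_nonneg[OF nuc_level[OF n(1)], of p] lnorm_nonneg[OF nuc_level[OF n(2)], of p]
      by (auto simp: asum_def)
    have le: "exp (\<bar>a\<bar> + \<bar>b\<bar>) \<le> exp (2 * \<bar>a\<bar>) + exp (2 * \<bar>b\<bar>)" for a b :: real
    proof (cases "\<bar>a\<bar> \<le> \<bar>b\<bar>")
      case True
      then have "exp (\<bar>a\<bar> + \<bar>b\<bar>) \<le> exp (2 * \<bar>b\<bar>)" by simp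
      then show ?thesis by (meson add_increasing exp_ge_zero)
    next
      case False
      then have "exp (\<bar>a\<bar> + \<bar>b\<bar>) \<le> exp (2 * \<bar>a\<bar>)" by simp
      then show ?thesis by (meson add_increasing2 exp_ge_zero)
    qed
    have i: "integrable \<mu> (\<lambda>x. exp (2 * \<bar>x (fst \<theta>)\<bar>) + exp (2 * \<bar>x (snd \<theta>)\<bar>))"
      using one n l by auto
    have i2: "integrable \<mu> (\<lambda>x. exp (\<bar>x (fst \<theta>)\<bar> + \<bar>x (snd \<theta>)\<bar>))"
    proof (rule Bochner_Integration.integrable_bound[OF i])
      have "(\<lambda>x. \<bar>x (fst \<theta>)\<bar> + \<bar>x (snd \<theta>)\<bar>) \<in> borel_measurable \<mu>"
        using n by (intro borel_measurable_add borel_measurable_abs measurable_eval)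
      then show "(\<lambda>x. exp (\<bar>x (fst \<theta>)\<bar> + \<bar>x (snd \<theta>)\<bar>)) \<in> borel_measurable \<mu>"
        by (rule measurable_compose[OF _ borel_measurable_exp])
      show "AE x in \<mu>. norm (exp (\<bar>x (fst \<theta>)\<bar> + \<bar>x (snd \<theta>)\<bar>)) \<le>
          norm (exp (2 * \<bar>x (fst \<theta>)\<bar>) + exp (2 * \<bar>x (snd \<theta>)\<bar>))"
        by (rule AE_I2) (simp only: real_norm_def abs_exp_cancel order_trans[OF le abs_ge_self])
    qed
    have "(\<integral>x. exp (\<bar>x (fst \<theta>)\<bar> + \<bar>x (snd \<theta>)\<bar>) \<partial>\<mu>) \<le>
        (\<integral>x. exp (2 * \<bar>x (fst \<theta>)\<bar>) + exp (2 * \<bar>x (snd \<theta>)\<bar>) \<partial>\<mu>)"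
      using le by (intro integral_mono[OF i2 i]) auto
    also have "\<dots> \<le> 4 * E"
      using one[OF n(1) l(1)] one[OF n(2) l(2)] by (subst Bochner_Integration.integral_add) auto
    finally show ?thesis using i2 by simp
  qed
  then show ?thesis using r unfolding exp_bound_def by (intro exI[of _ p] exI[of _ "r / 4"] exI[of _ "max 1 (4 * E)"]) auto
qed

lemma exp_bound_pos: "exp_bound p r E \<Longrightarrow> r > 0 \<and> E \<ge> 1"
  by (simp add: exp_bound_def)

lemma pairing_abs_le: "cmod (pairing (cplx x) \<theta>) \<le> \<bar>x (fst \<theta>)\<bar> + \<bar>x (snd \<theta>)\<bar>"
  unfolding pairing_def cplx_def by (rule order_trans[OF norm_triangle_ineq]) (simp add: norm_mult)

lemma measurable_pairing_prod:
  "\<theta>s \<in> tuples (nucC S) n \<Longrightarrow> (\<lambda>x. \<Prod>\<theta>\<leftarrow>\<theta>s. pairing (cplx x) \<theta>) \<in> borel_measurable \<mu>"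
proof (induction n arbitrary: \<theta>s)
  case (Suc n)
  obtain \<theta> \<eta>s where "\<theta>s = \<theta> # \<eta>s" "\<theta> \<in> nucC S" "\<eta>s \<in> tuples (nucC S) n" using Suc.prems by (rule tuples_SucE)
  then show ?case using Suc.IH measurable_pairing by simp
qed simp

text \<open>Each vector is rescaled to have \<open>asum\<close> equal to \<open>r\<close>. The
  product of the rescaled pairings is at most a sum of \<open>n\<close>-th powers, hence at most
  \<open>fact n\<close> times a sum of exponentials with integrals bounded by \<open>E\<close>. The
  number of summands is absorbed in \<open>2 ^ n\<close>.\<close>

lemma moment_bound:
  assumes eb: "exp_bound p r E" and \<theta>s: "\<theta>s \<in> tuples (nucC S) n"
  shows "integrable \<mu> (\<lambda>x. \<Prod>\<theta>\<leftarrow>\<theta>s. pairing (cplx x) \<theta>)"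
    "(\<integral>x. cmod (\<Prod>\<theta>\<leftarrow>\<theta>s. pairing (cplx x) \<theta>) \<partial>\<mu>) \<le> E * fact n * (2 / r) ^ n * (\<Prod>\<theta>\<leftarrow>\<theta>s. asum p \<theta>)"
proof -
  note r = exp_bound_pos[OF eb]
  have len: "length \<theta>s = n" and nC: "\<And>\<theta>. \<theta> \<in> set \<theta>s \<Longrightarrow> \<theta> \<in> nucC S" using \<theta>s by (auto simp: tuples_def)
  have "integrable \<mu> (\<lambda>x. \<Prod>\<theta>\<leftarrow>\<theta>s. pairing (cplx x) \<theta>) \<and>
    (\<integral>x. cmod (\<Prod>\<theta>\<leftarrow>\<theta>s. pairing (cplx x) \<theta>) \<partial>\<mu>) \<le> E * fact n * (2 / r) ^ n * (\<Prod>\<theta>\<leftarrow>\<theta>s. asum p \<theta>)"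
  proof (cases "\<exists>\<theta>\<in>set \<theta>s. asum p \<theta> = 0")
    \<comment> \<open>A vector with \<open>asum\<close> 0 cannot be rescaled, but it is 0, and both
      sides of the estimate vanish.\<close>
    case True
    then obtain \<theta> where \<theta>: "\<theta> \<in> set \<theta>s" "asum p \<theta> = 0" by blast
    have "fst \<theta> = 0" "snd \<theta> = 0"
      using \<theta>(2) nC[OF \<theta>(1)] lnorm_pos[OF nuc_level] lnorm_nonneg[OF nuc_level]
      by (auto simp: asum_def nucC_def mem_Times_iff add_nonneg_eq_0_iff) (metis less_irrefl)+
    then have "pairing (cplx x) \<theta> = 0" if "x \<in> space \<mu>" for x
    proof -
      have "x 0 = 0" using that dual_0 unfolding space_mu nuc_dual_def by blast
      then show ?thesis by (simp add: pairing_def cplx_def \<open>fst \<theta> = 0\<close> \<open>snd \<theta> = 0\<close>)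
    qed
    then have z: "(\<Prod>\<theta>\<leftarrow>\<theta>s. pairing (cplx x) \<theta>) = 0" if "x \<in> space \<mu>" for x
      using that \<theta>(1) by (force simp: prod_list_zero_iff)
    have "(\<Prod>\<theta>\<leftarrow>\<theta>s. asum p \<theta>) = 0" using \<theta> by (auto simp: prod_list_zero_iff)
    then show ?thesis
      using z Bochner_Integration.integral_cong[of \<mu> \<mu> "\<lambda>x. cmod (\<Prod>\<theta>\<leftarrow>\<theta>s. pairing (cplx x) \<theta>)" "\<lambda>x. 0"]
        Bochner_Integration.integrable_cong[OF refl[of \<mu>], where f = "\<lambda>x. \<Prod>\<theta>\<leftarrow>\<theta>s. pairing (cplx x) \<theta>" and g = "\<lambda>x. 0"] by simp
  next
    case False
    then have pos: "0 < asum p \<theta>" if "\<theta> \<in> set \<theta>s" for \<theta>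
      using that asum_nonneg[OF nC[OF that], of p] by (metis less_eq_real_def)
    define v where "v \<theta> x = (r / asum p \<theta>) * (\<bar>x (fst \<theta>)\<bar> + \<bar>x (snd \<theta>)\<bar>)" for \<theta> and x :: "'h \<Rightarrow> real"
    have v0: "0 \<le> v \<theta> x" if "\<theta> \<in> set \<theta>s" for \<theta> x using pos[OF that] r by (simp add: v_def)
    have iv: "integrable \<mu> (\<lambda>x. exp (v \<theta> x)) \<and> (\<integral>x. exp (v \<theta> x) \<partial>\<mu>) \<le> E" if t: "\<theta> \<in> set \<theta>s" for \<theta>
    proof -
      define c where "c = r / asum p \<theta>"
      have c: "c > 0" using pos[OF t] r by (simp add: c_def)
      define \<eta> where "\<eta> = (c *\<^sub>R fst \<theta>, c *\<^sub>R snd \<theta>)"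
      have n: "fst \<theta> \<in> nuc S" "snd \<theta> \<in> nuc S" using nC[OF t] by (auto simp: nucC_def)
      have \<eta>: "\<eta> \<in> nucC S" using n by (simp add: \<eta>_def nucC_def nuc_scale)
      have "asum p \<eta> = c * asum p \<theta>" using n c by (simp add: \<eta>_def asum_def lnorm_scale nuc_level algebra_simps)
      then have "asum p \<eta> \<le> r" using pos[OF t] by (simp add: c_def)
      then have *: "integrable \<mu> (\<lambda>x. exp (\<bar>x (fst \<eta>)\<bar> + \<bar>x (snd \<eta>)\<bar>))"
        "(\<integral>x. exp (\<bar>x (fst \<eta>)\<bar> + \<bar>x (snd \<eta>)\<bar>) \<partial>\<mu>) \<le> E" using eb \<eta> unfolding exp_bound_def by blast+
      have eq: "exp (\<bar>x (fst \<eta>)\<bar> + \<bar>x (snd \<eta>)\<bar>) = exp (v \<theta> x)" if "x \<in> space \<mu>" for x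
      proof -
        have "x (c *\<^sub>R \<theta>') = c * x \<theta>'" if "\<theta>' \<in> nuc S" for \<theta>'
          using \<open>x \<in> space \<mu>\<close> that dual_scale unfolding space_mu nuc_dual_def by blast
        then show ?thesis using n c by (simp add: \<eta>_def v_def abs_mult algebra_simps flip: c_def)
      qed
      show ?thesis
        using * Bochner_Integration.integrable_cong[OF refl[of \<mu>], where f = "\<lambda>x. exp (\<bar>x (fst \<eta>)\<bar> + \<bar>x (snd \<eta>)\<bar>)" and g = "\<lambda>x. exp (v \<theta> x)"]
          Bochner_Integration.integral_cong[of \<mu> \<mu> "\<lambda>x. exp (\<bar>x (fst \<eta>)\<bar> + \<bar>x (snd \<eta>)\<bar>)" "\<lambda>x. exp (v \<theta> x)"] eq
        by simp
    qed
    define P where "P = (\<Prod>\<theta>\<leftarrow>\<theta>s. asum p \<theta> / r)"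
    have P0: "0 \<le> P" unfolding P_def using pos r by (intro prod_list_nonneg_real) (auto intro: less_imp_le)
    \<comment> \<open>The summand 1 covers the empty list, whose product is 1 while the sum of
      exponentials is 0.\<close>
    define g where "g x = P * (fact n * (1 + (\<Sum>\<theta>\<leftarrow>\<theta>s. exp (v \<theta> x))))" for x
    have pw: "cmod (\<Prod>\<theta>\<leftarrow>\<theta>s. pairing (cplx x) \<theta>) \<le> g x" for x
    proof -
      have "cmod (\<Prod>\<theta>\<leftarrow>\<theta>s. pairing (cplx x) \<theta>) = (\<Prod>\<theta>\<leftarrow>\<theta>s. cmod (pairing (cplx x) \<theta>))" by (rule norm_prod_list)
      also have "\<dots> \<le> (\<Prod>\<theta>\<leftarrow>\<theta>s. (asum p \<theta> / r) * v \<theta> x)"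
      proof (rule prod_list_mono_real)
        fix \<theta> assume "\<theta> \<in> set \<theta>s"
        then have "(asum p \<theta> / r) * v \<theta> x = \<bar>x (fst \<theta>)\<bar> + \<bar>x (snd \<theta>)\<bar>" using pos r by (fastforce simp: v_def)
        then show "0 \<le> cmod (pairing (cplx x) \<theta>) \<and> cmod (pairing (cplx x) \<theta>) \<le> (asum p \<theta> / r) * v \<theta> x"
          using pairing_abs_le by simp
      qed
      also have "\<dots> = P * (\<Prod>\<theta>\<leftarrow>\<theta>s. v \<theta> x)" unfolding P_def by (induction \<theta>s) (auto simp: mult_ac)
      also have "\<dots> \<le> P * (fact n * (1 + (\<Sum>\<theta>\<leftarrow>\<theta>s. exp (v \<theta> x))))"
      proof (rule mult_left_mono[OF _ P0])
        show "(\<Prod>\<theta>\<leftarrow>\<theta>s. v \<theta> x) \<le> fact n * (1 + (\<Sum>\<theta>\<leftarrow>\<theta>s. exp (v \<theta> x)))"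
        proof (cases "\<theta>s = []")
          case True
          then show ?thesis using len by simp
        next
          case False
          have "(\<Prod>\<theta>\<leftarrow>\<theta>s. v \<theta> x) \<le> (\<Sum>u\<leftarrow>map (\<lambda>\<theta>. v \<theta> x) \<theta>s. u ^ length (map (\<lambda>\<theta>. v \<theta> x) \<theta>s))"
            using v0 False by (intro prod_list_le_sum_power) auto
          also have "\<dots> = (\<Sum>\<theta>\<leftarrow>\<theta>s. v \<theta> x ^ n)" using len by (simp add: comp_def)
          also have "\<dots> \<le> (\<Sum>\<theta>\<leftarrow>\<theta>s. fact n * exp (v \<theta> x))" using v0 by (intro sum_list_mono power_le_fact_exp)
          also have "\<dots> = fact n * (\<Sum>\<theta>\<leftarrow>\<theta>s. exp (v \<theta> x))" by (rule sum_list_const_mult)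
          finally show ?thesis by (simp add: distrib_left add_increasing)
        qed
      qed
      finally show ?thesis by (simp add: g_def)
    qed
    have sl: "integrable \<mu> (\<lambda>x. \<Sum>\<theta>\<leftarrow>\<eta>s. exp (v \<theta> x)) \<and> (\<integral>x. (\<Sum>\<theta>\<leftarrow>\<eta>s. exp (v \<theta> x)) \<partial>\<mu>) \<le> real (length \<eta>s) * E"
      if "set \<eta>s \<subseteq> set \<theta>s" for \<eta>s
      using that
    proof (induction \<eta>s)
      case (Cons \<theta> \<eta>s)
      then have "integrable \<mu> (\<lambda>x. exp (v \<theta> x)) \<and> (\<integral>x. exp (v \<theta> x) \<partial>\<mu>) \<le> E" using iv by simp
      then show ?case using Cons by (simp add: distrib_right)
    qed simp
    have ig: "integrable \<mu> g" unfolding g_def using sl[of \<theta>s] by auto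
    have i: "integrable \<mu> (\<lambda>x. \<Prod>\<theta>\<leftarrow>\<theta>s. pairing (cplx x) \<theta>)"
      using pw by (intro Bochner_Integration.integrable_bound[OF ig measurable_pairing_prod[OF \<theta>s]])
        (auto intro!: AE_I2 order_trans[OF pw abs_ge_self])
    have "(\<integral>x. cmod (\<Prod>\<theta>\<leftarrow>\<theta>s. pairing (cplx x) \<theta>) \<partial>\<mu>) \<le> (\<integral>x. g x \<partial>\<mu>)"
      using pw by (intro integral_mono[OF integrable_norm[OF i] ig])
    also have "\<dots> = P * (fact n * (1 + (\<integral>x. (\<Sum>\<theta>\<leftarrow>\<theta>s. exp (v \<theta> x)) \<partial>\<mu>)))"
      unfolding g_def using sl[of \<theta>s] by (simp add: prob_space)
    also have "\<dots> \<le> P * (fact n * (2 ^ n * E))"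
    proof (intro mult_left_mono P0)
      have "1 + (\<integral>x. (\<Sum>\<theta>\<leftarrow>\<theta>s. exp (v \<theta> x)) \<partial>\<mu>) \<le> 1 + real n * E" using sl[of \<theta>s] len by simp
      also have "\<dots> \<le> E + real n * E" using r by simp
      also have "\<dots> = (1 + real n) * E" by (simp add: algebra_simps)
      also have "\<dots> \<le> 2 ^ n * E"
      proof (rule mult_right_mono)
        have "1 + n \<le> 2 ^ n" using less_exp[of n] by linarith
        then have "real (1 + n) \<le> real (2 ^ n)" by (rule of_nat_mono)
        then show "1 + real n \<le> 2 ^ n" by simp
      qed (use r in simp)
      finally show "1 + (\<integral>x. (\<Sum>\<theta>\<leftarrow>\<theta>s. exp (v \<theta> x)) \<partial>\<mu>) \<le> 2 ^ n * E" .
    qed simp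
    also have "P = (1 / r) ^ n * (\<Prod>\<theta>\<leftarrow>\<theta>s. asum p \<theta>)"
      unfolding P_def len[symmetric] using prod_list_const_mult[of "1 / r" "asum p" \<theta>s] by simp
    finally show ?thesis using i by (simp add: power_divide mult_ac)
  qed
  then show "integrable \<mu> (\<lambda>x. \<Prod>\<theta>\<leftarrow>\<theta>s. pairing (cplx x) \<theta>)"
    "(\<integral>x. cmod (\<Prod>\<theta>\<leftarrow>\<theta>s. pairing (cplx x) \<theta>) \<partial>\<mu>) \<le> E * fact n * (2 / r) ^ n * (\<Prod>\<theta>\<leftarrow>\<theta>s. asum p \<theta>)"
    by blast+
qed

definition moment :: "('h \<times> 'h) list \<Rightarrow> complex" where
  "moment \<theta>s = (\<integral>x. (\<Prod>\<theta>\<leftarrow>\<theta>s. pairing (cplx x) \<theta>) \<partial>\<mu>)"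

lemma norm_moment_le:
  assumes "exp_bound p r E" "\<theta>s \<in> tuples (nucC S) n"
  shows "cmod (moment \<theta>s) \<le> E * fact n * (2 / r) ^ n * (\<Prod>\<theta>\<leftarrow>\<theta>s. asum p \<theta>)"
  unfolding moment_def
  using order_trans[OF integral_norm_bound moment_bound(2)[OF assms]] .

text \<open>\<open>u^n - v^n\<close> factors as \<open>u - v\<close> times mixed products, and the
  moment of each mixed tuple is controlled by \<open>norm_moment_le\<close>. Thus moments of powers
  are continuous along sequences bounded in \<open>asum\<close>.\<close>

lemma moment_power_limit:
  assumes eb: "exp_bound p r E" and \<theta>: "\<theta> \<in> nucC S" and \<eta>: "\<And>j. \<eta> j \<in> nucC S"
    and lim: "(\<lambda>j. asum p (\<eta> j - \<theta>)) \<longlonglongrightarrow> 0" and b: "\<And>j. asum p (\<eta> j) \<le> b" "asum p \<theta> \<le> b"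
  shows "(\<lambda>j. moment (replicate n (\<eta> j))) \<longlonglongrightarrow> moment (replicate n \<theta>)"
proof (cases n)
  case (Suc m)
  define C where "C = E * fact n * (2 / r) ^ n"
  have C: "0 \<le> C" using exp_bound_pos[OF eb] by (simp add: C_def)
  have d: "\<eta> j - \<theta> \<in> nucC S" for j using \<eta>[of j] \<theta> by (auto simp: nucC_def intro: nuc_diff)
  have "cmod (moment (replicate n (\<eta> j)) - moment (replicate n \<theta>)) \<le> real n * C * b ^ m * asum p (\<eta> j - \<theta>)" for j
  proof -
    \<comment> \<open>The \<open>i\<close>-th term of that factorization as a list of
      \<open>n = Suc m\<close> vectors: one difference, \<open>i\<close> copies of the approximating
      vector and \<open>m - i\<close> of the limit.\<close>
    define L where "L i = (\<eta> j - \<theta>) # replicate i (\<eta> j) @ replicate (m - i) \<theta>" for i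
    have L: "L i \<in> tuples (nucC S) n" if "i < n" for i
      using that d[of j] \<eta>[of j] \<theta> Suc by (auto simp: L_def tuples_def)
    have rep: "replicate n (\<eta> j) \<in> tuples (nucC S) n" "replicate n \<theta> \<in> tuples (nucC S) n"
      using \<eta>[of j] \<theta> by (auto intro: replicate_tuples)
    have "(\<Prod>\<theta>\<leftarrow>replicate n (\<eta> j). pairing (cplx x) \<theta>) - (\<Prod>\<theta>\<leftarrow>replicate n \<theta>. pairing (cplx x) \<theta>) =
        (\<Sum>i<n. \<Prod>\<theta>\<leftarrow>L i. pairing (cplx x) \<theta>)" if x: "x \<in> space \<mu>" for x
    proof -
      obtain q where q: "x \<in> dual_level S q" using x unfolding space_mu nuc_dual_def by blast
      have "pairing (cplx x) (\<eta> j - \<theta>) = pairing (cplx x) (\<eta> j) - pairing (cplx x) \<theta>"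
        using \<eta>[of j] \<theta> by (auto simp: pairing_def cplx_def nucC_def mem_Times_iff dual_diff[OF q] algebra_simps)
      then show ?thesis
        unfolding L_def Suc using diff_power_eq_sum[of "pairing (cplx x) (\<eta> j)" m "pairing (cplx x) \<theta>"]
        by (simp add: prod_list_replicate map_replicate sum_distrib_left del: power_Suc replicate_Suc sum.lessThan_Suc)
    qed
    then have "(\<integral>x. (\<Prod>\<theta>\<leftarrow>replicate n (\<eta> j). pairing (cplx x) \<theta>) - (\<Prod>\<theta>\<leftarrow>replicate n \<theta>. pairing (cplx x) \<theta>) \<partial>\<mu>) =
        (\<integral>x. (\<Sum>i<n. \<Prod>\<theta>\<leftarrow>L i. pairing (cplx x) \<theta>) \<partial>\<mu>)"
      by (intro Bochner_Integration.integral_cong) auto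
    moreover have "(\<integral>x. (\<Sum>i<n. \<Prod>\<theta>\<leftarrow>L i. pairing (cplx x) \<theta>) \<partial>\<mu>) = (\<Sum>i<n. moment (L i))"
      unfolding moment_def by (rule Bochner_Integration.integral_sum) (use moment_bound(1)[OF eb L] in simp)
    moreover have "(\<integral>x. (\<Prod>\<theta>\<leftarrow>replicate n (\<eta> j). pairing (cplx x) \<theta>) - (\<Prod>\<theta>\<leftarrow>replicate n \<theta>. pairing (cplx x) \<theta>) \<partial>\<mu>)
        = moment (replicate n (\<eta> j)) - moment (replicate n \<theta>)"
      unfolding moment_def
      by (rule Bochner_Integration.integral_diff[OF moment_bound(1)[OF eb rep(1)] moment_bound(1)[OF eb rep(2)]])
    ultimately have "moment (replicate n (\<eta> j)) - moment (replicate n \<theta>) = (\<Sum>i<n. moment (L i))"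
      by simp
    also have "cmod \<dots> \<le> (\<Sum>i<n. C * (asum p (\<eta> j - \<theta>) * b ^ m))"
    proof (rule sum_norm_le)
      fix i assume i: "i \<in> {..<n}"
      then have iL: "L i \<in> tuples (nucC S) n" using L by simp
      have "cmod (moment (L i)) \<le> C * (\<Prod>\<theta>\<leftarrow>L i. asum p \<theta>)"
        unfolding C_def by (rule norm_moment_le[OF eb iL])
      also have "\<dots> \<le> C * (asum p (\<eta> j - \<theta>) * b ^ m)"
      proof (rule mult_left_mono[OF _ C])
        have "(\<Prod>\<theta>\<leftarrow>L i. asum p \<theta>) = asum p (\<eta> j - \<theta>) * (asum p (\<eta> j) ^ i * asum p \<theta> ^ (m - i))"
          by (simp add: L_def prod_list_replicate map_replicate)
        also have "\<dots> \<le> asum p (\<eta> j - \<theta>) * (b ^ i * b ^ (m - i))"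
          using b asum_nonneg d \<eta> \<theta> order_trans[OF asum_nonneg[OF \<theta>] b(2)]
          by (intro mult_left_mono mult_mono power_mono) auto
        finally show "(\<Prod>\<theta>\<leftarrow>L i. asum p \<theta>) \<le> asum p (\<eta> j - \<theta>) * b ^ m"
          using i Suc by (simp flip: power_add)
      qed
      finally show "cmod (moment (L i)) \<le> C * (asum p (\<eta> j - \<theta>) * b ^ m)" .
    qed
    also have "\<dots> = real n * C * b ^ m * asum p (\<eta> j - \<theta>)" by simp
    finally show ?thesis .
  qed
  then have "\<forall>\<^sub>F j in sequentially. norm (moment (replicate n (\<eta> j)) - moment (replicate n \<theta>)) \<le>
      real n * C * b ^ m * asum p (\<eta> j - \<theta>)" by (intro always_eventually allI)
  then have "(\<lambda>j. moment (replicate n (\<eta> j)) - moment (replicate n \<theta>)) \<longlonglongrightarrow> 0"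
    by (rule Lim_null_comparison) (use tendsto_mult_right_zero[OF lim] in blast)
  then show ?thesis by (rule LIM_zero_cancel)
qed simp

end

text \<open>A power series with a nonzero coefficient has an isolated zero at 0. Vanishing is
  assumed along the reals only, because uniqueness of the coefficients of a tensor series is tested
  on real multiples of a real functional.\<close>

lemma power_series_zero:
  fixes a :: "nat \<Rightarrow> complex"
  assumes \<delta>: "\<delta> > 0" and summ: "\<And>t. cmod t < \<delta> \<Longrightarrow> summable (\<lambda>n. a n * t ^ n)"
    and zero: "\<And>t. \<bar>t\<bar> < \<delta> \<Longrightarrow> (\<lambda>n. a n * of_real t ^ n) sums 0"
  shows "a n = 0"
proof (cases "n = 0")
  case True
  have "(\<lambda>n. a n * 0 ^ n) sums 0" using zero[of 0] \<delta> by simp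
  then have "a 0 = 0" by (metis powser_sums_zero sums_unique2)
  then show ?thesis using True by simp
next
  case False
  show ?thesis
  proof (rule ccontr)
    assume an: "a n \<noteq> 0"
    define f where "f t = (\<Sum>n. a n * t ^ n)" for t
    have f0: "f (of_real t) = 0" if "\<bar>t\<bar> < \<delta>" for t
      unfolding f_def using sums_unique[OF zero[OF that]] by simp
    show False
    proof (rule powser_0_nonzero[of \<delta> 0 a f n])
      fix s :: real
      assume s: "0 < s" "\<And>z :: complex. z \<in> cball 0 s - {0} \<Longrightarrow> f z \<noteq> 0"
      define u where "u = min s (\<delta> / 2)"
      have u: "0 < u" "u \<le> s" "u < \<delta>" using s \<delta> by (auto simp: u_def)
      have "f (of_real u) \<noteq> 0" using u by (intro s(2)) auto
      then show False using f0[of u] u by simp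
    next
      show "(\<lambda>n. a n * (x - 0) ^ n) sums f x" if "norm (x - 0) < \<delta>" for x
        unfolding f_def using summable_sums[OF summ] that by simp
      show "f 0 = 0" using f0[of 0] \<delta> by simp
    qed (use \<delta> an False in auto)
  qed
qed

text \<open>Lets the termination proof of the next recursion see that the summation index stays
  below \<open>n\<close>.\<close>

declare sum.cong [fundef_cong]

context nuclear_scale
begin

section \<open>Inversion of a sequence of functionals\<close>

text \<open>The recursion for the reciprocal of a formal power series: the convolution of
  \<open>inv_seq c\<close> with \<open>c\<close> is to be the evaluation at \<open>[]\<close> in
  degree 0 and zero in all other degrees, where \<open>c 0\<close> is this evaluation.\<close>

function inv_seq :: "(nat \<Rightarrow> 'h tensor \<Rightarrow> complex) \<Rightarrow> nat \<Rightarrow> 'h tensor \<Rightarrow> complex" where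
  "inv_seq c n F = (if n = 0 then F []
     else - (\<Sum>m<n. of_nat (n choose m) * inv_seq c m (contr m (c (n - m)) F)))"
  by pat_completeness auto
termination by (relation "Wellfounded.measure (\<lambda>(c, n, F). n)") auto

declare inv_seq.simps [simp del]

lemma dlin_eval_Nil: "dlin 0 (\<lambda>F. F [])"
  by (simp add: dlin_def)

lemma dbound_eval_Nil: "dbound p 0 (\<lambda>F. F []) 1"
  unfolding dbound_def tbound_def by simp

lemma dlin_sum_functional:
  assumes "\<And>i. i \<in> I \<Longrightarrow> dlin n (P i)"
  shows "dlin n (\<lambda>F. \<Sum>i\<in>I. a i * P i F)"
  unfolding dlin_def
proof (intro ballI allI)
  fix F G b c assume FG: "F \<in> nuc_tensor S n" "G \<in> nuc_tensor S n"
  have "(\<Sum>i\<in>I. a i * P i (\<lambda>xs. b * F xs + c * G xs)) = (\<Sum>i\<in>I. b * (a i * P i F) + c * (a i * P i G))"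
    using dlinD[OF assms FG] by (intro sum.cong) (auto simp: algebra_simps)
  then show "(\<Sum>i\<in>I. a i * P i (\<lambda>xs. b * F xs + c * G xs)) = b * (\<Sum>i\<in>I. a i * P i F) + c * (\<Sum>i\<in>I. a i * P i G)"
    by (simp add: sum.distrib sum_distrib_left)
qed

lemma dbound_sum_functional:
  assumes "\<And>i. i \<in> I \<Longrightarrow> dbound p n (P i) (C i)"
  shows "dbound p n (\<lambda>F. \<Sum>i\<in>I. a i * P i F) (\<Sum>i\<in>I. cmod (a i) * C i)"
  unfolding dbound_def
proof (intro conjI ballI allI impI)
  show "0 \<le> (\<Sum>i\<in>I. cmod (a i) * C i)" using assms by (intro sum_nonneg) (auto simp: dbound_def)
  fix F M assume F: "F \<in> nuc_tensor S n" "0 \<le> M" "tbound p n F M"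
  have "cmod (\<Sum>i\<in>I. a i * P i F) \<le> (\<Sum>i\<in>I. cmod (a i) * (C i * M))"
    using dboundD[OF assms F(1,3,2)] by (intro sum_norm_le) (auto simp: norm_mult intro!: mult_left_mono)
  then show "cmod (\<Sum>i\<in>I. a i * P i F) \<le> (\<Sum>i\<in>I. cmod (a i) * C i) * M"
    by (simp add: sum_distrib_right mult.assoc)
qed

lemma dbound_weaken: "dbound p n P C \<Longrightarrow> C \<le> C' \<Longrightarrow> dbound p n P C'"
  unfolding dbound_def by (meson mult_right_mono order_trans)

lemma dlin_cong: "dlin n P \<Longrightarrow> (\<And>F. Q F = P F) \<Longrightarrow> dlin n Q"
  by (simp add: dlin_def)

lemma dbound_cong: "dbound p n P C \<Longrightarrow> (\<And>F. Q F = P F) \<Longrightarrow> dbound p n Q C"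
  by (simp add: dbound_def)

text \<open>With the bound \<open>\<rho> ^ m * fact m\<close> for lower degrees, binomials and
  factorials cancel in the recursion. There remains \<open>K\<close> times the sum of
  \<open>(1 + K) ^ m\<close> over \<open>m < n\<close>, which is \<open>(1 + K) ^ n - 1\<close>.
  This dictates \<open>\<rho> = r * (1 + K)\<close> with leading constant 1.\<close>

lemma functional_seq_inv_seq:
  assumes c: "functional_seq p K r c"
  shows "functional_seq p 1 (r * (1 + K)) (inv_seq c)"
proof -
  have K: "0 \<le> K" "0 \<le> r" using c by (auto simp: functional_seq_def)
  define \<rho> where "\<rho> = r * (1 + K)"
  have \<rho>: "0 \<le> \<rho>" using K by (simp add: \<rho>_def)
  have "dlin n (inv_seq c n) \<and> dbound p n (inv_seq c n) (\<rho> ^ n * fact n)" for n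
  proof (induction n rule: less_induct)
    case (less n)
    show ?case
    proof (cases "n = 0")
      case True
      then have "inv_seq c n = (\<lambda>F. F [])" by (simp add: inv_seq.simps fun_eq_iff)
      then show ?thesis using True dlin_eval_Nil dbound_eval_Nil by simp
    next
      case False
      have eq: "inv_seq c n F = (\<Sum>m<n. - of_nat (n choose m) * inv_seq c m (contr m (c (n - m)) F))" for F
        using False by (subst inv_seq.simps) (simp add: sum_negf)
      have l: "dlin n (\<lambda>F. inv_seq c m (contr m (c (n - m)) F))" if "m < n" for m
        using comp_contr_dlin[of m "inv_seq c m" "n - m" "c (n - m)" p, OF _ functional_seq_dlin[OF c]
            functional_seq_dbound[OF c order_refl]] less[OF that] that by simp
      have b: "dbound p n (\<lambda>F. inv_seq c m (contr m (c (n - m)) F))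
          (\<rho> ^ m * fact m * (K * r ^ (n - m) * fact (n - m)))" if "m < n" for m
        using comp_contr_dbound[of p m "inv_seq c m" _ "n - m" "c (n - m)", OF _ functional_seq_dlin[OF c]
            functional_seq_dbound[OF c order_refl]] less[OF that] that by simp
      have "dlin n (inv_seq c n)"
        by (rule dlin_cong[OF dlin_sum_functional[of "{..<n}" n _ "\<lambda>m. - of_nat (n choose m)"] eq]) (use l in auto)
      moreover have "dbound p n (inv_seq c n) (\<Sum>m<n. cmod (- of_nat (n choose m)) *
          (\<rho> ^ m * fact m * (K * r ^ (n - m) * fact (n - m))))"
        by (rule dbound_cong[OF dbound_sum_functional[of "{..<n}"] eq]) (use b in auto)
      moreover have "(\<Sum>m<n. cmod (- of_nat (n choose m)) * (\<rho> ^ m * fact m * (K * r ^ (n - m) * fact (n - m))))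
          \<le> \<rho> ^ n * fact n"
      proof -
        have "cmod (- of_nat (n choose m)) * (\<rho> ^ m * fact m * (K * r ^ (n - m) * fact (n - m)))
            = fact n * r ^ n * (K * (1 + K) ^ m)" if "m < n" for m
        proof -
          have "real (n choose m) = fact n / (fact m * fact (n - m))" using that by (simp add: binomial_fact)
          moreover have "r ^ n = r ^ m * r ^ (n - m)" using that by (simp flip: power_add)
          moreover have "\<rho> ^ m = r ^ m * (1 + K) ^ m" by (simp only: \<rho>_def power_mult_distrib)
          ultimately show ?thesis by simp
        qed
        then have "(\<Sum>m<n. cmod (- of_nat (n choose m)) * (\<rho> ^ m * fact m * (K * r ^ (n - m) * fact (n - m))))
            = (\<Sum>m<n. fact n * r ^ n * (K * (1 + K) ^ m))"
          by (intro sum.cong refl) (simp only: lessThan_iff)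
        also have "\<dots> = fact n * r ^ n * (K * (\<Sum>m<n. (1 + K) ^ m))"
          by (simp add: sum_distrib_left)
        also have "K * (\<Sum>m<n. (1 + K) ^ m) = (1 + K) ^ n - 1"
          using power_diff_1_eq[of "1 + K" n] by simp
        also have "fact n * r ^ n * ((1 + K) ^ n - 1) \<le> fact n * r ^ n * (1 + K) ^ n"
          using K by (intro mult_left_mono) auto
        finally show ?thesis by (simp add: \<rho>_def power_mult_distrib mult_ac)
      qed
      ultimately show ?thesis using dbound_weaken by blast
    qed
  qed
  then show ?thesis using \<rho> by (simp add: functional_seq_def flip: \<rho>_def)
qed

lemma inv_seq_left:
  assumes c: "functional_seq p K r c" and c0: "\<And>F. F \<in> nuc_tensor S 0 \<Longrightarrow> c 0 F = F []"
    and F: "F \<in> nuc_tensor S n"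
  shows "(\<Sum>m\<le>n. of_nat (n choose m) * inv_seq c m (contr m (c (n - m)) F)) = (if n = 0 then F [] else 0)"
proof -
  have cn: "contr n (c 0) F = F"
  proof
    fix xs
    show "contr n (c 0) F xs = F xs"
    proof (cases "xs \<in> tuples (nuc_dual S) n")
      case True
      then have "(\<lambda>ys. F (xs @ ys)) \<in> nuc_tensor S 0" using F by (intro nuc_tensor_append) auto
      then show ?thesis using True c0 by (simp add: contr_def)
    qed (use nuc_tensor_outside[OF F] in \<open>simp add: contr_def\<close>)
  qed
  show ?thesis
  proof (cases "n = 0")
    case True
    then show ?thesis using cn by (simp add: inv_seq.simps)
  next
    case False
    have "(\<Sum>m\<le>n. of_nat (n choose m) * inv_seq c m (contr m (c (n - m)) F)) =
        (\<Sum>m<n. of_nat (n choose m) * inv_seq c m (contr m (c (n - m)) F)) + inv_seq c n F"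
      using cn by (simp flip: lessThan_Suc_atMost)
    also have "inv_seq c n F = - (\<Sum>m<n. of_nat (n choose m) * inv_seq c m (contr m (c (n - m)) F))"
      using False by (subst inv_seq.simps) simp
    finally show ?thesis using False by simp
  qed
qed

text \<open>The recursion makes \<open>inv_seq c\<close> a left inverse; exchanging the two
  functionals by \<open>comp_contr_commute\<close> and reversing the summation makes it a right
  inverse as well.\<close>

lemma inv_seq_right:
  assumes c: "functional_seq p K r c" and c0: "\<And>F. F \<in> nuc_tensor S 0 \<Longrightarrow> c 0 F = F []"
    and F: "F \<in> nuc_tensor S n"
  shows "(\<Sum>m\<le>n. of_nat (n choose m) * c m (contr m (inv_seq c (n - m)) F)) = (if n = 0 then F [] else 0)"
proof -
  note i = functional_seq_inv_seq[OF c]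
  have "(\<Sum>m\<le>n. of_nat (n choose m) * c m (contr m (inv_seq c (n - m)) F)) =
      (\<Sum>m\<le>n. of_nat (n choose (n - m)) * inv_seq c (n - m) (contr (n - m) (c (n - (n - m))) F))"
  proof (rule sum.cong)
    fix m assume m: "m \<in> {..n}"
    have "c m (contr m (inv_seq c (n - m)) F) = inv_seq c (n - m) (contr (n - m) (c m) F)"
      using comp_contr_commute[OF functional_seq_dlin[OF c] functional_seq_dbound[OF c order_refl]
          functional_seq_dlin[OF i] functional_seq_dbound[OF i order_refl], of F m "n - m"] F m by simp
    then show "of_nat (n choose m) * c m (contr m (inv_seq c (n - m)) F) =
        of_nat (n choose (n - m)) * inv_seq c (n - m) (contr (n - m) (c (n - (n - m))) F)"
      using m by (simp add: binomial_symmetric[of m n])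
  qed simp
  also have "\<dots> = (\<Sum>m\<le>n. of_nat (n choose m) * inv_seq c m (contr m (c (n - m)) F))"
    by (rule sum.reindex_bij_witness[of _ "\<lambda>m. n - m" "\<lambda>m. n - m"]) auto
  also have "\<dots> = (if n = 0 then F [] else 0)" by (rule inv_seq_left[OF c c0 F])
  finally show ?thesis .
qed

section \<open>Kernels of bounded multilinear forms\<close>

text \<open>Approximating systems of increasing precision need not be nested. Each one is therefore
  absorbed into the span of an extension of its predecessor, and the approximation quality survives
  the enlargement of the span. Monotonicity lets sums over tuples be computed along the
  sequence.\<close>

lemma exhausting_orthonormal_sequence:
  assumes hs: "hs_bound p q K"
  obtains B where "\<And>j. finite (B j)" "\<And>j. orthonormal_in S q (B j)" "\<And>j. B j \<subseteq> nuc S" "incseq B"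
    "\<And>j \<theta>. \<theta> \<in> nuc S \<Longrightarrow> lnorm S p (\<theta> - proj q (B j) \<theta>) \<le> 1 / real (Suc j) * lnorm S q \<theta>"
proof -
  have pq: "p \<le> q" using hs by (simp add: hs_bound_def)
  have "\<forall>j. \<exists>C. finite C \<and> orthonormal_in S q C \<and> C \<subseteq> nuc S \<and>
      (\<forall>\<theta>\<in>nuc S. lnorm S p (\<theta> - proj q C \<theta>) \<le> 1 / real (Suc j) * lnorm S q \<theta>)"
    using finite_rank_approximation[OF hs, of "1 / real (Suc _)"] by (metis divide_pos_pos of_nat_0_less_iff zero_less_Suc zero_less_one)
  then obtain C where C: "\<And>j. finite (C j)" "\<And>j. orthonormal_in S q (C j)" "\<And>j. C j \<subseteq> nuc S"
    "\<And>j \<theta>. \<theta> \<in> nuc S \<Longrightarrow> lnorm S p (\<theta> - proj q (C j) \<theta>) \<le> 1 / real (Suc j) * lnorm S q \<theta>"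
    by metis
  have ext: "\<exists>B'. finite B' \<and> orthonormal_in S q B' \<and> B \<subseteq> B' \<and> B' \<subseteq> nuc S \<and> (\<forall>c\<in>C j. proj q B' c = c)"
    if "finite B" "orthonormal_in S q B" "B \<subseteq> nuc S" for B j
    using that C nuc_level by (intro Gram_Schmidt subspace_nuc) auto
  define Q where "Q j B \<longleftrightarrow> finite B \<and> orthonormal_in S q B \<and> B \<subseteq> nuc S \<and> (\<forall>c\<in>C j. proj q B c = c)" for j B
  have "\<exists>B. \<forall>j. Q j (B j) \<and> B j \<subseteq> B (Suc j)"
  proof (rule dependent_nat_choice)
    show "\<exists>B. Q 0 B"
      using ext[of "{}" 0] by (auto simp: Q_def orthonormal_in_def)
    fix B j assume "Q j B"
    then show "\<exists>B'. Q (Suc j) B' \<and> B \<subseteq> B'"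
      using ext[of B "Suc j"] by (auto simp: Q_def)
  qed
  then obtain B where B: "\<And>j. Q j (B j)" "\<And>j. B j \<subseteq> B (Suc j)" by blast
  have on: "finite (B j)" "orthonormal_in S q (B j)" "B j \<subseteq> nuc S" "\<forall>c\<in>C j. proj q (B j) c = c" for j
    using B(1)[of j] by (auto simp: Q_def)
  show ?thesis
  proof (rule that[OF on(1-3)])
    show "incseq B" using B(2) by (rule incseq_SucI)
    fix j \<theta> assume \<theta>: "\<theta> \<in> nuc S"
    define u where "u = \<theta> - proj q (B j) \<theta>"
    have u: "u \<in> nuc S" using \<theta> on by (simp add: u_def nuc_diff proj_nuc)
    have ul: "u \<in> level S q" using u nuc_level by blast
    \<comment> \<open>The residual \<open>u\<close> of the larger system is orthogonal to
      \<open>C j\<close>, so its projection onto \<open>C j\<close> is 0 and the approximation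
      property of \<open>C j\<close> bounds \<open>u\<close> itself.\<close>
    have orth: "ip S q c u = 0" if c: "c \<in> C j" for c
    proof -
      have e: "ip S q e u = 0" if "e \<in> B j" for e
        unfolding u_def using ip_proj_residual[OF on(1,2) that nuc_level[OF \<theta>]] .
      have "ip S q c u = ip S q (proj q (B j) c) u" using on(4) c by simp
      also have "\<dots> = (\<Sum>e\<in>B j. ip S q e c * ip S q e u)"
        unfolding proj_def using on(2)[of j] ul
        by (simp add: ip_sum_left ip_scale_left level_scale orthonormal_level)
      also have "\<dots> = 0" using e by simp
      finally show ?thesis .
    qed
    have "proj q (C j) u = 0" unfolding proj_def using orth by simp
    then have "lnorm S p u \<le> 1 / real (Suc j) * lnorm S q u" using C(4)[OF u, of j] by simp
    also have "\<dots> \<le> 1 / real (Suc j) * lnorm S q \<theta>"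
      unfolding u_def using lnorm_proj_le(2)[OF on(1,2) nuc_level[OF \<theta>]] by (intro mult_left_mono) auto
    finally show "lnorm S p (\<theta> - proj q (B j) \<theta>) \<le> 1 / real (Suc j) * lnorm S q \<theta>" by (simp add: u_def)
  qed
qed

text \<open>Kernel theorem: a form \<open>A\<close> on \<open>\<N>\<close> that is bounded for \<open>|\<cdot>|\<^sub>p\<close> acts on tensors by summing its values on
  a system that is orthonormal for a stronger norm; Cauchy-Schwarz and the Hilbert-Schmidt property
  make the sum converge.\<close>

lemma kernel_sum_bound:
  assumes hs: "hs_bound p q K" and D: "0 \<le> D"
    and fin: "finite L" "L \<subseteq> tuples B n"
    and on: "\<And>C. finite C \<Longrightarrow> C \<subseteq> B \<Longrightarrow> orthonormal_in S q C"
    and A: "\<And>es. es \<in> tuples B n \<Longrightarrow> cmod (A es) \<le> D * (\<Prod>e\<leftarrow>es. lnorm S p e)"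
    and F: "F \<in> tensor_level S q n"
  shows "(\<Sum>es\<in>L. cmod (F (map (riesz S q) es) * A es)) \<le> tnorm S q n F * (D * K ^ n)"
proof -
  define C where "C = (\<Union>es\<in>L. set es)"
  have C: "finite C" "C \<subseteq> B" "L \<subseteq> tuples C n" using fin by (auto simp: C_def tuples_def)
  have onC: "orthonormal_in S q C" using on C by blast
  have t0: "0 \<le> tnorm S q n F" using F by (rule tnorm_nonneg)
  have "(\<Sum>es\<in>L. cmod (F (map (riesz S q) es) * A es)) \<le> (\<Sum>es\<in>tuples C n. cmod (F (map (riesz S q) es) * A es))"
    using C finite_tuples by (intro sum_mono2) auto
  also have "\<dots> \<le> (\<Sum>es\<in>tuples C n. \<bar>cmod (F (map (riesz S q) es))\<bar> * \<bar>D * (\<Prod>e\<leftarrow>es. lnorm S p e)\<bar>)"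
  proof (rule sum_mono)
    fix es assume "es \<in> tuples C n"
    then have "cmod (A es) \<le> \<bar>D * (\<Prod>e\<leftarrow>es. lnorm S p e)\<bar>"
      using A[of es] tuples_mono[OF C(2)] by (meson abs_ge_self order_trans)
    then show "cmod (F (map (riesz S q) es) * A es) \<le> \<bar>cmod (F (map (riesz S q) es))\<bar> * \<bar>D * (\<Prod>e\<leftarrow>es. lnorm S p e)\<bar>"
      by (simp add: norm_mult mult_left_mono)
  qed
  also have "\<dots> \<le> L2_set (\<lambda>es. cmod (F (map (riesz S q) es))) (tuples C n)
      * L2_set (\<lambda>es. D * (\<Prod>e\<leftarrow>es. lnorm S p e)) (tuples C n)"
    by (rule L2_set_mult_ineq)
  also have "\<dots> \<le> tnorm S q n F * (D * K ^ n)"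
  proof (rule mult_mono[OF _ _ t0 L2_set_nonneg])
    show "L2_set (\<lambda>es. cmod (F (map (riesz S q) es))) (tuples C n) \<le> tnorm S q n F"
      unfolding L2_set_def tnorm_def tuples_def using C onC F
      by (intro real_sqrt_le_mono cSup_upper) (auto simp: hs_sums_def tensor_level_def)
    have "(\<Sum>es\<in>tuples C n. (D * (\<Prod>e\<leftarrow>es. lnorm S p e))\<^sup>2) = D\<^sup>2 * (\<Sum>es\<in>tuples C n. \<Prod>e\<leftarrow>es. (lnorm S p e)\<^sup>2)"
      by (simp add: power_mult_distrib prod_list_power sum_distrib_left)
    also have "\<dots> = D\<^sup>2 * (\<Sum>e\<in>C. (lnorm S p e)\<^sup>2) ^ n" by (simp add: sum_tuples_power)
    also have "\<dots> \<le> D\<^sup>2 * (K\<^sup>2) ^ n"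
      using hs C onC by (intro mult_left_mono power_mono) (auto simp: hs_bound_def sum_nonneg)
    also have "\<dots> = (D * K ^ n)\<^sup>2" by (simp add: power_mult_distrib mult.commute flip: power_mult)
    finally show "L2_set (\<lambda>es. D * (\<Prod>e\<leftarrow>es. lnorm S p e)) (tuples C n) \<le> D * K ^ n"
      unfolding L2_set_def using D hs by (intro real_le_lsqrt) (auto simp: hs_bound_def)
  qed
  finally show ?thesis .
qed

text \<open>\<open>F (map (riesz S q) es)\<close> are the coefficients of the tensor
  \<open>F\<close> along the system \<open>B\<close>, and \<open>A\<close> supplies the values of
  the form on the same basis tuples.\<close>

definition kernel :: "nat \<Rightarrow> 'h set \<Rightarrow> ('h list \<Rightarrow> complex) \<Rightarrow> nat \<Rightarrow> 'h tensor \<Rightarrow> complex" where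
  "kernel q B A n F = infsum (\<lambda>es. F (map (riesz S q) es) * A es) (tuples B n)"

text \<open>Two Hilbert-Schmidt steps enter: from \<open>p\<close> to \<open>q\<close>, making the
  values of the form square summable, and from \<open>q\<close> to \<open>q'\<close>, bounding the
  Hilbert-Schmidt norm of \<open>F\<close> by its operator bound.\<close>

lemma kernel_functional:
  assumes hs: "hs_bound p q K" and D: "0 \<le> D" and hs': "hs_bound q q' K'"
    and on: "\<And>C. finite C \<Longrightarrow> C \<subseteq> B \<Longrightarrow> orthonormal_in S q C"
    and A: "\<And>es. es \<in> tuples B n \<Longrightarrow> cmod (A es) \<le> D * (\<Prod>e\<leftarrow>es. lnorm S p e)"
  shows "\<And>F. F \<in> nuc_tensor S n \<Longrightarrow> (\<lambda>es. F (map (riesz S q) es) * A es) summable_on (tuples B n)"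
    "dlin n (kernel q B A n)" "dbound q' n (kernel q B A n) (D * K ^ n * K' ^ n)"
proof -
  have abs: "(\<lambda>es. norm (F (map (riesz S q) es) * A es)) summable_on (tuples B n)" if F: "F \<in> nuc_tensor S n" for F
  proof (rule nonneg_bdd_above_summable_on)
    show "bdd_above (sum (\<lambda>es. norm (F (map (riesz S q) es) * A es)) ` {L. L \<subseteq> tuples B n \<and> finite L})"
      using kernel_sum_bound[OF hs D _ _ on A nuc_tensor_level[OF F]]
      by (intro bdd_aboveI[of _ "tnorm S q n F * (D * K ^ n)"]) auto
  qed simp
  show summ: "(\<lambda>es. F (map (riesz S q) es) * A es) summable_on (tuples B n)" if "F \<in> nuc_tensor S n" for F
    using abs[OF that] by (rule abs_summable_summable)
  show "dlin n (kernel q B A n)"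
    unfolding dlin_def
  proof (intro ballI allI)
    fix F G a b assume F: "F \<in> nuc_tensor S n" and G: "G \<in> nuc_tensor S n"
    have "kernel q B A n (\<lambda>xs. a * F xs + b * G xs) =
        infsum (\<lambda>es. a * (F (map (riesz S q) es) * A es) + b * (G (map (riesz S q) es) * A es)) (tuples B n)"
      unfolding kernel_def by (intro infsum_cong) (simp add: algebra_simps)
    also have "\<dots> = a * kernel q B A n F + b * kernel q B A n G"
      unfolding kernel_def using summ[OF F] summ[OF G]
      by (simp add: infsum_add summable_on_cmult_right infsum_cmult_right)
    finally show "kernel q B A n (\<lambda>xs. a * F xs + b * G xs) = a * kernel q B A n F + b * kernel q B A n G" .
  qed
  show "dbound q' n (kernel q B A n) (D * K ^ n * K' ^ n)"
    unfolding dbound_def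
  proof (intro conjI ballI allI impI)
    have K: "0 \<le> K" "0 \<le> K'" using hs hs' by (auto simp: hs_bound_def)
    then show "0 \<le> D * K ^ n * K' ^ n" using D by simp
    fix F M assume F: "F \<in> nuc_tensor S n" "0 \<le> M" "tbound q' n F M"
    have "cmod (kernel q B A n F) \<le> infsum (\<lambda>es. norm (F (map (riesz S q) es) * A es)) (tuples B n)"
      unfolding kernel_def by (rule norm_infsum_bound[OF abs[OF F(1)]])
    also have "\<dots> \<le> tnorm S q n F * (D * K ^ n)"
      using kernel_sum_bound[OF hs D _ _ on A nuc_tensor_level[OF F(1)]]
      by (intro infsum_le_finite_sums[OF abs[OF F(1)]])
    also have "\<dots> \<le> (K' ^ n * M) * (D * K ^ n)"
      using tnorm_le(2)[OF hs' F(3,2)] D K by (intro mult_right_mono) auto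
    finally show "cmod (kernel q B A n F) \<le> D * K ^ n * K' ^ n * M" by (simp add: mult_ac)
  qed
qed

end

section \<open>Moments as functionals on tensors and the expansion of the Laplace transform\<close>

context analytic_measure
begin

text \<open>The kernel is built from the moments of real basis vectors. On a tensor power its
  partial sums over \<open>tuples (B j) n\<close> are the moments of the projected vector, which
  converge to the moment of the vector by \<open>moment_power_limit\<close>.\<close>

lemma moment_functionals:
  obtains M p K r where "functional_seq p K r M" "\<And>F. F \<in> nuc_tensor S 0 \<Longrightarrow> M 0 F = F []"
    "\<And>n \<theta>. \<theta> \<in> nucC S \<Longrightarrow> M n (tensor_power S n \<theta>) = moment (replicate n \<theta>)"
proof -
  obtain p r E where eb: "exp_bound p r E" using exp_bound_exists by blast
  note r = exp_bound_pos[OF eb]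
  obtain q K where hs: "hs_bound p q K" using hs_bound_exists by blast
  obtain q' K' where hs': "hs_bound q q' K'" using hs_bound_exists by blast
  have K: "0 \<le> K" "0 \<le> K'" using hs hs' by (auto simp: hs_bound_def)
  obtain B where B: "\<And>j. finite (B j)" "\<And>j. orthonormal_in S q (B j)" "\<And>j. B j \<subseteq> nuc S" "incseq B"
    "\<And>j \<theta>. \<theta> \<in> nuc S \<Longrightarrow> lnorm S p (\<theta> - proj q (B j) \<theta>) \<le> 1 / real (Suc j) * lnorm S q \<theta>"
    by (rule exhausting_orthonormal_sequence[OF hs], rule that)
  define BB where "BB = (\<Union>j. B j)"
  have cover: "\<exists>j. C \<subseteq> B j" if "finite C" "C \<subseteq> BB" for C
    using that
  proof (induction C rule: finite_induct)
    case (insert c C)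
    then obtain i j where "C \<subseteq> B i" "c \<in> B j" by (auto simp: BB_def)
    then have "insert c C \<subseteq> B (max i j)" using incseqD[OF B(4), of i "max i j"] incseqD[OF B(4), of j "max i j"] by auto
    then show ?case by blast
  qed simp
  have on: "orthonormal_in S q C" if C: "finite C" "C \<subseteq> BB" for C
  proof -
    obtain j where "C \<subseteq> B j" using cover[OF C] by blast
    then show ?thesis using B(2)[of j] unfolding orthonormal_in_def by blast
  qed
  have BBn: "BB \<subseteq> nuc S" using B(3) by (auto simp: BB_def)
  define A where "A es = moment (map (\<lambda>e. (e, 0)) es)" for es
  define D where "D n = E * fact n * (2 / r) ^ n" for n
  have D: "0 \<le> D n" for n using r by (simp add: D_def)
  have t: "map (\<lambda>e. (e, 0)) es \<in> tuples (nucC S) n" if "es \<in> tuples BB n" for es n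
    using that BBn nuc_0 by (intro map_tuples[of _ BB]) (auto simp: nucC_def)
  have A: "cmod (A es) \<le> D n * (\<Prod>e\<leftarrow>es. lnorm S p e)" if "es \<in> tuples BB n" for es n
    using norm_moment_le[OF eb t[OF that]] by (simp add: A_def D_def asum_def comp_def)
  have ker1: "(\<lambda>es. F (map (riesz S q) es) * A es) summable_on (tuples BB n)" if "F \<in> nuc_tensor S n" for F n
    by (rule kernel_functional(1)[OF hs D hs' on A that]; assumption)
  have ker2: "dlin n (kernel q BB A n)" for n
    by (rule kernel_functional(2)[OF hs D hs' on A]; assumption)
  have ker3: "dbound q' n (kernel q BB A n) (D n * K ^ n * K' ^ n)" for n
    by (rule kernel_functional(3)[OF hs D hs' on A]; assumption)
  define M where "M n = kernel q BB A n" for n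
  have "functional_seq q' E (2 / r * K * K') M"
    unfolding functional_seq_def
  proof (intro conjI allI)
    show "0 \<le> E" "0 \<le> 2 / r * K * K'" using r K by auto
    fix m
    show "dlin m (M m)" unfolding M_def by (rule ker2)
    have "D m * K ^ m * K' ^ m = E * (2 / r * K * K') ^ m * fact m"
      by (simp add: D_def power_mult_distrib power_divide mult_ac)
    then show "dbound q' m (M m) (E * (2 / r * K * K') ^ m * fact m)" unfolding M_def using ker3[of m] by simp
  qed
  moreover have "M 0 F = F []" for F
    by (simp add: M_def kernel_def A_def moment_def prob_space)
  moreover have "M n (tensor_power S n \<theta>) = moment (replicate n \<theta>)" if \<theta>: "\<theta> \<in> nucC S" for n \<theta>
  proof -
    have \<theta>n: "fst \<theta> \<in> nuc S" "snd \<theta> \<in> nuc S" using \<theta> by (auto simp: nucC_def)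
    define f where "f es = tensor_power S n \<theta> (map (riesz S q) es) * A es" for es
    define \<eta> where "\<eta> j = (proj q (B j) (fst \<theta>), proj q (B j) (snd \<theta>))" for j
    have \<eta>: "\<eta> j \<in> nucC S" for j using B(3)[of j] by (simp add: \<eta>_def nucC_def proj_nuc)
    have "(f has_sum M n (tensor_power S n \<theta>)) (tuples BB n)"
      unfolding f_def M_def kernel_def by (intro has_sum_infsum ker1 tensor_power_nuc \<theta>)
    then have lim: "(sum f \<longlongrightarrow> M n (tensor_power S n \<theta>)) (finite_subsets_at_top (tuples BB n))"
      by (simp add: has_sum_def)
    \<comment> \<open>The unordered sum is evaluated along a cofinal sequence of finite sets; every
      finite set of tuples is contained in one of them because \<open>B\<close> increases.\<close>
    have "filterlim (\<lambda>j. tuples (B j) n) (finite_subsets_at_top (tuples BB n)) sequentially"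
      unfolding filterlim_finite_subsets_at_top
    proof (intro allI impI)
      fix X assume X: "finite X \<and> X \<subseteq> tuples BB n"
      then obtain i where i: "(\<Union>es\<in>X. set es) \<subseteq> B i"
        using cover[of "\<Union>es\<in>X. set es"] by (auto simp: tuples_def)
      show "\<forall>\<^sub>F j in sequentially. finite (tuples (B j) n) \<and> X \<subseteq> tuples (B j) n \<and> tuples (B j) n \<subseteq> tuples BB n"
      proof (rule eventually_sequentiallyI[of i])
        fix j assume "i \<le> j"
        then have "B i \<subseteq> B j" using B(4) by (rule incseqD[rotated])
        then show "finite (tuples (B j) n) \<and> X \<subseteq> tuples (B j) n \<and> tuples (B j) n \<subseteq> tuples BB n"
          using i X finite_tuples[OF B(1)] by (auto simp: tuples_def BB_def)
      qed
    qed
    from filterlim_compose[OF lim this]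
    have lim1: "(\<lambda>j. sum f (tuples (B j) n)) \<longlonglongrightarrow> M n (tensor_power S n \<theta>)" .
    \<comment> \<open>Under the integral the sum over tuples is the expanded \<open>n\<close>-th
      power of the pairing with the projected vector.\<close>
    have "sum f (tuples (B j) n) = moment (replicate n (\<eta> j))" for j
    proof -
      define c where "c e = pairing (cplx (riesz S q e)) \<theta>" for e
      have sub: "es \<in> tuples BB n" if "es \<in> tuples (B j) n" for es
        using that by (rule tuples_mono[rotated]) (auto simp: BB_def)
      have f: "f es = (\<integral>x. (\<Prod>e\<leftarrow>es. c e) * (\<Prod>e\<leftarrow>es. pairing (cplx x) (e, 0)) \<partial>\<mu>)" if es: "es \<in> tuples (B j) n" for es
      proof -
        have "map (riesz S q) es \<in> tuples (nuc_dual S) n"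
          using es B(3)[of j] riesz_dual nuc_level nuc_dualI by (intro map_tuples[of _ "B j"]) blast+
        then have "f es = (\<Prod>e\<leftarrow>es. c e) * (\<integral>x. (\<Prod>e\<leftarrow>es. pairing (cplx x) (e, 0)) \<partial>\<mu>)"
          by (simp add: f_def A_def moment_def tensor_power_eq c_def comp_def)
        then show ?thesis by simp
      qed
      have "sum f (tuples (B j) n) =
          (\<Sum>es\<in>tuples (B j) n. (\<integral>x. (\<Prod>e\<leftarrow>es. c e) * (\<Prod>e\<leftarrow>es. pairing (cplx x) (e, 0)) \<partial>\<mu>))"
        using f by (intro sum.cong) auto
      also have "\<dots> = (\<integral>x. (\<Sum>es\<in>tuples (B j) n. (\<Prod>e\<leftarrow>es. c e) * (\<Prod>e\<leftarrow>es. pairing (cplx x) (e, 0))) \<partial>\<mu>)"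
        using moment_bound(1)[OF eb t[OF sub]]
        by (intro Bochner_Integration.integral_sum[symmetric] integrable_mult_right) (auto simp: comp_def)
      also have "\<dots> = moment (replicate n (\<eta> j))"
        unfolding moment_def
      proof (rule Bochner_Integration.integral_cong)
        fix x assume "x \<in> space \<mu>"
        then obtain s where x: "x \<in> dual_level S s" unfolding space_mu nuc_dual_def by blast
        have "(\<Sum>es\<in>tuples (B j) n. (\<Prod>e\<leftarrow>es. c e) * (\<Prod>e\<leftarrow>es. pairing (cplx x) (e, 0))) =
            (\<Sum>es\<in>tuples (B j) n. \<Prod>e\<leftarrow>es. c e * of_real (x e))"
        proof (rule sum.cong)
          fix es :: "'h list"
          show "(\<Prod>e\<leftarrow>es. c e) * (\<Prod>e\<leftarrow>es. pairing (cplx x) (e, 0)) = (\<Prod>e\<leftarrow>es. c e * of_real (x e))"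
            using dual_0[OF x] by (induction es) (auto simp: pairing_def cplx_def mult_ac)
        qed simp
        also have "\<dots> = (\<Sum>e\<in>B j. c e * of_real (x e)) ^ n" by (rule sum_tuples_power)
        also have "(\<Sum>e\<in>B j. c e * of_real (x e)) = pairing (cplx x) (\<eta> j)"
        proof -
          have "x (proj q (B j) \<zeta>) = (\<Sum>e\<in>B j. riesz S q e \<zeta> * x e)" if "\<zeta> \<in> nuc S" for \<zeta>
            using padj_apply[OF B(3) x that, of q j] by (simp add: padj_def mult.commute)
          then show ?thesis
            using \<theta>n by (simp add: pairing_def cplx_def \<eta>_def c_def sum.distrib sum_distrib_left distrib_right mult.assoc)
        qed
        finally show "(\<Sum>es\<in>tuples (B j) n. (\<Prod>e\<leftarrow>es. c e) * (\<Prod>e\<leftarrow>es. pairing (cplx x) (e, 0))) =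
            (\<Prod>\<theta>\<leftarrow>replicate n (\<eta> j). pairing (cplx x) \<theta>)" by (simp add: map_replicate prod_list_replicate)
      qed simp
      finally show ?thesis .
    qed
    then have lim2: "(\<lambda>j. moment (replicate n (\<eta> j))) \<longlonglongrightarrow> M n (tensor_power S n \<theta>)" using lim1 by simp
    have pq: "p \<le> q" using hs by (simp add: hs_bound_def)
    have "(\<lambda>j. moment (replicate n (\<eta> j))) \<longlonglongrightarrow> moment (replicate n \<theta>)"
    proof (rule moment_power_limit[OF eb \<theta> \<eta>])
      show "asum p (\<eta> j) \<le> asum q \<theta>" for j
        unfolding asum_def \<eta>_def fst_conv snd_conv
        using \<theta>n lnorm_proj_le(1)[OF B(1,2) nuc_level] lnorm_mono[OF pq nuc_level[OF proj_nuc[OF B(3)]]]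
        by (intro add_mono) (meson order_trans)+
      show "asum p \<theta> \<le> asum q \<theta>"
        unfolding asum_def using \<theta>n by (intro add_mono lnorm_mono[OF pq] nuc_level)
      have le: "asum p (\<eta> j - \<theta>) \<le> 1 / real (Suc j) * asum q \<theta>" for j
      proof -
        have "lnorm S p (proj q (B j) \<zeta> - \<zeta>) \<le> 1 / real (Suc j) * lnorm S q \<zeta>" if "\<zeta> \<in> nuc S" for \<zeta>
          using B(5)[OF that, of j] lnorm_minus_commute[OF nuc_level[OF that] nuc_level[OF proj_nuc[OF B(3)]]] by metis
        from add_mono[OF this[OF \<theta>n(1)] this[OF \<theta>n(2)]] show ?thesis
          by (simp add: asum_def \<eta>_def algebra_simps)
      qed
      have "(\<lambda>j. 1 / real (Suc j) * asum q \<theta>) \<longlonglongrightarrow> 0"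
        using tendsto_mult_left_zero[OF LIMSEQ_inverse_real_of_nat, of "asum q \<theta>"] by (simp add: inverse_eq_divide)
      then show "(\<lambda>j. asum p (\<eta> j - \<theta>)) \<longlonglongrightarrow> 0"
      proof (rule tendsto_sandwich[rotated 3])
        have "\<eta> j - \<theta> \<in> nucC S" for j using \<eta>[of j] \<theta> by (auto simp: nucC_def intro: nuc_diff)
        then show "\<forall>\<^sub>F j in sequentially. 0 \<le> asum p (\<eta> j - \<theta>)" by (simp add: asum_nonneg)
      qed (use le in auto)
    qed
    with lim2 show ?thesis by (rule LIMSEQ_unique)
  qed
  ultimately show ?thesis using that by blast
qed

text \<open>Termwise integration of the exponential series. With
  \<open>asum p \<theta> \<le> r / 4\<close> the factor \<open>2 / r\<close> of the moment bound
  gives a geometric majorant of ratio \<open>1 / 2\<close>.\<close>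

lemma laplace_moments:
  assumes eb: "exp_bound p r E" and \<theta>: "\<theta> \<in> nucC S" "asum p \<theta> \<le> r / 4"
  shows "(\<lambda>n. 1 / fact n * moment (replicate n \<theta>)) sums laplace \<mu> \<theta>"
    "summable (\<lambda>n. norm (1 / fact n * moment (replicate n \<theta>)))"
proof -
  note r = exp_bound_pos[OF eb]
  define f where "f n x = 1 / fact n * (\<Prod>\<theta>\<leftarrow>replicate n \<theta>. pairing (cplx x) \<theta>)" for n x
  have rep: "replicate n \<theta> \<in> tuples (nucC S) n" for n using \<theta> by (intro replicate_tuples)
  have i: "integrable \<mu> (f n)" for n
    unfolding f_def by (intro integrable_mult_right moment_bound(1)[OF eb rep])
  have a0: "0 \<le> asum p \<theta>" using \<theta> asum_nonneg by simp
  have le: "(\<integral>x. norm (f n x) \<partial>\<mu>) \<le> E * (1 / 2) ^ n" for n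
  proof -
    have "(\<integral>x. norm (f n x) \<partial>\<mu>) = 1 / fact n * (\<integral>x. cmod (\<Prod>\<theta>\<leftarrow>replicate n \<theta>. pairing (cplx x) \<theta>) \<partial>\<mu>)"
      by (simp add: f_def norm_mult norm_divide)
    also have "\<dots> \<le> 1 / fact n * (E * fact n * (2 / r) ^ n * (\<Prod>\<theta>\<leftarrow>replicate n \<theta>. asum p \<theta>))"
      using moment_bound(2)[OF eb rep] by (intro mult_left_mono) auto
    also have "\<dots> = E * (2 / r * asum p \<theta>) ^ n"
      by (simp add: map_replicate prod_list_replicate flip: power_mult_distrib)
    also have "\<dots> \<le> E * (1 / 2) ^ n"
      using r \<theta> a0 by (intro mult_left_mono power_mono) (auto simp: field_simps)
    finally show ?thesis .
  qed
  have geo: "summable (\<lambda>n. E * (1 / 2) ^ n)" by (intro summable_mult summable_geometric) auto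
  have s: "summable (\<lambda>n. \<integral>x. norm (f n x) \<partial>\<mu>)"
    by (rule summable_comparison_test'[OF geo, of 0]) (use le in \<open>auto simp: abs_of_nonneg\<close>)
  have fexp: "(\<lambda>n. f n x) sums exp (pairing (cplx x) \<theta>)" for x
    using exp_converges[of "pairing (cplx x) \<theta>"]
    by (simp add: f_def map_replicate prod_list_replicate scaleR_conv_of_real inverse_eq_divide)
  have fn: "summable (\<lambda>n. norm (f n x))" for x
    using summable_norm_exp[of "pairing (cplx x) \<theta>"]
    by (simp add: f_def map_replicate prod_list_replicate scaleR_conv_of_real inverse_eq_divide norm_mult norm_divide norm_power)
  have "(\<lambda>n. integral\<^sup>L \<mu> (f n)) sums (\<integral>x. (\<Sum>n. f n x) \<partial>\<mu>)"
    using i fn s by (intro sums_integral) auto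
  moreover have "(\<integral>x. (\<Sum>n. f n x) \<partial>\<mu>) = laplace \<mu> \<theta>"
    unfolding laplace_def using fexp sums_unique by metis
  moreover have "integral\<^sup>L \<mu> (f n) = 1 / fact n * moment (replicate n \<theta>)" for n
    unfolding f_def moment_def by (rule integral_mult_right_zero)
  ultimately show "(\<lambda>n. 1 / fact n * moment (replicate n \<theta>)) sums laplace \<mu> \<theta>" by simp
  show "summable (\<lambda>n. norm (1 / fact n * moment (replicate n \<theta>)))"
  proof (rule summable_comparison_test'[OF geo, of 0])
    fix n
    have "norm (1 / fact n * moment (replicate n \<theta>)) = norm (integral\<^sup>L \<mu> (f n))"
      unfolding f_def moment_def by simp
    also have "\<dots> \<le> (\<integral>x. norm (f n x) \<partial>\<mu>)" by (rule integral_norm_bound)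
    finally show "norm (norm (1 / fact n * moment (replicate n \<theta>))) \<le> E * (1 / 2) ^ n" using le[of n] by simp
  qed
qed


end

context nuclear_scale
begin

section \<open>The Appell kernels\<close>

lemma pairing_nucC_line_zero:
  assumes "x \<in> nuc_dual S" "\<theta> \<in> nucC S"
  shows "pairing (cplx x) (nucC_line 0 t \<theta>) = t * pairing (cplx x) \<theta>"
proof -
  obtain p where x: "x \<in> dual_level S p" using assms by (auto simp: nuc_dual_def)
  have n: "fst \<theta> \<in> nuc S" "snd \<theta> \<in> nuc S" using assms by (auto simp: nucC_def)
  show ?thesis
    using n by (simp add: pairing_def cplx_def nucC_line_def dual_diff[OF x] dual_add[OF x] dual_scale[OF x]
        nuc_scale complex_eq_iff algebra_simps)
qed

lemma nucC_line_zero: "\<theta> \<in> nucC S \<Longrightarrow> nucC_line 0 t \<theta> \<in> nucC S"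
  by (auto simp: nucC_def nucC_line_def intro!: nuc_add nuc_diff nuc_scale)

lemma tensor_power_nucC_line:
  assumes "\<theta> \<in> nucC S"
  shows "tensor_power S n (nucC_line 0 t \<theta>) = (\<lambda>xs. t ^ n * tensor_power S n \<theta> xs)"
proof
  fix xs
  show "tensor_power S n (nucC_line 0 t \<theta>) xs = t ^ n * tensor_power S n \<theta> xs"
  proof (cases "xs \<in> tuples (nuc_dual S) n")
    case True
    have "(\<Prod>x\<leftarrow>xs. pairing (cplx x) (nucC_line 0 t \<theta>)) = (\<Prod>x\<leftarrow>xs. t * pairing (cplx x) \<theta>)"
    proof (intro arg_cong[where f = prod_list] map_cong refl)
      fix x assume "x \<in> set xs"
      then have "x \<in> nuc_dual S" using True by (auto simp: tuples_def)
      then show "pairing (cplx x) (nucC_line 0 t \<theta>) = t * pairing (cplx x) \<theta>"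
        by (rule pairing_nucC_line_zero[OF _ assms])
    qed
    then show ?thesis using True prod_list_const_mult[of t _ xs] by (simp add: tensor_power_eq tuples_def)
  qed (simp add: tensor_power_outside)
qed

lemma lnormC_nucC_line:
  assumes "\<theta> \<in> nucC S"
  shows "lnormC S p (nucC_line 0 t \<theta>) \<le> 2 * cmod t * asum p \<theta>"
proof -
  define a where "a = lnorm S p (fst \<theta>)"
  define b where "b = lnorm S p (snd \<theta>)"
  have n: "fst \<theta> \<in> level S p" "snd \<theta> \<in> level S p" using assms nuc_level by (auto simp: nucC_def)
  have ab: "0 \<le> a" "0 \<le> b" using n lnorm_nonneg by (auto simp: a_def b_def)
  have 1: "lnorm S p (Re t *\<^sub>R fst \<theta> - Im t *\<^sub>R snd \<theta>) \<le> cmod t * (a + b)"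
  proof -
    have "lnorm S p (Re t *\<^sub>R fst \<theta> + (- Im t) *\<^sub>R snd \<theta>) \<le> \<bar>Re t\<bar> * a + \<bar>Im t\<bar> * b"
      using lnorm_triangle[of "Re t *\<^sub>R fst \<theta>" p "(- Im t) *\<^sub>R snd \<theta>"] n
      by (simp add: level_scale lnorm_scale a_def b_def del: scaleR_minus_left)
    also have "\<dots> \<le> cmod t * a + cmod t * b"
      using ab by (intro add_mono mult_right_mono abs_Re_le_cmod abs_Im_le_cmod)
    finally show ?thesis by (simp add: distrib_left)
  qed
  have 2: "lnorm S p (Re t *\<^sub>R snd \<theta> + Im t *\<^sub>R fst \<theta>) \<le> cmod t * (a + b)"
  proof -
    have "lnorm S p (Re t *\<^sub>R snd \<theta> + Im t *\<^sub>R fst \<theta>) \<le> \<bar>Re t\<bar> * b + \<bar>Im t\<bar> * a"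
      using lnorm_triangle[of "Re t *\<^sub>R snd \<theta>" p "Im t *\<^sub>R fst \<theta>"] n
      by (simp add: level_scale lnorm_scale a_def b_def)
    also have "\<dots> \<le> cmod t * b + cmod t * a"
      using ab by (intro add_mono mult_right_mono abs_Re_le_cmod abs_Im_le_cmod)
    finally show ?thesis by (simp add: distrib_left add.commute)
  qed
  have "lnormC S p (nucC_line 0 t \<theta>) \<le> \<bar>lnorm S p (fst (nucC_line 0 t \<theta>))\<bar> + \<bar>lnorm S p (snd (nucC_line 0 t \<theta>))\<bar>"
    unfolding lnormC_def by (rule sqrt_sum_squares_le_sum_abs)
  also have "\<dots> \<le> cmod t * (a + b) + cmod t * (a + b)"
    using 1 2 n by (intro add_mono) (auto simp: nucC_line_def abs_of_nonneg lnorm_nonneg level_diff level_add level_scale)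
  finally show ?thesis by (simp add: asum_def a_def b_def)
qed

text \<open>On the complex line through \<open>\<theta>\<close> both generating series are power
  series in \<open>t\<close> with the same sum near 0, so their coefficients, the values on tensor
  powers, agree. Continuity extends the equality to all symmetric tensors.\<close>

lemma appell_spec_unique:
  assumes P: "\<And>n. P n \<in> tensor_dual S n" and Q: "\<And>n. Q n \<in> tensor_dual S n"
    and U: "openin (nucC_topology S) U" "0 \<in> U" and V: "openin (nucC_topology S) V" "0 \<in> V"
    and sP: "\<And>\<theta>. \<theta> \<in> U \<Longrightarrow> (\<lambda>n. 1 / fact n * P n (tensor_power S n \<theta>)) sums g \<theta>"
    and sQ: "\<And>\<theta>. \<theta> \<in> V \<Longrightarrow> (\<lambda>n. 1 / fact n * Q n (tensor_power S n \<theta>)) sums g \<theta>"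
    and F: "F \<in> nuc_tensor S n"
  shows "P n F = Q n F"
proof -
  obtain p \<epsilon> where p: "\<epsilon> > 0" "{\<theta> \<in> nucC S. lnormC S p \<theta> < \<epsilon>} \<subseteq> U \<inter> V"
    by (rule nucC_neighbourhood[of "U \<inter> V", OF openin_Int[OF U(1) V(1)]]) (use U V in auto)
  have eq: "P n (tensor_power S n \<theta>) = Q n (tensor_power S n \<theta>)" if \<theta>: "\<theta> \<in> nucC S" for n \<theta>
  proof -
    define a where "a n = 1 / fact n * (P n (tensor_power S n \<theta>) - Q n (tensor_power S n \<theta>))" for n
    \<comment> \<open>By \<open>lnormC_nucC_line\<close> the multiple of \<open>\<theta>\<close> by
      \<open>t\<close> has norm at most \<open>2 * cmod t * asum p \<theta>\<close>, so
      \<open>cmod t < \<delta>\<close> keeps it in both neighbourhoods.\<close>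
    define \<delta> where "\<delta> = \<epsilon> / (2 * asum p \<theta> + 1)"
    have \<delta>: "\<delta> > 0" using p asum_nonneg[OF \<theta>, of p] by (simp add: \<delta>_def)
    have "(\<lambda>n. a n * t ^ n) sums 0" if t: "cmod t < \<delta>" for t
    proof -
      define \<eta> where "\<eta> = nucC_line 0 t \<theta>"
      have "lnormC S p \<eta> \<le> 2 * cmod t * asum p \<theta>" unfolding \<eta>_def by (rule lnormC_nucC_line[OF \<theta>])
      also have "\<dots> \<le> cmod t * (2 * asum p \<theta> + 1)" by (simp add: algebra_simps)
      also have "\<dots> < \<delta> * (2 * asum p \<theta> + 1)"
        using t asum_nonneg[OF \<theta>, of p] by (intro mult_strict_right_mono) auto
      also have "\<dots> = \<epsilon>" using asum_nonneg[OF \<theta>, of p] by (simp add: \<delta>_def)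
      finally have "\<eta> \<in> U \<inter> V" using p nucC_line_zero[OF \<theta>] by (auto simp: \<eta>_def)
      then have "(\<lambda>n. 1 / fact n * P n (tensor_power S n \<eta>) - 1 / fact n * Q n (tensor_power S n \<eta>)) sums (g \<eta> - g \<eta>)"
        using sP sQ by (intro sums_diff) auto
      moreover have "R n (tensor_power S n \<eta>) = t ^ n * R n (tensor_power S n \<theta>)"
        if "R n \<in> tensor_dual S n" for R :: "nat \<Rightarrow> 'h tensor \<Rightarrow> complex" and n
        unfolding \<eta>_def tensor_power_nucC_line[OF \<theta>]
        using dlin_scale[OF tensor_dual_dlin[OF that] tensor_power_nuc[OF \<theta>]] .
      ultimately show ?thesis using P Q by (simp add: a_def algebra_simps)
    qed
    then have "a n = 0" by (intro power_series_zero[OF \<delta>]) (auto intro: sums_summable)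
    then show ?thesis by (simp add: a_def)
  qed
  obtain p1 C1 where "dbound p1 n (P n) C1" using tensor_dual_dbound[OF P] by blast
  moreover obtain p2 C2 where "dbound p2 n (Q n) C2" using tensor_dual_dbound[OF Q] by blast
  ultimately show ?thesis
    using functional_unique[OF tensor_dual_dlin[OF P] _ tensor_dual_dlin[OF Q] _ eq F] by blast
qed

definition appell_fun :: "(nat \<Rightarrow> 'h tensor \<Rightarrow> complex) \<Rightarrow> ('h \<Rightarrow> real) \<Rightarrow> nat \<Rightarrow> 'h tensor \<Rightarrow> complex" where
  "appell_fun a x n F = (\<Sum>k\<le>n. of_nat (n choose k) * contr k (a (n - k)) F (replicate k x))"

lemma appell_fun_tensor_dual:
  assumes a: "functional_seq p K r a" and x: "x \<in> nuc_dual S"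
  shows "appell_fun a x n \<in> tensor_dual S n"
proof -
  obtain q where q: "p \<le> q" "x \<in> dual_level S q" using nuc_dual_levelE[OF x] by blast
  have l: "dlin n (\<lambda>F. contr k (a (n - k)) F (replicate k x))" if k: "k \<le> n" for k
    unfolding dlin_def
    using contr_lincomb[of _ k "n - k" _ "a (n - k)"] functional_seq_dlin[OF a] k by simp
  have b: "dbound q n (\<lambda>F. contr k (a (n - k)) F (replicate k x)) (K * r ^ (n - k) * fact (n - k) * dnorm S q x ^ k)"
    if k: "k \<le> n" for k
    unfolding dbound_def
  proof (intro conjI ballI allI impI)
    have K: "0 \<le> K" "0 \<le> r" using a by (auto simp: functional_seq_def)
    then show "0 \<le> K * r ^ (n - k) * fact (n - k) * dnorm S q x ^ k" using dnorm_nonneg[OF q(2)] by simp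
    fix F M assume F: "F \<in> nuc_tensor S n" "0 \<le> M" "tbound q n F M"
    have "tbound q k (contr k (a (n - k)) F) (K * r ^ (n - k) * fact (n - k) * M)"
      using contr_tbound[of F k "n - k" q "a (n - k)" _ M] functional_seq_dbound[OF a q(1)] F k by simp
    from tboundD[OF this replicate_tuples[OF q(2)]]
    show "cmod (contr k (a (n - k)) F (replicate k x)) \<le> K * r ^ (n - k) * fact (n - k) * dnorm S q x ^ k * M"
      by (simp add: map_replicate prod_list_replicate mult_ac)
  qed
  show ?thesis
  proof (rule tensor_dualI)
    show "dlin n (appell_fun a x n)"
      unfolding appell_fun_def by (rule dlin_sum_functional) (simp add: l)
    show "dbound q n (appell_fun a x n) (\<Sum>k\<le>n. cmod (of_nat (n choose k)) * (K * r ^ (n - k) * fact (n - k) * dnorm S q x ^ k))"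
      unfolding appell_fun_def by (rule dbound_sum_functional) (simp add: b)
  qed
qed

lemma functional_seq_power_summable:
  assumes a: "functional_seq p K r a" and \<theta>: "\<theta> \<in> nucC S" "r * asum p \<theta> < 1"
  shows "summable (\<lambda>n. norm (1 / fact n * a n (tensor_power S n \<theta>)))"
proof (rule summable_comparison_test'[of "\<lambda>n. K * (r * asum p \<theta>) ^ n" 0])
  have K: "0 \<le> K" "0 \<le> r" using a by (auto simp: functional_seq_def)
  have a0: "0 \<le> asum p \<theta>" using \<theta> asum_nonneg by simp
  show "summable (\<lambda>n. K * (r * asum p \<theta>) ^ n)"
    using K a0 \<theta> by (intro summable_mult summable_geometric) auto
  fix n
  have "cmod (a n (tensor_power S n \<theta>)) \<le> K * r ^ n * fact n * asum p \<theta> ^ n"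
    using tensor_power_tbound[OF \<theta>(1), of p n] a0
    by (intro dboundD[OF functional_seq_dbound[OF a order_refl] tensor_power_nuc[OF \<theta>(1)]]) (auto simp: asum_def)
  then show "norm (norm (1 / fact n * a n (tensor_power S n \<theta>))) \<le> K * (r * asum p \<theta>) ^ n"
    by (simp add: norm_mult norm_divide power_mult_distrib field_simps)
qed

end

section \<open>Identification of the Appell kernels of the measure\<close>

context analytic_measure
begin

text \<open>On tensor powers convolution is the Cauchy product of generating series, so the series
  of \<open>inv_seq c\<close> sums to \<open>1 / laplace \<mu> \<theta>\<close>. A further Cauchy
  product with the exponential series shows that \<open>appell_fun\<close> meets the specification
  in \<open>appell\<close>, and uniqueness identifies it with the chosen kernels.\<close>

lemma appell_representation:
  obtains c p K r where "functional_seq p K r c" "\<And>F. F \<in> nuc_tensor S 0 \<Longrightarrow> c 0 F = F []"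
    "\<And>x n F. x \<in> nuc_dual S \<Longrightarrow> F \<in> nuc_tensor S n \<Longrightarrow>
      appell S \<mu> (cplx x) n F = appell_fun (inv_seq c) x n F"
proof -
  obtain p0 r0 E where eb: "exp_bound p0 r0 E" using exp_bound_exists by blast
  note r0 = exp_bound_pos[OF eb]
  obtain c p K r where c: "functional_seq p K r c" "\<And>F. F \<in> nuc_tensor S 0 \<Longrightarrow> c 0 F = F []"
    "\<And>n \<theta>. \<theta> \<in> nucC S \<Longrightarrow> c n (tensor_power S n \<theta>) = moment (replicate n \<theta>)"
    by (rule moment_functionals, rule that)
  define a where "a = inv_seq c"
  define \<rho> where "\<rho> = r * (1 + K)"
  have a: "functional_seq p 1 \<rho> a" unfolding a_def \<rho>_def by (rule functional_seq_inv_seq[OF c(1)])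
  have \<rho>: "0 \<le> \<rho>" using a by (simp add: functional_seq_def)
  define q where "q = max p p0"
  \<comment> \<open>Since \<open>asum\<close> is at most \<open>2 * lnormC\<close>, the first term
    gives \<open>asum p0 \<theta> \<le> r0 / 4\<close>, as \<open>laplace_moments\<close> requires,
    and the second gives \<open>\<rho> * asum p \<theta> < 1\<close>.\<close>
  define \<epsilon> where "\<epsilon> = min (r0 / 8) (1 / (2 * \<rho> + 2))"
  have \<epsilon>: "\<epsilon> > 0" using r0 \<rho> by (simp add: \<epsilon>_def)
  define U where "U = {\<theta> \<in> nucC S. lnormC S q \<theta> < \<epsilon>}"
  have U: "openin (nucC_topology S) U" "0 \<in> U"
    using openin_nucC_ball[OF \<epsilon>] \<epsilon> zero_nucC by (auto simp: U_def lnormC_def)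
  have inv: "(\<lambda>n. 1 / fact n * a n (tensor_power S n \<theta>)) sums (1 / laplace \<mu> \<theta>)"
    and abs: "summable (\<lambda>n. norm (1 / fact n * a n (tensor_power S n \<theta>)))" if "\<theta> \<in> U" for \<theta>
  proof -
    have \<theta>: "\<theta> \<in> nucC S" "lnormC S q \<theta> < \<epsilon>" using that by (auto simp: U_def)
    have mono: "asum p' \<theta> \<le> asum q \<theta>" if "p' \<le> q" for p'
      unfolding asum_def using \<theta>(1) that by (intro add_mono lnorm_mono nuc_level) (auto simp: nucC_def)
    have aq: "asum q \<theta> < 2 * \<epsilon>" using asum_le_lnormC[of q \<theta>] \<theta> by simp
    have "asum p0 \<theta> \<le> r0 / 4" using mono[of p0] aq by (auto simp: q_def \<epsilon>_def)
    note lap = laplace_moments[OF eb \<theta>(1) this]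
    have "asum p \<theta> \<le> 2 * \<epsilon>" using mono[of p] aq by (auto simp: q_def)
    then have "\<rho> * asum p \<theta> \<le> \<rho> * (2 * (1 / (2 * \<rho> + 2)))"
      using \<rho> by (intro mult_left_mono) (auto simp: \<epsilon>_def)
    also have "\<dots> < 1" using \<rho> by (simp add: field_simps)
    finally show abs: "summable (\<lambda>n. norm (1 / fact n * a n (tensor_power S n \<theta>)))"
      by (rule functional_seq_power_summable[OF a \<theta>(1)])
    have "(\<Sum>m\<le>n. (1 / fact m * a m (tensor_power S m \<theta>)) * (1 / fact (n - m) * moment (replicate (n - m) \<theta>)))
        = (if n = 0 then 1 else 0)" for n
    proof -
      have "(\<Sum>m\<le>n. (1 / fact m * a m (tensor_power S m \<theta>)) * (1 / fact (n - m) * moment (replicate (n - m) \<theta>)))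
        = (\<Sum>m\<le>n. 1 / fact n * (of_nat (n choose m) * a m (contr m (c (n - m)) (tensor_power S n \<theta>))))"
      proof (rule sum.cong)
        fix m assume m: "m \<in> {..n}"
        have "a m (contr m (c (n - m)) (tensor_power S n \<theta>)) =
            a m (tensor_power S m \<theta>) * moment (replicate (n - m) \<theta>)"
          using comp_contr_tensor_power[OF \<theta>(1) functional_seq_dlin[OF a] functional_seq_dlin[OF c(1)], of m "n - m"]
            c(3)[OF \<theta>(1)] m by simp
        moreover have "of_nat (n choose m) = (fact n / (fact m * fact (n - m)) :: complex)"
          using m by (simp add: binomial_fact)
        ultimately show "(1 / fact m * a m (tensor_power S m \<theta>)) * (1 / fact (n - m) * moment (replicate (n - m) \<theta>))
          = 1 / fact n * (of_nat (n choose m) * a m (contr m (c (n - m)) (tensor_power S n \<theta>)))" by simp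
      qed simp
      also have "\<dots> = 1 / fact n * (if n = 0 then tensor_power S n \<theta> [] else 0)"
        unfolding sum_distrib_left[symmetric] a_def
        using inv_seq_left[OF c(1,2) tensor_power_nuc[OF \<theta>(1)], of n] by (simp only:)
      finally show ?thesis by (simp add: tensor_power_def)
    qed
    then have "(\<lambda>n. if n = 0 then 1 else 0) sums
        ((\<Sum>n. 1 / fact n * a n (tensor_power S n \<theta>)) * (\<Sum>n. 1 / fact n * moment (replicate n \<theta>)))"
      using Cauchy_product_sums[OF abs lap(2)] by simp
    moreover have "(\<lambda>n. if n = 0 then 1 else 0) sums (1 :: complex)"
      using sums_single[of 0 "\<lambda>_. 1 :: complex"] by simp
    ultimately have "(\<Sum>n. 1 / fact n * a n (tensor_power S n \<theta>)) * (\<Sum>n. 1 / fact n * moment (replicate n \<theta>)) = 1"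
      by (rule sums_unique2)
    then have "(\<Sum>n. 1 / fact n * a n (tensor_power S n \<theta>)) * laplace \<mu> \<theta> = 1"
      unfolding sums_unique[OF lap(1), symmetric] .
    \<comment> \<open>The product being 1, the Laplace transform has no zero on \<open>U\<close>;
      this is a by-product of the inversion.\<close>
    then have "(\<Sum>n. 1 / fact n * a n (tensor_power S n \<theta>)) = 1 / laplace \<mu> \<theta>"
      by (cases "laplace \<mu> \<theta> = 0") (simp_all add: eq_divide_eq)
    then show "(\<lambda>n. 1 / fact n * a n (tensor_power S n \<theta>)) sums (1 / laplace \<mu> \<theta>)"
      using summable_sums[OF summable_norm_cancel[OF abs]] by simp
  qed
  have gen: "(\<lambda>n. 1 / fact n * appell_fun a x n (tensor_power S n \<theta>)) sums (exp (pairing (cplx x) \<theta>) / laplace \<mu> \<theta>)"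
    if x: "x \<in> nuc_dual S" and \<theta>U: "\<theta> \<in> U" for x \<theta>
  proof -
    have \<theta>: "\<theta> \<in> nucC S" using \<theta>U by (simp add: U_def)
    define w where "w = pairing (cplx x) \<theta>"
    have ex: "(\<lambda>n. w ^ n / fact n) sums exp w"
      using exp_converges[of w] by (simp add: scaleR_conv_of_real inverse_eq_divide)
    have exn: "summable (\<lambda>n. norm (w ^ n / fact n))"
      using summable_norm_exp[of w] by (simp add: scaleR_conv_of_real inverse_eq_divide norm_mult norm_divide norm_power)
    have "1 / fact n * appell_fun a x n (tensor_power S n \<theta>) =
        (\<Sum>k\<le>n. (w ^ k / fact k) * (1 / fact (n - k) * a (n - k) (tensor_power S (n - k) \<theta>)))" for n
      unfolding appell_fun_def sum_distrib_left
    proof (rule sum.cong)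
      fix k assume k: "k \<in> {..n}"
      have "contr k (a (n - k)) (tensor_power S n \<theta>) (replicate k x) =
          a (n - k) (tensor_power S (n - k) \<theta>) * w ^ k"
        using contr_tensor_power[OF \<theta> functional_seq_dlin[OF a], of k "n - k"] k replicate_tuples[OF x, of k]
        by (simp add: tensor_power_eq map_replicate prod_list_replicate w_def)
      moreover have "of_nat (n choose k) = (fact n / (fact k * fact (n - k)) :: complex)"
        using k by (simp add: binomial_fact)
      ultimately show "1 / fact n * (of_nat (n choose k) * contr k (a (n - k)) (tensor_power S n \<theta>) (replicate k x)) =
          (w ^ k / fact k) * (1 / fact (n - k) * a (n - k) (tensor_power S (n - k) \<theta>))" by simp
    qed simp
    then have "(\<lambda>n. 1 / fact n * appell_fun a x n (tensor_power S n \<theta>)) sums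
        ((\<Sum>n. w ^ n / fact n) * (\<Sum>n. 1 / fact n * a n (tensor_power S n \<theta>)))"
      using Cauchy_product_sums[OF exn abs[OF \<theta>U]] by (simp only:)
    then show ?thesis
      unfolding sums_unique[OF ex, symmetric] sums_unique[OF inv[OF \<theta>U], symmetric] by (simp add: w_def)
  qed
  have "appell S \<mu> (cplx x) n F = appell_fun a x n F" if x: "x \<in> nuc_dual S" and F: "F \<in> nuc_tensor S n" for x n F
  proof -
    let ?spec = "\<lambda>P. (\<forall>n. P n \<in> tensor_dual S n) \<and>
     (\<exists>U. openin (nucC_topology S) U \<and> 0 \<in> U \<and>
          (\<forall>\<theta>\<in>U. (\<lambda>n. 1 / fact n * P n (tensor_power S n \<theta>)) sums
                     (exp (pairing (cplx x) \<theta>) / laplace \<mu> \<theta>)))"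
    have "?spec (appell_fun a x)"
      using appell_fun_tensor_dual[OF a x] U gen[OF x] by blast
    then have "?spec (appell S \<mu> (cplx x))" unfolding appell_def by (rule someI[where P = ?spec])
    then obtain V where V: "openin (nucC_topology S) V" "0 \<in> V"
      "\<And>\<theta>. \<theta> \<in> V \<Longrightarrow> (\<lambda>n. 1 / fact n * appell S \<mu> (cplx x) n (tensor_power S n \<theta>)) sums
         (exp (pairing (cplx x) \<theta>) / laplace \<mu> \<theta>)" and ap: "\<And>n. appell S \<mu> (cplx x) n \<in> tensor_dual S n" by blast
    show ?thesis
      by (rule appell_spec_unique[OF ap appell_fun_tensor_dual[OF a x] V(1,2) U V(3) gen[OF x] F])
  qed
  then show ?thesis using that c(1,2) unfolding a_def by blast
qed

end

section \<open>Separately holomorphic functions of two variables\<close>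

text \<open>The second derivative on the unit disc is at most \<open>2 * M\<close> by Cauchy's
  inequality on circles of radius 1, which stay inside the disc of radius 2.\<close>

lemma Taylor_remainder_entire:
  assumes hol: "f holomorphic_on UNIV" and M: "\<And>s. cmod s \<le> 2 \<Longrightarrow> cmod (f s) \<le> M" and h: "cmod h \<le> 1"
  shows "cmod (f h - f 0 - deriv f 0 * h) \<le> 2 * M * (cmod h)\<^sup>2"
proof -
  have "cmod ((deriv ^^ 0) f h - (\<Sum>i\<le>1. (deriv ^^ i) f 0 * (h - 0) ^ i / fact i)) \<le> 2 * M * cmod (h - 0) ^ Suc 1 / fact 1"
  proof (rule complex_Taylor[of "cball 0 1" 1 "\<lambda>i. (deriv ^^ i) f"])
    fix i x
    show "((deriv ^^ i) f has_field_derivative (deriv ^^ Suc i) f x) (at x within cball 0 1)"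
      using holomorphic_derivI[OF holomorphic_higher_deriv[OF hol open_UNIV] open_UNIV, of x i]
      by (auto intro: has_field_derivative_at_within)
  next
    fix x :: complex assume x: "x \<in> cball 0 1"
    have "cmod ((deriv ^^ 2) f x) \<le> fact 2 * M / 1 ^ 2"
    proof (rule Cauchy_inequality)
      show "cmod (f y) \<le> M" if "cmod (x - y) = 1" for y
        using x that norm_triangle_sub[of y x] by (intro M) (auto simp: norm_minus_commute)
    qed (use hol in \<open>auto intro: holomorphic_on_subset holomorphic_on_imp_continuous_on\<close>)
    then show "cmod ((deriv ^^ Suc 1) f x) \<le> 2 * M" by (simp add: numeral_2_eq_2)
  qed (use h in auto)
  then show ?thesis by (simp add: power2_eq_square diff_diff_eq)
qed

text \<open>Restrictions of an entire function on a dual level to points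
  \<open>z + s v + t w\<close> have these properties. Separate holomorphy with bounds on bidiscs is
  enough to differentiate in one variable uniformly in the other.\<close>

locale two_holomorphic =
  fixes g :: "complex \<Rightarrow> complex \<Rightarrow> complex"
  assumes hol1: "\<And>t. (\<lambda>s. g s t) holomorphic_on UNIV" and hol2: "\<And>s. g s holomorphic_on UNIV"
    and bdd: "\<And>R. \<exists>M. \<forall>s t. cmod s \<le> R \<longrightarrow> cmod t \<le> R \<longrightarrow> cmod (g s t) \<le> M"
begin

lemma remainder_uniform:
  assumes "2 \<le> R"
  obtains C where "0 \<le> C" "\<And>h t. cmod h \<le> 1 \<Longrightarrow> cmod t \<le> R \<Longrightarrow>
    cmod (g h t - g 0 t - deriv (\<lambda>s. g s t) 0 * h) \<le> C * (cmod h)\<^sup>2"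
proof -
  obtain M where M: "\<And>s t. cmod s \<le> R \<Longrightarrow> cmod t \<le> R \<Longrightarrow> cmod (g s t) \<le> M" using bdd by blast
  have "0 \<le> M" using order_trans[OF norm_ge_zero M[of 0 0]] assms by simp
  show ?thesis
  proof (rule that[of "2 * M"])
    show "cmod (g h t - g 0 t - deriv (\<lambda>s. g s t) 0 * h) \<le> 2 * M * (cmod h)\<^sup>2"
      if "cmod h \<le> 1" "cmod t \<le> R" for h t
      using that assms M by (intro Taylor_remainder_entire hol1) auto
  qed (use \<open>0 \<le> M\<close> in simp)
qed

text \<open>Difference quotients in the first variable for the steps \<open>1 / Suc k\<close>; a
  sequence of entire functions, so that convergence theorems for holomorphic functions
  apply.\<close>

definition quot :: "nat \<Rightarrow> complex \<Rightarrow> complex" where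
  "quot k t = (g (of_real (1 / real (Suc k))) t - g 0 t) * of_nat (Suc k)"

lemma quot_holomorphic: "quot k holomorphic_on UNIV"
  unfolding quot_def by (intro holomorphic_intros hol2)

lemma quot_uniform_limit: "uniform_limit (cball 0 R) quot (\<lambda>t. deriv (\<lambda>s. g s t) 0) sequentially"
proof -
  obtain C where C: "0 \<le> C" "\<And>h t. cmod h \<le> 1 \<Longrightarrow> cmod t \<le> max 2 R \<Longrightarrow>
    cmod (g h t - g 0 t - deriv (\<lambda>s. g s t) 0 * h) \<le> C * (cmod h)\<^sup>2"
    using remainder_uniform[of "max 2 R"] by auto
  have le: "cmod (quot k t - deriv (\<lambda>s. g s t) 0) \<le> C * (1 / real (Suc k))" if t: "t \<in> cball 0 R" for k t
  proof -
    define h where "h = (of_real (1 / real (Suc k)) :: complex)"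
    have ch: "cmod h = 1 / real (Suc k)" by (simp only: h_def norm_of_real) simp
    have hk: "h * of_nat (Suc k) = 1" by (simp add: h_def del: of_nat_Suc)
    have "quot k t - deriv (\<lambda>s. g s t) 0 = (g h t - g 0 t - deriv (\<lambda>s. g s t) 0 * h) * of_nat (Suc k)"
      unfolding quot_def h_def[symmetric] using hk by (simp add: left_diff_distrib mult.assoc del: of_nat_Suc)
    then have "cmod (quot k t - deriv (\<lambda>s. g s t) 0) =
        cmod (g h t - g 0 t - deriv (\<lambda>s. g s t) 0 * h) * real (Suc k)" by (simp add: norm_mult del: of_nat_Suc)
    also have "\<dots> \<le> C * (cmod h)\<^sup>2 * real (Suc k)"
      using t by (intro mult_right_mono C) (auto simp: ch)
    also have "\<dots> = C * (1 / real (Suc k))" unfolding ch by (simp add: power2_eq_square del: of_nat_Suc)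
    finally show ?thesis .
  qed
  show ?thesis
  proof (rule uniform_limitI)
    fix e :: real assume e: "e > 0"
    have "(\<lambda>k. C * (1 / real (Suc k))) \<longlonglongrightarrow> 0"
      using tendsto_mult_right_zero[OF LIMSEQ_inverse_real_of_nat, of C] by (simp add: inverse_eq_divide)
    then have "\<forall>\<^sub>F k in sequentially. C * (1 / real (Suc k)) < e" by (rule order_tendstoD(2)[OF _ e])
    then show "\<forall>\<^sub>F k in sequentially. \<forall>t\<in>cball 0 R. dist (quot k t) (deriv (\<lambda>s. g s t) 0) < e"
    proof eventually_elim
      case (elim k)
      then show ?case using le[of _ k] unfolding dist_norm by (blast intro: le_less_trans)
    qed
  qed
qed

lemma deriv_first_holomorphic: "(\<lambda>t. deriv (\<lambda>s. g s t) 0) holomorphic_on UNIV"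
proof (rule holomorphic_uniform_sequence[OF open_UNIV quot_holomorphic])
  fix x :: complex
  have "cball x 1 \<subseteq> cball 0 (cmod x + 1)" by (simp add: cball_subset_cball_iff)
  then have "uniform_limit (cball x 1) quot (\<lambda>t. deriv (\<lambda>s. g s t) 0) sequentially"
    using quot_uniform_limit uniform_limit_on_subset by blast
  then show "\<exists>d. 0 < d \<and> cball x d \<subseteq> UNIV \<and> uniform_limit (cball x d) quot (\<lambda>t. deriv (\<lambda>s. g s t) 0) sequentially"
    by (intro exI[of _ 1]) auto
qed

lemma two_holomorphic_swap: "two_holomorphic (\<lambda>s t. g t s)"
  using hol1 hol2 bdd by unfold_locales (auto, meson)

text \<open>The derivatives of \<open>quot k\<close> at 0 have two limits: locally uniform
  convergence yields the mixed derivative in one order, while each of them is a difference quotient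
  of \<open>T\<close>, which yields the other order.\<close>

lemma deriv_commute:
  "deriv (\<lambda>t. deriv (\<lambda>s. g s t) 0) 0 = deriv (\<lambda>s. deriv (\<lambda>t. g s t) 0) 0"
proof -
  interpret sw: two_holomorphic "\<lambda>s t. g t s" by (rule two_holomorphic_swap)
  define T where "T s = deriv (g s) 0" for s
  have "T holomorphic_on UNIV" unfolding T_def using sw.deriv_first_holomorphic by simp
  then have "(T has_field_derivative deriv T 0) (at 0)" by (rule holomorphic_derivI) auto
  then have "((\<lambda>h. (T h - T 0) / h) \<longlongrightarrow> deriv T 0) (at 0)" by (simp add: DERIV_def)
  moreover have "filterlim (\<lambda>k. of_real (1 / real (Suc k)) :: complex) (at 0) sequentially"
  proof (rule filterlim_atI)
    show "(\<lambda>k. of_real (1 / real (Suc k)) :: complex) \<longlonglongrightarrow> 0"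
      using tendsto_of_real[OF LIMSEQ_inverse_real_of_nat, where 'a = complex] by (simp add: inverse_eq_divide)
  qed (auto intro!: always_eventually simp del: of_nat_Suc)
  ultimately have "(\<lambda>k. (T (of_real (1 / real (Suc k))) - T 0) / of_real (1 / real (Suc k))) \<longlonglongrightarrow> deriv T 0"
    by (rule filterlim_compose)
  moreover have "(T (of_real (1 / real (Suc k))) - T 0) / of_real (1 / real (Suc k)) = deriv (quot k) 0" for k
  proof -
    have d: "(g s has_field_derivative T s) (at 0)" for s
      unfolding T_def using hol2 by (intro holomorphic_derivI[of _ UNIV]) auto
    have "(quot k has_field_derivative (T (of_real (1 / real (Suc k))) - T 0) * of_nat (Suc k)) (at 0)"
      unfolding quot_def by (intro DERIV_cmult_right DERIV_diff d)
    then show ?thesis by (simp add: DERIV_imp_deriv del: of_nat_Suc)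
  qed
  ultimately have "(\<lambda>k. deriv (quot k) 0) \<longlonglongrightarrow> deriv T 0" by simp
  moreover have "(\<lambda>k. (deriv ^^ 1) (quot k) 0) \<longlonglongrightarrow> (deriv ^^ 1) (\<lambda>t. deriv (\<lambda>s. g s t) 0) 0"
    by (rule higher_deriv_complex_uniform_limit[where A = "ball 0 1"])
      (use quot_holomorphic quot_uniform_limit[of 1] in
        \<open>auto intro: uniform_limit_on_subset holomorphic_on_subset always_eventually\<close>)
  ultimately show ?thesis unfolding T_def by (simp add: LIMSEQ_unique)
qed

text \<open>Chain rule at the origin. \<open>g\<close> is expanded in its first variable around
  \<open>(0, b * t)\<close>; as the quadratic remainder is uniform in the second variable, it has
  derivative 0 at \<open>t = 0\<close>.\<close>

lemma deriv_line:
  "deriv (\<lambda>t. g (a * t) (b * t)) 0 = a * deriv (\<lambda>s. g s 0) 0 + b * deriv (g 0) 0"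
proof -
  define D where "D t = deriv (\<lambda>s. g s t) 0" for t
  have Dh: "D holomorphic_on UNIV" unfolding D_def by (rule deriv_first_holomorphic)
  \<comment> \<open>For \<open>cmod t \<le> \<delta>\<close> both \<open>a * t\<close> and
    \<open>b * t\<close> stay in the discs where the remainder estimate holds.\<close>
  define \<delta> where "\<delta> = 1 / (cmod a + cmod b + 1)"
  have \<delta>: "\<delta> > 0" by (simp add: \<delta>_def add_nonneg_pos)
  obtain C where C: "0 \<le> C" "\<And>h t. cmod h \<le> 1 \<Longrightarrow> cmod t \<le> 2 \<Longrightarrow>
    cmod (g h t - g 0 t - D t * h) \<le> C * (cmod h)\<^sup>2"
    using remainder_uniform[of 2] unfolding D_def by auto
  define r where "r t = g (a * t) (b * t) - g 0 (b * t) - D (b * t) * (a * t)" for t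
  have r: "cmod (r t) \<le> C * (cmod a)\<^sup>2 * (cmod t)\<^sup>2" if t: "cmod t \<le> \<delta>" for t
  proof -
    have "cmod a * cmod t \<le> cmod a * \<delta>" "cmod b * cmod t \<le> cmod b * \<delta>" using t by (auto intro: mult_left_mono)
    moreover have "cmod a * \<delta> \<le> 1" "cmod b * \<delta> \<le> 1"
      by (auto simp: \<delta>_def divide_le_eq add_nonneg_pos add_pos_nonneg)
    ultimately have "cmod (a * t) \<le> 1" "cmod (b * t) \<le> 2" by (auto simp: norm_mult)
    from C(2)[OF this] show ?thesis unfolding r_def by (simp add: norm_mult power_mult_distrib mult_ac)
  qed
  have "(r has_field_derivative 0) (at 0)"
    unfolding DERIV_def
  proof (rule Lim_null_comparison)
    have "r 0 = 0" using r[of 0] \<delta> by simp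
    have "\<forall>\<^sub>F h in at 0. cmod h < \<delta>" using \<delta> unfolding eventually_at by (auto intro!: exI[of _ \<delta>])
    moreover have "\<forall>\<^sub>F h in at 0. h \<noteq> (0::complex)" by (simp add: eventually_at_filter)
    ultimately show "\<forall>\<^sub>F h in at 0. norm ((r (0 + h) - r 0) / h) \<le> C * (cmod a)\<^sup>2 * cmod h"
    proof eventually_elim
      case (elim h)
      have "cmod (r h) \<le> C * (cmod a)\<^sup>2 * (cmod h)\<^sup>2" using elim by (intro r) simp
      then show ?case using elim \<open>r 0 = 0\<close> by (simp add: norm_divide divide_le_eq power2_eq_square mult.assoc)
    qed
    show "((\<lambda>h. C * (cmod a)\<^sup>2 * cmod h) \<longlongrightarrow> 0) (at 0)"
      by (intro tendsto_mult_right_zero tendsto_norm_zero tendsto_ident_at)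
  qed
  moreover have "((\<lambda>t. D (b * t) * (a * t)) has_field_derivative D (b * 0) * a) (at 0)"
  proof -
    have "(D has_field_derivative deriv D (b * 0)) (at (b * 0))" using Dh by (rule holomorphic_derivI) auto
    then have "((\<lambda>t. D (b * t)) has_field_derivative deriv D (b * 0) * b) (at 0)"
      by (rule DERIV_chain2) (auto intro!: derivative_eq_intros)
    then show ?thesis by (rule DERIV_cong[OF DERIV_mult, of _ _ 0 UNIV "\<lambda>t. a * t" a]) (auto intro!: derivative_eq_intros)
  qed
  moreover have "((\<lambda>t. g 0 (b * t)) has_field_derivative deriv (g 0) (b * 0) * b) (at 0)"
  proof (rule DERIV_chain2[where f = "g 0" and g = "\<lambda>t. b * t"])
    show "(g 0 has_field_derivative deriv (g 0) (b * 0)) (at (b * 0))" using hol2 by (rule holomorphic_derivI) auto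
  qed (auto intro!: derivative_eq_intros)
  ultimately have "((\<lambda>t. r t + D (b * t) * (a * t) + g 0 (b * t)) has_field_derivative
      0 + D (b * 0) * a + deriv (g 0) (b * 0) * b) (at 0)" by (intro DERIV_add)
  then have "((\<lambda>t. g (a * t) (b * t)) has_field_derivative a * D 0 + b * deriv (g 0) 0) (at 0)"
    by (simp add: r_def mult.commute)
  then show ?thesis by (simp add: DERIV_imp_deriv D_def)
qed

end

context nuclear_scale
begin

section \<open>The complexified dual levels\<close>

definition reD :: "('h \<Rightarrow> complex) \<Rightarrow> 'h \<Rightarrow> real" where "reD z = (\<lambda>\<theta>. Re (z \<theta>))"
definition imD :: "('h \<Rightarrow> complex) \<Rightarrow> 'h \<Rightarrow> real" where "imD z = (\<lambda>\<theta>. Im (z \<theta>))"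

lemma dual_levelC_iff: "z \<in> dual_levelC S p \<longleftrightarrow> reD z \<in> dual_level S p \<and> imD z \<in> dual_level S p"
  by (simp add: dual_levelC_def reD_def imD_def)

lemma dnormC_eq: "dnormC S p z = sqrt ((dnorm S p (reD z))\<^sup>2 + (dnorm S p (imD z))\<^sup>2)"
  by (simp add: dnormC_def reD_def imD_def)

lemma dnormC_nonneg: "0 \<le> dnormC S p z"
  by (simp add: dnormC_eq)

lemma dnorm_le_dnormC: "dnorm S p (reD z) \<le> dnormC S p z" "dnorm S p (imD z) \<le> dnormC S p z"
  unfolding dnormC_eq by (rule real_le_rsqrt; simp)+

lemma reD_line: "reD (dualC_line z t w) = (\<lambda>\<theta>. reD z \<theta> + (Re t * reD w \<theta> + (- Im t) * imD w \<theta>))"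
  by (simp add: reD_def imD_def dualC_line_def fun_eq_iff)

lemma imD_line: "imD (dualC_line z t w) = (\<lambda>\<theta>. imD z \<theta> + (Re t * imD w \<theta> + Im t * reD w \<theta>))"
  by (simp add: reD_def imD_def dualC_line_def fun_eq_iff)

lemma dualC_line_level:
  "z \<in> dual_levelC S p \<Longrightarrow> w \<in> dual_levelC S p \<Longrightarrow> dualC_line z t w \<in> dual_levelC S p"
  unfolding dual_levelC_iff reD_line imD_line by (intro conjI dual_level_add dual_level_comb) auto

lemma reD_cplx [simp]: "reD (cplx x) = x" and imD_cplx [simp]: "imD (cplx x) = (\<lambda>\<theta>. 0)"
  by (simp_all add: reD_def imD_def cplx_def)

lemma cplx_level: "x \<in> dual_level S p \<Longrightarrow> cplx x \<in> dual_levelC S p"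
  by (simp add: dual_levelC_iff dual_level_zero)

lemma dnorm_add_le:
  "x \<in> dual_level S p \<Longrightarrow> y \<in> dual_level S p \<Longrightarrow> dnorm S p (\<lambda>\<theta>. x \<theta> + y \<theta>) \<le> dnorm S p x + dnorm S p y"
  using dnorm_comb[of x p y 1 1] by simp

text \<open>The factor 2 comes from estimating real and imaginary part of the complex multiple
  separately. For a real direction \<open>dnormC_line_cplx_le\<close> has factor 1, which is what
  Cauchy's estimate for directional derivatives uses.\<close>

lemma dnormC_line_le:
  assumes z: "z \<in> dual_levelC S p" and w: "w \<in> dual_levelC S p"
  shows "dnormC S p (dualC_line z t w) \<le> dnormC S p z + 2 * cmod t * dnormC S p w"
proof -
  define a where "a = dnorm S p (reD w)"
  define b where "b = dnorm S p (imD w)"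
  have l: "reD z \<in> dual_level S p" "imD z \<in> dual_level S p" "reD w \<in> dual_level S p" "imD w \<in> dual_level S p"
    using z w by (auto simp: dual_levelC_iff)
  have ab: "0 \<le> a" "0 \<le> b" "a \<le> dnormC S p w" "b \<le> dnormC S p w"
    using l dnorm_nonneg dnorm_le_dnormC by (auto simp: a_def b_def)
  have dn: "0 \<le> dnorm S p (reD (dualC_line z t w))" "0 \<le> dnorm S p (imD (dualC_line z t w))"
    using dualC_line_level[OF z w] dnorm_nonneg by (auto simp: dual_levelC_iff)
  have re: "dnorm S p (reD (dualC_line z t w)) \<le> dnorm S p (reD z) + (\<bar>Re t\<bar> * a + \<bar>Im t\<bar> * b)"
    unfolding reD_line a_def b_def
    using dnorm_comb[OF l(3,4), of "Re t" "- Im t"] dnorm_add_le[OF l(1) dual_level_comb[OF l(3,4), of "Re t" "- Im t"]]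
    by simp
  have im: "dnorm S p (imD (dualC_line z t w)) \<le> dnorm S p (imD z) + (\<bar>Re t\<bar> * b + \<bar>Im t\<bar> * a)"
    unfolding imD_line a_def b_def
    using dnorm_comb[OF l(4,3), of "Re t" "Im t"] dnorm_add_le[OF l(2) dual_level_comb[OF l(4,3), of "Re t" "Im t"]]
    by simp
  have "dnormC S p (dualC_line z t w) \<le> sqrt ((dnorm S p (reD z) + (\<bar>Re t\<bar> * a + \<bar>Im t\<bar> * b))\<^sup>2
      + (dnorm S p (imD z) + (\<bar>Re t\<bar> * b + \<bar>Im t\<bar> * a))\<^sup>2)"
    unfolding dnormC_eq using re im dn by (intro real_sqrt_le_mono add_mono power_mono) auto
  also have "\<dots> \<le> dnormC S p z + sqrt ((\<bar>Re t\<bar> * a + \<bar>Im t\<bar> * b)\<^sup>2 + (\<bar>Re t\<bar> * b + \<bar>Im t\<bar> * a)\<^sup>2)"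
    unfolding dnormC_eq by (rule real_sqrt_sum_squares_triangle_ineq)
  also have "sqrt ((\<bar>Re t\<bar> * a + \<bar>Im t\<bar> * b)\<^sup>2 + (\<bar>Re t\<bar> * b + \<bar>Im t\<bar> * a)\<^sup>2) \<le> 2 * cmod t * dnormC S p w"
  proof (rule real_le_lsqrt)
    have c: "(\<bar>Re t\<bar>)\<^sup>2 + (\<bar>Im t\<bar>)\<^sup>2 = (cmod t)\<^sup>2" by (simp add: cmod_def)
    have "(u * a' + v * b')\<^sup>2 \<le> (u\<^sup>2 + v\<^sup>2) * (a'\<^sup>2 + b'\<^sup>2)" for u v a' b' :: real
      using zero_le_power2[of "u * b' - v * a'"] by (simp add: power2_eq_square algebra_simps)
    from this[of "\<bar>Re t\<bar>" a "\<bar>Im t\<bar>" b] this[of "\<bar>Re t\<bar>" b "\<bar>Im t\<bar>" a]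
    have "(\<bar>Re t\<bar> * a + \<bar>Im t\<bar> * b)\<^sup>2 + (\<bar>Re t\<bar> * b + \<bar>Im t\<bar> * a)\<^sup>2 \<le> 2 * ((cmod t)\<^sup>2 * (a\<^sup>2 + b\<^sup>2))"
      unfolding c by (simp add: add.commute)
    also have "a\<^sup>2 + b\<^sup>2 = (dnormC S p w)\<^sup>2" by (simp add: dnormC_eq a_def b_def)
    also have "2 * ((cmod t)\<^sup>2 * (dnormC S p w)\<^sup>2) \<le> (2 * cmod t * dnormC S p w)\<^sup>2"
      by (simp add: power_mult_distrib)
    finally show "(\<bar>Re t\<bar> * a + \<bar>Im t\<bar> * b)\<^sup>2 + (\<bar>Re t\<bar> * b + \<bar>Im t\<bar> * a)\<^sup>2 \<le> (2 * cmod t * dnormC S p w)\<^sup>2" .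
  qed (use dnormC_nonneg in auto)
  finally show ?thesis by simp
qed

lemma dnormC_line_cplx_le:
  assumes z: "z \<in> dual_levelC S p" and x: "x \<in> dual_level S p"
  shows "dnormC S p (dualC_line z t (cplx x)) \<le> dnormC S p z + cmod t * dnorm S p x"
proof -
  have l: "reD z \<in> dual_level S p" "imD z \<in> dual_level S p" using z by (auto simp: dual_levelC_iff)
  have re: "reD (dualC_line z t (cplx x)) = (\<lambda>\<theta>. 1 * reD z \<theta> + Re t * x \<theta>)"
    and im: "imD (dualC_line z t (cplx x)) = (\<lambda>\<theta>. 1 * imD z \<theta> + Im t * x \<theta>)"
    by (simp_all add: reD_line imD_line)
  have dn: "0 \<le> dnorm S p (reD (dualC_line z t (cplx x)))" "0 \<le> dnorm S p (imD (dualC_line z t (cplx x)))"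
    using dualC_line_level[OF z cplx_level[OF x]] dnorm_nonneg by (auto simp: dual_levelC_iff)
  have "dnormC S p (dualC_line z t (cplx x)) \<le> sqrt ((dnorm S p (reD z) + \<bar>Re t\<bar> * dnorm S p x)\<^sup>2
      + (dnorm S p (imD z) + \<bar>Im t\<bar> * dnorm S p x)\<^sup>2)"
    unfolding dnormC_eq using dn dnorm_comb[OF l(1) x, of 1 "Re t"] dnorm_comb[OF l(2) x, of 1 "Im t"]
    by (intro real_sqrt_le_mono add_mono power_mono) (auto simp: re im)
  also have "\<dots> \<le> dnormC S p z + sqrt ((\<bar>Re t\<bar> * dnorm S p x)\<^sup>2 + (\<bar>Im t\<bar> * dnorm S p x)\<^sup>2)"
    unfolding dnormC_eq by (rule real_sqrt_sum_squares_triangle_ineq)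
  also have "sqrt ((\<bar>Re t\<bar> * dnorm S p x)\<^sup>2 + (\<bar>Im t\<bar> * dnorm S p x)\<^sup>2) = cmod t * dnorm S p x"
    using dnorm_nonneg[OF x] by (simp add: power_mult_distrib cmod_def real_sqrt_mult flip: distrib_right)
  finally show ?thesis .
qed

lemma dnormC_diff_self: "dnormC S p (z - z) = 0"
  using dnorm_zero[of p] by (simp add: dnormC_def)

lemma topspace_dual_levelC: "topspace (dual_levelC_topology S p) = dual_levelC S p"
  unfolding dual_levelC_topology_def projlim_topology_def
proof (subst topology_generated_by_topspace, safe)
  fix z assume "z \<in> dual_levelC S p"
  then have "z \<in> {y \<in> dual_levelC S p. dnormC S p (y - z) < 1}" using dnormC_diff_self by simp
  then show "z \<in> \<Union> {{y \<in> dual_levelC S p. dnormC S p (y - x) < \<epsilon>} | (i::unit) x \<epsilon>. x \<in> dual_levelC S p \<and> 0 < \<epsilon>}"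
    using \<open>z \<in> dual_levelC S p\<close> zero_less_one by blast
qed

lemma dual_levelC_nuc: "z \<in> dual_levelC S p \<Longrightarrow> z \<in> nuc_dualC S"
  by (auto simp: nuc_dualC_def)

text \<open>A form of \<open>entire_level\<close> without topology, stable under directional
  derivatives. Local boundedness is contained in the exponential bound.\<close>

definition entire_growth :: "nat \<Rightarrow> real \<Rightarrow> real \<Rightarrow> (('h \<Rightarrow> complex) \<Rightarrow> complex) \<Rightarrow> bool" where
  "entire_growth p A c \<Phi> \<longleftrightarrow>
     (\<forall>z\<in>dual_levelC S p. \<forall>w\<in>dual_levelC S p. (\<lambda>t. \<Phi> (dualC_line z t w)) holomorphic_on UNIV) \<and>
     (\<forall>z\<in>dual_levelC S p. cmod (\<Phi> z) \<le> A * exp (c * dnormC S p z))"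

lemma entire_growth_level:
  assumes eg: "entire_growth p A c \<Phi>" and c: "0 \<le> c" "c \<le> 1 / 2 ^ l"
  shows "\<Phi> \<in> entire_level S p l" "growth_norm S (p, l) \<Phi> \<le> A"
proof -
  have A: "0 \<le> A"
  proof -
    have z: "cplx (\<lambda>\<theta>. 0) \<in> dual_levelC S p" by (intro cplx_level dual_level_zero)
    then have "0 \<le> A * exp (c * dnormC S p (cplx (\<lambda>\<theta>. 0)))"
      using eg order_trans[OF norm_ge_zero] unfolding entire_growth_def by blast
    then show ?thesis by (simp add: zero_le_mult_iff)
  qed
  have le: "cmod (\<Phi> z) * exp (- (1 / 2 ^ l * dnormC S p z)) \<le> A" if z: "z \<in> dual_levelC S p" for z
  proof -
    have "cmod (\<Phi> z) \<le> A * exp (c * dnormC S p z)" using eg z by (simp add: entire_growth_def)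
    also have "\<dots> \<le> A * exp (1 / 2 ^ l * dnormC S p z)"
      using A c dnormC_nonneg[of p z] by (intro mult_left_mono) (auto intro!: mult_right_mono[of c "1 / 2 ^ l", simplified])
    finally have "cmod (\<Phi> z) * exp (- (1 / 2 ^ l * dnormC S p z)) \<le>
        A * exp (1 / 2 ^ l * dnormC S p z) * exp (- (1 / 2 ^ l * dnormC S p z))" by (intro mult_right_mono) auto
    also have "\<dots> = A" by (simp add: mult.assoc flip: exp_add)
    finally show ?thesis .
  qed
  have "holomorphic_in dualC_line (dual_levelC_topology S p) (dual_levelC S p) \<Phi>"
    unfolding holomorphic_in_def topspace_dual_levelC
  proof (intro conjI ballI)
    show "openin (dual_levelC_topology S p) (dual_levelC S p)"
      using openin_topspace[of "dual_levelC_topology S p"] by (simp add: topspace_dual_levelC)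
    show "(\<lambda>t. \<Phi> (dualC_line z t w)) analytic_on {0}" if "z \<in> dual_levelC S p" "w \<in> dual_levelC S p" for z w
      using eg that unfolding entire_growth_def analytic_at by (auto intro!: exI[of _ UNIV])
    fix z assume z: "z \<in> dual_levelC S p"
    define V where "V = {y \<in> dual_levelC S p. dnormC S p (y - z) < 1}"
    have "openin (dual_levelC_topology S p) V"
      unfolding dual_levelC_topology_def projlim_topology_def V_def
      by (rule topology_generated_by_Basis) (use z zero_less_one in blast)
    moreover have "z \<in> V" using z dnormC_diff_self by (simp add: V_def)
    moreover have "cmod (\<Phi> y) \<le> A * exp (c * (dnormC S p z + 2))" if y: "y \<in> V" for y
    proof -
      have yl: "y \<in> dual_levelC S p" using y by (simp add: V_def)
      have dl: "y - z \<in> dual_levelC S p"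
        using yl z dual_level_diff by (auto simp: dual_levelC_def fun_diff_def)
      have "y = dualC_line z 1 (y - z)" by (simp add: dualC_line_def fun_eq_iff)
      then have "dnormC S p y \<le> dnormC S p z + 2 * dnormC S p (y - z)" using dnormC_line_le[OF z dl, of 1] by simp
      then have "dnormC S p y \<le> dnormC S p z + 2" using y by (simp add: V_def)
      then have "exp (c * dnormC S p y) \<le> exp (c * (dnormC S p z + 2))" using c by (simp add: mult_left_mono)
      moreover have "cmod (\<Phi> y) \<le> A * exp (c * dnormC S p y)" using eg yl by (simp add: entire_growth_def)
      ultimately show ?thesis using A by (meson mult_left_mono order_trans)
    qed
    ultimately show "\<exists>V. openin (dual_levelC_topology S p) V \<and> z \<in> V \<and> V \<subseteq> dual_levelC S p \<and> bounded (\<Phi> ` V)"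
      unfolding bounded_iff by (intro exI[of _ V]) (auto simp: V_def)
  qed
  moreover have "bdd_above ((\<lambda>z. cmod (\<Phi> z) * exp (- (1 / 2 ^ l * dnormC S p z))) ` dual_levelC S p)"
    using le by (intro bdd_aboveI[of _ A]) auto
  ultimately show "\<Phi> \<in> entire_level S p l" by (simp add: entire_level_def)
  have "dual_levelC S p \<noteq> {}" using cplx_level[OF dual_level_zero] by blast
  then show "growth_norm S (p, l) \<Phi> \<le> A"
    unfolding growth_norm_def using le by (auto intro!: cSUP_least)
qed

lemma dualC_line_0 [simp]: "dualC_line z 0 w = z"
  by (simp add: dualC_line_def)

lemma dualC_line_line: "dualC_line (dualC_line z s w) t w = dualC_line z (s + t) w"
  by (simp add: dualC_line_def fun_eq_iff algebra_simps)

text \<open>Analyticity is given at the base point of each line. Moving the base point along the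
  line gives differentiability at every parameter, hence an entire function of the
  parameter.\<close>

lemma entire_level_growth:
  assumes \<Phi>: "\<Phi> \<in> entire_level S p l"
  shows "entire_growth p (growth_norm S (p, l) \<Phi>) (1 / 2 ^ l) \<Phi>"
  unfolding entire_growth_def
proof (intro conjI ballI)
  have hol: "holomorphic_in dualC_line (dual_levelC_topology S p) (dual_levelC S p) \<Phi>"
    and bdd: "bdd_above ((\<lambda>z. cmod (\<Phi> z) * exp (- (1 / 2 ^ l * dnormC S p z))) ` dual_levelC S p)"
    using \<Phi> by (auto simp: entire_level_def)
  show "(\<lambda>t. \<Phi> (dualC_line z t w)) holomorphic_on UNIV" if z: "z \<in> dual_levelC S p" and w: "w \<in> dual_levelC S p" for z w
  proof -
    have "(\<lambda>t. \<Phi> (dualC_line z t w)) field_differentiable (at s)" for s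
    proof -
      have "(\<lambda>t. \<Phi> (dualC_line (dualC_line z s w) t w)) analytic_on {0}"
        using hol dualC_line_level[OF z w] w unfolding holomorphic_in_def topspace_dual_levelC by blast
      then have "(\<lambda>t. \<Phi> (dualC_line z (s + t) w)) field_differentiable (at 0)"
        unfolding dualC_line_line using analytic_on_imp_differentiable_at by blast
      then obtain D where "((\<lambda>t. \<Phi> (dualC_line z (s + t) w)) has_field_derivative D) (at 0)"
        by (auto simp: field_differentiable_def)
      then have "((\<lambda>t. \<Phi> (dualC_line z t w)) has_field_derivative D) (at (0 + s))"
        by (subst DERIV_shift) (simp add: add.commute)
      then show ?thesis by (auto simp: field_differentiable_def)
    qed
    then show ?thesis by (simp add: holomorphic_on_def field_differentiable_at_within)
  qed
  fix z assume z: "z \<in> dual_levelC S p"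
  have "cmod (\<Phi> z) * exp (- (1 / 2 ^ l * dnormC S p z)) \<le> growth_norm S (p, l) \<Phi>"
    unfolding growth_norm_def using cSUP_upper[OF z bdd] by simp
  then have "cmod (\<Phi> z) * exp (- (1 / 2 ^ l * dnormC S p z)) * exp (1 / 2 ^ l * dnormC S p z) \<le>
      growth_norm S (p, l) \<Phi> * exp (1 / 2 ^ l * dnormC S p z)" by (intro mult_right_mono) auto
  then show "cmod (\<Phi> z) \<le> growth_norm S (p, l) \<Phi> * exp (1 / 2 ^ l * dnormC S p z)"
    by (simp add: mult.assoc flip: exp_add)
qed

section \<open>Directional derivatives and Taylor coefficients\<close>

text \<open>Only directions from the real dual occur, since the Taylor tensors take real functionals
  as arguments.\<close>

definition dird :: "('h \<Rightarrow> real) \<Rightarrow> (('h \<Rightarrow> complex) \<Rightarrow> complex) \<Rightarrow> ('h \<Rightarrow> complex) \<Rightarrow> complex" where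
  "dird x \<Phi> z = deriv (\<lambda>t. \<Phi> (dualC_line z t (cplx x))) 0"

lemma dird_cong:
  assumes "\<And>z. z \<in> dual_levelC S p \<Longrightarrow> \<Phi> z = \<Psi> z" "x \<in> dual_level S p" "z \<in> dual_levelC S p"
  shows "dird x \<Phi> z = dird x \<Psi> z"
  unfolding dird_def using assms dualC_line_level[OF assms(3) cplx_level[OF assms(2)]] by simp

lemma entire_growth_two_holomorphic:
  assumes eg: "entire_growth p A c \<Phi>" and c: "0 \<le> c"
    and z: "z \<in> dual_levelC S p" and v: "v \<in> dual_levelC S p" and w: "w \<in> dual_levelC S p"
  shows "two_holomorphic (\<lambda>s t. \<Phi> (dualC_line (dualC_line z s v) t w))"
proof
  show "(\<lambda>t. \<Phi> (dualC_line (dualC_line z s v) t w)) holomorphic_on UNIV" for s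
    using eg dualC_line_level[OF z v] w unfolding entire_growth_def by blast
  have "dualC_line (dualC_line z s v) t w = dualC_line (dualC_line z t w) s v" for s t
    by (simp add: dualC_line_def fun_eq_iff)
  then show "(\<lambda>s. \<Phi> (dualC_line (dualC_line z s v) t w)) holomorphic_on UNIV" for t
    using eg dualC_line_level[OF z w] v unfolding entire_growth_def by simp
  fix R
  have A: "0 \<le> A"
  proof -
    have "0 \<le> A * exp (c * dnormC S p z)"
      using eg z order_trans[OF norm_ge_zero] unfolding entire_growth_def by blast
    then show ?thesis by (simp add: zero_le_mult_iff)
  qed
  define N where "N = dnormC S p z + 2 * R * dnormC S p v + 2 * R * dnormC S p w"
  have "cmod (\<Phi> (dualC_line (dualC_line z s v) t w)) \<le> A * exp (c * N)" if "cmod s \<le> R" "cmod t \<le> R" for s t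
  proof -
    have "dnormC S p (dualC_line (dualC_line z s v) t w) \<le> dnormC S p (dualC_line z s v) + 2 * cmod t * dnormC S p w"
      using dualC_line_level[OF z v] w by (rule dnormC_line_le)
    also have "\<dots> \<le> (dnormC S p z + 2 * cmod s * dnormC S p v) + 2 * cmod t * dnormC S p w"
      using dnormC_line_le[OF z v] by simp
    also have "\<dots> \<le> N"
      unfolding N_def using that dnormC_nonneg by (intro add_mono mult_right_mono) auto
    finally have "exp (c * dnormC S p (dualC_line (dualC_line z s v) t w)) \<le> exp (c * N)"
      using c by (simp add: mult_left_mono)
    moreover have "cmod (\<Phi> (dualC_line (dualC_line z s v) t w)) \<le>
        A * exp (c * dnormC S p (dualC_line (dualC_line z s v) t w))"
      using eg dualC_line_level[OF dualC_line_level[OF z v] w] unfolding entire_growth_def by blast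
    ultimately show ?thesis using A by (meson mult_left_mono order_trans)
  qed
  then show "\<exists>M. \<forall>s t. cmod s \<le> R \<longrightarrow> cmod t \<le> R \<longrightarrow> cmod (\<Phi> (dualC_line (dualC_line z s v) t w)) \<le> M" by blast
qed

lemma dird_holomorphic:
  assumes eg: "entire_growth p A c \<Phi>" and c: "0 \<le> c" and x: "x \<in> dual_level S p"
    and z: "z \<in> dual_levelC S p" and w: "w \<in> dual_levelC S p"
  shows "(\<lambda>t. dird x \<Phi> (dualC_line z t w)) holomorphic_on UNIV"
proof -
  interpret two_holomorphic "\<lambda>s t. \<Phi> (dualC_line (dualC_line z s (cplx x)) t w)"
    by (rule entire_growth_two_holomorphic[OF eg c z cplx_level[OF x] w])
  have "dualC_line (dualC_line z s (cplx x)) t w = dualC_line (dualC_line z t w) s (cplx x)" for s t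
    by (simp add: dualC_line_def fun_eq_iff)
  then show ?thesis using deriv_first_holomorphic by (simp add: dird_def)
qed

lemma dird_commute:
  assumes eg: "entire_growth p A c \<Phi>" and c: "0 \<le> c" and x: "x \<in> dual_level S p" and y: "y \<in> dual_level S p"
    and z: "z \<in> dual_levelC S p"
  shows "dird x (dird y \<Phi>) z = dird y (dird x \<Phi>) z"
proof -
  interpret two_holomorphic "\<lambda>s t. \<Phi> (dualC_line (dualC_line z s (cplx x)) t (cplx y))"
    by (rule entire_growth_two_holomorphic[OF eg c z cplx_level[OF x] cplx_level[OF y]])
  have "dualC_line (dualC_line z s (cplx x)) t (cplx y) = dualC_line (dualC_line z t (cplx y)) s (cplx x)" for s t
    by (simp add: dualC_line_def fun_eq_iff)
  then show ?thesis using deriv_commute by (simp add: dird_def)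
qed

lemma dird_linear:
  assumes eg: "entire_growth p A c \<Phi>" and c: "0 \<le> c" and x: "x \<in> dual_level S p" and y: "y \<in> dual_level S p"
    and z: "z \<in> dual_levelC S p"
  shows "dird (\<lambda>\<theta>. a * x \<theta> + b * y \<theta>) \<Phi> z = of_real a * dird x \<Phi> z + of_real b * dird y \<Phi> z"
proof -
  interpret two_holomorphic "\<lambda>s t. \<Phi> (dualC_line (dualC_line z s (cplx x)) t (cplx y))"
    by (rule entire_growth_two_holomorphic[OF eg c z cplx_level[OF x] cplx_level[OF y]])
  have "dualC_line z t (cplx (\<lambda>\<theta>. a * x \<theta> + b * y \<theta>)) =
      dualC_line (dualC_line z (of_real a * t) (cplx x)) (of_real b * t) (cplx y)" for t
    by (simp add: dualC_line_def cplx_def fun_eq_iff algebra_simps)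
  then show ?thesis using deriv_line[of "of_real a" "of_real b"] by (simp add: dird_def)
qed

text \<open>Cauchy's estimate on a circle of radius \<open>1/c\<close>, the optimal one for growth \<open>exp (c |z|)\<close>.\<close>

lemma dird_growth:
  assumes eg: "entire_growth p A c \<Phi>" and c: "0 < c" and x: "x \<in> dual_level S p" "dnorm S p x \<le> 1"
  shows "entire_growth p (A * (exp 1 * c)) c (dird x \<Phi>)"
  unfolding entire_growth_def
proof (intro conjI ballI)
  show "(\<lambda>t. dird x \<Phi> (dualC_line z t w)) holomorphic_on UNIV"
    if "z \<in> dual_levelC S p" "w \<in> dual_levelC S p" for z w
    using dird_holomorphic[OF eg _ x(1) that] c by simp
  fix z assume z: "z \<in> dual_levelC S p"
  define f where "f t = \<Phi> (dualC_line z t (cplx x))" for t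
  have A: "0 \<le> A"
  proof -
    have "0 \<le> A * exp (c * dnormC S p z)"
      using eg z order_trans[OF norm_ge_zero] unfolding entire_growth_def by blast
    then show ?thesis by (simp add: zero_le_mult_iff)
  qed
  have hol: "f holomorphic_on UNIV"
    unfolding f_def using eg z cplx_level[OF x(1)] by (simp add: entire_growth_def)
  have "cmod ((deriv ^^ 1) f 0) \<le> fact 1 * (A * exp (c * dnormC S p z + 1)) / (1 / c) ^ 1"
  proof (rule Cauchy_inequality)
    fix t :: complex assume "cmod (0 - t) = 1 / c"
    then have t: "cmod t = 1 / c" by simp
    have "dnormC S p (dualC_line z t (cplx x)) \<le> dnormC S p z + 1 / c * dnorm S p x"
      using dnormC_line_cplx_le[OF z x(1), of t] t by simp
    also have "\<dots> \<le> dnormC S p z + 1 / c" using c x by (simp add: divide_right_mono)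
    finally have "c * dnormC S p (dualC_line z t (cplx x)) \<le> c * (dnormC S p z + 1 / c)"
      using c by (intro mult_left_mono) auto
    also have "\<dots> = c * dnormC S p z + 1" using c by (simp add: distrib_left)
    finally have "A * exp (c * dnormC S p (dualC_line z t (cplx x))) \<le> A * exp (c * dnormC S p z + 1)"
      using A by (intro mult_left_mono) auto
    moreover have "cmod (f t) \<le> A * exp (c * dnormC S p (dualC_line z t (cplx x)))"
      unfolding f_def using eg dualC_line_level[OF z cplx_level[OF x(1)]] by (simp add: entire_growth_def)
    ultimately show "cmod (f t) \<le> A * exp (c * dnormC S p z + 1)" by simp
  qed (use hol c in \<open>auto intro: holomorphic_on_subset holomorphic_on_imp_continuous_on\<close>)
  then show "cmod (dird x \<Phi> z) \<le> A * (exp 1 * c) * exp (c * dnormC S p z)"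
    unfolding dird_def f_def by (simp add: exp_add mult_ac)
qed

text \<open>For a direction of any norm the constant is irrelevant; the finiteness of growth is what
  further differentiation requires. The summand 1 in \<open>d\<close> keeps the rescaling defined
  when the norm is 0.\<close>

lemma dird_scale_growth:
  assumes eg: "entire_growth p A c \<Phi>" and c: "0 < c" and x: "x \<in> dual_level S p"
  shows "\<exists>A'. entire_growth p A' c (dird x \<Phi>)"
proof -
  define d where "d = dnorm S p x + 1"
  have d: "d > 0" "dnorm S p x \<le> d" using dnorm_nonneg[OF x] by (auto simp: d_def)
  define u where "u = (\<lambda>\<theta>. 1 / d * x \<theta>)"
  have u: "u \<in> dual_level S p" unfolding u_def by (rule dual_level_scale[OF x])
  have "dnorm S p u \<le> 1"
  proof -
    have "dnorm S p u \<le> \<bar>1 / d\<bar> * dnorm S p x" unfolding u_def by (rule dnorm_scale_le[OF x])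
    also have "\<dots> \<le> 1" using d by simp
    finally show ?thesis .
  qed
  then have eu: "entire_growth p (A * (exp 1 * c)) c (dird u \<Phi>)" by (rule dird_growth[OF eg c u])
  have "dird x \<Phi> z = of_real d * dird u \<Phi> z" if "z \<in> dual_levelC S p" for z
    using dird_linear[OF eg _ u u that, of d 0] c d by (simp add: u_def)
  then have "entire_growth p (d * (A * (exp 1 * c))) c (dird x \<Phi>)"
    using eu d dird_holomorphic[OF eg _ x] c unfolding entire_growth_def
    by (auto simp: norm_mult mult.assoc intro!: mult_left_mono)
  then show ?thesis by blast
qed

definition dirds :: "('h \<Rightarrow> real) list \<Rightarrow> (('h \<Rightarrow> complex) \<Rightarrow> complex) \<Rightarrow> ('h \<Rightarrow> complex) \<Rightarrow> complex" where
  "dirds xs \<Phi> = foldr dird xs \<Phi>"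

lemma dirds_simps [simp]: "dirds [] \<Phi> = \<Phi>" "dirds (x # xs) \<Phi> = dird x (dirds xs \<Phi>)"
  by (simp_all add: dirds_def)

lemma dirds_growth_exists:
  assumes "entire_growth p A c \<Phi>" "0 < c" "set xs \<subseteq> dual_level S p"
  shows "\<exists>A'. entire_growth p A' c (dirds xs \<Phi>)"
  using assms(3)
proof (induction xs)
  case Nil
  then show ?case using assms by auto
next
  case (Cons x xs)
  then obtain A' where "entire_growth p A' c (dirds xs \<Phi>)" by auto
  from dird_scale_growth[OF this assms(2)] Cons show ?case by simp
qed

text \<open>The rate \<open>c\<close> is unchanged by a derivative, so each unit direction costs the
  same factor \<open>exp 1 * c\<close> and no factorial arises. After division by
  \<open>fact n\<close> this is exactly a bound of type \<open>tsb\<close>.\<close>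

lemma dirds_growth:
  assumes "entire_growth p A c \<Phi>" "0 < c" "set xs \<subseteq> dual_level S p" "\<And>x. x \<in> set xs \<Longrightarrow> dnorm S p x \<le> 1"
  shows "entire_growth p (A * (exp 1 * c) ^ length xs) c (dirds xs \<Phi>)"
  using assms(3,4)
proof (induction xs)
  case Nil
  then show ?case using assms by simp
next
  case (Cons x xs)
  then have "entire_growth p (A * (exp 1 * c) ^ length xs) c (dirds xs \<Phi>)" by simp
  from dird_growth[OF this assms(2), of x] Cons show ?case by (simp add: mult_ac)
qed

lemma dirds_move:
  assumes eg: "entire_growth p A c \<Phi>" and c: "0 < c" and "set (us @ x # vs) \<subseteq> dual_level S p" "z \<in> dual_levelC S p"
  shows "dirds (us @ x # vs) \<Phi> z = dirds (x # us @ vs) \<Phi> z"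
  using assms(3,4)
proof (induction us arbitrary: z)
  case (Cons u us)
  have "dirds ((u # us) @ x # vs) \<Phi> z = dird u (dirds (x # us @ vs) \<Phi>) z"
    using Cons by (simp del: dirds_simps add: dirds_simps(2)[of u "us @ x # vs"]) (rule dird_cong[of p], auto)
  also have "\<dots> = dird x (dird u (dirds (us @ vs) \<Phi>)) z"
  proof -
    obtain A' where "entire_growth p A' c (dirds (us @ vs) \<Phi>)"
      using dirds_growth_exists[OF eg c, of "us @ vs"] Cons.prems by auto
    then show ?thesis using dird_commute[of p A' c _ u x z] c Cons.prems by simp
  qed
  finally show ?case by simp
qed simp

lemma dirds_perm:
  assumes eg: "entire_growth p A c \<Phi>" and c: "0 < c"
  shows "mset ys = mset xs \<Longrightarrow> set xs \<subseteq> dual_level S p \<Longrightarrow> z \<in> dual_levelC S p \<Longrightarrow> dirds ys \<Phi> z = dirds xs \<Phi> z"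
proof (induction xs arbitrary: ys z)
  case (Cons x xs)
  have "x \<in> set ys" using Cons.prems(1) by (metis list.set_intros(1) mset_eq_setD)
  then obtain us vs where ys: "ys = us @ x # vs" by (meson split_list)
  then have m: "mset (us @ vs) = mset xs" using Cons.prems(1) by simp
  have "set ys = set (x # xs)" using Cons.prems(1) by (rule mset_eq_setD)
  then have "dirds ys \<Phi> z = dirds (x # us @ vs) \<Phi> z"
    unfolding ys using Cons.prems ys by (intro dirds_move[OF eg c]) auto
  also have "\<dots> = dirds (x # xs) \<Phi> z"
    using Cons.IH[OF m] Cons.prems by (simp, intro dird_cong[of p]) auto
  finally show ?case .
qed simp

end

section \<open>Exponential bounds and polarization of symmetric forms\<close>

lemma small_exp_radius:
  assumes "(R::real) > 0"
  obtains l where "exp 1 * (1 / 2 ^ l) \<le> R"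
proof -
  obtain l where "(1 / 2) ^ l < R / exp 1" using real_arch_pow_inv[of "R / exp 1" "1 / 2"] assms by auto
  then have "exp 1 * (1 / 2 ^ l) \<le> R" by (simp add: power_one_over field_simps)
  then show ?thesis using that by blast
qed

lemma exp_sums_real: "(\<lambda>n. A * (u ^ n / fact n)) sums (A * exp (u :: real))"
  using sums_mult[OF exp_converges[of u], of A] by (simp add: scaleR_conv_of_real inverse_eq_divide)

lemma poly_zero_on_reals:
  fixes q :: "complex poly"
  assumes "\<And>t :: real. poly q (of_real t) = 0"
  shows "q = 0"
proof -
  have "range (of_real :: real \<Rightarrow> complex) \<subseteq> {u. poly q u = 0}" using assms by auto
  moreover have "infinite (range (of_real :: real \<Rightarrow> complex))"
    using finite_imageD[of "of_real :: real \<Rightarrow> complex" UNIV] infinite_UNIV_char_0[where 'a = real]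
    by (auto simp: inj_on_def)
  ultimately have "infinite {u. poly q u = 0}" using infinite_super by blast
  then show ?thesis using poly_roots_finite by blast
qed

text \<open>The two lowest coefficients of the polynomial in \<open>t\<close> suffice for
  polarization: the linear one contains the form with a single argument replaced by
  \<open>y\<close>.\<close>

lemma diagonal_polynomial:
  assumes D: "lin_closed D" and x: "x \<in> D" and y: "y \<in> D" and "sym_multilinear D n F"
  shows "\<exists>q. (\<forall>t. F (replicate n (\<lambda>\<theta>. 1 * x \<theta> + t * y \<theta>)) = poly q (of_real t)) \<and> coeff q 0 = F (replicate n x) \<and>
    coeff q 1 = of_nat n * F (y # replicate (n - 1) x)"
  using assms(4)
proof (induction n arbitrary: F)
  case 0
  show ?case by (intro exI[of _ "[:F []:]"]) simp
next
  case (Suc n)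
  obtain qx where qx: "\<And>t. F (x # replicate n (\<lambda>\<theta>. 1 * x \<theta> + t * y \<theta>)) = poly qx (of_real t)"
    "coeff qx 0 = F (x # replicate n x)" "coeff qx 1 = of_nat n * F (x # y # replicate (n - 1) x)"
    using Suc.IH[OF symml_Cons[OF D Suc.prems x]] by blast
  obtain qy where qy: "\<And>t. F (y # replicate n (\<lambda>\<theta>. 1 * x \<theta> + t * y \<theta>)) = poly qy (of_real t)"
    "coeff qy 0 = F (y # replicate n x)"
    using Suc.IH[OF symml_Cons[OF D Suc.prems y]] by blast
  define q where "q = qx + pCons 0 qy"
  have "F (replicate (Suc n) (\<lambda>\<theta>. 1 * x \<theta> + t * y \<theta>)) = poly q (of_real t)" for t
    using symml_head[OF Suc.prems replicate_tuples[OF lin_closedD[OF D x y], of n 1 t] x y, of 1 t] qx(1)[of t] qy(1)[of t]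
    by (simp add: q_def)
  moreover have "coeff q 0 = F (replicate (Suc n) x)" using qx(2) by (simp add: q_def)
  moreover have "coeff q 1 = of_nat (Suc n) * F (y # replicate n x)"
  proof (cases n)
    case (Suc m)
    have "F (x # y # replicate m x) = F (y # x # replicate m x)"
      using Suc x y replicate_tuples[OF x, of m] by (intro symml_perm[OF Suc.prems]) auto
    then show ?thesis using qx(3) qy(2) Suc by (simp add: q_def algebra_simps)
  qed (use qx(3) qy(2) in \<open>simp add: q_def\<close>)
  ultimately show ?case by (intro exI[of _ q]) simp
qed

text \<open>Polarization by one argument at a time. If the form vanishes on the diagonal, so does
  the polynomial of \<open>diagonal_polynomial\<close>, hence the form with first argument
  \<open>y\<close> vanishes on the diagonal too, and its degree is smaller.\<close>

lemma symml_diagonal_zero: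
  assumes D: "lin_closed D" and "sym_multilinear D n F" "\<And>x. x \<in> D \<Longrightarrow> F (replicate n x) = 0" "xs \<in> tuples D n"
  shows "F xs = 0"
  using assms(2-)
proof (induction n arbitrary: F xs)
  case 0
  then show ?case using D by (auto simp: lin_closed_def)
next
  case (Suc n)
  obtain y ys where y: "xs = y # ys" "y \<in> D" "ys \<in> tuples D n" using Suc.prems(3) by (rule tuples_SucE)
  have "F (y # replicate n x) = 0" if x: "x \<in> D" for x
  proof -
    obtain q where q: "\<And>t. F (replicate (Suc n) (\<lambda>\<theta>. 1 * x \<theta> + t * y \<theta>)) = poly q (of_real t)"
      "coeff q 1 = of_nat (Suc n) * F (y # replicate n x)"
      using diagonal_polynomial[OF D x y(2) Suc.prems(1)] by auto
    have "poly q (of_real t) = 0" for t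
      using q(1)[of t] Suc.prems(2)[OF lin_closedD[OF D x y(2)]] by metis
    then have "q = 0" by (rule poly_zero_on_reals)
    then show ?thesis using q(2) by (simp del: of_nat_Suc)
  qed
  then show ?case
    using Suc.IH[OF symml_Cons[OF D Suc.prems(1) y(2)] _ y(3)] y(1) by simp
qed

section \<open>Taylor coefficients of entire functions of minimal type\<close>

context nuclear_scale
begin

definition taylor :: "(('h \<Rightarrow> complex) \<Rightarrow> complex) \<Rightarrow> nat \<Rightarrow> 'h tensor" where
  "taylor \<Phi> n = (\<lambda>xs. if xs \<in> tuples (nuc_dual S) n then dirds xs \<Phi> (\<lambda>\<theta>. 0) / fact n else 0)"

lemma zero_dual_levelC: "(\<lambda>\<theta>. 0) \<in> dual_levelC S p"
  using cplx_level[OF dual_level_zero] by (simp add: cplx_def)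

lemma dnormC_zero: "dnormC S p (\<lambda>\<theta>. 0) = 0"
  by (simp add: dnormC_def dnorm_zero)

lemma entire_min_growth: "\<Phi> \<in> entire_min S \<Longrightarrow> entire_growth p (growth_norm S (p, l) \<Phi>) (1 / 2 ^ l) \<Phi>"
  by (rule entire_level_growth) (simp add: entire_min_def)

lemma growth_norm_nonneg: "\<Phi> \<in> entire_min S \<Longrightarrow> 0 \<le> growth_norm S (p, l) \<Phi>"
proof -
  assume "\<Phi> \<in> entire_min S"
  then have "cmod (\<Phi> (\<lambda>\<theta>. 0)) \<le> growth_norm S (p, l) \<Phi>"
    using entire_min_growth zero_dual_levelC dnormC_zero unfolding entire_growth_def by fastforce
  then show ?thesis using norm_ge_zero order_trans by blast
qed

lemma taylor_symml:
  assumes \<Phi>: "\<Phi> \<in> entire_min S"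
  shows "sym_multilinear (nuc_dual S) n (taylor \<Phi> n)"
proof (rule symmlI[OF lin_closed_nuc_dual])
  have eg: "entire_growth p (growth_norm S (p, 0) \<Phi>) 1 \<Phi>" for p
    using entire_min_growth[OF \<Phi>, of p 0] by simp
  fix xs ys assume *: "xs \<in> tuples (nuc_dual S) n" "mset ys = mset xs"
  then have ys: "ys \<in> tuples (nuc_dual S) n"
    unfolding tuples_def using mset_eq_setD[OF *(2)] mset_eq_length[OF *(2)] by simp
  obtain q where "xs \<in> tuples (dual_level S q) n" using nuc_dual_tuplesE[OF *(1)] by blast
  then have "dirds ys \<Phi> (\<lambda>\<theta>. 0) = dirds xs \<Phi> (\<lambda>\<theta>. 0)"
    using *(2) by (intro dirds_perm[OF eg] zero_dual_levelC) (auto simp: tuples_def)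
  then show "taylor \<Phi> n ys = taylor \<Phi> n xs" using * ys by (simp add: taylor_def)
next
  have eg: "entire_growth p (growth_norm S (p, 0) \<Phi>) 1 \<Phi>" for p
    using entire_min_growth[OF \<Phi>, of p 0] by simp
  fix m xs x y and a b :: real
  assume n: "n = Suc m" and xs: "xs \<in> tuples (nuc_dual S) m" and x: "x \<in> nuc_dual S" and y: "y \<in> nuc_dual S"
  have "y # x # xs \<in> tuples (nuc_dual S) (Suc (Suc m))" using xs x y by simp
  then obtain q where q: "y # x # xs \<in> tuples (dual_level S q) (Suc (Suc m))" using nuc_dual_tuplesE by blast
  then have l: "x \<in> dual_level S q" "y \<in> dual_level S q" "set xs \<subseteq> dual_level S q" by (auto simp: tuples_def)
  obtain A where "entire_growth q A 1 (dirds xs \<Phi>)" using dirds_growth_exists[OF eg _ l(3)] by auto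
  from dird_linear[OF this _ l(1,2) zero_dual_levelC, of a b]
  show "taylor \<Phi> n ((\<lambda>\<theta>. a * x \<theta> + b * y \<theta>) # xs) = of_real a * taylor \<Phi> n (x # xs) + of_real b * taylor \<Phi> n (y # xs)"
    using n xs x y lin_closedD[OF lin_closed_nuc_dual x y, of a b]
    by (simp add: taylor_def add_divide_distrib)
qed

text \<open>\<open>exp 1 * (1 / 2 ^ l)\<close> is the cost of one Cauchy estimate at growth rate
  \<open>1 / 2 ^ l\<close>. As \<open>l\<close> is free, the radius can be made as small as desired,
  which is where minimal type enters.\<close>

lemma taylor_tsb:
  assumes \<Phi>: "\<Phi> \<in> entire_min S"
  shows "tsb p (exp 1 * (1 / 2 ^ l)) (growth_norm S (p, l) \<Phi>) (taylor \<Phi>)"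
  unfolding tsb_def
proof (intro conjI allI)
  show "0 \<le> growth_norm S (p, l) \<Phi>" by (rule growth_norm_nonneg[OF \<Phi>])
  fix n
  show "tbound p n (taylor \<Phi> n) (growth_norm S (p, l) \<Phi> * (exp 1 * (1 / 2 ^ l)) ^ n / fact n)"
  proof (rule tbound_from_unit_ball)
    show "sym_multilinear (dual_level S p) n (taylor \<Phi> n)"
      by (rule symml_mono[OF dual_level_subset taylor_symml[OF \<Phi>]])
    fix xs assume xs: "xs \<in> tuples (dual_level S p) n" "\<And>x. x \<in> set xs \<Longrightarrow> dnorm S p x \<le> 1"
    have "entire_growth p (growth_norm S (p, l) \<Phi> * (exp 1 * (1 / 2 ^ l)) ^ length xs) (1 / 2 ^ l) (dirds xs \<Phi>)"
      using xs by (intro dirds_growth[OF entire_min_growth[OF \<Phi>]]) (auto simp: tuples_def)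
    then have "cmod (dirds xs \<Phi> (\<lambda>\<theta>. 0)) \<le> growth_norm S (p, l) \<Phi> * (exp 1 * (1 / 2 ^ l)) ^ length xs"
      using zero_dual_levelC[of p] dnormC_zero[of p] unfolding entire_growth_def by fastforce
    then show "cmod (taylor \<Phi> n xs) \<le> growth_norm S (p, l) \<Phi> * (exp 1 * (1 / 2 ^ l)) ^ n / fact n"
      using xs dual_tuples_nuc[OF xs(1)] by (simp add: taylor_def norm_divide divide_right_mono tuples_def)
  qed
qed

lemma taylor_test_series:
  assumes \<Phi>: "\<Phi> \<in> entire_min S"
  shows "taylor \<Phi> \<in> test_series S"
proof (rule test_seriesI)
  show "taylor \<Phi> n \<in> nuc_tensor S n" for n
  proof (rule nuc_tensorI[OF taylor_symml[OF \<Phi>]])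
    show "\<exists>M. tbound p n (taylor \<Phi> n) M" for p using tsbD[OF taylor_tsb[OF \<Phi>]] by blast
  qed (simp add: taylor_def)
  fix p and R0 :: real assume "R0 > 0"
  then obtain l where "exp 1 * (1 / 2 ^ l) \<le> R0" using small_exp_radius by blast
  then show "\<exists>R A. 0 < R \<and> R \<le> R0 \<and> tsb p R A (taylor \<Phi>)"
    using taylor_tsb[OF \<Phi>, of p l]
    by (intro exI[of _ "exp 1 * (1 / 2 ^ l)"] exI[of _ "growth_norm S (p, l) \<Phi>"]) auto
qed

text \<open>On the complex line through \<open>x\<close> the restriction is an entire function of
  one variable whose derivatives are the iterated directional derivatives; its Taylor series at 0 is
  evaluated at 1.\<close>

lemma taylor_sums:
  assumes \<Phi>: "\<Phi> \<in> entire_min S" and x: "x \<in> nuc_dual S"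
  shows "(\<lambda>n. taylor \<Phi> n (replicate n x)) sums \<Phi> (cplx x)"
proof -
  obtain p where p: "x \<in> dual_level S p" using x by (auto simp: nuc_dual_def)
  have eg: "entire_growth p (growth_norm S (p, 0) \<Phi>) 1 \<Phi>" using entire_min_growth[OF \<Phi>, of p 0] by simp
  define f where "f t = \<Phi> (dualC_line (\<lambda>\<theta>. 0) t (cplx x))" for t
  have hol: "f holomorphic_on UNIV"
    unfolding f_def using eg zero_dual_levelC cplx_level[OF p] by (simp add: entire_growth_def)
  have der: "(deriv ^^ n) f = (\<lambda>t. dirds (replicate n x) \<Phi> (dualC_line (\<lambda>\<theta>. 0) t (cplx x)))" for n
  proof (induction n)
    case 0
    then show ?case by (simp add: f_def fun_eq_iff)
  next
    case (Suc n)
    define g where "g t = dirds (replicate n x) \<Phi> (dualC_line (\<lambda>\<theta>. 0) t (cplx x))" for t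
    have "deriv g t = deriv (\<lambda>s. g (t + s)) 0" for t
    proof -
      have "(\<lambda>s. g (t + s)) = g \<circ> (\<lambda>s. s + t)" by (simp add: fun_eq_iff add.commute)
      then show ?thesis
        unfolding deriv_def using DERIV_shift[of g _ 0 t] by (simp add: comp_def)
    qed
    then have "deriv g t = dirds (replicate (Suc n) x) \<Phi> (dualC_line (\<lambda>\<theta>. 0) t (cplx x))" for t
      by (simp add: dird_def g_def dualC_line_line)
    moreover have "(deriv ^^ n) f = g" using Suc by (simp add: g_def[abs_def])
    ultimately show ?case by (intro ext) (simp del: dirds_simps replicate_Suc)
  qed
  have "(\<lambda>n. (deriv ^^ n) f 0 / fact n * (1 - 0) ^ n) sums f 1"
    by (rule holomorphic_power_series[of f 0 2]) (use hol in \<open>auto intro: holomorphic_on_subset\<close>)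
  moreover have "f 1 = \<Phi> (cplx x)" by (simp add: f_def dualC_line_def)
  ultimately show ?thesis using replicate_tuples[OF x] by (simp add: der taylor_def)
qed

section \<open>Complex multilinear extension\<close>

text \<open>Splitting every argument into real and imaginary part evaluates a tensor, defined on
  real functionals, at complex ones.\<close>

primrec cext :: "('h \<Rightarrow> complex) list \<Rightarrow> 'h tensor \<Rightarrow> complex" where
  "cext [] F = F []"
| "cext (z # zs) F = cext zs (\<lambda>xs. F (reD z # xs)) + \<i> * cext zs (\<lambda>xs. F (imD z # xs))"

lemma cext_lincomb: "cext zs (\<lambda>xs. a * F xs + b * G xs) = a * cext zs F + b * cext zs G"
  by (induction zs arbitrary: F G) (auto simp: algebra_simps)

lemma cext_cong:
  assumes "\<And>xs. xs \<in> tuples (dual_level S p) n \<Longrightarrow> F xs = G xs" "zs \<in> tuples (dual_levelC S p) n"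
  shows "cext zs F = cext zs G"
  using assms
proof (induction n arbitrary: F G zs)
  case (Suc n)
  obtain z ws where z: "zs = z # ws" "z \<in> dual_levelC S p" "ws \<in> tuples (dual_levelC S p) n"
    using Suc.prems(2) by (rule tuples_SucE)
  have "cext ws (\<lambda>xs. F (u # xs)) = cext ws (\<lambda>xs. G (u # xs))" if "u \<in> dual_level S p" for u
    using that z by (intro Suc.IH Suc.prems(1)) auto
  then show ?case using z by (simp add: dual_levelC_iff)
qed simp

lemma cext_zero: "cext zs (\<lambda>xs. 0) = 0"
  by (induction zs) auto

lemma cext_cplx:
  assumes "sym_multilinear (dual_level S p) n F" "xs \<in> tuples (dual_level S p) n"
  shows "cext (map cplx xs) F = F xs"
  using assms
proof (induction n arbitrary: F xs)
  case (Suc n)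
  obtain x ys where x: "xs = x # ys" "x \<in> dual_level S p" "ys \<in> tuples (dual_level S p) n"
    using Suc.prems(2) by (rule tuples_SucE)
  have "cext (map cplx ys) (\<lambda>xs. F ((\<lambda>\<theta>. 0) # xs)) = cext (map cplx ys) (\<lambda>xs. 0)"
    using x symml_zero_head[OF lin_closed_dual_level Suc.prems(1)]
    by (intro cext_cong[of p n] map_tuples[of _ "dual_level S p"]) (auto simp: cplx_level)
  then show ?case
    using x Suc.IH[OF symml_Cons[OF lin_closed_dual_level Suc.prems(1) x(2)] x(3)] by (simp add: cext_zero)
qed simp

text \<open>Each argument splits into two parts with norms at most \<open>dnormC\<close>, whence a
  factor 2 per argument. It doubles the growth rate, which minimal type tolerates.\<close>

lemma cext_bound:
  assumes "tbound p n F M" "0 \<le> M" "zs \<in> tuples (dual_levelC S p) n"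
  shows "cmod (cext zs F) \<le> M * (\<Prod>z\<leftarrow>zs. 2 * dnormC S p z)"
  using assms
proof (induction n arbitrary: F M zs)
  case 0
  then show ?case using tboundD[OF 0(1), of "[]"] by simp
next
  case (Suc n)
  obtain z ws where z: "zs = z # ws" "z \<in> dual_levelC S p" "ws \<in> tuples (dual_levelC S p) n"
    using Suc.prems(3) by (rule tuples_SucE)
  define W where "W = (\<Prod>z\<leftarrow>ws. 2 * dnormC S p z)"
  have W: "0 \<le> W" unfolding W_def by (intro prod_list_nonneg_real) (simp add: dnormC_nonneg)
  have part: "cmod (cext ws (\<lambda>xs. F (u # xs))) \<le> M * dnormC S p z * W"
    if u: "u \<in> dual_level S p" "dnorm S p u \<le> dnormC S p z" for u
    unfolding W_def
  proof (rule Suc.IH)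
    have "tbound p n (\<lambda>ys. F ([u] @ ys)) (M * (\<Prod>x\<leftarrow>[u]. dnorm S p x))"
      using Suc.prems(1) u by (intro tbound_append) (auto simp: tuples_def)
    then show "tbound p n (\<lambda>ys. F (u # ys)) (M * dnormC S p z)"
      using u Suc.prems(2) by (auto intro: tbound_weaken mult_left_mono)
  qed (use z Suc.prems(2) dnormC_nonneg in auto)
  have "cmod (cext zs F) \<le> cmod (cext ws (\<lambda>xs. F (reD z # xs))) + cmod (cext ws (\<lambda>xs. F (imD z # xs)))"
    unfolding z(1) cext.simps by (rule order_trans[OF norm_triangle_ineq]) (simp add: norm_mult)
  also have "\<dots> \<le> M * dnormC S p z * W + M * dnormC S p z * W"
    using z(2) dnorm_le_dnormC by (intro add_mono part) (auto simp: dual_levelC_iff)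
  finally show ?case by (simp add: z(1) W_def)
qed

text \<open>The first argument enters linearly in \<open>t\<close>, with coefficients
  \<open>h u t\<close> that depend on \<open>t\<close> through the remaining arguments and are
  holomorphic by induction.\<close>

lemma cext_line_holomorphic:
  assumes "sym_multilinear (dual_level S p) n F" "z \<in> dual_levelC S p" "w \<in> dual_levelC S p"
  shows "(\<lambda>t. cext (replicate n (dualC_line z t w)) F) holomorphic_on UNIV"
  using assms(1)
proof (induction n arbitrary: F)
  case (Suc n)
  note D = lin_closed_dual_level
  have l: "reD z \<in> dual_level S p" "imD z \<in> dual_level S p" "reD w \<in> dual_level S p" "imD w \<in> dual_level S p"
    using assms by (auto simp: dual_levelC_iff)
  define h where "h u t = cext (replicate n (dualC_line z t w)) (\<lambda>xs. F (u # xs))" for u t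
  have hh: "h u holomorphic_on UNIV" if "u \<in> dual_level S p" for u
    unfolding h_def using Suc.IH[OF symml_Cons[OF D Suc.prems that]] .
  have hl: "h (\<lambda>\<theta>. u \<theta> + (a * v \<theta> + b * v' \<theta>)) t = h u t + (of_real a * h v t + of_real b * h v' t)"
    if "u \<in> dual_level S p" "v \<in> dual_level S p" "v' \<in> dual_level S p" for u v v' a b t
  proof -
    have tz: "replicate n (dualC_line z t w) \<in> tuples (dual_levelC S p) n"
      using assms by (intro replicate_tuples dualC_line_level)
    have lin: "h (\<lambda>\<theta>. a * v \<theta> + b * v' \<theta>) t = of_real a * h v t + of_real b * h v' t"
      if "v \<in> dual_level S p" "v' \<in> dual_level S p" for v v' a b
      unfolding h_def cext_lincomb[symmetric] using symml_head[OF Suc.prems _ that] tz by (intro cext_cong[of p n]) auto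
    from lin[of u "\<lambda>\<theta>. a * v \<theta> + b * v' \<theta>" 1 1] show ?thesis
      using that lin[OF that(2,3)] by (simp add: dual_level_comb)
  qed
  have "cext (replicate (Suc n) (dualC_line z t w)) F =
      h (reD z) t + \<i> * h (imD z) t + t * (h (reD w) t + \<i> * h (imD w) t)" for t
  proof -
    have "cext (replicate (Suc n) (dualC_line z t w)) F = h (reD (dualC_line z t w)) t + \<i> * h (imD (dualC_line z t w)) t"
      by (simp add: h_def)
    also have "\<dots> = h (reD z) t + (of_real (Re t) * h (reD w) t + of_real (- Im t) * h (imD w) t)
       + \<i> * (h (imD z) t + (of_real (Re t) * h (imD w) t + of_real (Im t) * h (reD w) t))"
      unfolding reD_line imD_line using l by (simp only: hl)
    also have "\<dots> = h (reD z) t + \<i> * h (imD z) t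
        + (of_real (Re t) + \<i> * of_real (Im t)) * (h (reD w) t + \<i> * h (imD w) t)"
    proof -
      have "A + (of_real r * C + of_real (- s) * D) + \<i> * (B + (of_real r * D + of_real s * C)) =
          A + \<i> * B + (of_real r + \<i> * of_real s) * (C + \<i> * D)" for A B C D :: complex and r s :: real
        by (simp add: complex_eq_iff algebra_simps)
      then show ?thesis .
    qed
    also have "of_real (Re t) + \<i> * of_real (Im t) = t" by (simp add: complex_eq_iff)
    finally show ?thesis .
  qed
  then show ?case using hh l by (auto intro!: holomorphic_intros)
qed simp

section \<open>Power series as entire functions\<close>

definition entire_of :: "(nat \<Rightarrow> 'h tensor) \<Rightarrow> ('h \<Rightarrow> complex) \<Rightarrow> complex" where
  "entire_of \<psi> z = (if z \<in> nuc_dualC S then \<Sum>n. cext (replicate n z) (\<psi> n) else 0)"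

lemma entire_of_term_bound:
  assumes "tsb p R A \<psi>" "0 \<le> R" "z \<in> dual_levelC S p"
  shows "cmod (cext (replicate n z) (\<psi> n)) \<le> A * ((2 * R * dnormC S p z) ^ n / fact n)"
proof -
  have "cmod (cext (replicate n z) (\<psi> n)) \<le> A * R ^ n / fact n * (\<Prod>z\<leftarrow>replicate n z. 2 * dnormC S p z)"
    using assms tsb_nonneg[OF assms(1)] by (intro cext_bound[OF tsbD[OF assms(1)]] replicate_tuples) auto
  also have "\<dots> = A * ((2 * R * dnormC S p z) ^ n / fact n)"
    by (simp add: map_replicate prod_list_replicate power_mult_distrib)
  finally show ?thesis .
qed

text \<open>The exponential series is a majorant. It yields the growth bound directly, and on each
  line it gives locally uniform convergence, so that the sum is entire there.\<close>

lemma entire_of_growth: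
  assumes \<psi>: "\<psi> \<in> test_series S" "tsb p R A \<psi>" and R: "0 \<le> R"
  shows "entire_growth p A (2 * R) (entire_of \<psi>)"
  unfolding entire_growth_def
proof (intro conjI ballI)
  note bd = entire_of_term_bound[OF \<psi>(2) R]
  have A: "0 \<le> A" using \<psi> tsb_nonneg by blast
  show "(\<lambda>t. entire_of \<psi> (dualC_line z t w)) holomorphic_on UNIV"
    if z: "z \<in> dual_levelC S p" and w: "w \<in> dual_levelC S p" for z w
  proof -
    define f where "f n t = cext (replicate n (dualC_line z t w)) (\<psi> n)" for n t
    have fh: "f n holomorphic_on UNIV" for n
      unfolding f_def using symml_mono[OF dual_level_subset nuc_tensor_symml[OF test_series_nuc[OF \<psi>(1)]]] z w
      by (rule cext_line_holomorphic)
    have "(\<lambda>t. \<Sum>n. f n t) holomorphic_on UNIV"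
    proof (rule holomorphic_uniform_sequence[OF open_UNIV])
      show "(\<lambda>t. \<Sum>i<n. f i t) holomorphic_on UNIV" for n by (intro holomorphic_intros fh)
      fix x :: complex
      define N where "N = dnormC S p z + 2 * (cmod x + 1) * dnormC S p w"
      have "uniform_limit (cball x 1) (\<lambda>n t. \<Sum>i<n. f i t) (\<lambda>t. \<Sum>n. f n t) sequentially"
      proof (rule Weierstrass_m_test)
        fix n t assume "t \<in> cball x 1"
        then have t: "cmod t \<le> cmod x + 1"
          using norm_triangle_sub[of t x] by (simp add: dist_norm norm_minus_commute)
        have "dnormC S p (dualC_line z t w) \<le> dnormC S p z + 2 * cmod t * dnormC S p w"
          by (rule dnormC_line_le[OF z w])
        also have "\<dots> \<le> N" unfolding N_def using t dnormC_nonneg[of p w] by (simp add: mult_right_mono)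
        finally have "A * ((2 * R * dnormC S p (dualC_line z t w)) ^ n / fact n) \<le> A * ((2 * R * N) ^ n / fact n)"
          using A R dnormC_nonneg by (intro mult_left_mono divide_right_mono power_mono) auto
        then show "norm (f n t) \<le> A * ((2 * R * N) ^ n / fact n)"
          unfolding f_def using bd[OF dualC_line_level[OF z w]] order_trans by blast
      qed (rule sums_summable[OF exp_sums_real])
      then show "\<exists>d. 0 < d \<and> cball x d \<subseteq> UNIV \<and> uniform_limit (cball x d) (\<lambda>n t. \<Sum>i<n. f i t) (\<lambda>t. \<Sum>n. f n t) sequentially"
        by (intro exI[of _ 1]) auto
    qed
    then show ?thesis
      using dual_levelC_nuc[OF dualC_line_level[OF z w]] by (simp add: entire_of_def f_def)
  qed
  fix z assume z: "z \<in> dual_levelC S p"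
  have sn: "summable (\<lambda>n. norm (cext (replicate n z) (\<psi> n)))"
    by (rule summable_comparison_test'[OF sums_summable[OF exp_sums_real], of 0]) (use bd[OF z] in simp)
  have "cmod (entire_of \<psi> z) \<le> (\<Sum>n. norm (cext (replicate n z) (\<psi> n)))"
    using dual_levelC_nuc[OF z] summable_norm[OF sn] by (simp add: entire_of_def)
  also have "\<dots> \<le> (\<Sum>n. A * ((2 * R * dnormC S p z) ^ n / fact n))"
    by (rule suminf_le[OF bd[OF z] sn sums_summable[OF exp_sums_real]])
  also have "\<dots> = A * exp (2 * R * dnormC S p z)" by (rule sums_unique[OF exp_sums_real, symmetric])
  finally show "cmod (entire_of \<psi> z) \<le> A * exp (2 * R * dnormC S p z)" .
qed

lemma entire_of_entire_min:
  assumes \<psi>: "\<psi> \<in> test_series S"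
  shows "entire_of \<psi> \<in> entire_min S"
proof -
  have "entire_of \<psi> \<in> entire_level S p l" for p l
  proof -
    \<comment> \<open>The extra 1 compensates the factor 2 between the radius of the series and the
      growth rate of its sum.\<close>
    obtain A where A: "tsb p (1 / 2 ^ (l + 1)) A \<psi>" using test_series_tsb[OF \<psi>, of "1 / 2 ^ (l + 1)" p] by auto
    show ?thesis
      using entire_growth_level(1)[OF entire_of_growth[OF \<psi> A], of l] by simp
  qed
  then show ?thesis by (auto simp: entire_min_def entire_of_def)
qed

lemma entire_of_cplx:
  assumes \<psi>: "\<psi> \<in> test_series S" and x: "x \<in> nuc_dual S"
  shows "(\<lambda>n. \<psi> n (replicate n x)) sums entire_of \<psi> (cplx x)"
    "summable (\<lambda>n. norm (\<psi> n (replicate n x)))"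
proof -
  obtain p where p: "x \<in> dual_level S p" using x by (auto simp: nuc_dual_def)
  obtain A where A: "tsb p 1 A \<psi>" using test_series_tsb[OF \<psi>, of 1 p] by auto
  have eq: "cext (replicate n (cplx x)) (\<psi> n) = \<psi> n (replicate n x)" for n
    using cext_cplx[OF symml_mono[OF dual_level_subset nuc_tensor_symml[OF test_series_nuc[OF \<psi>]]]
        replicate_tuples[OF p], of n] by (simp add: map_replicate)
  show sn: "summable (\<lambda>n. norm (\<psi> n (replicate n x)))"
    by (rule summable_comparison_test'[OF sums_summable[OF exp_sums_real[of A "2 * 1 * dnormC S p (cplx x)"]], of 0])
      (use entire_of_term_bound[OF A _ cplx_level[OF p]] in \<open>simp add: eq\<close>)
  show "(\<lambda>n. \<psi> n (replicate n x)) sums entire_of \<psi> (cplx x)"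
    using summable_sums[OF summable_norm_cancel[OF sn]] dual_levelC_nuc[OF cplx_level[OF p]]
    by (simp add: entire_of_def eq)
qed

text \<open>With \<open>z = x + \<i> y\<close>, both functions are entire on the line
  \<open>x + t y\<close> and agree for real \<open>t\<close>; the identity theorem gives equality at
  \<open>t = \<i>\<close>. Hence restriction to the real dual loses nothing.\<close>

lemma entire_min_real_unique:
  assumes \<Phi>: "\<Phi> \<in> entire_min S" and \<Psi>: "\<Psi> \<in> entire_min S"
    and eq: "\<And>x. x \<in> nuc_dual S \<Longrightarrow> \<Phi> (cplx x) = \<Psi> (cplx x)"
  shows "\<Phi> = \<Psi>"
proof
  fix z
  show "\<Phi> z = \<Psi> z"
  proof (cases "z \<in> nuc_dualC S")
    case False
    then show ?thesis using \<Phi> \<Psi> by (simp add: entire_min_def)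
  next
    case True
    then obtain p where z: "z \<in> dual_levelC S p" by (auto simp: nuc_dualC_def)
    define x where "x = reD z"
    define y where "y = imD z"
    have xy: "x \<in> dual_level S p" "y \<in> dual_level S p" using z by (auto simp: x_def y_def dual_levelC_iff)
    define f where "f t = \<Phi> (dualC_line (cplx x) t (cplx y)) - \<Psi> (dualC_line (cplx x) t (cplx y))" for t
    have hol: "f holomorphic_on UNIV"
      unfolding f_def using entire_min_growth[OF \<Phi>, of p 0] entire_min_growth[OF \<Psi>, of p 0] cplx_level xy
      by (intro holomorphic_intros) (auto simp: entire_growth_def)
    have zero: "f t = 0" if t: "t \<in> \<real>" for t
    proof -
      obtain r where r: "t = of_real r" using t by (rule Reals_cases)
      have "dualC_line (cplx x) t (cplx y) = cplx (\<lambda>\<theta>. 1 * x \<theta> + r * y \<theta>)"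
        by (simp add: dualC_line_def cplx_def fun_eq_iff r)
      moreover have "(\<lambda>\<theta>. 1 * x \<theta> + r * y \<theta>) \<in> nuc_dual S" using dual_level_comb[OF xy] nuc_dualI by blast
      ultimately show ?thesis using eq by (simp add: f_def)
    qed
    have lim: "(0::complex) islimpt \<real>"
      unfolding islimpt_approachable
    proof (intro allI impI)
      fix e :: real assume "e > 0"
      then show "\<exists>x'\<in>\<real>. x' \<noteq> (0::complex) \<and> dist x' 0 < e"
        by (intro bexI[of _ "of_real (e / 2)"]) (auto simp: dist_norm)
    qed
    have "f \<i> = 0"
      by (rule analytic_continuation[OF hol open_UNIV connected_UNIV subset_UNIV UNIV_I lim zero UNIV_I])
    moreover have "dualC_line (cplx x) \<i> (cplx y) = z"
      by (simp add: dualC_line_def cplx_def x_def y_def reD_def imD_def fun_eq_iff complex_eq_iff)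
    ultimately show ?thesis by (simp add: f_def)
  qed
qed

lemma entire_of_taylor:
  assumes \<Phi>: "\<Phi> \<in> entire_min S"
  shows "entire_of (taylor \<Phi>) = \<Phi>"
proof (rule entire_min_real_unique[OF entire_of_entire_min[OF taylor_test_series[OF \<Phi>]] \<Phi>])
  fix x assume x: "x \<in> nuc_dual S"
  show "entire_of (taylor \<Phi>) (cplx x) = \<Phi> (cplx x)"
    using entire_of_cplx(1)[OF taylor_test_series[OF \<Phi>] x] taylor_sums[OF \<Phi> x] by (rule sums_unique2)
qed

subsection \<open>Uniqueness of the coefficients\<close>

text \<open>Along real multiples of \<open>x\<close> the difference of the two series is a power
  series in one variable with sum 0, so every component of the difference vanishes on the diagonal.
  Polarization does the rest.\<close>

lemma entire_of_inj:
  assumes \<psi>: "\<psi> \<in> test_series S" and \<psi>': "\<psi>' \<in> test_series S"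
    and eq: "entire_of \<psi> = entire_of \<psi>'"
  shows "\<psi> = \<psi>'"
proof (intro ext)
  fix n xs
  define F where "F n = (\<lambda>xs. \<psi> n xs - \<psi>' n xs)" for n
  have Fn: "F n \<in> nuc_tensor S n" for n
    unfolding F_def by (intro nuc_tensor_diff test_series_nuc \<psi> \<psi>')
  have "F n (replicate n x) = 0" if x: "x \<in> nuc_dual S" for x
  proof (rule power_series_zero[of 2 "\<lambda>n. F n (replicate n x)"])
    have sc: "\<phi> n (replicate n (\<lambda>\<theta>. t * x \<theta>)) = of_real t ^ n * \<phi> n (replicate n x)"
      if "\<phi> \<in> test_series S" for \<phi> n t
    proof -
      have "G (replicate n (\<lambda>\<theta>. t * x \<theta>)) = of_real t ^ n * G (replicate n x)"
        if "sym_multilinear (nuc_dual S) n G" for G n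
        using that
      proof (induction n arbitrary: G)
        case (Suc n)
        have tx: "(\<lambda>\<theta>. t * x \<theta>) \<in> nuc_dual S" using lin_closedD[OF lin_closed_nuc_dual x x, of t 0] by simp
        show ?case
          using symml_scale_head[OF Suc.prems replicate_tuples[OF tx] x, of t]
            Suc.IH[OF symml_Cons[OF lin_closed_nuc_dual Suc.prems x]] by (simp add: mult_ac)
      qed simp
      then show ?thesis using nuc_tensor_symml[OF test_series_nuc[OF that]] by blast
    qed
    show "(\<lambda>n. F n (replicate n x) * of_real t ^ n) sums 0" for t :: real
    proof -
      have tx: "(\<lambda>\<theta>. t * x \<theta>) \<in> nuc_dual S" using lin_closedD[OF lin_closed_nuc_dual x x, of t 0] by simp
      have "(\<lambda>n. \<psi> n (replicate n (\<lambda>\<theta>. t * x \<theta>)) - \<psi>' n (replicate n (\<lambda>\<theta>. t * x \<theta>))) sums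
          (entire_of \<psi> (cplx (\<lambda>\<theta>. t * x \<theta>)) - entire_of \<psi>' (cplx (\<lambda>\<theta>. t * x \<theta>)))"
        by (intro sums_diff entire_of_cplx(1) \<psi> \<psi>' tx)
      then show ?thesis unfolding sc[OF \<psi>] sc[OF \<psi>'] eq by (simp add: F_def algebra_simps)
    qed
    show "summable (\<lambda>n. F n (replicate n x) * t ^ n)" if "cmod t < 2" for t
    proof -
      \<comment> \<open>Absolute convergence at \<open>2 x\<close> dominates the power series on the
        disc of radius 2.\<close>
      have tx: "(\<lambda>\<theta>. 2 * x \<theta>) \<in> nuc_dual S" using lin_closedD[OF lin_closed_nuc_dual x x, of 2 0] by simp
      have "summable (\<lambda>n. norm (\<psi> n (replicate n (\<lambda>\<theta>. 2 * x \<theta>))) + norm (\<psi>' n (replicate n (\<lambda>\<theta>. 2 * x \<theta>))))"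
        by (intro summable_add entire_of_cplx(2) \<psi> \<psi>' tx)
      then show ?thesis
      proof (rule summable_comparison_test'[of _ 0])
        fix n
        have "norm (F n (replicate n x) * t ^ n) \<le> (norm (\<psi> n (replicate n x)) + norm (\<psi>' n (replicate n x))) * 2 ^ n"
          unfolding norm_mult norm_power F_def using that
          by (intro mult_mono norm_triangle_ineq4 power_mono) auto
        then show "norm (F n (replicate n x) * t ^ n) \<le>
            norm (\<psi> n (replicate n (\<lambda>\<theta>. 2 * x \<theta>))) + norm (\<psi>' n (replicate n (\<lambda>\<theta>. 2 * x \<theta>)))"
          unfolding sc[OF \<psi>, of _ 2] sc[OF \<psi>', of _ 2] by (simp add: norm_mult norm_power algebra_simps)
      qed
    qed
  qed simp
  then have "F n xs = 0"
    using symml_diagonal_zero[OF lin_closed_nuc_dual nuc_tensor_symml[OF Fn]] nuc_tensor_outside[OF Fn]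
    by (cases "xs \<in> tuples (nuc_dual S) n") auto
  then show "\<psi> n xs = \<psi>' n xs" by (simp add: F_def)
qed

lemma taylor_entire_of: "\<psi> \<in> test_series S \<Longrightarrow> taylor (entire_of \<psi>) = \<psi>"
  by (rule entire_of_inj) (auto simp: taylor_test_series entire_of_entire_min entire_of_taylor)

end

section \<open>Comparison of topologies\<close>

lemma openin_carried_topology:
  assumes "inj_on f (topspace T)"
  shows "openin (carried_topology f T) W \<longleftrightarrow> (\<exists>U. openin T U \<and> W = f ` U)"
proof -
  have eq: "inv_into (topspace T) f -` U \<inter> f ` topspace T = f ` U" if "openin T U" for U
    using openin_subset[OF that] assms by (auto simp: inv_into_f_f)
  show ?thesis
    unfolding carried_topology_def openin_pullback_topology using eq by metis
qed

lemma topspace_projlim: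
  assumes "\<And>i x. x \<in> V \<Longrightarrow> \<nu> i (x - x) = 0"
  shows "topspace (projlim_topology V \<nu>) = V"
  unfolding projlim_topology_def
proof (subst topology_generated_by_topspace, safe)
  fix x assume "x \<in> V"
  then have "x \<in> {y \<in> V. \<nu> undefined (y - x) < 1}" using assms by simp
  then show "x \<in> \<Union> {{y \<in> V. \<nu> i (y - x) < \<epsilon>} | i x \<epsilon>. x \<in> V \<and> 0 < \<epsilon>}"
    using \<open>x \<in> V\<close> zero_less_one by blast
qed

lemma openin_projlim_ball:
  "x \<in> V \<Longrightarrow> 0 < \<epsilon> \<Longrightarrow> openin (projlim_topology V \<nu>) {y \<in> V. \<nu> i (y - x) < \<epsilon>}"
  unfolding projlim_topology_def by (rule topology_generated_by_Basis) blast

text \<open>A Lipschitz estimate for each target seminorm by some source seminorm makes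
  \<open>h\<close> continuous. It suffices to treat the balls that generate the topology.\<close>

lemma openin_projlim_preimage:
  assumes h: "\<And>x. x \<in> V \<Longrightarrow> h x \<in> W"
    and zero: "\<And>i x. x \<in> V \<Longrightarrow> \<nu> i (x - x) = 0"
    and tri: "\<And>j x y z. x \<in> W \<Longrightarrow> y \<in> W \<Longrightarrow> z \<in> W \<Longrightarrow> \<nu>' j (x - z) \<le> \<nu>' j (x - y) + \<nu>' j (y - z)"
    and bound: "\<And>j. \<exists>i C. C > 0 \<and> (\<forall>x\<in>V. \<forall>y\<in>V. \<nu>' j (h x - h y) \<le> C * \<nu> i (x - y))"
    and U: "openin (projlim_topology W \<nu>') U"
  shows "openin (projlim_topology V \<nu>) {x \<in> V. h x \<in> U}"
proof -
  have "generate_topology_on {{y \<in> W. \<nu>' i (y - x) < \<epsilon>} | i x \<epsilon>. x \<in> W \<and> \<epsilon> > 0} U"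
    using U unfolding projlim_topology_def openin_topology_generated_by_iff .
  then show ?thesis
  proof (induction rule: generate_topology_on.induct)
    case (Int a b)
    have "{x \<in> V. h x \<in> a \<inter> b} = {x \<in> V. h x \<in> a} \<inter> {x \<in> V. h x \<in> b}" by auto
    then show ?case using openin_Int[OF Int.IH] by simp
  next
    case (UN K)
    have "{x \<in> V. h x \<in> \<Union>K} = (\<Union>k\<in>K. {x \<in> V. h x \<in> k})" by auto
    then show ?case using UN.IH by (auto intro!: openin_Union)
  next
    case (Basis s)
    then obtain j w \<epsilon> where s: "s = {y \<in> W. \<nu>' j (y - w) < \<epsilon>}" "w \<in> W" "\<epsilon> > 0" by blast
    obtain i C where C: "C > 0" "\<And>x y. x \<in> V \<Longrightarrow> y \<in> V \<Longrightarrow> \<nu>' j (h x - h y) \<le> C * \<nu> i (x - y)"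
      using bound by blast
    show ?case
    proof (subst openin_subopen, intro ballI)
      fix x assume x: "x \<in> {x \<in> V. h x \<in> s}"
      \<comment> \<open>The room left inside the target ball at \<open>h x\<close>, divided by the
        Lipschitz constant.\<close>
      define \<delta> where "\<delta> = (\<epsilon> - \<nu>' j (h x - w)) / C"
      have \<delta>: "\<delta> > 0" using x s C by (simp add: \<delta>_def)
      define N where "N = {y \<in> V. \<nu> i (y - x) < \<delta>}"
      have "openin (projlim_topology V \<nu>) N" unfolding N_def using x \<delta> by (intro openin_projlim_ball) auto
      moreover have "x \<in> N" using x \<delta> zero by (simp add: N_def)
      moreover have "N \<subseteq> {x \<in> V. h x \<in> s}"
      proof
        fix y assume y: "y \<in> N"
        then have yV: "y \<in> V" by (simp add: N_def)
        have "\<nu>' j (h y - w) \<le> \<nu>' j (h y - h x) + \<nu>' j (h x - w)" using yV x s h by (intro tri) auto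
        also have "\<dots> \<le> C * \<nu> i (y - x) + \<nu>' j (h x - w)" using C(2) yV x by simp
        also have "\<dots> < C * \<delta> + \<nu>' j (h x - w)" using y C(1) by (simp add: N_def)
        also have "\<dots> = \<epsilon>" using C(1) by (simp add: \<delta>_def)
        finally show "y \<in> {x \<in> V. h x \<in> s}" using yV h s by simp
      qed
      ultimately show "\<exists>T. openin (projlim_topology V \<nu>) T \<and> x \<in> T \<and> T \<subseteq> {x \<in> V. h x \<in> s}" by blast
    qed
  qed simp
qed

text \<open>Minkowski's inequality for partial sums, with a bound that does not depend on
  \<open>N\<close>.\<close>

lemma sqrt_suminf_triangle:
  fixes c u v :: "nat \<Rightarrow> real"
  assumes le: "\<And>n. 0 \<le> c n" "\<And>n. c n \<le> u n + v n"
    and summ: "summable (\<lambda>n. (c n)\<^sup>2)" "summable (\<lambda>n. (u n)\<^sup>2)" "summable (\<lambda>n. (v n)\<^sup>2)"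
  shows "sqrt (\<Sum>n. (c n)\<^sup>2) \<le> sqrt (\<Sum>n. (u n)\<^sup>2) + sqrt (\<Sum>n. (v n)\<^sup>2)"
proof -
  define B where "B = sqrt (\<Sum>n. (u n)\<^sup>2) + sqrt (\<Sum>n. (v n)\<^sup>2)"
  have B: "0 \<le> B" unfolding B_def using summ by (intro add_nonneg_nonneg real_sqrt_ge_zero suminf_nonneg) auto
  have "(\<Sum>n<N. (c n)\<^sup>2) \<le> B\<^sup>2" for N
  proof -
    have "sqrt (\<Sum>n<N. (c n)\<^sup>2) = L2_set c {..<N}" by (simp add: L2_set_def)
    also have "\<dots> \<le> L2_set (\<lambda>n. u n + v n) {..<N}" using le by (intro L2_set_mono)
    also have "\<dots> \<le> L2_set u {..<N} + L2_set v {..<N}" by (rule L2_set_triangle_ineq)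
    also have "\<dots> \<le> B"
      unfolding B_def L2_set_def using summ by (intro add_mono real_sqrt_le_mono sum_le_suminf) auto
    finally show ?thesis by (rule sqrt_le_D)
  qed
  then have "(\<Sum>n. (c n)\<^sup>2) \<le> B\<^sup>2" using summ by (intro suminf_le_const)
  then show ?thesis using B unfolding B_def[symmetric] by (rule real_le_lsqrt[rotated])
qed

section \<open>Seminorm estimates for the maps between the two spaces\<close>

context nuclear_scale
begin

lemma tnorm_zero: "tnorm S p n (\<lambda>xs. 0) = 0"
proof -
  have "hs_sums S p n (\<lambda>xs. 0) = {0}" using hs_sums_nonempty[of p n "\<lambda>xs. 0"] by (auto simp: hs_sums_def)
  then show ?thesis by (simp add: tnorm_def)
qed

lemma test_norm_diff_self: "test_norm S i (\<phi> - \<phi>) = 0"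
  by (cases i) (simp add: test_norm_def fun_diff_def tnorm_zero)

lemma test_norm_triangle:
  assumes "\<phi> \<in> test_series S" "\<psi> \<in> test_series S" "\<zeta> \<in> test_series S"
  shows "test_norm S i (\<phi> - \<zeta>) \<le> test_norm S i (\<phi> - \<psi>) + test_norm S i (\<psi> - \<zeta>)"
proof -
  obtain p q where i: "i = (p, q)" by (cases i)
  define w where "w n = (fact n * sqrt (2 ^ (n * q)) :: real)" for n
  have w0: "0 \<le> w n" for n by (simp add: w_def)
  have sq: "(fact n)\<^sup>2 * 2 ^ (n * q) * (tnorm S p n F)\<^sup>2 = (w n * tnorm S p n F)\<^sup>2" for n F
    by (simp add: w_def power_mult_distrib)
  have nn: "0 \<le> tnorm S p n (\<alpha> n)" if "\<alpha> \<in> test_series S" for \<alpha> n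
    using that by (intro tnorm_nonneg nuc_tensor_level test_series_nuc)
  have summ: "summable (\<lambda>n. (w n * tnorm S p n (\<alpha> n))\<^sup>2)" if "\<alpha> \<in> test_series S" for \<alpha>
    using that unfolding sq[symmetric] by (auto simp: test_series_def test_level_def)
  have d: "\<phi> - \<zeta> \<in> test_series S" "\<phi> - \<psi> \<in> test_series S" "\<psi> - \<zeta> \<in> test_series S"
    using assms test_series_diff by auto
  show ?thesis
    unfolding i test_norm_def prod.case sq
  proof (rule sqrt_suminf_triangle)
    fix n
    show "0 \<le> w n * tnorm S p n ((\<phi> - \<zeta>) n)" by (intro mult_nonneg_nonneg w0 nn d)
    have "tnorm S p n (\<lambda>xs. (\<phi> - \<psi>) n xs + (\<psi> - \<zeta>) n xs) \<le> tnorm S p n ((\<phi> - \<psi>) n) + tnorm S p n ((\<psi> - \<zeta>) n)"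
      using d by (intro tnorm_triangle nuc_tensor_level test_series_nuc)
    moreover have "(\<lambda>xs. (\<phi> - \<psi>) n xs + (\<psi> - \<zeta>) n xs) = (\<phi> - \<zeta>) n" by (simp add: fun_eq_iff)
    ultimately have "tnorm S p n ((\<phi> - \<zeta>) n) \<le> tnorm S p n ((\<phi> - \<psi>) n) + tnorm S p n ((\<psi> - \<zeta>) n)" by simp
    then show "w n * tnorm S p n ((\<phi> - \<zeta>) n) \<le> w n * tnorm S p n ((\<phi> - \<psi>) n) + w n * tnorm S p n ((\<psi> - \<zeta>) n)"
      using w0 by (simp add: mult_left_mono flip: distrib_left)
  qed (rule summ d)+
qed

lemma entire_of_diff:
  assumes \<psi>: "\<psi> \<in> test_series S" and \<psi>': "\<psi>' \<in> test_series S"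
  shows "entire_of (\<psi> - \<psi>') = entire_of \<psi> - entire_of \<psi>'"
proof
  fix z
  show "entire_of (\<psi> - \<psi>') z = (entire_of \<psi> - entire_of \<psi>') z"
  proof (cases "z \<in> nuc_dualC S")
    case True
    then obtain p where z: "z \<in> dual_levelC S p" by (auto simp: nuc_dualC_def)
    have summ: "summable (\<lambda>n. cext (replicate n z) (\<phi> n))" if \<phi>: "\<phi> \<in> test_series S" for \<phi>
    proof -
      obtain A where A: "tsb p 1 A \<phi>" using test_series_tsb[OF \<phi>, of 1 p] by auto
      show ?thesis
        by (rule summable_comparison_test'[OF sums_summable[OF exp_sums_real[of A "2 * 1 * dnormC S p z"]], of 0])
          (use entire_of_term_bound[OF A _ z] in simp)
    qed
    have "cext (replicate n z) ((\<psi> - \<psi>') n) = cext (replicate n z) (\<psi> n) - cext (replicate n z) (\<psi>' n)" for n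
      using cext_lincomb[of "replicate n z" 1 "\<psi> n" "-1" "\<psi>' n"] by (simp add: fun_diff_def)
    then show ?thesis using True suminf_diff[OF summ[OF \<psi>] summ[OF \<psi>']] by (simp add: entire_of_def)
  qed (simp add: entire_of_def)
qed

text \<open>The difference is written as the sum of the power series with the difference of the
  coefficients. Both claims are then transported through the correspondence with test
  series.\<close>

lemma entire_min_diff:
  assumes "\<Phi> \<in> entire_min S" "\<Psi> \<in> entire_min S"
  shows "\<Phi> - \<Psi> \<in> entire_min S" "taylor (\<Phi> - \<Psi>) = taylor \<Phi> - taylor \<Psi>"
proof -
  have t: "taylor \<Phi> - taylor \<Psi> \<in> test_series S" using assms by (intro test_series_diff taylor_test_series)
  have eq: "\<Phi> - \<Psi> = entire_of (taylor \<Phi> - taylor \<Psi>)"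
    using assms by (simp add: entire_of_diff taylor_test_series entire_of_taylor)
  show "\<Phi> - \<Psi> \<in> entire_min S" unfolding eq by (rule entire_of_entire_min[OF t])
  show "taylor (\<Phi> - \<Psi>) = taylor \<Phi> - taylor \<Psi>" unfolding eq by (rule taylor_entire_of[OF t])
qed

lemma growth_norm_diff_self: "growth_norm S i (\<Phi> - \<Phi>) = 0"
proof -
  have "dual_levelC S (fst i) \<noteq> {}" using zero_dual_levelC by blast
  then show ?thesis by (simp add: growth_norm_def case_prod_unfold cSUP_const)
qed

lemma growth_norm_triangle:
  assumes "\<Phi> \<in> entire_min S" "\<Psi> \<in> entire_min S" "\<Xi> \<in> entire_min S"
  shows "growth_norm S i (\<Phi> - \<Xi>) \<le> growth_norm S i (\<Phi> - \<Psi>) + growth_norm S i (\<Psi> - \<Xi>)"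
proof -
  obtain p l where i: "i = (p, l)" by (cases i)
  define e where "e z = exp (- (1 / 2 ^ l * dnormC S p z))" for z
  have le: "cmod (\<Theta> z) * e z \<le> growth_norm S (p, l) \<Theta>" if "\<Theta> \<in> entire_min S" "z \<in> dual_levelC S p" for \<Theta> z
  proof -
    have "bdd_above ((\<lambda>z. cmod (\<Theta> z) * exp (- (1 / 2 ^ l * dnormC S p z))) ` dual_levelC S p)"
      using that by (simp add: entire_min_def entire_level_def)
    from cSUP_upper[OF that(2) this] show ?thesis by (simp add: growth_norm_def e_def)
  qed
  have "growth_norm S (p, l) (\<Phi> - \<Xi>) = (SUP z\<in>dual_levelC S p. cmod ((\<Phi> - \<Xi>) z) * e z)"
    by (simp add: growth_norm_def e_def)
  also have "\<dots> \<le> growth_norm S (p, l) (\<Phi> - \<Psi>) + growth_norm S (p, l) (\<Psi> - \<Xi>)"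
  proof (rule cSUP_least)
    show "dual_levelC S p \<noteq> {}" using zero_dual_levelC by blast
    fix z assume z: "z \<in> dual_levelC S p"
    have "cmod ((\<Phi> - \<Xi>) z) \<le> cmod ((\<Phi> - \<Psi>) z) + cmod ((\<Psi> - \<Xi>) z)"
      using norm_triangle_ineq[of "(\<Phi> - \<Psi>) z" "(\<Psi> - \<Xi>) z"] by simp
    then have "cmod ((\<Phi> - \<Xi>) z) * e z \<le> (cmod ((\<Phi> - \<Psi>) z) + cmod ((\<Psi> - \<Xi>) z)) * e z"
      by (intro mult_right_mono) (simp_all add: e_def)
    also have "\<dots> = cmod ((\<Phi> - \<Psi>) z) * e z + cmod ((\<Psi> - \<Xi>) z) * e z" by (rule distrib_right)
    also have "\<dots> \<le> growth_norm S (p, l) (\<Phi> - \<Psi>) + growth_norm S (p, l) (\<Psi> - \<Xi>)"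
      using assms z by (intro add_mono le entire_min_diff(1))
    finally show "cmod ((\<Phi> - \<Xi>) z) * e z \<le> growth_norm S (p, l) (\<Phi> - \<Psi>) + growth_norm S (p, l) (\<Psi> - \<Xi>)" .
  qed
  finally show ?thesis by (simp add: i)
qed

lemma functional_seq_mono:
  assumes "functional_seq p K r c" "r \<le> r'"
  shows "functional_seq p K r' c"
proof -
  have K: "0 \<le> K" "0 \<le> r" using assms by (auto simp: functional_seq_def)
  then have "K * r ^ m * fact m \<le> K * r' ^ m * fact m" for m
    using assms(2) by (intro mult_right_mono mult_left_mono power_mono) auto
  then show ?thesis using assms K dbound_weaken unfolding functional_seq_def by (meson order_trans)
qed

lemma tsb_mono: "p \<le> q \<Longrightarrow> 0 \<le> R \<Longrightarrow> tsb q R A \<phi> \<Longrightarrow> tsb p R A \<phi>"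
  unfolding tsb_def by (auto intro: tbound_mono)

text \<open>Test norm to coefficient bound, convolution at the same radius, then summation of the
  power series, with a loss of level for the sake of \<open>a\<close>. The estimate is applied to
  the difference, the operators being additive.\<close>

lemma conv_op_growth_bound:
  assumes a: "functional_seq p0 K r a"
  shows "\<exists>i C. C > 0 \<and> (\<forall>\<phi>\<in>test_series S. \<forall>\<psi>\<in>test_series S.
    growth_norm S j (entire_of (conv_op a \<phi>) - entire_of (conv_op a \<psi>)) \<le> C * test_norm S i (\<phi> - \<psi>))"
proof -
  obtain p l where j: "j = (p, l)" by (cases j)
  have K: "0 \<le> K" "0 \<le> r" using a by (auto simp: functional_seq_def)
  \<comment> \<open>The middle condition gives the growth rate \<open>2 * R \<le> 1 / 2 ^ l\<close>,
    the last one convergence of the convolution.\<close>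
  obtain R where R: "0 < R" "R \<le> 1 / 2 ^ (l + 1)" "r * R \<le> 1 / 2"
    using radius_for[OF K(2), of "1 / 2 ^ (l + 1)"] by auto
  obtain m where "(1 / 2) ^ m < R" using real_arch_pow_inv[OF R(1), of "1 / 2"] by auto
  then have m: "1 / 2 ^ m \<le> R" by (simp add: power_one_over)
  define q where "q = max p p0"
  have "growth_norm S j (entire_of (conv_op a \<phi>) - entire_of (conv_op a \<psi>)) \<le>
      (2 * K + 1) * test_norm S (q, 2 * m) (\<phi> - \<psi>)"
    if \<phi>: "\<phi> \<in> test_series S" and \<psi>: "\<psi> \<in> test_series S" for \<phi> \<psi>
  proof -
    define \<zeta> where "\<zeta> = \<phi> - \<psi>"
    have \<zeta>: "\<zeta> \<in> test_series S" unfolding \<zeta>_def using \<phi> \<psi> by (rule test_series_diff)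
    define N where "N = test_norm S (q, 2 * m) \<zeta>"
    have tN: "tsb q R N \<zeta>" unfolding N_def using m by (intro tsb_radius_mono[OF test_norm_tsb[OF \<zeta>]]) auto
    have "tsb q R (2 * K * N) (conv_op a \<zeta>)"
      using R by (intro conv_op_tsb[OF a _ \<zeta> tN]) (auto simp: q_def)
    then have "tsb p R (2 * K * N) (conv_op a \<zeta>)" using R by (intro tsb_mono[of p q]) (auto simp: q_def)
    then have "entire_growth p (2 * K * N) (2 * R) (entire_of (conv_op a \<zeta>))"
      using R by (intro entire_of_growth conv_op_test_series[OF a \<zeta>]) auto
    then have "growth_norm S (p, l) (entire_of (conv_op a \<zeta>)) \<le> 2 * K * N"
      using R by (intro entire_growth_level(2)) auto
    moreover have "entire_of (conv_op a \<phi>) - entire_of (conv_op a \<psi>) = entire_of (conv_op a \<zeta>)"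
      unfolding \<zeta>_def conv_op_diff[OF a \<phi> \<psi>]
      by (intro entire_of_diff[symmetric] conv_op_test_series[OF a] \<phi> \<psi>)
    moreover have "2 * K * N \<le> (2 * K + 1) * N" using tsb_nonneg[OF tN] by (simp add: algebra_simps)
    ultimately show ?thesis by (simp add: j N_def \<zeta>_def)
  qed
  then show ?thesis using K by (intro exI[of _ "(q, 2 * m)"] exI[of _ "2 * K + 1"]) auto
qed

text \<open>The opposite direction: Cauchy's estimates give radius \<open>R\<close> at level
  \<open>s\<close>, convolution costs \<open>2 * K\<close>, and the Hilbert-Schmidt step from
  \<open>p'\<close> to \<open>p\<close> another factor 2. The summand 1 in \<open>4 * K + 1\<close>
  makes the constant positive.\<close>

lemma taylor_conv_op_bound:
  assumes c: "functional_seq p0 K r c"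
  shows "\<exists>i C. C > 0 \<and> (\<forall>\<Phi>\<in>entire_min S. \<forall>\<Psi>\<in>entire_min S.
    test_norm S j (conv_op c (taylor \<Phi>) - conv_op c (taylor \<Psi>)) \<le> C * growth_norm S i (\<Phi> - \<Psi>))"
proof -
  obtain p q where j: "j = (p, q)" by (cases j)
  have K: "0 \<le> K" "0 \<le> r" using c by (auto simp: functional_seq_def)
  obtain p' K' where hs: "hs_bound p p' K'" using hs_bound_exists by blast
  have "0 \<le> K'" using hs by (simp add: hs_bound_def)
  then obtain R0 :: real where R0: "0 < R0" "2 ^ q * (K' * R0)\<^sup>2 \<le> 1 / 4" using small_radius_exists by blast
  obtain R where R: "0 < R" "R \<le> R0" "r * R \<le> 1 / 2" using radius_for[OF K(2) R0(1)] by auto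
  obtain l where l: "exp 1 * (1 / 2 ^ l) \<le> R" using small_exp_radius[OF R(1)] by blast
  define s where "s = max p' p0"
  have "test_norm S j (conv_op c (taylor \<Phi>) - conv_op c (taylor \<Psi>)) \<le> (4 * K + 1) * growth_norm S (s, l) (\<Phi> - \<Psi>)"
    if \<Phi>: "\<Phi> \<in> entire_min S" and \<Psi>: "\<Psi> \<in> entire_min S" for \<Phi> \<Psi>
  proof -
    define \<Xi> where "\<Xi> = \<Phi> - \<Psi>"
    have \<Xi>: "\<Xi> \<in> entire_min S" "taylor \<Xi> = taylor \<Phi> - taylor \<Psi>"
      unfolding \<Xi>_def using entire_min_diff[OF \<Phi> \<Psi>] by auto
    note tx = taylor_test_series[OF \<Xi>(1)]
    define N where "N = growth_norm S (s, l) \<Xi>"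
    have tN: "tsb s R N (taylor \<Xi>)" unfolding N_def using l by (intro tsb_radius_mono[OF taylor_tsb[OF \<Xi>(1)]]) auto
    have "tsb s R (2 * K * N) (conv_op c (taylor \<Xi>))"
      using R by (intro conv_op_tsb[OF c _ tx tN]) (auto simp: s_def)
    then have "tsb p' R (2 * K * N) (conv_op c (taylor \<Xi>))" using R by (intro tsb_mono[of p' s]) (auto simp: s_def)
    then have t: "tsb p' R0 (2 * K * N) (conv_op c (taylor \<Xi>))" by (rule tsb_radius_mono) (use R in auto)
    have "test_norm S (p, q) (conv_op c (taylor \<Xi>)) \<le> 2 * (2 * K * N)"
      using R0 by (intro test_norm_le(2)[OF hs t _ R0(2)] tnorm_nonneg nuc_tensor_level conv_op_nuc[OF c tx]) auto
    moreover have "conv_op c (taylor \<Xi>) = conv_op c (taylor \<Phi>) - conv_op c (taylor \<Psi>)"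
      unfolding \<Xi>(2) by (rule conv_op_diff[OF c taylor_test_series[OF \<Phi>] taylor_test_series[OF \<Psi>]])
    moreover have "2 * (2 * K * N) \<le> (4 * K + 1) * N" using tsb_nonneg[OF tN] by (simp add: algebra_simps)
    ultimately show ?thesis by (simp add: j N_def \<Xi>_def)
  qed
  then show ?thesis using K by (intro exI[of _ "(s, l)"] exI[of _ "4 * K + 1"]) auto
qed

text \<open>One double series read in two ways. Its diagonals are the values of the Appell
  functionals on the components of \<open>\<phi>\<close>; its rows are the components of the
  convolution evaluated at powers of \<open>x\<close>. The radius must also compensate the norm of
  \<open>x\<close>, hence the condition on \<open>d * R0\<close>.\<close>

lemma appell_fun_sums:
  assumes a: "functional_seq p0 K r a" and \<phi>: "\<phi> \<in> test_series S" and x: "x \<in> nuc_dual S"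
  shows "(\<lambda>n. appell_fun a x n (\<phi> n)) sums entire_of (conv_op a \<phi>) (cplx x)"
proof -
  obtain p where p: "p0 \<le> p" "x \<in> dual_level S p" using nuc_dual_levelE[OF x] by blast
  have K: "0 \<le> K" "0 \<le> r" using a by (auto simp: functional_seq_def)
  define d where "d = dnorm S p x"
  have d: "0 \<le> d" using dnorm_nonneg[OF p(2)] by (simp add: d_def)
  obtain R0 where R0: "0 < R0" "d * R0 \<le> 1 / 2" using radius_for[OF d, of 1] by auto
  obtain R where R: "0 < R" "R \<le> R0" "r * R \<le> 1 / 2" using radius_for[OF K(2) R0(1)] by auto
  obtain A where A: "tsb p R A \<phi>" using test_series_tsb[OF \<phi> R(1)] by blast
  have A0: "0 \<le> A" using A tsb_nonneg by blast
  have dR: "d * R \<le> 1 / 2" using R0 R d by (meson mult_left_mono order_trans)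
  define f where "f k m = of_nat ((k + m) choose k) * contr k (a m) (\<phi> (k + m)) (replicate k x)" for k m
  have fb: "cmod (f k m) \<le> K * A * (1 / 2) ^ k * (1 / 2) ^ m" for k m
  proof -
    have "cmod (f k m) \<le> K * A * R ^ k / fact k * (r * R) ^ m * (\<Prod>x\<leftarrow>replicate k x. dnorm S p x)"
      unfolding f_def using R by (intro tboundD[OF conv_op_term_bound[OF a p(1) \<phi> A]] replicate_tuples p(2)) auto
    also have "\<dots> = K * A * ((d * R) ^ k / fact k) * (r * R) ^ m"
      by (simp add: map_replicate prod_list_replicate d_def power_mult_distrib mult_ac)
    also have "\<dots> \<le> K * A * (1 / 2) ^ k * (1 / 2) ^ m"
    proof (intro mult_mono mult_left_mono)
      have "(d * R) ^ k / fact k \<le> (d * R) ^ k / 1"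
        using d R by (intro divide_left_mono) (auto simp: fact_ge_1)
      also have "\<dots> \<le> (1 / 2) ^ k" using dR d R by (simp add: power_mono)
      finally show "(d * R) ^ k / fact k \<le> (1 / 2) ^ k" .
      show "(r * R) ^ m \<le> (1 / 2) ^ m" using R K by (intro power_mono) auto
    qed (use K A0 R d in auto)
    finally show ?thesis .
  qed
  have "(\<lambda>n. \<Sum>k\<le>n. f k (n - k)) sums (\<Sum>k. \<Sum>m. f k m)"
    by (rule double_series_diagonal(2)[OF fb]) auto
  moreover have "(\<Sum>k\<le>n. f k (n - k)) = appell_fun a x n (\<phi> n)" for n
    unfolding f_def appell_fun_def by (intro sum.cong) auto
  moreover have "(\<Sum>k. \<Sum>m. f k m) = entire_of (conv_op a \<phi>) (cplx x)"
    using sums_unique[OF entire_of_cplx(1)[OF conv_op_test_series[OF a \<phi>] x]]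
    by (simp add: conv_op_def f_def)
  ultimately show ?thesis by simp
qed

end

section \<open>Equality of the two function spaces and of their topologies\<close>

theorem theorem27:
  fixes S :: "'h::{real_inner, polish_space} hilbert_scale"
    and \<mu> :: "('h \<Rightarrow> real) measure"
  assumes "nuclear_triple S"
    and "\<mu> \<in> analytic_measures S"
  shows "(\<forall>\<phi>\<in>test_series S. \<forall>x\<in>nuc_dual S. summable (\<lambda>n. appell S \<mu> (cplx x) n (\<phi> n))) \<and>
         inj_on (test_fun S \<mu>) (test_series S) \<and>
         test_topology S \<mu> = entire_min_real_topology S"
proof -
  interpret analytic_measure S \<mu> using assms by unfold_locales
  obtain c p K r where c: "functional_seq p K r c" "\<And>F. F \<in> nuc_tensor S 0 \<Longrightarrow> c 0 F = F []"
    "\<And>x n F. x \<in> nuc_dual S \<Longrightarrow> F \<in> nuc_tensor S n \<Longrightarrow>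
      appell S \<mu> (cplx x) n F = appell_fun (inv_seq c) x n F"
    by (rule appell_representation, rule that)
  define a where "a = inv_seq c"
  have K: "0 \<le> K" "0 \<le> r" using c(1) by (auto simp: functional_seq_def)
  have a: "functional_seq p 1 (r * (1 + K)) a" unfolding a_def by (rule functional_seq_inv_seq[OF c(1)])
  \<comment> \<open>\<open>conv_op_inverse\<close> takes both sequences with a common rate; that of
    \<open>inv_seq c\<close> is the larger one.\<close>
  have c': "functional_seq p K (r * (1 + K)) c"
    using K by (intro functional_seq_mono[OF c(1)]) (simp add: algebra_simps)
  have ac: "conv_op a (conv_op c \<phi>) = \<phi>" if "\<phi> \<in> test_series S" for \<phi>
    by (rule conv_op_inverse[OF a c' _ that]) (unfold a_def, rule inv_seq_left[OF c(1,2)], assumption+)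
  have ca: "conv_op c (conv_op a \<phi>) = \<phi>" if "\<phi> \<in> test_series S" for \<phi>
    by (rule conv_op_inverse[OF c' a _ that]) (unfold a_def, rule inv_seq_right[OF c(1,2)], assumption+)
  \<comment> \<open>\<open>h\<close> sends a family of kernels to the entire function whose
    restriction is its Appell series, and \<open>k\<close> below is the inverse map. Equality of the
    topologies amounts to \<open>h\<close> being a homeomorphism.\<close>
  define h where "h \<phi> = entire_of (conv_op a \<phi>)" for \<phi>
  define k where "k \<Phi> = conv_op c (taylor \<Phi>)" for \<Phi>
  have hW: "h \<phi> \<in> entire_min S" if "\<phi> \<in> test_series S" for \<phi>
    unfolding h_def by (intro entire_of_entire_min conv_op_test_series[OF a] that)
  have kV: "k \<Phi> \<in> test_series S" if "\<Phi> \<in> entire_min S" for \<Phi>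
    unfolding k_def by (intro conv_op_test_series[OF c(1)] taylor_test_series that)
  have kh: "k (h \<phi>) = \<phi>" if "\<phi> \<in> test_series S" for \<phi>
    using that by (simp add: h_def k_def taylor_entire_of conv_op_test_series[OF a] ca)
  have hk: "h (k \<Phi>) = \<Phi>" if "\<Phi> \<in> entire_min S" for \<Phi>
    using that by (simp add: h_def k_def taylor_test_series ac entire_of_taylor)
  have ap: "(\<lambda>n. appell S \<mu> (cplx x) n (\<phi> n)) sums h \<phi> (cplx x)"
    if \<phi>: "\<phi> \<in> test_series S" and x: "x \<in> nuc_dual S" for \<phi> x
    using appell_fun_sums[OF a \<phi> x] c(3)[OF x test_series_nuc[OF \<phi>]] by (simp add: h_def a_def)
  have tf: "test_fun S \<mu> \<phi> = real_restriction S (h \<phi>)" if \<phi>: "\<phi> \<in> test_series S" for \<phi>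
    using sums_unique[OF ap[OF \<phi>]] by (auto simp: test_fun_def real_restriction_def fun_eq_iff)
  have injR: "inj_on (real_restriction S) (entire_min S)"
  proof (rule inj_onI)
    fix \<Phi> \<Psi> assume *: "\<Phi> \<in> entire_min S" "\<Psi> \<in> entire_min S" "real_restriction S \<Phi> = real_restriction S \<Psi>"
    show "\<Phi> = \<Psi>"
      using fun_cong[OF *(3)] by (intro entire_min_real_unique[OF *(1,2)]) (metis real_restriction_def)
  qed
  have injT: "inj_on (test_fun S \<mu>) (test_series S)"
  proof (rule inj_onI)
    fix \<phi> \<psi> assume *: "\<phi> \<in> test_series S" "\<psi> \<in> test_series S" "test_fun S \<mu> \<phi> = test_fun S \<mu> \<psi>"
    then have "h \<phi> = h \<psi>" using inj_onD[OF injR] hW tf by metis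
    then show "\<phi> = \<psi>" using kh * by metis
  qed
  define TV where "TV = projlim_topology (test_series S) (test_norm S)"
  define TW where "TW = projlim_topology (entire_min S) (growth_norm S)"
  have topV: "topspace TV = test_series S"
    unfolding TV_def by (intro topspace_projlim test_norm_diff_self)
  have topW: "topspace TW = entire_min S"
    unfolding TW_def by (intro topspace_projlim growth_norm_diff_self)
  have hU: "openin TW (h ` U)" if U: "openin TV U" for U
  proof -
    have "U \<subseteq> test_series S" using openin_subset[OF U] topV by simp
    then have "h ` U = {\<Phi> \<in> entire_min S. k \<Phi> \<in> U}" using hW kh hk by (force simp: image_iff)
    moreover have "openin TW {\<Phi> \<in> entire_min S. k \<Phi> \<in> U}"
      unfolding TW_def
    proof (rule openin_projlim_preimage[where h = k and \<nu>' = "test_norm S" and W = "test_series S"])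
      show "openin (projlim_topology (test_series S) (test_norm S)) U" using U by (simp add: TV_def)
      show "\<exists>i C. C > 0 \<and> (\<forall>\<Phi>\<in>entire_min S. \<forall>\<Psi>\<in>entire_min S. test_norm S j (k \<Phi> - k \<Psi>) \<le> C * growth_norm S i (\<Phi> - \<Psi>))" for j
        unfolding k_def by (rule taylor_conv_op_bound[OF c(1)])
    qed (simp_all only: kV growth_norm_diff_self test_norm_triangle)
    ultimately show ?thesis by simp
  qed
  have kU: "openin TV {\<phi> \<in> test_series S. h \<phi> \<in> U}" if U: "openin TW U" for U
    unfolding TV_def
  proof (rule openin_projlim_preimage[where h = h and \<nu>' = "growth_norm S" and W = "entire_min S"])
    show "openin (projlim_topology (entire_min S) (growth_norm S)) U" using U by (simp add: TW_def)
    show "\<exists>i C. C > 0 \<and> (\<forall>\<phi>\<in>test_series S. \<forall>\<psi>\<in>test_series S. growth_norm S j (h \<phi> - h \<psi>) \<le> C * test_norm S i (\<phi> - \<psi>))" for j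
      unfolding h_def by (rule conv_op_growth_bound[OF a])
  qed (simp_all only: hW test_norm_diff_self growth_norm_triangle)
  \<comment> \<open>Open sets of both carried topologies are images under injective maps, and
    \<open>tf\<close> factors \<open>test_fun\<close> as \<open>real_restriction\<close> after
    \<open>h\<close>, so the two families of images coincide.\<close>
  have "openin (test_topology S \<mu>) X \<longleftrightarrow> openin (entire_min_real_topology S) X" for X
  proof -
    have 1: "openin (test_topology S \<mu>) X \<longleftrightarrow> (\<exists>U. openin TV U \<and> X = test_fun S \<mu> ` U)"
      unfolding test_topology_def TV_def[symmetric] using injT topV by (intro openin_carried_topology) simp
    have 2: "openin (entire_min_real_topology S) X \<longleftrightarrow> (\<exists>U. openin TW U \<and> X = real_restriction S ` U)"
      unfolding entire_min_real_topology_def TW_def[symmetric] using injR topW by (intro openin_carried_topology) simp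
    have im: "test_fun S \<mu> ` U = real_restriction S ` (h ` U)" if "U \<subseteq> test_series S" for U
      unfolding image_image using that tf by (intro image_cong) auto
    show ?thesis
      unfolding 1 2
    proof
      assume "\<exists>U. openin TV U \<and> X = test_fun S \<mu> ` U"
      then obtain U where U: "openin TV U" "X = test_fun S \<mu> ` U" by blast
      then have "X = real_restriction S ` (h ` U)" using im openin_subset topV by metis
      then show "\<exists>U. openin TW U \<and> X = real_restriction S ` U" using hU[OF U(1)] by blast
    next
      assume "\<exists>U. openin TW U \<and> X = real_restriction S ` U"
      then obtain U where U: "openin TW U" "X = real_restriction S ` U" by blast
      define V where "V = {\<phi> \<in> test_series S. h \<phi> \<in> U}"
      have "U \<subseteq> entire_min S" using openin_subset[OF U(1)] topW by simp
      then have "h ` V = U" using hk kV by (force simp: V_def image_iff)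
      then have "X = test_fun S \<mu> ` V" using im[of V] U(2) by (simp add: V_def)
      then show "\<exists>U. openin TV U \<and> X = test_fun S \<mu> ` U" using kU[OF U(1)] V_def by blast
    qed
  qed
  then have "test_topology S \<mu> = entire_min_real_topology S" by (simp add: topology_eq)
  then show ?thesis using injT ap sums_summable by blast
qed

end
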